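(* Let $T$ be a complete simple first-order theory, let $\mathfrak{C}$ be its monster model, and let $\kappa,\mu$ be cardinals with $|T|<\kappa$ and $\mu=\mu^{<\kappa}$. Suppose $M\prec N\prec\mathfrak{C}$, $\|M\|=\mu$ and $\|N\|=\mu^+$. Then there are models $M^+\prec N^+\prec\mathfrak{C}$ such that $N\prec N^+$, $M\prec M^+$, $\|M^+\|=\mu$, $\|N^+\|=\mu^+$, and: $( * )_1$ if $B\subseteq A\subseteq N$, $B\subseteq M$, $|A|<\kappa$, $m<\omega$, $p\in S^m(A)$ and $p$ does not weakly divide over $(p\restriction B,\emptyset)$, then $p$ is realized in $M^+$; $( * )_2$ if $B\subseteq A\subseteq N$, $B\subseteq M$, $|A|<\kappa$, $C\subseteq\mathfrak{C}$, $|C|<\kappa$, and $A/(B\cup C)$ does not weakly divide over $B$, then there is $C'\subseteq M^+$ realizing $C/(B\cup A)$.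
   Context: $T$ is simple means $T$ does not have the tree property: there are no formula $\varphi(\bar x,\bar y)$, $k<\omega$ and parameters $\langle\bar a_\eta:\eta\in{}^{\omega>}\omega\rangle$ such that for every $\eta$ the set $\{\varphi(\bar x,\bar a_{\eta^\frown\langle i\rangle}):i<\omega\}$ is $k$-contradictory (no $k$ distinct members are jointly realized) while for every $\eta\in{}^\omega\omega$ the set $\{\varphi(\bar x,\bar a_{\eta\restriction n}):n<\omega\}$ is consistent. $\mathfrak{C}$ is a $\bar\kappa$-saturated model of $T$ with $\bar\kappa$ very large; all sets are subsets of $\mathfrak{C}$ of cardinality $<\bar\kappa$ and all models are elementary submodels of $\mathfrak{C}$ of cardinality $<\bar\kappa$. For a set or sequence $C$ (under a fixed enumeration) and a set $B$, $C/B$ denotes $\mathrm{tp}(C,B)$. For a formula $\psi(\bar x^1,\dots,\bar x^n)$ (possibly with parameters), where the $\bar x^\ell$ are pairwise disjoint copies of $\bar x$, and a type $q(\bar x)$, let $[q]^\psi=\{\psi\}\cup\bigcup_{\ell=1}^n q(\bar x^\ell)$. If $r=r(\bar x)$ is a type over a set $B$ and $p=p(\bar x)$ is a type, then "$p$ does not weakly divide over $(r,B)$" means: for every finite $\bar b$ from $B$ and every parameter-free formula $\psi(\bar x^1,\dots,\bar x^n,\bar y)$, if $[r]^{\psi(\bar x^1,\dots,\bar x^n,\bar b)}$ is consistent then so is $[r\cup p]^{\psi(\bar x^1,\dots,\bar x^n,\bar b)}$. For $B\subseteq A$, "$\bar a/A$ (or $A'/A$ for a set $A'$) does not weakly divide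 over $B$" means $\mathrm{tp}(\bar a,A)$ does not weakly divide over $(\mathrm{tp}(\bar a,B),B)$. *)

theory Defs
  imports Main
begin

unbundle cardinal_syntax

section \<open>Languages, formulas, structures\<close>

text \<open>Symbols are given by sets, not by whole types, so that for instance purely relational
  languages are included.\<close>

record ('f, 'r) lang =
  Funs :: "'f set"
  Rels :: "'r set"
  far :: "'f \<Rightarrow> nat"
  rar :: "'r \<Rightarrow> nat"

text \<open>Bound variables are de Bruijn indices; free variables come from an arbitrary type \<open>'v\<close>,
  so that types in infinitely many variables can be written. Since only the free variables are
  live, \<^term>\<open>map_fm\<close> is capture-free renaming/instantiation and \<^term>\<open>set_fm\<close> the set of free
  variables.\<close>

datatype (dead 'f, 'v) tm = Free 'v | Bound nat | App 'f "('f, 'v) tm list"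

datatype (dead 'f, dead 'r, 'v) fm =
    Eql "('f, 'v) tm" "('f, 'v) tm"
  | Rel 'r "('f, 'v) tm list"
  | Neg "('f, 'r, 'v) fm"
  | Conj "('f, 'r, 'v) fm" "('f, 'r, 'v) fm"
  | Exist "('f, 'r, 'v) fm"

fun wf_tm :: "('f, 'r) lang \<Rightarrow> nat \<Rightarrow> ('f, 'v) tm \<Rightarrow> bool" where
  "wf_tm L k (Free v) = True"
| "wf_tm L k (Bound i) = (i < k)"
| "wf_tm L k (App f ts) =
     (f \<in> Funs L \<and> length ts = far L f \<and> (\<forall>t \<in> set ts. wf_tm L k t))"

fun wf_fm :: "('f, 'r) lang \<Rightarrow> nat \<Rightarrow> ('f, 'r, 'v) fm \<Rightarrow> bool" where
  "wf_fm L k (Eql s t) = (wf_tm L k s \<and> wf_tm L k t)"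
| "wf_fm L k (Rel R ts) =
     (R \<in> Rels L \<and> length ts = rar L R \<and> (\<forall>t \<in> set ts. wf_tm L k t))"
| "wf_fm L k (Neg \<phi>) = wf_fm L k \<phi>"
| "wf_fm L k (Conj \<phi> \<psi>) = (wf_fm L k \<phi> \<and> wf_fm L k \<psi>)"
| "wf_fm L k (Exist \<phi>) = wf_fm L (Suc k) \<phi>"

definition formulas :: "('f, 'r) lang \<Rightarrow> 'v set \<Rightarrow> ('f, 'r, 'v) fm set" where
  "formulas L V = {\<phi>. wf_fm L 0 \<phi> \<and> set_fm \<phi> \<subseteq> V}"

record ('f, 'r, 'u) struct =
  Dom :: "'u set"
  FunI :: "'f \<Rightarrow> 'u list \<Rightarrow> 'u"
  RelI :: "'r \<Rightarrow> 'u list \<Rightarrow> bool"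

definition structure_of :: "('f, 'r) lang \<Rightarrow> ('f, 'r, 'u) struct \<Rightarrow> bool" where
  "structure_of L S \<longleftrightarrow> Dom S \<noteq> {} \<and>
     (\<forall>f \<in> Funs L. \<forall>us. length us = far L f \<longrightarrow> set us \<subseteq> Dom S \<longrightarrow> FunI S f us \<in> Dom S)"

fun val :: "('f, 'r, 'u) struct \<Rightarrow> ('v \<Rightarrow> 'u) \<Rightarrow> 'u list \<Rightarrow> ('f, 'v) tm \<Rightarrow> 'u" where
  "val S s e (Free v) = s v"
| "val S s e (Bound i) = e ! i"
| "val S s e (App f ts) = FunI S f (map (val S s e) ts)"

fun sat :: "('f, 'r, 'u) struct \<Rightarrow> ('v \<Rightarrow> 'u) \<Rightarrow> 'u list \<Rightarrow> ('f, 'r, 'v) fm \<Rightarrow> bool" where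
  "sat S s e (Eql t t') \<longleftrightarrow> val S s e t = val S s e t'"
| "sat S s e (Rel R ts) \<longleftrightarrow> RelI S R (map (val S s e) ts)"
| "sat S s e (Neg \<phi>) \<longleftrightarrow> \<not> sat S s e \<phi>"
| "sat S s e (Conj \<phi> \<psi>) \<longleftrightarrow> sat S s e \<phi> \<and> sat S s e \<psi>"
| "sat S s e (Exist \<phi>) \<longleftrightarrow> (\<exists>u \<in> Dom S. sat S s (u # e) \<phi>)"

definition complete_theory :: "('f, 'r) lang \<Rightarrow> ('f, 'r, nat) fm set \<Rightarrow> bool" where
  "complete_theory L T \<longleftrightarrow> T \<subseteq> formulas L {} \<and> (\<forall>\<phi> \<in> formulas L {}. \<phi> \<in> T \<longleftrightarrow> Neg \<phi> \<notin> T)"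

definition is_model :: "('f, 'r) lang \<Rightarrow> ('f, 'r, nat) fm set \<Rightarrow> ('f, 'r, 'u) struct \<Rightarrow> bool" where
  "is_model L T S \<longleftrightarrow> structure_of L S \<and> (\<forall>\<phi> \<in> T. \<forall>s. sat S s [] \<phi>)"

text \<open>The atomic instances say that \<open>M\<close> is a substructure of \<open>N\<close>.\<close>

definition elem_sub ::
  "('f, 'r) lang \<Rightarrow> ('f, 'r, 'u) struct \<Rightarrow> ('f, 'r, 'u) struct \<Rightarrow> bool" where
  "elem_sub L M N \<longleftrightarrow> structure_of L M \<and> structure_of L N \<and> Dom M \<subseteq> Dom N \<and>
     (\<forall>\<phi> \<in> formulas L (UNIV :: nat set). \<forall>s. range s \<subseteq> Dom M \<longrightarrow>
        (sat M s [] \<phi> \<longleftrightarrow> sat N s [] \<phi>))"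


section \<open>Types\<close>

text \<open>Formulas with parameters have free variables in \<open>'x + 'u\<close>: \<^term>\<open>Inl i\<close> is the variable
  \<open>x\<^sub>i\<close> and \<^term>\<open>Inr b\<close> the parameter \<open>b\<close>. The tuple \<open>x\<close> of variables is indexed by a set
  \<open>I\<close>, possibly infinite, and \<^term>\<open>formulas L (I <+> A)\<close> is the set of formulas over \<open>A\<close>
  in these variables.\<close>

definition realizes ::
  "('f, 'r, 'u) struct \<Rightarrow> ('x \<Rightarrow> 'u) \<Rightarrow> ('f, 'r, 'x + 'u) fm set \<Rightarrow> bool" where
  "realizes S a q \<longleftrightarrow> (\<forall>\<phi> \<in> q. sat S (case_sum a id) [] \<phi>)"

definition consistent :: "('f, 'r, 'u) struct \<Rightarrow> ('f, 'r, 'x + 'u) fm set \<Rightarrow> bool" where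
  "consistent S q \<longleftrightarrow>
     (\<forall>F. finite F \<longrightarrow> F \<subseteq> q \<longrightarrow> (\<exists>a. range a \<subseteq> Dom S \<and> realizes S a F))"

definition tp ::
  "('f, 'r) lang \<Rightarrow> ('f, 'r, 'u) struct \<Rightarrow> 'x set \<Rightarrow> ('x \<Rightarrow> 'u) \<Rightarrow> 'u set \<Rightarrow>
     ('f, 'r, 'x + 'u) fm set" where
  "tp L S I a A = {\<phi> \<in> formulas L (I <+> A). sat S (case_sum a id) [] \<phi>}"

definition complete_types ::
  "('f, 'r) lang \<Rightarrow> ('f, 'r, 'u) struct \<Rightarrow> 'x set \<Rightarrow> 'u set \<Rightarrow>
     ('f, 'r, 'x + 'u) fm set set" where
  "complete_types L S I A = {p. p \<subseteq> formulas L (I <+> A) \<and> consistent S p \<and>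
     (\<forall>\<phi> \<in> formulas L (I <+> A). \<phi> \<in> p \<or> Neg \<phi> \<in> p)}"

definition restrict_type ::
  "('f, 'r, 'x + 'u) fm set \<Rightarrow> 'u set \<Rightarrow> ('f, 'r, 'x + 'u) fm set" where
  "restrict_type p B = {\<phi> \<in> p. \<forall>b. Inr b \<in> set_fm \<phi> \<longrightarrow> b \<in> B}"

definition saturated :: "('f, 'r) lang \<Rightarrow> 'k rel \<Rightarrow> ('f, 'r, 'u) struct \<Rightarrow> bool" where
  "saturated L \<kappa> S \<longleftrightarrow> (\<forall>A \<subseteq> Dom S. |A| <o \<kappa> \<longrightarrow>
     (\<forall>p \<in> complete_types L S {..<1::nat} A. \<exists>a. range a \<subseteq> Dom S \<and> realizes S a p))"


section \<open>Simplicity\<close>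

text \<open>A family is \<open>k\<close>-contradictory when no \<open>k\<close> members with distinct indices are jointly
  realized. Counting distinct formulas instead would make every constant family
  2-contradictory.\<close>

definition k_contradictory ::
  "('f, 'r, 'u) struct \<Rightarrow> nat \<Rightarrow> (nat \<Rightarrow> ('f, 'r, 'x + 'u) fm) \<Rightarrow> bool" where
  "k_contradictory S k q \<longleftrightarrow>
     (\<forall>J. finite J \<longrightarrow> card J = k \<longrightarrow> \<not> (\<exists>a. range a \<subseteq> Dom S \<and> realizes S a (q ` J)))"

text \<open>In \<open>\<phi>(x, y)\<close> the variables \<open>x\<close> are tagged by \<^term>\<open>Inl\<close> and the variables \<open>y\<close> by
  \<^term>\<open>Inr\<close>; \<^term>\<open>inst \<phi> b\<close> is \<open>\<phi>(x, b)\<close>. Only the finitely many entries of \<open>b\<close> at variables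
  occurring in \<open>\<phi>\<close> matter.\<close>

definition inst ::
  "('f, 'r, nat + nat) fm \<Rightarrow> (nat \<Rightarrow> 'u) \<Rightarrow> ('f, 'r, nat + 'u) fm" where
  "inst \<phi> b = map_fm (map_sum id b) \<phi>"

definition tree_property :: "('f, 'r) lang \<Rightarrow> ('f, 'r, 'u) struct \<Rightarrow> bool" where
  "tree_property L S \<longleftrightarrow>
     (\<exists>\<phi> \<in> formulas L UNIV. \<exists>k. \<exists>a :: nat list \<Rightarrow> nat \<Rightarrow> 'u.
        (\<forall>\<eta>. range (a \<eta>) \<subseteq> Dom S) \<and>
        (\<forall>\<eta>. k_contradictory S k (\<lambda>i. inst \<phi> (a (\<eta> @ [i])))) \<and>
        (\<forall>\<eta> :: nat \<Rightarrow> nat. consistent S (range (\<lambda>n. inst \<phi> (a (map \<eta> [0..<n]))))))"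

text \<open>Simplicity of the theory of \<open>S\<close>, where \<open>S\<close> is meant to be its monster model.\<close>

definition simple_theory :: "('f, 'r) lang \<Rightarrow> ('f, 'r, 'u) struct \<Rightarrow> bool" where
  "simple_theory L S \<longleftrightarrow> \<not> tree_property L S"


section \<open>Weak dividing\<close>

text \<open>\<open>[q]\<^sup>\<psi>\<close>, where the \<open>l\<close>-th copy of the variable \<open>x\<^sub>i\<close> is indexed by the pair \<open>(l, i)\<close>, for
  \<open>l < n\<close>.\<close>

definition copies ::
  "nat \<Rightarrow> ('f, 'r, nat \<times> 'x + 'u) fm \<Rightarrow> ('f, 'r, 'x + 'u) fm set \<Rightarrow>
     ('f, 'r, nat \<times> 'x + 'u) fm set" where
  "copies n \<psi> q = insert \<psi> (\<Union>l<n. map_fm (map_sum (Pair l) id) ` q)"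

text \<open>A formula \<open>\<psi>(x\<^sup>1, \<dots>, x\<^sup>n, b)\<close> with a finite tuple \<open>b\<close> from \<open>B\<close> is a formula over \<open>B\<close>.
  The type \<open>r\<close> may have parameters outside \<open>B\<close>.\<close>

definition not_weakly_divides ::
  "('f, 'r) lang \<Rightarrow> ('f, 'r, 'u) struct \<Rightarrow> 'x set \<Rightarrow> ('f, 'r, 'x + 'u) fm set \<Rightarrow>
     ('f, 'r, 'x + 'u) fm set \<Rightarrow> 'u set \<Rightarrow> bool" where
  "not_weakly_divides L S I p r B \<longleftrightarrow>
     (\<forall>n. \<forall>\<psi> \<in> formulas L (({..<n} \<times> I) <+> B).
        consistent S (copies n \<psi> r) \<longrightarrow> consistent S (copies n \<psi> (r \<union> p)))"

text \<open>\<open>A'/A\<close> does not weakly divide over \<open>B\<close>. A set \<open>A'\<close> is enumerated by itself, that is, its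
  variables are \<open>x\<^sub>a\<close> for \<open>a \<in> A'\<close>.\<close>

definition set_not_weakly_divides ::
  "('f, 'r) lang \<Rightarrow> ('f, 'r, 'u) struct \<Rightarrow> 'u set \<Rightarrow> 'u set \<Rightarrow> 'u set \<Rightarrow> bool" where
  "set_not_weakly_divides L S A' A B \<longleftrightarrow>
     not_weakly_divides L S A' (tp L S A' id A) (tp L S A' id B) B"


section \<open>Cardinals\<close>

text \<open>\<open>\<mu>\<^bsup><\<kappa>\<^esup>\<close>, as the number of sequences of elements of \<open>\<mu>\<close> of length an ordinal below \<open>\<kappa>\<close>.\<close>

definition cexp_less :: "'m rel \<Rightarrow> 'k rel \<Rightarrow> ('k \<times> ('k \<Rightarrow> 'm)) rel" where
  "cexp_less \<mu> \<kappa> = (CSUM \<alpha> : \<kappa>. \<mu> ^c |underS \<kappa> \<alpha>| )"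

end

theory Submission
  imports Defs "HOL-Library.Ramsey" "HOL-Library.Countable_Set"
begin

text \<open>Write \<open>N\<close> as the increasing union of models \<open>Nle a\<close> of size \<open>\<mu>\<close> containing \<open>M\<close>. If \<open>p\<close> does not
  weakly divide over its restriction to \<open>B \<subseteq> M\<close>, then it does not divide over \<open>B\<close>, since dividing
  would build a tree that contradicts simplicity. Hence \<open>p\<close> has a realization \<open>c\<close> that is independent
  from \<open>N\<close> over \<open>M\<close>, and by local character already over \<open>A \<inter> M\<close>, for some \<open>A \<subseteq> N\<close> of size below \<open>\<kappa>\<close>
  that contains the parameters of \<open>p\<close> and is independent from the models of the filtration over its
  own intersections with them. There are only \<open>\<mu>\<^sup><\<^sup>\<kappa> = \<mu>\<close> isomorphism types (colours) of such pairs
  \<open>(A, c)\<close>. All the types \<open>tp(c, A)\<close> of one colour are realized by a single tuple: this is shown by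
  induction along the filtration, the step being the independence theorem for simple theories over
  the model \<open>A \<inter> Nlt a\<close>. Thus \<open>\<mu>\<close> tuples suffice for the first property. For the second property,
  weak nondividing gives directly, by compactness, one tuple for all \<open>(A, C)\<close> with the same labelled
  type over the same \<open>B\<close>.

  Dividing is developed semantically: \<open>Dfn D P\<close> says that the predicate \<open>P\<close> on tuples is definable
  over \<open>D\<close>, \<open>ind D c b\<close> that \<open>tp(c, D b)\<close> does not divide over \<open>D\<close>, and \<open>Ind D c W\<close> that
  \<open>tp(c, D W)\<close> does not.\<close>

section \<open>Formulas and satisfaction\<close>

text \<open>Already the singletons of \<open>N\<close> outnumber \<open>M\<close>, so types cannot
  be realized one by one: types over different sets have to share realizations. Two facts keep the
  number of colours small. A level of the filtration can be named by a subset of \<open>M\<close>,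
  because the successor of \<mu> is at most the number of subsets of \<open>M\<close>; and a set
  \<open>A\<close> of size below \<kappa> gains elements at fewer than \<kappa> levels, whose names
  are told apart by a small subset of \<open>M\<close>. Independence is defined by dividing, not
  forking, so extending a nondividing type is itself a theorem. It is proved over models, with
  coheirs, which is why the sets \<open>A\<close> are closed until their traces on the filtration
  are models. In the independence theorem the types of \<open>a\<close> and \<open>b\<close> are
  given, but not that of the pair. Each such pair is compared with \<open>(a, e)\<close>, where
  \<open>e\<close> realizes over \<open>a\<close> a coheir of the type of \<open>b\<close>: in one
  interlaced sequence, one order of the indices gives the first kind of pair and the opposite order
  the second, and the two conjuncts of a formula can be satisfied on alternating positions.\<close>

lemma val_cong: "(\<And>v. v \<in> set_tm t \<Longrightarrow> s v = s' v) \<Longrightarrow> val S s e t = val S s' e t"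
proof (induction t)
  case (App f ts)
  have "map (val S s e) ts = map (val S s' e) ts"
    using App.prems by (intro map_cong refl App.IH) auto
  then show ?case by (simp only: val.simps)
qed auto

lemma sat_cong: "(\<And>v. v \<in> set_fm \<phi> \<Longrightarrow> s v = s' v) \<Longrightarrow> sat S s e \<phi> = sat S s' e \<phi>"
proof (induction \<phi> arbitrary: e)
  case (Eql t t')
  then have "val S s e t = val S s' e t" "val S s e t' = val S s' e t'"
    by (auto intro: val_cong)
  then show ?case by simp
next
  case (Rel R ts)
  then have "map (val S s e) ts = map (val S s' e) ts"
    by (auto intro!: val_cong)
  then show ?case by (simp only: sat.simps)
qed auto

lemma val_map: "val S s e (map_tm f t) = val S (s \<circ> f) e t"
  by (induction t) (auto intro!: arg_cong[where f="FunI S _"])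

lemma sat_map: "sat S s e (map_fm f \<phi>) = sat S (s \<circ> f) e \<phi>"
  by (induction \<phi> arbitrary: e) (auto simp: val_map comp_def)

lemma wf_tm_map: "wf_tm L k (map_tm f t) = wf_tm L k t"
  by (induction t) auto

lemma wf_fm_map: "wf_fm L k (map_fm f \<phi>) = wf_fm L k \<phi>"
  by (induction \<phi> arbitrary: k) (auto simp: wf_tm_map)

lemma map_formulas: "\<phi> \<in> formulas L V \<Longrightarrow> f ` set_fm \<phi> \<subseteq> W \<Longrightarrow> map_fm f \<phi> \<in> formulas L W"
  by (auto simp: formulas_def wf_fm_map fm.set_map)

lemma formulas_mono: "V \<subseteq> W \<Longrightarrow> formulas L V \<subseteq> formulas L W"
  by (auto simp: formulas_def)

lemma Neg_formulas [simp]: "Neg \<phi> \<in> formulas L V \<longleftrightarrow> \<phi> \<in> formulas L V"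
  by (simp add: formulas_def)

lemma Conj_formulas [simp]: "Conj \<phi> \<psi> \<in> formulas L V \<longleftrightarrow> \<phi> \<in> formulas L V \<and> \<psi> \<in> formulas L V"
  by (auto simp: formulas_def)

lemma formulas_set_fm: "\<phi> \<in> formulas L V \<Longrightarrow> \<phi> \<in> formulas L (set_fm \<phi>)"
  by (simp add: formulas_def)

lemma finite_set_fm [simp]: "finite (set_fm \<phi>)"
  by (induction \<phi>) auto

text \<open>\<open>Exist\<close> binds index 0, so quantifying a free variable requires turning it
  into an index first: under \<open>d\<close> inner binders the new, outermost binder has index
  \<open>d\<close>.\<close>

fun bnd_tm :: "'v \<Rightarrow> nat \<Rightarrow> ('f, 'v) tm \<Rightarrow> ('f, 'v) tm" where
  "bnd_tm v d (Free w) = (if w = v then Bound d else Free w)"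
| "bnd_tm v d (Bound i) = Bound i"
| "bnd_tm v d (App f ts) = App f (map (bnd_tm v d) ts)"

fun bnd_fm :: "'v \<Rightarrow> nat \<Rightarrow> ('f, 'r, 'v) fm \<Rightarrow> ('f, 'r, 'v) fm" where
  "bnd_fm v d (Eql s t) = Eql (bnd_tm v d s) (bnd_tm v d t)"
| "bnd_fm v d (Rel R ts) = Rel R (map (bnd_tm v d) ts)"
| "bnd_fm v d (Neg \<phi>) = Neg (bnd_fm v d \<phi>)"
| "bnd_fm v d (Conj \<phi> \<psi>) = Conj (bnd_fm v d \<phi>) (bnd_fm v d \<psi>)"
| "bnd_fm v d (Exist \<phi>) = Exist (bnd_fm v (Suc d) \<phi>)"

lemma val_bnd: "wf_tm L (length e) t \<Longrightarrow>
    val S s (e @ [u]) (bnd_tm v (length e) t) = val S (s(v := u)) e t"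
  by (induction t) (auto simp: nth_append intro!: arg_cong[where f="FunI S _"])

lemma sat_bnd: "wf_fm L (length e) \<phi> \<Longrightarrow>
    sat S s (e @ [u]) (bnd_fm v (length e) \<phi>) = sat S (s(v := u)) e \<phi>"
proof (induction \<phi> arbitrary: e)
  case (Rel R ts)
  then have "map (val S s (e @ [u])) (map (bnd_tm v (length e)) ts) = map (val S (s(v := u)) e) ts"
    by (simp add: val_bnd[of L])
  then show ?case by (simp only: bnd_fm.simps sat.simps)
next
  case (Exist \<phi>)
  have "sat S s (x # e @ [u]) (bnd_fm v (Suc (length e)) \<phi>) = sat S (s(v := u)) (x # e) \<phi>" for x
    using Exist.IH[of "x # e"] Exist.prems
    by (simp only: append_Cons length_Cons wf_fm.simps simp_thms)
  then show ?case by (simp only: bnd_fm.simps sat.simps)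
qed (auto simp: val_bnd)

lemma wf_bnd_tm: "wf_tm L d t \<Longrightarrow> wf_tm L (Suc d) (bnd_tm v d t)"
  by (induction t) auto

lemma wf_bnd_fm: "wf_fm L d \<phi> \<Longrightarrow> wf_fm L (Suc d) (bnd_fm v d \<phi>)"
  by (induction \<phi> arbitrary: d) (auto simp: wf_bnd_tm)

lemma set_bnd_tm: "set_tm (bnd_tm v d t) \<subseteq> set_tm t - {v}"
  by (induction t) auto

lemma set_bnd_fm: "set_fm (bnd_fm v d \<phi>) \<subseteq> set_fm \<phi> - {v}"
proof (induction \<phi> arbitrary: d)
  case (Eql s t)
  then show ?case using set_bnd_tm[of v d s] set_bnd_tm[of v d t] by auto
next
  case (Rel R ts)
  then show ?case using set_bnd_tm[of v d] by fastforce
qed auto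

text \<open>The formula is chosen uniformly in the structure because it is later evaluated both in
  an elementary submodel and in the monster.\<close>

lemma ex_block:
  assumes "finite V" "\<phi> \<in> formulas L W"
  shows "\<exists>\<phi>' \<in> formulas L (W - V). \<forall>(S :: ('f, 'r, 'u) struct) s. sat S s [] \<phi>' \<longleftrightarrow>
    (\<exists>t. (\<forall>v. v \<notin> V \<longrightarrow> t v = s v) \<and> (\<forall>v \<in> V. t v \<in> Dom S) \<and> sat S t [] \<phi>)"
  using assms(1)
proof induction
  case empty
  have "(\<exists>t. (\<forall>v. v \<notin> {} \<longrightarrow> t v = s v) \<and> (\<forall>v \<in> {}. t v \<in> Dom S) \<and> sat S t [] \<phi>) = sat S s [] \<phi>"
    for s and S :: "('f, 'r, 'u) struct"
    by (auto simp: fun_eq_iff[symmetric])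
  then show ?case using assms(2) by (intro bexI[of _ \<phi>]) auto
next
  case (insert v V)
  then obtain \<psi> where \<psi>: "\<psi> \<in> formulas L (W - V)" and
    sat: "\<And>(S :: ('f, 'r, 'u) struct) s. sat S s [] \<psi> \<longleftrightarrow>
      (\<exists>t. (\<forall>v. v \<notin> V \<longrightarrow> t v = s v) \<and> (\<forall>v \<in> V. t v \<in> Dom S) \<and> sat S t [] \<phi>)"
    by blast
  show ?case
  proof (intro bexI[of _ "Exist (bnd_fm v 0 \<psi>)"] allI)
    fix S :: "('f, 'r, 'u) struct" and s :: "'a \<Rightarrow> 'u"
    have wf: "wf_fm L 0 \<psi>" using \<psi> by (simp add: formulas_def)
    have "sat S s [] (Exist (bnd_fm v 0 \<psi>)) \<longleftrightarrow> (\<exists>u \<in> Dom S. sat S (s(v := u)) [] \<psi>)"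
      using sat_bnd[of L "[]" \<psi> S s _ v] wf by simp
    also have "\<dots> \<longleftrightarrow> (\<exists>t. (\<forall>w. w \<notin> insert v V \<longrightarrow> t w = s w) \<and>
        (\<forall>w \<in> insert v V. t w \<in> Dom S) \<and> sat S t [] \<phi>)"
    proof
      assume "\<exists>u \<in> Dom S. sat S (s(v := u)) [] \<psi>"
      then obtain u t where "u \<in> Dom S" "\<forall>w. w \<notin> V \<longrightarrow> t w = (s(v := u)) w"
        "\<forall>w \<in> V. t w \<in> Dom S" "sat S t [] \<phi>" unfolding sat by blast
      then show "\<exists>t. (\<forall>w. w \<notin> insert v V \<longrightarrow> t w = s w) \<and>
        (\<forall>w \<in> insert v V. t w \<in> Dom S) \<and> sat S t [] \<phi>"
        using insert.hyps by (intro exI[of _ t]) auto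
    next
      assume "\<exists>t. (\<forall>w. w \<notin> insert v V \<longrightarrow> t w = s w) \<and>
        (\<forall>w \<in> insert v V. t w \<in> Dom S) \<and> sat S t [] \<phi>"
      then obtain t where t: "\<forall>w. w \<notin> insert v V \<longrightarrow> t w = s w"
        "\<forall>w \<in> insert v V. t w \<in> Dom S" "sat S t [] \<phi>" by blast
      then show "\<exists>u \<in> Dom S. sat S (s(v := u)) [] \<psi>"
        unfolding sat by (intro bexI[of _ "t v"] exI[of _ t]) auto
    qed
    finally show "sat S s [] (Exist (bnd_fm v 0 \<psi>)) \<longleftrightarrow> (\<exists>t. (\<forall>w. w \<notin> insert v V \<longrightarrow> t w = s w) \<and>
        (\<forall>w \<in> insert v V. t w \<in> Dom S) \<and> sat S t [] \<phi>)" .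
  next
    show "Exist (bnd_fm v 0 \<psi>) \<in> formulas L (W - insert v V)"
      using \<psi> set_bnd_fm[of v 0 \<psi>] by (auto simp: formulas_def wf_bnd_fm)
  qed
qed

lemma finite_conj:
  assumes "finite F" "F \<subseteq> formulas L V"
  shows "\<exists>\<chi> \<in> formulas L V. \<forall>(S :: ('f, 'r, 'u) struct) s. Dom S \<noteq> {} \<longrightarrow>
    (sat S s [] \<chi> \<longleftrightarrow> (\<forall>\<phi> \<in> F. sat S s [] \<phi>))"
  using assms
proof induction
  case empty
  \<comment> \<open>The language has no truth constant, so the empty conjunction is
    \<open>\<exists>x. x = x\<close>; this is where \<open>Dom S \<noteq> {}\<close> enters.\<close>
  have "Exist (Eql (Bound 0) (Bound 0)) \<in> formulas L V" by (simp add: formulas_def)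
  then show ?case by (intro bexI[of _ "Exist (Eql (Bound 0) (Bound 0))"]) auto
next
  case (insert \<phi> F)
  then obtain \<chi> where "\<chi> \<in> formulas L V" "\<forall>(S :: ('f, 'r, 'u) struct) s. Dom S \<noteq> {} \<longrightarrow>
    (sat S s [] \<chi> \<longleftrightarrow> (\<forall>\<phi> \<in> F. sat S s [] \<phi>))" by auto
  then show ?case using insert.prems by (intro bexI[of _ "Conj \<phi> \<chi>"]) auto
qed


section \<open>Compactness from saturation\<close>

lemma consistentD:
  assumes "consistent S q" "finite F" "F \<subseteq> q"
  obtains a where "range a \<subseteq> Dom S" "realizes S a F"
  using assms unfolding consistent_def by blast

lemma lindenbaum:
  assumes "consistent S q" "q \<subseteq> formulas L V"
  shows "\<exists>q'. q \<subseteq> q' \<and> q' \<subseteq> formulas L V \<and> consistent S q' \<and>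
    (\<forall>\<phi> \<in> formulas L V. \<phi> \<in> q' \<or> Neg \<phi> \<in> q')"
proof -
  define \<A> where "\<A> = {q'. q \<subseteq> q' \<and> q' \<subseteq> formulas L V \<and> consistent S q'}"
  have "q \<in> \<A>" using assms by (simp add: \<A>_def)
  moreover have "\<Union>\<C> \<in> \<A>" if ne: "\<C> \<noteq> {}" and ch: "subset.chain \<A> \<C>" for \<C>
  proof -
    have sub: "\<C> \<subseteq> \<A>" using ch by (simp add: subset_chain_def)
    have "consistent S (\<Union>\<C>)" unfolding consistent_def
    proof (intro allI impI)
      fix F assume "finite F" "F \<subseteq> \<Union>\<C>"
      then obtain C where "C \<in> \<C>" "F \<subseteq> C"
        using finite_subset_Union_chain[of F \<C> \<A>] ne ch by metis
      then show "\<exists>a. range a \<subseteq> Dom S \<and> realizes S a F"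
        using sub \<open>finite F\<close> by (auto simp: \<A>_def consistent_def)
    qed
    then show ?thesis using sub ne by (auto simp: \<A>_def)
  qed
  ultimately obtain q' where q': "q' \<in> \<A>" and max: "\<forall>X \<in> \<A>. q' \<subseteq> X \<longrightarrow> X = q'"
    using subset_Zorn_nonempty[of \<A>] by blast
  have con': "consistent S q'" using q' by (simp add: \<A>_def)
  have "\<phi> \<in> q' \<or> Neg \<phi> \<in> q'" if \<phi>: "\<phi> \<in> formulas L V" for \<phi>
  proof (rule ccontr)
    assume neg: "\<not> (\<phi> \<in> q' \<or> Neg \<phi> \<in> q')"
    have "insert \<phi> q' \<notin> \<A>" "insert (Neg \<phi>) q' \<notin> \<A>" using max neg by blast+
    then have "\<not> consistent S (insert \<phi> q')" "\<not> consistent S (insert (Neg \<phi>) q')"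
      using q' \<phi> by (auto simp: \<A>_def)
    then obtain F1 F2 where F: "finite F1" "F1 \<subseteq> insert \<phi> q'" "finite F2" "F2 \<subseteq> insert (Neg \<phi>) q'"
      and no: "\<not> (\<exists>a. range a \<subseteq> Dom S \<and> realizes S a F1)" "\<not> (\<exists>a. range a \<subseteq> Dom S \<and> realizes S a F2)"
      unfolding consistent_def by blast
    let ?F = "(F1 - {\<phi>}) \<union> (F2 - {Neg \<phi>})"
    have "finite ?F" "?F \<subseteq> q'" using F by auto
    then obtain a where a: "range a \<subseteq> Dom S" "realizes S a ?F"
      by (rule consistentD[OF con'])
    have "realizes S a F1 \<or> realizes S a F2"
    proof (cases "sat S (case_sum a id) [] \<phi>")
      case True
      then have "realizes S a F1" using a(2) by (auto simp: realizes_def)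
      then show ?thesis ..
    next
      case False
      then have "sat S (case_sum a id) [] (Neg \<phi>)" by simp
      then have "realizes S a F2" using a(2) by (auto simp: realizes_def)
      then show ?thesis ..
    qed
    then show False using no a(1) by blast
  qed
  then show ?thesis using q' by (auto simp: \<A>_def)
qed

text \<open>An uncountable \<open>kb\<close> makes all countable sets small, so tuples with
  countably many coordinates can serve as variables and as parameters.\<close>

locale monster =
  fixes L :: "('f, 'r) lang" and S :: "('f, 'r, 'u) struct" and kb :: "'k rel"
  assumes struc: "structure_of L S"
    and card_kb: "Card_order kb"
    and kb_unc: "natLeq <o kb"
    and saturated: "saturated L kb S"
begin

abbreviation U :: "'u set" where "U \<equiv> Dom S"

definition small :: "'a set \<Rightarrow> bool" where "small X \<longleftrightarrow> |X| <o kb"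

lemma U_ne: "U \<noteq> {}"
  using struc by (simp add: structure_of_def)

lemma kb_inf: "\<not> finite (Field kb)"
  using kb_unc card_kb natLeq_Card_order
  by (metis card_of_Field_ordIso card_of_nat cinfinite_def cinfinite_mono natLeq_cinfinite
      ordLess_imp_ordLeq)

lemma small_Un: "small X \<Longrightarrow> small Y \<Longrightarrow> small (X \<union> Y)"
  unfolding small_def using card_of_Un_ordLess_infinite_Field[OF kb_inf card_kb] by blast

lemma small_ordLeq: "|X| \<le>o |Y| \<Longrightarrow> small Y \<Longrightarrow> small X"
  unfolding small_def by (rule ordLeq_ordLess_trans)

lemma small_subset: "X \<subseteq> Y \<Longrightarrow> small Y \<Longrightarrow> small X"
  by (rule small_ordLeq[OF card_of_mono1])

lemma small_image: "small Y \<Longrightarrow> small (f ` Y)"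
  by (rule small_ordLeq[OF card_of_image])

lemma small_countable: assumes "countable X" shows "small X"
proof -
  have "|X| \<le>o |UNIV :: nat set|"
    using assms unfolding countable_def by (blast intro: card_of_ordLeqI)
  also have "|UNIV :: nat set| =o natLeq" by (rule card_of_nat)
  finally show ?thesis unfolding small_def using kb_unc by (rule ordLeq_ordLess_trans)
qed

text \<open>Saturation is stated for types in one variable. By Zorn, take a maximal partial
  assignment \<open>g\<close> that keeps \<open>q\<close> consistent; if a variable \<open>i\<close>
  had no value, realizing the 1-type that a completion of \<open>q\<close> and \<open>g\<close>
  induces on \<open>i\<close> would extend \<open>g\<close>.\<close>

lemma realize:
  fixes q :: "('f, 'r, 'x + 'u) fm set"
  assumes X: "small X" and A: "small A" "A \<subseteq> U" and q: "q \<subseteq> formulas L (X <+> A)"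
    and con: "consistent S q"
  shows "\<exists>a. range a \<subseteq> U \<and> realizes S a q"
proof -
  define eq :: "'x \<times> 'u \<Rightarrow> ('f, 'r, 'x + 'u) fm" where
    "eq = (\<lambda>(i, u). Eql (Free (Inl i)) (Free (Inr u)))"
  have sat_eq: "sat S (case_sum a id) [] (eq (i, u)) \<longleftrightarrow> a i = u" for a i u
    by (simp add: eq_def)
  define \<G> where "\<G> = {g. g \<subseteq> X \<times> U \<and> consistent S (q \<union> eq ` g)}"
  have "{} \<in> \<G>" using con by (simp add: \<G>_def)
  moreover have "\<Union>\<C> \<in> \<G>" if ne: "\<C> \<noteq> {}" and ch: "subset.chain \<G> \<C>" for \<C>
  proof -
    have sub: "\<C> \<subseteq> \<G>" using ch by (simp add: subset_chain_def)
    have "consistent S (q \<union> eq ` \<Union>\<C>)" unfolding consistent_def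
    proof (intro allI impI)
      fix F assume F: "finite F" "F \<subseteq> q \<union> eq ` \<Union>\<C>"
      then have "finite (F - q)" "F - q \<subseteq> eq ` \<Union>\<C>" by auto
      then obtain H where H: "finite H" "H \<subseteq> \<Union>\<C>" "F - q = eq ` H"
        by (meson finite_subset_image)
      obtain C where "C \<in> \<C>" "H \<subseteq> C"
        using finite_subset_Union_chain[OF H(1,2) ne ch] by metis
      then have "eq ` H \<subseteq> eq ` C" "C \<in> \<G>" using sub by auto
      then have "F \<subseteq> q \<union> eq ` C" "C \<in> \<G>" using H(3) by blast+
      then show "\<exists>a. range a \<subseteq> Dom S \<and> realizes S a F"
        using F(1) by (auto simp: \<G>_def consistent_def)
    qed
    then show ?thesis using sub ne by (auto simp: \<G>_def)
  qed
  ultimately obtain g where g: "g \<in> \<G>" and max: "\<forall>X \<in> \<G>. g \<subseteq> X \<longrightarrow> X = g"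
    using subset_Zorn_nonempty[of \<G>] by blast
  have con_g: "consistent S (q \<union> eq ` g)" and gXU: "g \<subseteq> X \<times> U" using g by (auto simp: \<G>_def)
  have func: "u = u'" if "(i, u) \<in> g" "(i, u') \<in> g" for i u u'
  proof -
    have "finite {eq (i, u), eq (i, u')}" "{eq (i, u), eq (i, u')} \<subseteq> q \<union> eq ` g" using that by auto
    then obtain a where "realizes S a {eq (i, u), eq (i, u')}"
      by (rule consistentD[OF con_g])
    then show ?thesis using sat_eq by (auto simp: realizes_def)
  qed
  have "inj_on fst g" using func by (auto simp: inj_on_def)
  then have "|g| \<le>o |X|" using gXU by (intro card_of_ordLeqI[of fst]) auto
  then have small_g: "small g" using X by (rule small_ordLeq)
  define A' where "A' = A \<union> snd ` g"
  have A': "small A'" "A' \<subseteq> U" using A small_g gXU by (auto simp: A'_def intro: small_Un small_image)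
  have total: "\<exists>u. (i, u) \<in> g" if i: "i \<in> X" for i
  proof (rule ccontr)
    assume no: "\<nexists>u. (i, u) \<in> g"
    have "q \<subseteq> formulas L (X <+> A')"
      using q formulas_mono[of "X <+> A" "X <+> A'" L] by (auto simp: A'_def)
    moreover have "eq ` g \<subseteq> formulas L (X <+> A')"
      using gXU by (force simp: eq_def formulas_def A'_def)
    ultimately have "q \<union> eq ` g \<subseteq> formulas L (X <+> A')" by blast
    from lindenbaum[OF con_g this] obtain q' where q': "q \<union> eq ` g \<subseteq> q'"
      "q' \<subseteq> formulas L (X <+> A')" "consistent S q'"
      "\<forall>\<phi> \<in> formulas L (X <+> A'). \<phi> \<in> q' \<or> Neg \<phi> \<in> q'"
      by blast
    let ?up = "map_fm (map_sum (\<lambda>_ :: nat. i) id) :: _ \<Rightarrow> ('f, 'r, 'x + 'u) fm"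
    define p where "p = {\<phi> \<in> formulas L ({..<1::nat} <+> A'). ?up \<phi> \<in> q'}"
    have up: "?up \<phi> \<in> formulas L (X <+> A')" if "\<phi> \<in> formulas L ({..<1::nat} <+> A')" for \<phi>
      using that i by (intro map_formulas[OF that]) (auto simp: formulas_def)
    have sat_up: "sat S (case_sum a id) [] (?up \<phi>) = sat S (case_sum (\<lambda>_. a i) id) [] \<phi>" for a \<phi>
      unfolding sat_map by (rule sat_cong) (auto split: sum.split)
    have "consistent S p" unfolding consistent_def
    proof (intro allI impI)
      fix F assume "finite F" "F \<subseteq> p"
      then have "finite (?up ` F)" "?up ` F \<subseteq> q'" by (auto simp: p_def)
      then obtain a where "range a \<subseteq> U" "realizes S a (?up ` F)"
        by (rule consistentD[OF q'(3)])
      then show "\<exists>a. range a \<subseteq> U \<and> realizes S a F"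
        using sat_up by (intro exI[of _ "\<lambda>_. a i"]) (auto simp: realizes_def)
    qed
    then have "p \<in> complete_types L S {..<1::nat} A'"
      using up q'(4) by (auto simp: complete_types_def p_def)
    then obtain a0 where a0: "range a0 \<subseteq> U" "realizes S a0 p"
      using saturated A' unfolding saturated_def small_def by blast
    define u where "u = a0 0"
    \<comment> \<open>The other variables of a finite part \<open>F'\<close> of the completion are
      quantified away. The resulting formula lies in \<open>p\<close>, hence holds of
      \<open>u\<close>, and its witnesses give the required assignment.\<close>
    have "consistent S (q \<union> eq ` insert (i, u) g)" unfolding consistent_def
    proof (intro allI impI)
      fix F assume F: "finite F" "F \<subseteq> q \<union> eq ` insert (i, u) g"
      define F' where "F' = F - {eq (i, u)}"
      have F': "finite F'" "F' \<subseteq> q'" using F q'(1) by (auto simp: F'_def)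
      obtain \<chi> where \<chi>: "\<chi> \<in> formulas L (X <+> A')"
        "\<And>s. sat S s [] \<chi> \<longleftrightarrow> (\<forall>\<phi> \<in> F'. sat S s [] \<phi>)"
      proof -
        have "F' \<subseteq> formulas L (X <+> A')" using F'(2) q'(2) by blast
        from finite_conj[where 'u='u, OF F'(1) this] show thesis
          using U_ne by (elim bexE) (rule that, assumption, simp)
      qed
      define V where "V = set_fm \<chi> \<inter> Inl ` (- {i})"
      have "finite V" by (simp add: V_def)
      from ex_block[OF this formulas_set_fm[OF \<chi>(1)]]
      obtain \<theta>' where \<theta>': "\<theta>' \<in> formulas L (set_fm \<chi> - V)" and
        sat\<theta>': "\<And>s. sat S s [] \<theta>' \<longleftrightarrow>
          (\<exists>t. (\<forall>v. v \<notin> V \<longrightarrow> t v = s v) \<and> (\<forall>v \<in> V. t v \<in> U) \<and> sat S t [] \<chi>)" by blast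
      have set\<theta>': "set_fm \<theta>' \<subseteq> {Inl i} \<union> Inr ` A'"
        using \<theta>' \<chi>(1) by (fastforce simp: formulas_def V_def)
      define \<theta> where "\<theta> = map_fm (map_sum (\<lambda>_. 0::nat) id) \<theta>'"
      have \<theta>: "\<theta> \<in> formulas L ({..<1::nat} <+> A')"
        unfolding \<theta>_def using set\<theta>' by (intro map_formulas[OF \<theta>']) auto
      have sat\<theta>: "sat S (case_sum a id) [] \<theta> = sat S (case_sum (\<lambda>_. a 0) id) [] \<theta>'" for a :: "nat \<Rightarrow> 'u"
        unfolding \<theta>_def sat_map by (rule sat_cong) (auto split: sum.split)
      have "Neg \<theta> \<notin> p"
      proof
        assume "Neg \<theta> \<in> p"
        then have "?up (Neg \<theta>) \<in> q'" by (simp add: p_def)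
        then have "finite (insert (?up (Neg \<theta>)) F')" "insert (?up (Neg \<theta>)) F' \<subseteq> q'"
          using F' by auto
        then obtain a where a: "range a \<subseteq> U" "realizes S a (insert (?up (Neg \<theta>)) F')"
          by (rule consistentD[OF q'(3)])
        then have "\<not> sat S (case_sum (\<lambda>_. a i) id) [] \<theta>"
          using sat_up[of a "Neg \<theta>"] by (simp add: realizes_def)
        then have no: "\<not> sat S (case_sum (\<lambda>_. a i) id) [] \<theta>'" using sat\<theta> by simp
        have aU: "a j \<in> U" for j using a(1) by blast
        have "sat S (case_sum a id) [] \<theta>'" unfolding sat\<theta>'
          using a(2) aU by (intro exI[of _ "case_sum a id"]) (auto simp: \<chi>(2) realizes_def V_def)
        moreover have "sat S (case_sum a id) [] \<theta>' = sat S (case_sum (\<lambda>_. a i) id) [] \<theta>'"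
          using set\<theta>' by (intro sat_cong) auto
        ultimately show False using no by simp
      qed
      moreover have "\<theta> \<in> p \<or> Neg \<theta> \<in> p" using \<theta> up[OF \<theta>] q'(4) by (auto simp: p_def)
      ultimately have "\<theta> \<in> p" by blast
      then have "sat S (case_sum a0 id) [] \<theta>" using a0(2) by (auto simp: realizes_def)
      then have "sat S (case_sum (\<lambda>_. u) id) [] \<theta>'" using sat\<theta> by (simp add: u_def)
      then obtain t where t: "\<forall>v. v \<notin> V \<longrightarrow> t v = case_sum (\<lambda>_. u) id v" "\<forall>v \<in> V. t v \<in> U"
        "sat S t [] \<chi>" unfolding sat\<theta>' by blast
      define a where "a j = t (Inl j)" for j
      have u: "u \<in> U" using a0(1) by (auto simp: u_def)
      have "a j \<in> U" for j
        using t(1,2) u by (cases "Inl j \<in> V") (auto simp: a_def)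
      moreover have "t = case_sum a id"
        using t(1) by (auto simp: a_def V_def fun_eq_iff split: sum.split)
      moreover have "a i = u" using t(1) by (auto simp: a_def V_def)
      ultimately show "\<exists>a. range a \<subseteq> U \<and> realizes S a F"
        using t(3) \<chi>(2) sat_eq by (intro exI[of _ a]) (auto simp: realizes_def F'_def)
    qed
    moreover have "u \<in> U" using a0(1) by (auto simp: u_def)
    ultimately have "insert (i, u) g \<in> \<G>" using gXU i by (auto simp: \<G>_def)
    then have "insert (i, u) g = g" using max by blast
    then show False using no by blast
  qed
  obtain u0 where u0: "u0 \<in> U" using U_ne by blast
  define a where "a i = (if i \<in> X then SOME u. (i, u) \<in> g else u0)" for i
  have ag: "(i, a i) \<in> g" if "i \<in> X" for i
    using someI_ex[OF total[OF that]] that by (simp add: a_def)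
  have "range a \<subseteq> U" using ag gXU u0 by (auto simp: a_def split: if_splits)
  moreover have "sat S (case_sum a id) [] \<phi>" if \<phi>: "\<phi> \<in> q" for \<phi>
  proof -
    let ?V = "{i. Inl i \<in> set_fm \<phi>}"
    have V: "finite ?V" "?V \<subseteq> X"
      using finite_imageD[of Inl ?V] q \<phi> finite_subset[OF _ finite_set_fm[of \<phi>], of "Inl ` ?V"]
      by (auto simp: formulas_def)
    have "finite (insert \<phi> ((\<lambda>i. eq (i, a i)) ` ?V))"
      "insert \<phi> ((\<lambda>i. eq (i, a i)) ` ?V) \<subseteq> q \<union> eq ` g" using V ag \<phi> by auto
    then obtain a' where a': "realizes S a' (insert \<phi> ((\<lambda>i. eq (i, a i)) ` ?V))"
      by (rule consistentD[OF con_g])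
    then have "\<And>i. i \<in> ?V \<Longrightarrow> a' i = a i" using sat_eq by (simp add: realizes_def)
    then have "sat S (case_sum a id) [] \<phi> = sat S (case_sum a' id) [] \<phi>"
      by (intro sat_cong) (auto split: sum.split)
    then show ?thesis using a' by (simp add: realizes_def)
  qed
  ultimately show ?thesis by (auto simp: realizes_def)
qed

end

abbreviation jn :: "('a \<Rightarrow> 'c) \<Rightarrow> ('b \<Rightarrow> 'c) \<Rightarrow> 'a + 'b \<Rightarrow> 'c" (infixr "\<oplus>" 65) where
  "a \<oplus> b \<equiv> case_sum a b"

text \<open>Flattens a sequence of tuples into one tuple, so that the type of a whole sequence is
  again the type of a tuple.\<close>

definition sq :: "(nat \<Rightarrow> 'y \<Rightarrow> 'c) \<Rightarrow> nat \<times> 'y \<Rightarrow> 'c" where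
  "sq b = (\<lambda>(j, v). b j v)"

lemma sq_simp [simp]: "sq b (j, v) = b j v"
  by (simp add: sq_def)

section \<open>Increasing maps and finite sets of natural numbers\<close>

lemma strict_mono_image_unique:
  fixes h h' :: "nat \<Rightarrow> nat"
  assumes "strict_mono h" "strict_mono h'" "h ` {..<n} = h' ` {..<n}" "i < n"
  shows "h i = h' i"
proof -
  have *: "sorted (map g [0..<n]) \<and> distinct (map g [0..<n])" if "strict_mono g" for g :: "nat \<Rightarrow> nat"
    using that by (auto simp: sorted_iff_nth_mono distinct_map strict_mono_less_eq
        intro: strict_mono_imp_inj_on inj_on_subset)
  have "map h [0..<n] = map h' [0..<n]"
    using *[OF assms(1)] *[OF assms(2)] assms(3)
    by (intro sorted_distinct_set_unique) (auto simp: atLeast0LessThan)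
  then show ?thesis using assms(4) by (simp add: list_eq_iff_nth_eq)
qed

lemma strict_mono_enum:
  fixes J :: "nat set"
  assumes "finite J"
  shows "\<exists>h. strict_mono h \<and> h ` {..<card J} = J"
proof -
  let ?l = "sorted_list_of_set J"
  obtain m where m: "\<And>j. j \<in> J \<Longrightarrow> j < m" using assms by (metis finite_nat_set_iff_bounded)
  define h where "h i = (if i < card J then ?l ! i else m + i)" for i
  have mem: "?l ! i \<in> J" if "i < card J" for i
    using that assms nth_mem[of i ?l] by simp
  have "strict_mono h"
  proof (rule strict_monoI)
    fix i j :: nat assume "i < j"
    then show "h i < h j"
      using mem m strict_sorted_list_of_set[of J] assms
      by (auto simp: h_def sorted_wrt_iff_nth_less intro: less_le_trans[OF m] trans_less_add1)
  qed
  moreover have "h ` {..<card J} = set ?l"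
    unfolding set_conv_nth by (auto simp: h_def assms)
  ultimately show ?thesis using assms by auto
qed

section \<open>Definable relations on tuples\<close>

text \<open>The maps on tuples given by substituting variables or constants from \<open>D\<close>
  for variables. Definability and equality of types over \<open>D\<close> are stable under them,
  which replaces syntactic renaming.\<close>

definition rn :: "'u set \<Rightarrow> (('x \<Rightarrow> 'u) \<Rightarrow> ('y \<Rightarrow> 'u)) \<Rightarrow> bool" where
  "rn D h \<longleftrightarrow> (\<forall>x. (\<exists>y. \<forall>s. h s x = s y) \<or> (\<exists>u \<in> D. \<forall>s. h s x = u))"

lemma rn_jn [intro!]: "rn D h \<Longrightarrow> rn D h' \<Longrightarrow> rn D (\<lambda>s. h s \<oplus> h' s)"
  unfolding rn_def by (metis obj_sumE sum.case)

lemma rn_const [intro]: "range b \<subseteq> D \<Longrightarrow> rn D (\<lambda>s. b)"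
  unfolding rn_def by blast

lemma rn_ren [intro!]: "rn D (\<lambda>s x. s (f x))"
  unfolding rn_def by blast

lemma rn_id [intro!]: "rn D (\<lambda>s. s)"
  unfolding rn_def by blast

lemma rn_comp [intro]: "rn D h \<Longrightarrow> rn D (\<lambda>s. h (\<lambda>x. s (f x)))"
  unfolding rn_def by metis

context monster
begin

definition tup :: "('x \<Rightarrow> 'u) \<Rightarrow> bool" where "tup a \<longleftrightarrow> (\<forall>x. a x \<in> U)"

definition base :: "'u set \<Rightarrow> bool" where "base D \<longleftrightarrow> D \<subseteq> U \<and> small D"

lemma tup_range: "tup a \<longleftrightarrow> range a \<subseteq> U"
  by (auto simp: tup_def)

lemma tup_jn [simp]: "tup (a \<oplus> b) \<longleftrightarrow> tup a \<and> tup b"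
  by (force simp: tup_def split: sum.split)

lemma tup_comp [simp]: "tup s \<Longrightarrow> tup (\<lambda>x. s (f x))"
  by (simp add: tup_def)

lemma tup_sq [simp]: "tup (sq b) \<longleftrightarrow> (\<forall>j. tup (b j))"
  by (auto simp: tup_def sq_def)

lemma tup_rn: "rn D h \<Longrightarrow> D \<subseteq> U \<Longrightarrow> tup s \<Longrightarrow> tup (h s)"
  unfolding rn_def tup_def by (metis subsetD)

lemma ex_tup: "\<exists>a. tup a"
proof -
  obtain u where "u \<in> U" using U_ne by blast
  then show ?thesis by (intro exI[of _ "\<lambda>_. u"]) (simp add: tup_def)
qed

lemma base_D: "base D \<Longrightarrow> D \<subseteq> U"
  by (simp add: base_def)

lemma base_Un: "base D \<Longrightarrow> base D' \<Longrightarrow> base (D \<union> D')"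
  by (auto simp: base_def small_Un)

lemma base_range: "tup (a :: 'x::countable \<Rightarrow> 'u) \<Longrightarrow> base (range a)"
  by (auto simp: base_def tup_def intro: small_countable)

lemma base_Un_range: "base D \<Longrightarrow> tup (a :: 'x::countable \<Rightarrow> 'u) \<Longrightarrow> base (D \<union> range a)"
  by (intro base_Un base_range)

lemma base_ranges: "(\<And>i. tup (b i)) \<Longrightarrow> base (\<Union>i \<in> (I :: nat set). range (b i :: 'x::countable \<Rightarrow> 'u))"
  by (auto simp: base_def tup_def intro!: small_countable countable_UN)

lemma base_empty: "base {}"
  by (auto simp: base_def intro: small_countable)

lemma base_subset: "base D \<Longrightarrow> D' \<subseteq> D \<Longrightarrow> base D'"
  by (auto simp: base_def intro: small_subset)

text \<open>Only tuples of the monster are compared; elsewhere \<open>P\<close> may be arbitrary, so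
  predicates can be combined semantically.\<close>

definition Dfn :: "'u set \<Rightarrow> (('x \<Rightarrow> 'u) \<Rightarrow> bool) \<Rightarrow> bool" where
  "Dfn D P \<longleftrightarrow> (\<exists>\<phi> \<in> formulas L (UNIV <+> D). \<forall>a. tup a \<longrightarrow> (P a \<longleftrightarrow> sat S (case_sum a id) [] \<phi>))"

lemma DfnI: "\<phi> \<in> formulas L (UNIV <+> D) \<Longrightarrow> (\<And>a. tup a \<Longrightarrow> P a \<longleftrightarrow> sat S (case_sum a id) [] \<phi>) \<Longrightarrow> Dfn D P"
  unfolding Dfn_def by blast

lemma DfnE:
  assumes "Dfn D P"
  obtains \<phi> where "\<phi> \<in> formulas L (UNIV <+> D)" "\<And>a. tup a \<Longrightarrow> P a \<longleftrightarrow> sat S (case_sum a id) [] \<phi>"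
  using assms unfolding Dfn_def by blast

lemma Dfn_cong: "Dfn D P \<Longrightarrow> (\<And>a. tup a \<Longrightarrow> P a = Q a) \<Longrightarrow> Dfn D Q"
  unfolding Dfn_def by auto

lemma Dfn_mono: "Dfn D P \<Longrightarrow> D \<subseteq> D' \<Longrightarrow> Dfn D' P"
  by (erule DfnE, rule DfnI[OF subsetD[OF formulas_mono]]) auto

lemma Dfn_not: "Dfn D P \<Longrightarrow> Dfn D (\<lambda>a. \<not> P a)"
  by (erule DfnE, rule_tac \<phi>="Neg \<phi>" in DfnI) auto

lemma Dfn_conj: "Dfn D P \<Longrightarrow> Dfn D Q \<Longrightarrow> Dfn D (\<lambda>a. P a \<and> Q a)"
  by (elim DfnE, rule_tac \<phi>="Conj \<phi> \<phi>'" in DfnI) auto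

lemma Dfn_disj: "Dfn D P \<Longrightarrow> Dfn D Q \<Longrightarrow> Dfn D (\<lambda>a. P a \<or> Q a)"
  by (rule Dfn_cong[OF Dfn_not[OF Dfn_conj[OF Dfn_not[of D P] Dfn_not[of D Q]]]]) auto

lemma Dfn_imp: "Dfn D P \<Longrightarrow> Dfn D Q \<Longrightarrow> Dfn D (\<lambda>a. P a \<longrightarrow> Q a)"
  by (rule Dfn_cong[OF Dfn_disj[OF Dfn_not[of D P], of Q]]) auto

lemma Dfn_iff: "Dfn D P \<Longrightarrow> Dfn D Q \<Longrightarrow> Dfn D (\<lambda>a. P a \<longleftrightarrow> Q a)"
  by (rule Dfn_cong[OF Dfn_conj[OF Dfn_imp[of D P Q] Dfn_imp[of D Q P]]]) auto

lemma Dfn_True: "Dfn D (\<lambda>a. True)"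
  using U_ne by (intro DfnI[of "Exist (Eql (Bound 0) (Bound 0))"]) (auto simp: formulas_def)

lemma Dfn_ball: "finite I \<Longrightarrow> (\<And>i. i \<in> I \<Longrightarrow> Dfn D (P i)) \<Longrightarrow> Dfn D (\<lambda>a. \<forall>i \<in> I. P i a)"
  by (induction I rule: finite_induct) (auto intro: Dfn_True Dfn_conj)

lemma Dfn_bex: "finite I \<Longrightarrow> (\<And>i. i \<in> I \<Longrightarrow> Dfn D (P i)) \<Longrightarrow> Dfn D (\<lambda>a. \<exists>i \<in> I. P i a)"
  by (rule Dfn_cong[OF Dfn_not[OF Dfn_ball[of I D "\<lambda>i a. \<not> P i a"]]]) (auto intro: Dfn_not)

lemma Dfn_eq: "Dfn D (\<lambda>a. a x = a y)"
  by (intro DfnI[of "Eql (Free (Inl x)) (Free (Inl y))"]) (auto simp: formulas_def)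

lemma Dfn_eqc: "u \<in> D \<Longrightarrow> Dfn D (\<lambda>a. a x = u)"
  by (intro DfnI[of "Eql (Free (Inl x)) (Free (Inr u))"]) (auto simp: formulas_def)

lemma Dfn_rn:
  assumes P: "Dfn D P" and D: "D \<subseteq> D'" "D' \<subseteq> U" and h: "rn D' h"
  shows "Dfn D' (\<lambda>s. P (h s))"
proof -
  have "\<exists>z. z \<in> UNIV <+> D' \<and> (\<forall>s. h s x = case_sum s id z)" for x
  proof -
    consider y where "\<forall>s. h s x = s y" | u where "u \<in> D'" "\<forall>s. h s x = u"
      using h unfolding rn_def by blast
    then show ?thesis
    proof cases
      case 1
      then show ?thesis by (intro exI[of _ "Inl y"]) auto
    next
      case 2
      then show ?thesis by (intro exI[of _ "Inr u"]) auto
    qed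
  qed
  then obtain g where g: "\<And>x. g x \<in> UNIV <+> D'" "\<And>x s. h s x = case_sum s id (g x)" by metis
  from P obtain \<phi> where \<phi>: "\<phi> \<in> formulas L (UNIV <+> D)"
    "\<And>a. tup a \<Longrightarrow> P a \<longleftrightarrow> sat S (case_sum a id) [] \<phi>" by (rule DfnE) blast
  let ?g = "case_sum g Inr"
  show ?thesis
  proof (rule DfnI)
    show "map_fm ?g \<phi> \<in> formulas L (UNIV <+> D')"
    proof (rule map_formulas[OF \<phi>(1)])
      have "set_fm \<phi> \<subseteq> UNIV <+> D'" using \<phi>(1) D(1) by (auto simp: formulas_def)
      then show "?g ` set_fm \<phi> \<subseteq> UNIV <+> D'" using g(1) by auto
    qed
    fix s :: "'b \<Rightarrow> 'u" assume s: "tup s"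
    have "P (h s) = sat S (case_sum (h s) id) [] \<phi>" using \<phi>(2) tup_rn[OF h D(2) s] by blast
    also have "case_sum (h s) id = case_sum s id \<circ> ?g" using g(2) by (auto split: sum.split)
    finally show "P (h s) = sat S (case_sum s id) [] (map_fm ?g \<phi>)" by (simp add: sat_map comp_def)
  qed
qed

lemmas Dfn_rn' = Dfn_rn[OF _ order_refl]

lemma Dfn_comp: "Dfn D P \<Longrightarrow> D \<subseteq> U \<Longrightarrow> Dfn D (\<lambda>s. P (\<lambda>x. s (f x)))"
  by (rule Dfn_rn') auto

text \<open>The tuple \<open>a\<close> may be infinite, but only its finitely many coordinates in
  \<open>V\<close> are quantified; in the converse direction the others are filled from an arbitrary
  \<open>a0\<close>.\<close>

lemma Dfn_ex:
  assumes P: "Dfn D P"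
  shows "Dfn D (\<lambda>b. \<exists>a. tup a \<and> P (a \<oplus> b))"
proof -
  from P obtain \<phi> where \<phi>: "\<phi> \<in> formulas L (UNIV <+> D)"
    "\<And>a. tup a \<Longrightarrow> P a \<longleftrightarrow> sat S (case_sum a id) [] \<phi>" by (rule DfnE) blast
  define V where "V = set_fm \<phi> \<inter> Inl ` Inl ` UNIV"
  have "finite V" by (simp add: V_def)
  from ex_block[OF this formulas_set_fm[OF \<phi>(1)]]
  obtain \<psi> where \<psi>: "\<psi> \<in> formulas L (set_fm \<phi> - V)"
    "\<And>s. sat S s [] \<psi> \<longleftrightarrow> (\<exists>t. (\<forall>v. v \<notin> V \<longrightarrow> t v = s v) \<and> (\<forall>v \<in> V. t v \<in> U) \<and> sat S t [] \<phi>)"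
    by (elim bexE) blast
  have set\<psi>: "z \<in> Inl ` Inr ` UNIV \<union> Inr ` D" if "z \<in> set_fm \<psi>" for z
  proof -
    have "z \<in> set_fm \<phi>" "z \<notin> V" "z \<in> UNIV <+> D" using \<psi>(1) \<phi>(1) that by (auto simp: formulas_def)
    then show ?thesis
    proof (cases z rule: sum.exhaust)
      case (Inl w)
      then show ?thesis using \<open>z \<in> set_fm \<phi>\<close> \<open>z \<notin> V\<close> by (cases w rule: sum.exhaust) (auto simp: V_def)
    qed auto
  qed
  define g :: "('a + 'b) + 'u \<Rightarrow> 'b + 'u" where "g = case_sum (case_sum undefined Inl) Inr"
  show ?thesis
  proof (rule DfnI)
    show "map_fm g \<psi> \<in> formulas L (UNIV <+> D)"
      by (rule map_formulas[OF formulas_set_fm[OF \<psi>(1)]]) (use set\<psi> in \<open>force simp: g_def\<close>)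
    fix b :: "'b \<Rightarrow> 'u" assume b: "tup b"
    show "(\<exists>a. tup a \<and> P (a \<oplus> b)) = sat S (case_sum b id) [] (map_fm g \<psi>)"
    proof
      assume "\<exists>a. tup a \<and> P (a \<oplus> b)"
      then obtain a where a: "tup a" "P (a \<oplus> b)" by blast
      then have "sat S (case_sum (a \<oplus> b) id) [] \<phi>" using \<phi>(2)[of "a \<oplus> b"] b by simp
      then have "sat S (case_sum (a \<oplus> b) id) [] \<psi>" unfolding \<psi>(2)
        using a(1) by (intro exI[of _ "case_sum (a \<oplus> b) id"]) (auto simp: V_def tup_def)
      moreover have "sat S (case_sum (a \<oplus> b) id) [] \<psi> = sat S (case_sum b id \<circ> g) [] \<psi>"
        by (rule sat_cong) (use set\<psi> in \<open>force simp: g_def\<close>)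
      ultimately show "sat S (case_sum b id) [] (map_fm g \<psi>)" by (simp add: sat_map)
    next
      assume "sat S (case_sum b id) [] (map_fm g \<psi>)"
      then have "sat S (case_sum b id \<circ> g) [] \<psi>" by (simp add: sat_map)
      moreover obtain a0 :: "'a \<Rightarrow> 'u" where a0: "tup a0" using ex_tup by blast
      moreover have "sat S (case_sum (a0 \<oplus> b) id) [] \<psi> = sat S (case_sum b id \<circ> g) [] \<psi>"
        by (rule sat_cong) (use set\<psi> in \<open>force simp: g_def\<close>)
      ultimately have "sat S (case_sum (a0 \<oplus> b) id) [] \<psi>" by simp
      then obtain t where t: "\<forall>v. v \<notin> V \<longrightarrow> t v = case_sum (a0 \<oplus> b) id v" "\<forall>v \<in> V. t v \<in> U"
        "sat S t [] \<phi>" unfolding \<psi>(2) by blast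
      define a where "a x = t (Inl (Inl x))" for x
      have "a x \<in> U" for x
        using t(1,2) a0 by (cases "Inl (Inl x) \<in> V") (auto simp: a_def tup_def)
      then have "tup a" by (simp add: tup_def)
      moreover have "t = case_sum (a \<oplus> b) id"
        using t(1) by (auto simp: fun_eq_iff a_def V_def split: sum.split)
      ultimately show "\<exists>a. tup a \<and> P (a \<oplus> b)"
        using t(3) \<phi>(2)[of "a \<oplus> b"] b by (intro exI[of _ a]) simp
    qed
  qed
qed

lemma Dfn_ex':
  assumes "Dfn D P" "D \<subseteq> U"
  shows "Dfn D (\<lambda>b. \<exists>a. tup a \<and> P (b \<oplus> a))"
proof -
  have "Dfn D (\<lambda>s. P ((\<lambda>x. s (Inr x)) \<oplus> (\<lambda>x. s (Inl x))))"
    by (rule Dfn_rn'[OF assms]) auto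
  from Dfn_ex[OF this] show ?thesis by simp
qed

text \<open>A parameter \<open>u\<close> outside \<open>D\<close> occurs in \<open>b\<close>; it is
  replaced by the variable of a coordinate with that value, namely \<open>inv b u\<close>.\<close>

lemma Dfn_abs:
  fixes P :: "('x \<Rightarrow> 'u) \<Rightarrow> bool" and b :: "'y \<Rightarrow> 'u"
  assumes P: "Dfn D' P" and D: "D' \<subseteq> D \<union> range b" "D \<subseteq> U" and b: "tup b"
  shows "\<exists>Q. Dfn D Q \<and> (\<forall>a. P a \<longleftrightarrow> Q (a \<oplus> b))"
proof -
  from P obtain \<phi> where \<phi>: "\<phi> \<in> formulas L (UNIV <+> D')"
    "\<And>a. tup a \<Longrightarrow> P a \<longleftrightarrow> sat S (case_sum a id) [] \<phi>" by (rule DfnE) blast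
  define g :: "'x + 'u \<Rightarrow> ('x + 'y) + 'u" where "g = case_sum (\<lambda>x. Inl (Inl x)) (\<lambda>u. if u \<in> D then Inr u else Inl (Inr (inv b u)))"
  \<comment> \<open>Outside \<open>tup\<close> the predicate is taken from \<open>P\<close> itself,
    so that the equivalence holds for every \<open>a\<close>.\<close>
  define Q where "Q s \<longleftrightarrow> (if tup s then sat S (case_sum s id) [] (map_fm g \<phi>) else P (\<lambda>x. s (Inl x)))" for s
  have "Dfn D Q"
  proof (rule DfnI)
    show "map_fm g \<phi> \<in> formulas L (UNIV <+> D)"
      by (rule map_formulas[OF \<phi>(1)]) (auto simp: g_def split: sum.split)
  qed (simp add: Q_def)
  moreover have "P a \<longleftrightarrow> Q (a \<oplus> b)" for a
  proof (cases "tup a")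
    case True
    have "sat S (case_sum (a \<oplus> b) id) [] (map_fm g \<phi>) = sat S (case_sum a id) [] \<phi>"
      unfolding sat_map
    proof (rule sat_cong)
      fix v assume "v \<in> set_fm \<phi>"
      then have "v \<in> UNIV <+> D'" using \<phi>(1) by (auto simp: formulas_def)
      then show "(case_sum (a \<oplus> b) id \<circ> g) v = case_sum a id v"
        using D(1) by (auto simp: g_def f_inv_into_f)
    qed
    then show ?thesis using True b \<phi>(2) by (simp add: Q_def)
  qed (simp add: Q_def)
  ultimately show ?thesis by blast
qed

lemma Dfn_params:
  assumes "Dfn D P" shows "\<exists>D0 \<subseteq> D. finite D0 \<and> Dfn D0 P"
proof -
  from assms obtain \<phi> where \<phi>: "\<phi> \<in> formulas L (UNIV <+> D)"
    "\<And>a. tup a \<Longrightarrow> P a \<longleftrightarrow> sat S (case_sum a id) [] \<phi>" by (rule DfnE) blast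
  let ?D0 = "{u. Inr u \<in> set_fm \<phi>}"
  have "finite (Inr -` set_fm \<phi>)" by (rule finite_vimageI) auto
  then have "finite ?D0" by (simp add: vimage_def)
  moreover have "Dfn ?D0 P"
  proof (rule DfnI[OF _ \<phi>(2)])
    have "z \<in> UNIV <+> ?D0" if "z \<in> set_fm \<phi>" for z using that by (cases z rule: sum.exhaust) auto
    then show "\<phi> \<in> formulas L (UNIV <+> ?D0)" using \<phi>(1) by (auto simp: formulas_def)
  qed
  ultimately show ?thesis using \<phi>(1) by (intro exI[of _ ?D0]) (auto simp: formulas_def)
qed

text \<open>The finitely many parameters are listed by a sequence \<open>d\<close>. It must have
  values even when there are no parameters, hence the extra element \<open>u\<close> of
  \<open>D2\<close>.\<close>

lemma Dfn_abs_nat: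
  assumes P: "Dfn D2 P" and D: "D2 \<noteq> {}" "D2 \<subseteq> U"
  shows "\<exists>(d :: nat \<Rightarrow> 'u) Q. range d \<subseteq> D2 \<and> Dfn {} Q \<and> (\<forall>a. P a \<longleftrightarrow> Q (a \<oplus> d))"
proof -
  obtain D0 where D0: "D0 \<subseteq> D2" "finite D0" "Dfn D0 P" using Dfn_params[OF P] by blast
  obtain u where u: "u \<in> D2" using D(1) by blast
  have "insert u D0 \<noteq> {}" "countable (insert u D0)" using D0(2) by (auto intro: countable_finite)
  then have d: "range (from_nat_into (insert u D0)) = insert u D0"
    by (rule range_from_nat_into)
  then have "tup (from_nat_into (insert u D0))" using D0(1) D u by (auto simp: tup_range)
  from Dfn_abs[OF D0(3) _ _ this, of "{}"] d show ?thesis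
    using D0(1) u by (intro exI[of _ "from_nat_into (insert u D0)"]) auto
qed

lemma Dfn_support:
  assumes "Dfn D P"
  shows "\<exists>V. finite V \<and> (\<forall>a a'. tup a \<longrightarrow> tup a' \<longrightarrow> (\<forall>v \<in> V. a v = a' v) \<longrightarrow> P a = P a')"
proof -
  from assms obtain \<phi> where \<phi>: "\<phi> \<in> formulas L (UNIV <+> D)"
    "\<And>a. tup a \<Longrightarrow> P a \<longleftrightarrow> sat S (case_sum a id) [] \<phi>" by (rule DfnE) blast
  have fin: "finite (Inl -` set_fm \<phi>)" by (rule finite_vimageI) auto
  have "P a = P a'" if "tup a" "tup a'" "\<forall>v \<in> Inl -` set_fm \<phi>. a v = a' v" for a a'
  proof -
    have "sat S (case_sum a id) [] \<phi> = sat S (case_sum a' id) [] \<phi>"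
      using that(3) by (intro sat_cong) (auto split: sum.split)
    then show ?thesis using \<phi>(2) that by simp
  qed
  then show ?thesis using fin by blast
qed

text \<open>The countable index type makes the set of variables small, so that
  \<open>realize\<close> applies to the formulas chosen for the predicates.\<close>

lemma compact:
  fixes f :: "'i \<Rightarrow> ('x::countable \<Rightarrow> 'u) \<Rightarrow> bool"
  assumes D: "base D" and f: "\<And>i. i \<in> I \<Longrightarrow> Dfn D (f i)"
    and fin: "\<And>J. J \<subseteq> I \<Longrightarrow> finite J \<Longrightarrow> \<exists>a. tup a \<and> (\<forall>i \<in> J. f i a)"
  shows "\<exists>a. tup a \<and> (\<forall>i \<in> I. f i a)"
proof -
  have "\<forall>i \<in> I. \<exists>\<phi>. \<phi> \<in> formulas L (UNIV <+> D) \<and> (\<forall>a. tup a \<longrightarrow> (f i a \<longleftrightarrow> sat S (case_sum a id) [] \<phi>))"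
    using f unfolding Dfn_def by blast
  then obtain \<phi> where \<phi>: "\<And>i. i \<in> I \<Longrightarrow> \<phi> i \<in> formulas L (UNIV <+> D)"
    "\<And>i a. i \<in> I \<Longrightarrow> tup a \<Longrightarrow> f i a \<longleftrightarrow> sat S (case_sum a id) [] (\<phi> i)" by metis
  have "consistent S (\<phi> ` I)" unfolding consistent_def
  proof (intro allI impI)
    fix F assume "finite F" "F \<subseteq> \<phi> ` I"
    then obtain J where J: "J \<subseteq> I" "finite J" "F = \<phi> ` J" by (meson finite_subset_image)
    then obtain a where "tup a" "\<forall>i \<in> J. f i a" using fin by blast
    then show "\<exists>a. range a \<subseteq> U \<and> realizes S a F"
      using J \<phi>(2)[of _ a] by (intro exI[of _ a]) (auto simp: realizes_def tup_range subset_iff)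
  qed
  moreover have "small (UNIV :: 'x set)" by (rule small_countable) simp
  ultimately obtain a where a: "range a \<subseteq> U" "realizes S a (\<phi> ` I)"
    using realize[of UNIV D "\<phi> ` I"] D \<phi>(1) by (auto simp: base_def)
  then show ?thesis using \<phi>(2) by (intro exI[of _ a]) (auto simp: realizes_def tup_range)
qed


section \<open>Types and homogeneity\<close>

text \<open>Equality of the types of \<open>a\<close> and \<open>b\<close> over \<open>D\<close>;
  one implication suffices because negations of definable predicates are definable.\<close>

definition eqt :: "'u set \<Rightarrow> ('x \<Rightarrow> 'u) \<Rightarrow> ('x \<Rightarrow> 'u) \<Rightarrow> bool" where
  "eqt D a b \<longleftrightarrow> (\<forall>P. Dfn D P \<longrightarrow> P a \<longrightarrow> P b)"

lemma eqtD: "eqt D a b \<Longrightarrow> Dfn D P \<Longrightarrow> P a \<longleftrightarrow> P b"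
  unfolding eqt_def using Dfn_not by blast

lemma eqt_sym: "eqt D a b \<Longrightarrow> eqt D b a"
  using eqtD unfolding eqt_def by blast

lemma eqt_refl [simp]: "eqt D a a"
  unfolding eqt_def by blast

lemma eqt_trans: "eqt D a b \<Longrightarrow> eqt D b c \<Longrightarrow> eqt D a c"
  unfolding eqt_def by blast

lemma eqt_mono: "eqt D' a b \<Longrightarrow> D \<subseteq> D' \<Longrightarrow> eqt D a b"
  unfolding eqt_def using Dfn_mono by blast

lemma eqt_rn: "eqt D a b \<Longrightarrow> D \<subseteq> U \<Longrightarrow> rn D h \<Longrightarrow> eqt D (h a) (h b)"
  unfolding eqt_def[of D "h a"] using Dfn_rn'[of D _ h] eqtD[of D a b] by blast

lemma eqt_comp: "eqt D a b \<Longrightarrow> D \<subseteq> U \<Longrightarrow> eqt D (\<lambda>x. a (f x)) (\<lambda>x. b (f x))"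
  by (rule eqt_rn[where h="\<lambda>s x. s (f x)"]) auto

lemma eqt_jnD:
  assumes "eqt D (a \<oplus> c) (b \<oplus> d)" "D \<subseteq> U"
  shows "eqt D a b" "eqt D c d"
  using eqt_comp[OF assms, of Inl] eqt_comp[OF assms, of Inr] by simp_all

lemma eqt_swap: "eqt D (a \<oplus> c) (b \<oplus> d) \<Longrightarrow> D \<subseteq> U \<Longrightarrow> eqt D (c \<oplus> a) (d \<oplus> b)"
  using eqt_rn[of D "a \<oplus> c" "b \<oplus> d" "\<lambda>s. (\<lambda>x. s (Inr x)) \<oplus> (\<lambda>x. s (Inl x))", OF _ _ rn_jn[OF rn_ren rn_ren]]
  by simp

lemma eqt_base:
  assumes "D \<subseteq> U" "tup d"
  shows "eqt (D \<union> range d) a b \<longleftrightarrow> eqt D (a \<oplus> d) (b \<oplus> d)"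
proof
  have dU: "range d \<subseteq> U" using assms(2) by (simp add: tup_range)
  assume eq: "eqt (D \<union> range d) a b"
  show "eqt D (a \<oplus> d) (b \<oplus> d)" unfolding eqt_def
  proof (intro allI impI)
    fix P assume "Dfn D P" "P (a \<oplus> d)"
    moreover have "Dfn (D \<union> range d) (\<lambda>a. P (a \<oplus> d))"
      using dU by (intro Dfn_rn[OF \<open>Dfn D P\<close> _ _]) (auto simp: assms(1))
    ultimately show "P (b \<oplus> d)" using eqtD[OF eq] by blast
  qed
next
  assume eq: "eqt D (a \<oplus> d) (b \<oplus> d)"
  show "eqt (D \<union> range d) a b" unfolding eqt_def
    using Dfn_abs[OF _ order_refl assms] eqtD[OF eq] by blast
qed

text \<open>Takes the place of automorphisms, which saturation alone need not provide: when
  \<open>a\<close> is moved to \<open>b\<close>, a further tuple \<open>c\<close> is carried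
  along.\<close>

lemma homog:
  fixes a b :: "'x::countable \<Rightarrow> 'u" and c :: "'y::countable \<Rightarrow> 'u"
  assumes D: "base D" and eq: "eqt D a b" and t: "tup a" "tup b" "tup c"
  shows "\<exists>d. tup d \<and> eqt D (a \<oplus> c) (b \<oplus> d)"
proof -
  have DU: "D \<subseteq> U" using D by (rule base_D)
  have "\<exists>d. tup d \<and> (\<forall>P \<in> {P. Dfn D P \<and> P (a \<oplus> c)}. P (b \<oplus> d))"
  proof (rule compact[of "D \<union> range b"])
    show "base (D \<union> range b)" using D t by (intro base_Un_range)
    show "Dfn (D \<union> range b) (\<lambda>d. P (b \<oplus> d))" if "P \<in> {P. Dfn D P \<and> P (a \<oplus> c)}" for P
    proof (rule Dfn_rn[of D P])
      show "Dfn D P" using that by blast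
      show "D \<union> range b \<subseteq> U" using DU t by (auto simp: tup_range)
      show "rn (D \<union> range b) (\<lambda>d. b \<oplus> d)" by (intro rn_jn rn_const rn_id) blast
    qed blast
    fix J assume J: "J \<subseteq> {P. Dfn D P \<and> P (a \<oplus> c)}" "finite J"
    have "Dfn D (\<lambda>s. \<forall>P \<in> J. P s)" using J by (intro Dfn_ball) auto
    from Dfn_ex'[OF this DU] eqtD[OF eq, of "\<lambda>s. \<exists>d. tup d \<and> (\<forall>P \<in> J. P (s \<oplus> d))"]
    show "\<exists>d. tup d \<and> (\<forall>P \<in> J. P (b \<oplus> d))" using t J by blast
  qed
  then show ?thesis unfolding eqt_def by blast
qed


section \<open>Indiscernible sequences\<close>

text \<open>Order indiscernibility. Comparing infinite subsequences amounts to comparing finite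
  ones, since a formula sees only finitely many coordinates.\<close>

definition indisc :: "'u set \<Rightarrow> (nat \<Rightarrow> 'y \<Rightarrow> 'u) \<Rightarrow> bool" where
  "indisc D b \<longleftrightarrow> (\<forall>h. strict_mono h \<longrightarrow> eqt D (sq b) (sq (\<lambda>i. b (h i))))"

text \<open>\<open>P\<close> depends only on the first \<open>n\<close> entries of a subsequence. An
  increasing map is determined below \<open>n\<close> by the set of its values there, so
  \<open>P\<close> colours \<open>n\<close>-element sets and Ramsey's theorem applies.\<close>

lemma homogeneous_subsequence1:
  fixes b :: "nat \<Rightarrow> 'y \<Rightarrow> 'u"
  assumes P: "Dfn D P" and b: "\<And>j. tup (b j)"
  shows "\<exists>e :: nat \<Rightarrow> nat. strict_mono e \<and> (\<forall>h h'. strict_mono h \<longrightarrow> strict_mono h' \<longrightarrow>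
    P (sq (\<lambda>i. b (e (h i)))) = P (sq (\<lambda>i. b (e (h' i)))))"
proof -
  obtain V where V: "finite V" "\<And>a a'. tup a \<Longrightarrow> tup a' \<Longrightarrow> \<forall>v \<in> V. a v = a' v \<Longrightarrow> P a = P a'"
    using Dfn_support[OF P] by blast
  obtain n where n: "\<And>i v. (i, v) \<in> V \<Longrightarrow> i < n"
    using finite_nat_set_iff_bounded[of "fst ` V"] V(1) by force
  define g where "g X \<longleftrightarrow> (\<exists>h. strict_mono h \<and> h ` {..<n} = X \<and> P (sq (\<lambda>i. b (h i))))" for X
  have g: "g (h ` {..<n}) \<longleftrightarrow> P (sq (\<lambda>i. b (h i)))" if h: "strict_mono h" for h
  proof -
    have "P (sq (\<lambda>i. b (h' i))) = P (sq (\<lambda>i. b (h i)))"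
      if "strict_mono h'" "h' ` {..<n} = h ` {..<n}" for h'
      using b strict_mono_image_unique[OF that(1) h that(2)] n by (intro V(2)) auto
    then show ?thesis unfolding g_def using h by blast
  qed
  have "\<exists>Y t. Y \<subseteq> UNIV \<and> infinite Y \<and> t < 2 \<and>
    (\<forall>X. X \<subseteq> Y \<and> finite X \<and> card X = n \<longrightarrow> (if g X then 1 else 0 :: nat) = t)"
    by (rule Ramsey) auto
  then obtain Y t where Y: "infinite Y"
    "\<forall>X. X \<subseteq> Y \<and> finite X \<and> card X = n \<longrightarrow> (if g X then 1 else 0 :: nat) = t"
    by (elim exE conjE)
  have e: "strict_mono (enumerate Y)" "\<And>i. enumerate Y i \<in> Y"
    using Y(1) by (auto simp: strict_mono_enumerate enumerate_in_set)
  have *: "P (sq (\<lambda>i. b (enumerate Y (h i)))) \<longleftrightarrow> t = 1" if h: "strict_mono h" for h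
  proof -
    have sm: "strict_mono (\<lambda>i. enumerate Y (h i))" using e(1) h by (simp add: strict_mono_def)
    let ?X = "(\<lambda>i. enumerate Y (h i)) ` {..<n}"
    have "card ?X = n"
      using strict_mono_imp_inj_on[OF sm] by (simp add: card_image inj_on_subset)
    then have "(if g ?X then 1 else 0 :: nat) = t" using e(2) by (intro Y(2)[rule_format]) auto
    then show ?thesis using g[OF sm] by auto
  qed
  show ?thesis by (rule exI[of _ "enumerate Y"]) (simp add: e(1) *)
qed

lemma homogeneous_subsequence:
  fixes b :: "nat \<Rightarrow> 'y \<Rightarrow> 'u"
  assumes "finite \<P>" "\<And>P. P \<in> \<P> \<Longrightarrow> Dfn D P" and b: "\<And>j. tup (b j)"
  shows "\<exists>e :: nat \<Rightarrow> nat. strict_mono e \<and> (\<forall>P \<in> \<P>. \<forall>h h'. strict_mono h \<longrightarrow> strict_mono h' \<longrightarrow>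
    P (sq (\<lambda>i. b (e (h i)))) = P (sq (\<lambda>i. b (e (h' i)))))"
  using assms(1,2)
proof (induction rule: finite_induct)
  case empty
  show ?case by (rule exI[of _ id]) (simp add: strict_mono_def)
next
  case (insert P \<P>)
  have "\<exists>e :: nat \<Rightarrow> nat. strict_mono e \<and> (\<forall>P \<in> \<P>. \<forall>h h'. strict_mono h \<longrightarrow> strict_mono h' \<longrightarrow>
    P (sq (\<lambda>i. b (e (h i)))) = P (sq (\<lambda>i. b (e (h' i)))))"
    by (rule insert.IH) (simp add: insert.prems)
  then obtain e :: "nat \<Rightarrow> nat" where e: "strict_mono e" "\<forall>P \<in> \<P>. \<forall>h h'. strict_mono h \<longrightarrow> strict_mono h' \<longrightarrow>
    P (sq (\<lambda>i. b (e (h i)))) = P (sq (\<lambda>i. b (e (h' i))))"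
    by (elim exE conjE)
  have "Dfn D P" using insert.prems by simp
  from homogeneous_subsequence1[OF this, of "\<lambda>i. b (e i)", OF b]
  obtain e' :: "nat \<Rightarrow> nat" where e': "strict_mono e'" "\<forall>h h'. strict_mono h \<longrightarrow> strict_mono h' \<longrightarrow>
    P (sq (\<lambda>i. b (e (e' (h i))))) = P (sq (\<lambda>i. b (e (e' (h' i)))))"
    by (elim exE conjE)
  have sm: "strict_mono (\<lambda>i. e' (h i))" if "strict_mono h" for h
    using e'(1) that by (simp add: strict_mono_def)
  show ?case
  proof (intro exI[of _ "\<lambda>i. e (e' i)"] conjI ballI allI impI)
    show "strict_mono (\<lambda>i. e (e' i))" using e(1) e'(1) by (simp add: strict_mono_def)
    fix Q and h h' :: "nat \<Rightarrow> nat" assume "Q \<in> insert P \<P>" "strict_mono h" "strict_mono h'"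
    then show "Q (sq (\<lambda>i. b (e (e' (h i))))) = Q (sq (\<lambda>i. b (e (e' (h' i)))))"
      using e(2)[rule_format, of Q, OF _ sm sm] e'(2) by auto
  qed
qed

text \<open>\<open>I1\<close> is the Ehrenfeucht-Mostowski type of \<open>b\<close>, the properties
  shared by all its subsequences, and \<open>I2\<close> states indiscernibility; finitely many of
  these conditions hold on a homogeneous subsequence.\<close>

lemma extract_indisc:
  fixes b :: "nat \<Rightarrow> 'y::countable \<Rightarrow> 'u"
  assumes D: "base D" and b: "\<And>j. tup (b j)"
  shows "\<exists>b'. (\<forall>j. tup (b' j)) \<and> indisc D b' \<and>
    (\<forall>P. Dfn D P \<longrightarrow> (\<forall>h. strict_mono h \<longrightarrow> P (sq (\<lambda>i. b (h i)))) \<longrightarrow> P (sq b'))"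
proof -
  have DU: "D \<subseteq> U" using D by (rule base_D)
  define I1 where "I1 = {P. Dfn D P \<and> (\<forall>h. strict_mono h \<longrightarrow> P (sq (\<lambda>i. b (h i))))}"
  define I2 where "I2 = {(P, h). Dfn D (P :: (nat \<times> 'y \<Rightarrow> 'u) \<Rightarrow> bool) \<and> strict_mono (h :: nat \<Rightarrow> nat)}"
  define f :: "((nat \<times> 'y \<Rightarrow> 'u) \<Rightarrow> bool) + ((nat \<times> 'y \<Rightarrow> 'u) \<Rightarrow> bool) \<times> (nat \<Rightarrow> nat) \<Rightarrow> (nat \<times> 'y \<Rightarrow> 'u) \<Rightarrow> bool" where "f = case_sum id (\<lambda>(P, h) s. P s = P (\<lambda>(i, v). s (h i :: nat, v :: 'y)))"
  have "\<exists>s. tup s \<and> (\<forall>i \<in> I1 <+> I2. f i s)"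
  proof (rule compact[OF D])
    fix i assume i: "i \<in> I1 <+> I2"
    show "Dfn D (f i)"
    proof (cases i rule: sum.exhaust)
      case (Inl P)
      then show ?thesis using i by (auto simp: f_def I1_def)
    next
      case (Inr q)
      obtain P h where q: "q = (P, h)" by (cases q rule: prod.exhaust)
      have "Dfn D P" using i Inr q by (auto simp: I2_def)
      have "rn D (\<lambda>s x. s (case x of (i, v) \<Rightarrow> (h i, v)) :: 'u)" by (rule rn_ren)
      then have "rn D (\<lambda>s. \<lambda>(i, v). s (h i, v) :: 'u)" by (simp add: case_prod_unfold)
      from Dfn_rn'[OF \<open>Dfn D P\<close> DU this] \<open>Dfn D P\<close> show ?thesis
        unfolding Inr q f_def sum.case prod.case by (intro Dfn_iff)
    qed
  next
    fix J assume J: "J \<subseteq> I1 <+> I2" "finite J"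
    define \<P> where "\<P> = Inl -` J \<union> fst ` (Inr -` J)"
    have "finite \<P>" using J(2) by (auto simp: \<P>_def intro!: finite_vimageI)
    moreover have "Dfn D P" if "P \<in> \<P>" for P using that J(1) by (auto simp: \<P>_def I1_def I2_def)
    ultimately have "\<exists>e :: nat \<Rightarrow> nat. strict_mono e \<and> (\<forall>P \<in> \<P>. \<forall>h h'. strict_mono h \<longrightarrow> strict_mono h' \<longrightarrow>
    P (sq (\<lambda>i. b (e (h i)))) = P (sq (\<lambda>i. b (e (h' i)))))"
      using b by (rule homogeneous_subsequence)
    then obtain e :: "nat \<Rightarrow> nat" where e: "strict_mono e" "\<forall>P \<in> \<P>. \<forall>h h'. strict_mono h \<longrightarrow> strict_mono h' \<longrightarrow>
    P (sq (\<lambda>i. b (e (h i)))) = P (sq (\<lambda>i. b (e (h' i))))"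
      by (elim exE conjE)
    have "f i (sq (\<lambda>i. b (e i)))" if i: "i \<in> J" for i
    proof (cases i)
      case (Inl P)
      then show ?thesis using i J(1) e(1) by (auto simp: f_def I1_def)
    next
      case (Inr q)
      then obtain P h where q: "i = Inr (P, h)" by (cases q) auto
      then have P: "P \<in> \<P>" "strict_mono h" using i J(1) by (force simp: \<P>_def I2_def)+
      have "(\<lambda>(i, v). sq (\<lambda>i. b (e i)) (h i, v)) = sq (\<lambda>i. b (e (h i)))"
        by (auto simp: sq_def)
      then show ?thesis using e(2)[rule_format, OF P(1) _ P(2), of id] q by (simp add: f_def strict_mono_def)
    qed
    then show "\<exists>s. tup s \<and> (\<forall>i \<in> J. f i s)" using b by (intro exI[of _ "sq (\<lambda>i. b (e i))"]) simp
  qed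
  then obtain s where s: "tup s" "\<And>i. i \<in> I1 <+> I2 \<Longrightarrow> f i s" by blast
  define b' where "b' j v = s (j, v)" for j v
  have sb: "s = sq b'" by (auto simp: b'_def sq_def)
  show ?thesis
  proof (intro exI[of _ b'] conjI allI impI)
    show "tup (b' j)" for j using s(1) by (simp add: sb)
    show "indisc D b'" unfolding indisc_def eqt_def
    proof (intro allI impI)
      fix h :: "nat \<Rightarrow> nat" and P assume "strict_mono h" "Dfn D P" "P (sq b')"
      moreover have "(\<lambda>(i, v). s (h i, v)) = sq (\<lambda>i. b' (h i))" by (auto simp: b'_def sq_def)
      ultimately show "P (sq (\<lambda>i. b' (h i)))"
        using s(2)[OF InrI, of "(P, h)"] by (simp add: f_def I2_def sb[symmetric])
    qed
    fix P assume "Dfn D P" "\<forall>h. strict_mono h \<longrightarrow> P (sq (\<lambda>i. b (h i)))"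
    then show "P (sq b')" using s(2)[OF InlI, of P] by (simp add: f_def I1_def sb)
  qed
qed

lemma indisc_eqt:
  assumes "indisc D b" "D \<subseteq> U" shows "eqt D (b 0) (b j)"
proof -
  have "eqt D (sq b) (sq (\<lambda>i. b (i + j)))"
    using assms(1) by (auto simp: indisc_def strict_mono_def)
  from eqt_comp[OF this assms(2), of "\<lambda>v. (0, v)"] show ?thesis by simp
qed

end

context monster
begin

section \<open>Dividing and independence\<close>

lemma range_jn: "range (a \<oplus> b) = range a \<union> range b"
proof (rule set_eqI)
  fix u
  have "u \<in> range (a \<oplus> b) \<longleftrightarrow> (\<exists>z. u = (a \<oplus> b) z)" by blast
  also have "\<dots> \<longleftrightarrow> u \<in> range a \<union> range b" unfolding split_sum_ex by auto
  finally show "u \<in> range (a \<oplus> b) \<longleftrightarrow> u \<in> range a \<union> range b" .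
qed

lemma Dfn_exI: "Dfn D (\<lambda>z. Q (\<lambda>x. z (Inl x)) (\<lambda>y. z (Inr y))) \<Longrightarrow> Dfn D (\<lambda>b. \<exists>a. tup a \<and> Q a b)"
  using Dfn_ex[of D "\<lambda>z. Q (\<lambda>x. z (Inl x)) (\<lambda>y. z (Inr y))"] by simp

text \<open>The index set \<open>J0\<close> is a parameter so that finite approximations of a
  \<open>k\<close>-contradictory family, with \<open>J0 = {..<N}\<close>, can be stated.\<close>

definition kcon :: "nat \<Rightarrow> (('x + 'y \<Rightarrow> 'u) \<Rightarrow> bool) \<Rightarrow> (nat \<Rightarrow> 'y \<Rightarrow> 'u) \<Rightarrow> nat set \<Rightarrow> bool" where
  "kcon k \<phi> b J0 \<longleftrightarrow>
    (\<forall>J \<subseteq> J0. finite J \<longrightarrow> card J = k \<longrightarrow> \<not> (\<exists>a. tup a \<and> (\<forall>j \<in> J. \<phi> (a \<oplus> b j))))"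

text \<open>Dividing of \<open>\<phi>(x, b)\<close> over \<open>D\<close> with witness
  \<open>k\<close>. Any conjugates of \<open>b\<close> are allowed; an indiscernible sequence is
  extracted in \<open>kdiv_indisc\<close>.\<close>

definition kdiv :: "nat \<Rightarrow> 'u set \<Rightarrow> (('x + 'y \<Rightarrow> 'u) \<Rightarrow> bool) \<Rightarrow> ('y \<Rightarrow> 'u) \<Rightarrow> bool" where
  "kdiv k D \<phi> b \<longleftrightarrow> (\<exists>bs. (\<forall>j. tup (bs j) \<and> eqt D b (bs j)) \<and> kcon k \<phi> bs UNIV)"

definition ind :: "'u set \<Rightarrow> ('x \<Rightarrow> 'u) \<Rightarrow> ('y \<Rightarrow> 'u) \<Rightarrow> bool" where
  "ind D c b \<longleftrightarrow> (\<forall>\<phi> k. Dfn D \<phi> \<longrightarrow> \<phi> (c \<oplus> b) \<longrightarrow> \<not> kdiv k D \<phi> b)"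

lemma kdivE:
  assumes "kdiv k D \<phi> b"
  obtains bs where "\<And>j. tup (bs j)" "\<And>j. eqt D b (bs j)" "kcon k \<phi> bs UNIV"
  using assms unfolding kdiv_def by blast

lemma kdivI:
  "(\<And>j. tup (bs j)) \<Longrightarrow> (\<And>j. eqt D b (bs j)) \<Longrightarrow> kcon k \<phi> bs UNIV \<Longrightarrow> kdiv k D \<phi> b"
  unfolding kdiv_def by blast

lemma indD: "ind D c b \<Longrightarrow> Dfn D \<phi> \<Longrightarrow> \<phi> (c \<oplus> b) \<Longrightarrow> \<not> kdiv k D \<phi> b"
  unfolding ind_def by blast

lemma Dfn_real:
  assumes "Dfn D \<phi>" "D \<subseteq> U" "finite J"
  shows "Dfn D (\<lambda>s. \<exists>a. tup a \<and> (\<forall>j \<in> J. \<phi> (a \<oplus> (\<lambda>v. s (j, v)))))"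
proof -
  have "Dfn D (\<lambda>z. \<forall>j \<in> J. \<phi> ((\<lambda>x. z (Inl x)) \<oplus> (\<lambda>v. z (Inr (j, v)))))"
    by (rule Dfn_ball[OF assms(3)], rule Dfn_rn'[OF assms(1,2)], rule rn_jn[OF rn_ren rn_ren])
  then show ?thesis by (rule Dfn_exI)
qed

lemma kcon_weaken:
  assumes "kcon k \<phi> bs J0" "\<And>a j. tup a \<Longrightarrow> \<psi> (a \<oplus> cs j) \<Longrightarrow> tup (h a) \<and> \<phi> (h a \<oplus> bs j)"
  shows "kcon k \<psi> cs J0"
  unfolding kcon_def
proof (intro allI impI notI)
  fix J assume J: "J \<subseteq> J0" "finite J" "card J = k" "\<exists>a. tup a \<and> (\<forall>j \<in> J. \<psi> (a \<oplus> cs j))"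
  then obtain a where a: "tup a" "\<forall>j \<in> J. \<psi> (a \<oplus> cs j)" by blast
  obtain j0 where "tup (h a)" if "j0 \<in> J" using assms(2) a by blast
  \<comment> \<open>For \<open>k = 0\<close> the set \<open>J\<close> is empty, and any tuple
    refutes the hypothesis.\<close>
  show False
  proof (cases "J = {}")
    case True
    then show ?thesis using assms(1) J(1-3) ex_tup unfolding kcon_def by auto
  next
    case False
    then have "tup (h a) \<and> (\<forall>j \<in> J. \<phi> (h a \<oplus> bs j))" using assms(2) a by blast
    then show ?thesis using assms(1) J(1-3) unfolding kcon_def by blast
  qed
qed

lemma kcon_eqt:
  assumes "Dfn D \<phi>" "D \<subseteq> U" "eqt D (sq bs) (sq bs')" "kcon k \<phi> bs J0"
  shows "kcon k \<phi> bs' J0"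
proof -
  have "(\<exists>a. tup a \<and> (\<forall>j \<in> J. \<phi> (a \<oplus> bs' j))) \<longleftrightarrow> (\<exists>a. tup a \<and> (\<forall>j \<in> J. \<phi> (a \<oplus> bs j)))"
    if "finite J" for J
    using eqtD[OF assms(3) Dfn_real[OF assms(1,2) that]] by simp
  note * = this
  show ?thesis unfolding kcon_def
  proof (intro allI impI)
    fix J assume J: "J \<subseteq> J0" "finite J" "card J = k"
    show "\<not> (\<exists>a. tup a \<and> (\<forall>j \<in> J. \<phi> (a \<oplus> bs' j)))"
      unfolding *[OF J(2)] using assms(4)[unfolded kcon_def, rule_format, OF J] .
  qed
qed

lemma kdiv_eqt: "kdiv k D \<phi> b \<Longrightarrow> eqt D b b' \<Longrightarrow> kdiv k D \<phi> b'"
  by (elim kdivE, rule kdivI) (auto intro: eqt_trans eqt_sym)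

lemma kdiv_mono: "kdiv k D' \<phi> b \<Longrightarrow> D \<subseteq> D' \<Longrightarrow> kdiv k D \<phi> b"
  by (elim kdivE, rule kdivI) (auto intro: eqt_mono)

text \<open>Each member of the dividing sequence for \<open>h b\<close> is completed by homogeneity
  to a conjugate \<open>d j\<close> of \<open>b\<close>. Then \<open>h (d j) = bs j\<close>, because
  the equations expressing one tuple through the other belong to the type of the pair
  \<open>(h b, b)\<close>.\<close>

lemma kdiv_lift:
  fixes b :: "'y::countable \<Rightarrow> 'u" and h :: "('y \<Rightarrow> 'u) \<Rightarrow> ('z::countable \<Rightarrow> 'u)"
  assumes D: "base D" and h: "rn D h" and b: "tup b" and k: "kdiv k D \<phi> (h b)"
  shows "kdiv k D (\<lambda>z. \<phi> ((\<lambda>x. z (Inl x)) \<oplus> h (\<lambda>y. z (Inr y)))) b"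
proof -
  have DU: "D \<subseteq> U" using D by (rule base_D)
  from k obtain bs where bs: "\<And>j. tup (bs j)" "\<And>j. eqt D (h b) (bs j)" "kcon k \<phi> bs UNIV"
    by (rule kdivE) blast
  have "\<exists>d. tup d \<and> eqt D (h b \<oplus> b) (bs j \<oplus> d)" for j
    using homog[OF D bs(2) tup_rn[OF h DU b] bs(1) b] .
  then obtain d where d: "\<And>j. tup (d j)" "\<And>j. eqt D (h b \<oplus> b) (bs j \<oplus> d j)" by metis
  have hd: "h (d j) = bs j" for j
  proof
    fix x
    have "Dfn D (\<lambda>s. s (Inl x) = h (\<lambda>y. s (Inr y)) x)"
    proof -
      consider y where "\<forall>s. h s x = s y" | u where "u \<in> D" "\<forall>s. h s x = u"
        using h unfolding rn_def by blast
      then show ?thesis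
        by cases (simp_all add: Dfn_eq Dfn_eqc)
    qed
    from eqtD[OF d(2) this, of j] show "h (d j) x = bs j x" by simp
  qed
  show ?thesis
  proof (rule kdivI)
    show "eqt D b (d j)" for j using eqt_jnD(2)[OF d(2) DU] .
    show "kcon k (\<lambda>z. \<phi> ((\<lambda>x. z (Inl x)) \<oplus> h (\<lambda>y. z (Inr y)))) d UNIV"
      by (rule kcon_weaken[OF bs(3), where h="\<lambda>a. a"]) (simp add: hd)
  qed (rule d)
qed

text \<open>Being \<open>k\<close>-contradictory belongs to the Ehrenfeucht-Mostowski type of the
  sequence, as an increasing map preserves the size \<open>k\<close> of an index set.\<close>

lemma kdiv_indisc:
  fixes b :: "'y::countable \<Rightarrow> 'u"
  assumes D: "base D" and \<phi>: "Dfn D \<phi>" and k: "kdiv k D \<phi> b"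
  shows "\<exists>bs. (\<forall>j. tup (bs j)) \<and> (\<forall>j. eqt D b (bs j)) \<and> indisc D bs \<and> kcon k \<phi> bs UNIV"
proof -
  have DU: "D \<subseteq> U" using D by (rule base_D)
  from k obtain bs where bs: "\<And>j. tup (bs j)" "\<And>j. eqt D b (bs j)" "kcon k \<phi> bs UNIV"
    by (rule kdivE) blast
  from extract_indisc[where b=bs, OF D bs(1)] obtain bs' where bs': "\<forall>j. tup (bs' j)" "indisc D bs'"
    "\<forall>P. Dfn D P \<longrightarrow> (\<forall>h. strict_mono h \<longrightarrow> P (sq (\<lambda>i. bs (h i)))) \<longrightarrow> P (sq bs')"
    by (elim exE conjE)
  have "eqt D b (bs' j)" for j unfolding eqt_def
  proof (intro allI impI)
    fix P assume P: "Dfn D P" "P b"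
    have "Dfn D (\<lambda>s. P (\<lambda>v. s (j, v)))" by (rule Dfn_comp[OF P(1) DU])
    from bs'(3)[rule_format, OF this] show "P (bs' j)"
      using P(2) eqtD[OF bs(2) P(1)] by simp
  qed
  moreover have "kcon k \<phi> bs' UNIV" unfolding kcon_def
  proof (intro allI impI)
    fix J :: "nat set" assume J: "J \<subseteq> UNIV" "finite J" "card J = k"
    have "\<not> (\<exists>a. tup a \<and> (\<forall>j \<in> J. \<phi> (a \<oplus> bs (h j))))" if h: "strict_mono h" for h :: "nat \<Rightarrow> nat"
    proof -
      have "card (h ` J) = k"
        using J strict_mono_imp_inj_on[OF h] by (simp add: card_image inj_on_subset)
      then show ?thesis using bs(3)[unfolded kcon_def, rule_format, of "h ` J"] J by simp
    qed
    then show "\<not> (\<exists>a. tup a \<and> (\<forall>j \<in> J. \<phi> (a \<oplus> bs' j)))"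
      using bs'(3)[rule_format, OF Dfn_not[OF Dfn_real[OF \<phi> DU J(2)]]] by simp
  qed
  ultimately show ?thesis using bs'(1,2) by blast
qed

text \<open>Compactness: a dividing sequence is described by formulas of the type of
  \<open>b\<close> at each entry and by the inconsistency of all \<open>k\<close>-element index
  sets, and finitely many such conditions involve only entries below some \<open>N\<close>.\<close>

lemma kdiv_approx:
  fixes b :: "'y::countable \<Rightarrow> 'u"
  assumes D: "base D" and \<phi>: "Dfn D \<phi>" and b: "tup b"
    and app: "\<And>Q N. Dfn D Q \<Longrightarrow> Q b \<Longrightarrow>
      \<exists>bs. (\<forall>j. tup (bs j)) \<and> (\<forall>j<N. Q (bs j)) \<and> kcon k \<phi> bs {..<N::nat}"
  shows "kdiv k D \<phi> b"
proof -
  have DU: "D \<subseteq> U" using D by (rule base_D)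
  define I1 :: "((('y \<Rightarrow> 'u) \<Rightarrow> bool) \<times> nat) set" where "I1 = {Q. Dfn D Q \<and> Q b} \<times> UNIV"
  define I2 where "I2 = {J :: nat set. finite J \<and> card J = k}"
  define f :: "((('y \<Rightarrow> 'u) \<Rightarrow> bool) \<times> nat) + nat set \<Rightarrow> (nat \<times> 'y \<Rightarrow> 'u) \<Rightarrow> bool" where
    "f = case_sum (\<lambda>(Q, j) s. Q (\<lambda>v. s (j, v)))
      (\<lambda>J s. \<not> (\<exists>a. tup a \<and> (\<forall>j \<in> J. \<phi> (a \<oplus> (\<lambda>v. s (j, v))))))"
  have "\<exists>s. tup s \<and> (\<forall>i \<in> I1 <+> I2. f i s)"
  proof (rule compact[OF D])
    fix i assume i: "i \<in> I1 <+> I2"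
    show "Dfn D (f i)"
    proof (cases i rule: sum.exhaust)
      case (Inl q)
      obtain Q j where q: "q = (Q, j)" by (cases q rule: prod.exhaust)
      then have "Dfn D Q" using i Inl by (auto simp: I1_def)
      from Dfn_comp[OF this DU, of "\<lambda>v. (j, v)"] show ?thesis by (simp add: f_def Inl q)
    next
      case (Inr J)
      then show ?thesis using i Dfn_not[OF Dfn_real[OF \<phi> DU]] by (auto simp: f_def I2_def)
    qed
  next
    fix K assume K: "K \<subseteq> I1 <+> I2" "finite K"
    define \<Q> where "\<Q> = fst ` (Inl -` K)"
    define X where "X = snd ` (Inl -` K) \<union> \<Union> (Inr -` K)"
    have "finite (Inl -` K)" "finite (Inr -` K)" using K(2) by (auto intro!: finite_vimageI)
    moreover have "finite J" if "J \<in> Inr -` K" for J using that K(1) by (auto simp: I2_def)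
    ultimately have fin: "finite \<Q>" "finite X" by (auto simp: \<Q>_def X_def)
    obtain N where N: "\<And>x. x \<in> X \<Longrightarrow> x < N" using fin(2) by (metis finite_nat_set_iff_bounded)
    have Q: "Dfn D Q" "Q b" if "Q \<in> \<Q>" for Q using that K(1) by (auto simp: \<Q>_def I1_def)
    have "Dfn D (\<lambda>s. \<forall>Q \<in> \<Q>. Q s)" using fin Q by (intro Dfn_ball)
    from app[OF this, of N] Q(2) obtain bs where bs: "\<forall>j. tup (bs j)"
      "\<forall>j<N. \<forall>Q \<in> \<Q>. Q (bs j)" "kcon k \<phi> bs {..<N}" by blast
    have "f i (sq bs)" if i: "i \<in> K" for i
    proof (cases i rule: sum.exhaust)
      case (Inl q)
      obtain Q j where q: "q = (Q, j)" by (cases q rule: prod.exhaust)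
      have "Q \<in> \<Q>" "j \<in> X" using i Inl q by (force simp: \<Q>_def X_def)+
      then show ?thesis using bs(2)[rule_format, OF N] Inl q by (simp add: f_def)
    next
      case (Inr J)
      then have "J \<subseteq> X" "J \<in> I2" using i K(1) by (auto simp: X_def)
      then have "J \<subseteq> {..<N}" "finite J" "card J = k" using N by (auto simp: I2_def)
      then show ?thesis using bs(3) Inr by (auto simp: f_def kcon_def)
    qed
    then show "\<exists>s. tup s \<and> (\<forall>i \<in> K. f i s)" using bs(1) by (intro exI[of _ "sq bs"]) simp
  qed
  then obtain s where s: "tup s" "\<And>i. i \<in> I1 <+> I2 \<Longrightarrow> f i s" by blast
  show ?thesis
  proof (rule kdivI)
    show "tup (\<lambda>v. s (j, v))" for j using s(1) by simp
    show "eqt D b (\<lambda>v. s (j, v))" for j unfolding eqt_def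
    proof (intro allI impI)
      fix Q assume "Dfn D Q" "Q b"
      then have "(Q, j) \<in> I1" by (simp add: I1_def)
      from s(2)[OF InlI[OF this]] show "Q (\<lambda>v. s (j, v))" by (simp add: f_def)
    qed
    show "kcon k \<phi> (\<lambda>j v. s (j, v)) UNIV" unfolding kcon_def
    proof (intro allI impI)
      fix J :: "nat set" assume "finite J" "card J = k"
      then have "J \<in> I2" by (simp add: I2_def)
      from s(2)[OF InrI[OF this]] show "\<not> (\<exists>a. tup a \<and> (\<forall>j \<in> J. \<phi> (a \<oplus> (\<lambda>v. s (j, v)))))"
        by (simp add: f_def)
    qed
  qed
qed

text \<open>If the first \<open>N\<close> instances along the sequence were inconsistent,
  indiscernibility would make any \<open>N\<close> of them inconsistent, so \<open>\<phi>\<close>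
  would divide with \<open>k = N\<close>.\<close>

lemma nd_seq:
  fixes \<phi> :: "('x::countable + 'y::countable \<Rightarrow> 'u) \<Rightarrow> bool"
  assumes D: "base D" and \<phi>: "Dfn D \<phi>" and bs: "\<And>j. tup (bs j)" "indisc D bs" "eqt D b (bs 0)"
    and nd: "\<And>k. \<not> kdiv k D \<phi> b"
  shows "\<exists>c. tup c \<and> (\<forall>j. \<phi> (c \<oplus> bs j))"
proof -
  have DU: "D \<subseteq> U" using D by (rule base_D)
  define D' where "D' = D \<union> (\<Union>j \<in> UNIV. range (bs j))"
  have D': "base D'" unfolding D'_def using D bs(1) by (intro base_Un base_ranges)
  have "\<exists>c. tup c \<and> (\<forall>j \<in> UNIV. \<phi> (c \<oplus> bs j))"
  proof (rule compact[OF D'])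
    show "Dfn D' (\<lambda>c. \<phi> (c \<oplus> bs j))" for j
    proof (rule Dfn_rn[OF \<phi>])
      show "rn D' (\<lambda>c. c \<oplus> bs j)" by (intro rn_jn rn_id rn_const) (auto simp: D'_def)
    qed (use D' in \<open>auto simp: D'_def base_def\<close>)
    fix J :: "nat set" assume "finite J"
    then obtain N where N: "\<And>j. j \<in> J \<Longrightarrow> j < N" by (metis finite_nat_set_iff_bounded)
    have "\<exists>c. tup c \<and> (\<forall>j \<in> {..<N}. \<phi> (c \<oplus> bs j))"
    proof (rule ccontr)
      assume no: "\<not> ?thesis"
      have "kcon N \<phi> bs UNIV" unfolding kcon_def
      proof (intro allI impI)
        fix J :: "nat set" assume "finite J" and N: "card J = N"
        then obtain h where h: "strict_mono h" "h ` {..<N} = J" using strict_mono_enum by blast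
        have "eqt D (sq bs) (sq (\<lambda>i. bs (h i)))" using bs(2) h(1) by (simp add: indisc_def)
        from eqtD[OF this Dfn_real[OF \<phi> DU, of "{..<N}"]] no
        show "\<not> (\<exists>a. tup a \<and> (\<forall>j \<in> J. \<phi> (a \<oplus> bs j)))" unfolding h(2)[symmetric] by simp
      qed
      moreover have "eqt D b (bs j)" for j using eqt_trans[OF bs(3) indisc_eqt[OF bs(2) DU]] .
      ultimately have "kdiv N D \<phi> b" using bs(1) by (intro kdivI)
      then show False using nd by blast
    qed
    then show "\<exists>c. tup c \<and> (\<forall>j \<in> J. \<phi> (c \<oplus> bs j))" using N by blast
  qed
  then show ?thesis by simp
qed

lemma ind_seq:
  fixes c :: "'x::countable \<Rightarrow> 'u" and b :: "'y::countable \<Rightarrow> 'u"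
  assumes D: "base D" and i: "ind D c b" and bs: "\<And>j. tup (bs j)" "indisc D bs" "eqt D b (bs 0)"
  shows "\<exists>c'. tup c' \<and> (\<forall>j. eqt D (c \<oplus> b) (c' \<oplus> bs j))"
proof -
  define D' where "D' = D \<union> (\<Union>j \<in> UNIV. range (bs j))"
  have D': "base D'" unfolding D'_def using D bs(1) by (intro base_Un base_ranges)
  define I where "I = {\<phi>. Dfn D \<phi> \<and> \<phi> (c \<oplus> b)} \<times> (UNIV :: nat set)"
  have "\<exists>c'. tup c' \<and> (\<forall>q \<in> I. fst q (c' \<oplus> bs (snd q)))"
  proof (rule compact[OF D'])
    fix q assume "q \<in> I"
    then have "Dfn D (fst q)" by (auto simp: I_def)
    then show "Dfn D' (\<lambda>c'. fst q (c' \<oplus> bs (snd q)))"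
    proof (rule Dfn_rn)
      show "rn D' (\<lambda>c. c \<oplus> bs (snd q))" by (intro rn_jn rn_id rn_const) (auto simp: D'_def)
    qed (use D' in \<open>auto simp: D'_def base_def\<close>)
  next
    fix J assume J: "J \<subseteq> I" "finite J"
    define \<phi> where "\<phi> z \<longleftrightarrow> (\<forall>\<phi> \<in> fst ` J. \<phi> z)" for z
    have \<phi>: "Dfn D \<phi>" unfolding \<phi>_def using J by (intro Dfn_ball) (auto simp: I_def)
    have "\<phi> (c \<oplus> b)" using J by (auto simp: \<phi>_def I_def)
    from nd_seq[OF D \<phi> bs indD[OF i \<phi> this]]
    show "\<exists>c'. tup c' \<and> (\<forall>q \<in> J. fst q (c' \<oplus> bs (snd q)))" by (auto simp: \<phi>_def)
  qed
  then obtain c' where c': "tup c'" "\<And>q. q \<in> I \<Longrightarrow> fst q (c' \<oplus> bs (snd q))" by blast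
  have "eqt D (c \<oplus> b) (c' \<oplus> bs j)" for j unfolding eqt_def
  proof (intro allI impI)
    fix P assume "Dfn D P" "P (c \<oplus> b)"
    then show "P (c' \<oplus> bs j)" using c'(2)[of "(P, j)"] by (simp add: I_def)
  qed
  then show ?thesis using c'(1) by blast
qed

lemma ind_eqt:
  assumes "ind D c b" "eqt D (c \<oplus> b) (c' \<oplus> b')" "D \<subseteq> U"
  shows "ind D c' b'"
  unfolding ind_def
proof (intro allI impI notI)
  fix \<phi> k assume "Dfn D \<phi>" "\<phi> (c' \<oplus> b')" "kdiv k D \<phi> b'"
  then have "\<phi> (c \<oplus> b)" "kdiv k D \<phi> b"
    using eqtD[OF assms(2)] kdiv_eqt[OF _ eqt_sym[OF eqt_jnD(2)[OF assms(2,3)]]] by blast+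
  then show False using indD[OF assms(1) \<open>Dfn D \<phi>\<close>] by blast
qed

lemma ind_rn_right:
  fixes b :: "'y::countable \<Rightarrow> 'u" and h :: "('y \<Rightarrow> 'u) \<Rightarrow> ('z::countable \<Rightarrow> 'u)"
  assumes D: "base D" and i: "ind D c b" and h: "rn D h" and b: "tup b"
  shows "ind D c (h b)"
  unfolding ind_def
proof (intro allI impI notI)
  fix \<phi> k assume \<phi>: "Dfn D \<phi>" "\<phi> (c \<oplus> h b)" "kdiv k D \<phi> (h b)"
  from kdiv_lift[OF D h b \<phi>(3)]
  have "kdiv k D (\<lambda>z. \<phi> ((\<lambda>x. z (Inl x)) \<oplus> h (\<lambda>y. z (Inr y)))) b" .
  moreover have "Dfn D (\<lambda>z. \<phi> ((\<lambda>x. z (Inl x)) \<oplus> h (\<lambda>y. z (Inr y))))"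
    by (rule Dfn_rn'[OF \<phi>(1) base_D[OF D]]) (rule rn_jn[OF rn_ren rn_comp[OF h]])
  ultimately show False using indD[OF i] \<phi>(2) by simp
qed

lemma rn_sub:
  assumes "range b' \<subseteq> D \<union> range b"
  shows "\<exists>h. rn D h \<and> h b = b'"
proof (intro exI conjI)
  let ?h = "\<lambda>s v. if b' v \<in> D then b' v else s (inv b (b' v))"
  show "rn D ?h" unfolding rn_def by auto
  show "?h b = b'" using assms by (force simp: f_inv_into_f)
qed

lemma ind_sub_right:
  fixes b :: "'y::countable \<Rightarrow> 'u" and b' :: "'z::countable \<Rightarrow> 'u"
  assumes "base D" "ind D c b" "tup b" "range b' \<subseteq> D \<union> range b"
  shows "ind D c b'"
  using ind_rn_right[OF assms(1,2) _ assms(3)] rn_sub[OF assms(4)] by blast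

text \<open>With \<open>c\<close> in \<open>D\<close> the formula \<open>\<phi>(c, y)\<close> is
  over \<open>D\<close>, so \<open>c\<close> satisfies all conjugate instances at once.\<close>

lemma ind_refl:
  assumes "range c \<subseteq> D" "D \<subseteq> U"
  shows "ind D c b"
  unfolding ind_def
proof (intro allI impI notI)
  fix \<phi> k assume \<phi>: "Dfn D \<phi>" "\<phi> (c \<oplus> b)" "kdiv k D \<phi> b"
  from \<phi>(3) obtain bs where bs: "\<And>j. tup (bs j)" "\<And>j. eqt D b (bs j)" "kcon k \<phi> bs UNIV"
    by (rule kdivE) blast
  have "Dfn D (\<lambda>b. \<phi> (c \<oplus> b))"
    by (rule Dfn_rn'[OF \<phi>(1) assms(2)]) (rule rn_jn[OF rn_const[OF assms(1)] rn_id])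
  then have "\<phi> (c \<oplus> bs j)" for j using eqtD[OF bs(2)] \<phi>(2) by blast
  moreover have "tup c" using assms by (auto simp: tup_range)
  ultimately show False using bs(3)[unfolded kcon_def, rule_format, of "{..<k}"] by auto
qed

lemma eqt_absorb:
  assumes "eqt D2 b b'" "D \<subseteq> D2" "range d \<subseteq> D2" "D2 \<subseteq> U"
  shows "eqt D (b \<oplus> d) (b' \<oplus> d)"
proof -
  have "D \<subseteq> U" "tup d" using assms by (auto simp: tup_range)
  then show ?thesis using eqt_base[of D d b b'] eqt_mono[OF assms(1), of "D \<union> range d"] assms(2,3) by simp
qed

text \<open>The parameters of a formula over \<open>D2\<close> move to the right-hand tuple as
  \<open>d\<close>. Conjugation over \<open>D2\<close> fixes \<open>d\<close>, so a dividing
  sequence for \<open>b\<close> over \<open>D2\<close> gives one for \<open>(b, d)\<close> over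
  \<open>D\<close>.\<close>

lemma base_mono:
  fixes b :: "'y::countable \<Rightarrow> 'u"
  assumes D2: "base D2" "D2 \<noteq> {}" "D \<subseteq> D2"
    and i: "\<And>d :: nat \<Rightarrow> 'u. range d \<subseteq> D2 \<Longrightarrow> ind D c (b \<oplus> d)"
  shows "ind D2 c b"
  unfolding ind_def
proof (intro allI impI notI)
  have DU: "D2 \<subseteq> U" using D2(1) by (rule base_D)
  fix \<phi> k assume \<phi>: "Dfn D2 \<phi>" "\<phi> (c \<oplus> b)" "kdiv k D2 \<phi> b"
  obtain d :: "nat \<Rightarrow> 'u" and Q where d: "range d \<subseteq> D2" "Dfn {} Q" "\<forall>z. \<phi> z \<longleftrightarrow> Q (z \<oplus> d)"
    using Dfn_abs_nat[OF \<phi>(1) D2(2) DU] by (elim exE conjE)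
  let ?\<phi> = "\<lambda>z. Q (((\<lambda>x. z (Inl x)) \<oplus> (\<lambda>y. z (Inr (Inl y)))) \<oplus> (\<lambda>i. z (Inr (Inr i))))"
  from \<phi>(3) obtain bs where bs: "\<And>j. tup (bs j)" "\<And>j. eqt D2 b (bs j)" "kcon k \<phi> bs UNIV"
    by (rule kdivE) blast
  have "kdiv k D ?\<phi> (b \<oplus> d)"
  proof (rule kdivI)
    show "tup (bs j \<oplus> d)" for j using bs(1) d(1) DU by (auto simp: tup_range[of d])
    show "eqt D (b \<oplus> d) (bs j \<oplus> d)" for j using eqt_absorb[OF bs(2) D2(3) d(1) DU] .
    show "kcon k ?\<phi> (\<lambda>j. bs j \<oplus> d) UNIV"
      by (rule kcon_weaken[OF bs(3), where h="\<lambda>a. a"]) (simp add: d(3))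
  qed
  moreover have "Dfn D ?\<phi>"
    by (rule Dfn_rn[OF d(2)]) (use DU D2(3) in \<open>auto intro!: rn_jn[OF rn_jn[OF rn_ren rn_ren] rn_ren]\<close>)
  ultimately show False using indD[OF i[OF d(1)]] \<phi>(2) d(3) by simp
qed

text \<open>Take an indiscernible dividing sequence for \<open>b\<close>. Since the type of
  \<open>a\<close> does not divide, some \<open>a'\<close> stands to every member as
  \<open>a\<close> stands to \<open>b\<close>; moving \<open>a'\<close> to \<open>a\<close> by
  homogeneity gives a dividing sequence over \<open>D \<union> range a\<close>.\<close>

lemma kdiv_base:
  fixes a :: "'x::countable \<Rightarrow> 'u" and b :: "'y::countable \<Rightarrow> 'u"
  assumes D: "base D" and i: "ind D a b" and t: "tup a" "tup b" and \<phi>: "Dfn D \<phi>"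
    and k: "kdiv k D \<phi> b"
  shows "kdiv k (D \<union> range a) \<phi> b"
proof -
  have DU: "D \<subseteq> U" using D by (rule base_D)
  from kdiv_indisc[OF D \<phi> k] obtain bs where bs: "\<forall>j. tup (bs j)" "\<forall>j. eqt D b (bs j)"
    "indisc D bs" "kcon k \<phi> bs UNIV" by (elim exE conjE)
  from ind_seq[OF D i _ bs(3)] bs(1,2) obtain a' where
    a': "tup a'" "\<And>j. eqt D (a \<oplus> b) (a' \<oplus> bs j)" by blast
  have "eqt D a' a" using eqt_sym[OF eqt_jnD(1)[OF a'(2) DU]] .
  from homog[OF D this a'(1) t(1), of "sq bs"] bs(1) obtain s where
    s: "tup s" "eqt D (a' \<oplus> sq bs) (a \<oplus> s)" by auto
  define bs' where "bs' j v = s (j, v)" for j v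
  have sb: "s = sq bs'" by (auto simp: bs'_def sq_def)
  have "eqt D (a' \<oplus> bs j) (a \<oplus> bs' j)" for j
    using eqt_rn[OF s(2) DU, of "\<lambda>z. (\<lambda>x. z (Inl x)) \<oplus> (\<lambda>v. z (Inr (j, v)))", OF rn_jn[OF rn_ren rn_ren]]
    by (simp add: sb)
  then have e: "eqt D (a \<oplus> b) (a \<oplus> bs' j)" for j using a'(2) eqt_trans by blast
  show ?thesis
  proof (rule kdivI)
    show "tup (bs' j)" for j using s(1) by (simp add: sb)
    show "eqt (D \<union> range a) b (bs' j)" for j
      using eqt_swap[OF e DU] by (simp add: eqt_base[OF DU t(1)])
    show "kcon k \<phi> bs' UNIV"
      using eqt_jnD(2)[OF s(2) DU] bs(4) unfolding sb by (rule kcon_eqt[OF \<phi> DU])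
  qed
qed

text \<open>A formula \<open>Q\<close> of the type of \<open>b\<close> over \<open>D2\<close> has
  its parameters in one sequence \<open>d\<close>; \<open>kdiv_base\<close> for \<open>d\<close>
  supplies the approximation that \<open>kdiv_approx\<close> asks for.\<close>

lemma kdiv_set:
  fixes b :: "'y::countable \<Rightarrow> 'u"
  assumes D2: "base D2" "D2 \<noteq> {}" "D \<subseteq> D2" and t: "tup b" and \<phi>: "Dfn D \<phi>"
    and i: "\<And>d :: nat \<Rightarrow> 'u. range d \<subseteq> D2 \<Longrightarrow> ind D d b" and k: "kdiv k D \<phi> b"
  shows "kdiv k D2 \<phi> b"
proof (rule kdiv_approx[OF D2(1) Dfn_mono[OF \<phi> D2(3)] t])
  have DU: "D2 \<subseteq> U" using D2(1) by (rule base_D)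
  have D: "base D" using D2 base_subset by blast
  fix Q N assume Q: "Dfn D2 Q" "Q b"
  obtain d :: "nat \<Rightarrow> 'u" and Q' where d: "range d \<subseteq> D2" "Dfn {} Q'" "\<forall>z. Q z \<longleftrightarrow> Q' (z \<oplus> d)"
    using Dfn_abs_nat[OF Q(1) D2(2) DU] by (elim exE conjE)
  have td: "tup d" using d(1) DU by (auto simp: tup_range)
  from kdiv_base[OF D i[OF d(1)] td t \<phi> k] obtain bs where bs: "\<And>j. tup (bs j)"
    "\<And>j. eqt (D \<union> range d) b (bs j)" "kcon k \<phi> bs UNIV" by (rule kdivE) blast
  have "eqt {} (b \<oplus> d) (bs j \<oplus> d)" for j
    using bs(2) base_Un_range[OF D td] by (intro eqt_absorb) (auto simp: base_def)
  then have "Q (bs j)" for j using eqtD[OF _ d(2)] d(3) Q(2) by blast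
  then show "\<exists>bs. (\<forall>j. tup (bs j)) \<and> (\<forall>j<N. Q (bs j)) \<and> kcon k \<phi> bs {..<N}"
    using bs(1,3) by (intro exI[of _ bs]) (auto simp: kcon_def)
qed

text \<open>By \<open>kdiv_base\<close> the dividing sequence can be taken over
  \<open>D \<union> range a\<close>, where \<open>a\<close> is a constant; then a formula satisfied
  by \<open>c\<close> alone divides.\<close>

lemma ind_left_trans:
  fixes a :: "'x::countable \<Rightarrow> 'u" and b :: "'y::countable \<Rightarrow> 'u"
  assumes D: "base D" and i: "ind D a b" "ind (D \<union> range a) c b" and t: "tup a" "tup b"
  shows "ind D (a \<oplus> c) b"
  unfolding ind_def
proof (intro allI impI notI)
  fix \<phi> k assume \<phi>: "Dfn D \<phi>" "\<phi> ((a \<oplus> c) \<oplus> b)" "kdiv k D \<phi> b"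
  let ?\<phi> = "\<lambda>z. \<phi> ((a \<oplus> (\<lambda>x. z (Inl x))) \<oplus> (\<lambda>y. z (Inr y)))"
  from kdiv_base[OF D i(1) t \<phi>(1,3)] obtain bs where bs: "\<And>j. tup (bs j)"
    "\<And>j. eqt (D \<union> range a) b (bs j)" "kcon k \<phi> bs UNIV" by (rule kdivE) blast
  have "kcon k ?\<phi> bs UNIV"
    by (rule kcon_weaken[OF bs(3), where h="\<lambda>x. a \<oplus> x"]) (simp add: t)
  then have "kdiv k (D \<union> range a) ?\<phi> b" using bs(1,2) by (intro kdivI)
  moreover have "Dfn (D \<union> range a) ?\<phi>"
    by (rule Dfn_rn[OF \<phi>(1) _ base_D[OF base_Un_range[OF D t(1)]]])
      (auto intro!: rn_jn[OF rn_jn[OF rn_const rn_ren] rn_ren])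
  ultimately show False using indD[OF i(2)] \<phi>(2) by simp
qed

definition Ind :: "'u set \<Rightarrow> ('x \<Rightarrow> 'u) \<Rightarrow> 'u set \<Rightarrow> bool" where
  "Ind D c W \<longleftrightarrow> (\<forall>w :: nat \<Rightarrow> 'u. range w \<subseteq> W \<longrightarrow> ind D c w)"

lemma IndD:
  fixes b :: "'y::countable \<Rightarrow> 'u"
  assumes D: "base D" and i: "Ind D c W" and b: "range b \<subseteq> W" and W: "W \<subseteq> U"
  shows "ind D c b"
proof -
  have "range (\<lambda>n. b (from_nat n)) \<subseteq> W" using b by auto
  then have "ind D c (\<lambda>n. b (from_nat n))" using i by (simp add: Ind_def)
  moreover have "tup (\<lambda>n. b (from_nat n))" using b W by (auto simp: tup_def)
  ultimately show ?thesis
    by (rule ind_sub_right[OF D]) (metis (no_types, lifting) from_nat_to_nat image_subsetI rangeI Un_iff)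
qed

lemma Ind_mono: "Ind D c W \<Longrightarrow> W' \<subseteq> W \<Longrightarrow> Ind D c W'"
  unfolding Ind_def by blast

lemma Ind_base_mono:
  assumes "Ind D c W" "D \<subseteq> D2" "D2 \<subseteq> W" "base D2" "D2 \<noteq> {}" "W \<subseteq> U"
  shows "Ind D2 c W"
  unfolding Ind_def
proof (intro allI impI)
  fix w :: "nat \<Rightarrow> 'u" assume w: "range w \<subseteq> W"
  show "ind D2 c w"
  proof (rule base_mono[OF assms(4,5,2)])
    fix d :: "nat \<Rightarrow> 'u" assume "range d \<subseteq> D2"
    then have "range (w \<oplus> d) \<subseteq> W" using w assms(3) by (auto simp: range_jn)
    then show "ind D c (w \<oplus> d)"
      using assms base_subset by (intro IndD[OF _ assms(1)]) auto
  qed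
qed

lemma Ind_eqt:
  assumes "Ind D c W" "eqt W c c'" "D \<subseteq> W" "W \<subseteq> U"
  shows "Ind D c' W"
  unfolding Ind_def
proof (intro allI impI)
  fix w :: "nat \<Rightarrow> 'u" assume w: "range w \<subseteq> W"
  then have "ind D c w" using assms(1) by (simp add: Ind_def)
  moreover have "eqt D (c \<oplus> w) (c' \<oplus> w)" using eqt_absorb[OF assms(2,3) w assms(4)] .
  ultimately show "ind D c' w" using assms by (blast intro: ind_eqt)
qed


section \<open>Chains of dividing formulas and the tree property\<close>

text \<open>Approximation of height \<open>n\<close> to the tree property. Branches use the prefixes
  of length 1 to \<open>n\<close>, so the root carries no formula; \<open>Q\<close> is a condition
  on the branch realizations that is carried through inductions.\<close>

definition tree :: "nat \<Rightarrow> nat \<Rightarrow> (('x + 'y \<Rightarrow> 'u) \<Rightarrow> bool) \<Rightarrow> (('x \<Rightarrow> 'u) \<Rightarrow> bool) \<Rightarrow> bool" where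
  "tree n k \<phi> Q \<longleftrightarrow> (\<exists>b :: nat list \<Rightarrow> 'y \<Rightarrow> 'u. (\<forall>\<eta>. tup (b \<eta>)) \<and>
    (\<forall>\<eta>. length \<eta> < n \<longrightarrow> kcon k \<phi> (\<lambda>i. b (\<eta> @ [i])) UNIV) \<and>
    (\<forall>\<eta>. length \<eta> = n \<longrightarrow> (\<exists>a. tup a \<and> Q a \<and> (\<forall>i<n. \<phi> (a \<oplus> b (take (Suc i) \<eta>))))))"

lemma treeE:
  assumes "tree n k \<phi> Q"
  obtains b c where "\<And>\<eta>. tup (b \<eta>)" "\<And>\<eta>. tup (c \<eta>)"
    "\<And>\<eta>. length \<eta> < n \<Longrightarrow> kcon k \<phi> (\<lambda>i. b (\<eta> @ [i])) UNIV"
    "\<And>\<eta>. length \<eta> = n \<Longrightarrow> Q (c \<eta>)"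
    "\<And>\<eta> i. length \<eta> = n \<Longrightarrow> i < n \<Longrightarrow> \<phi> (c \<eta> \<oplus> b (take (Suc i) \<eta>))"
proof -
  obtain b where b: "\<forall>\<eta>. tup (b \<eta>)" "\<forall>\<eta>. length \<eta> < n \<longrightarrow> kcon k \<phi> (\<lambda>i. b (\<eta> @ [i])) UNIV"
    "\<forall>\<eta>. length \<eta> = n \<longrightarrow> (\<exists>a. tup a \<and> Q a \<and> (\<forall>i<n. \<phi> (a \<oplus> b (take (Suc i) \<eta>))))"
    using assms unfolding tree_def by (elim exE conjE)
  have "\<forall>\<eta>. \<exists>a. tup a \<and> (length \<eta> = n \<longrightarrow> Q a \<and> (\<forall>i<n. \<phi> (a \<oplus> b (take (Suc i) \<eta>))))"
    using b(3) ex_tup by metis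
  then obtain c where "\<forall>\<eta>. tup (c \<eta>) \<and> (length \<eta> = n \<longrightarrow> Q (c \<eta>) \<and> (\<forall>i<n. \<phi> (c \<eta> \<oplus> b (take (Suc i) \<eta>))))"
    by (rule choice[THEN exE])
  then show ?thesis using that[of b c] b by simp
qed

lemma treeI:
  assumes "\<And>\<eta>. tup (b \<eta>)" "\<And>\<eta>. length \<eta> = n \<Longrightarrow> tup (c \<eta>)"
    "\<And>\<eta>. length \<eta> < n \<Longrightarrow> kcon k \<phi> (\<lambda>i. b (\<eta> @ [i])) UNIV"
    "\<And>\<eta>. length \<eta> = n \<Longrightarrow> Q (c \<eta>)"
    "\<And>\<eta> i. length \<eta> = n \<Longrightarrow> i < n \<Longrightarrow> \<phi> (c \<eta> \<oplus> b (take (Suc i) \<eta>))"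
  shows "tree n k \<phi> Q"
  unfolding tree_def using assms by (intro exI[of _ b]) blast

text \<open>All nodes and branch realizations form one countable tuple \<open>t\<close>, which
  homogeneity moves along with \<open>z\<close>.\<close>

lemma tree_inv:
  fixes \<phi> :: "('x::countable + 'y::countable \<Rightarrow> 'u) \<Rightarrow> bool" and z z' :: "'z::countable \<Rightarrow> 'u"
  assumes D: "base D" and \<phi>: "Dfn D \<phi>" and \<Delta>: "\<And>P. P \<in> \<Delta> \<Longrightarrow> Dfn D P"
    and z: "eqt D z z'" "tup z" "tup z'" and tr: "tree n k \<phi> (\<lambda>a. \<forall>P \<in> \<Delta>. P (a \<oplus> z))"
  shows "tree n k \<phi> (\<lambda>a. \<forall>P \<in> \<Delta>. P (a \<oplus> z'))"
proof -
  have DU: "D \<subseteq> U" using D by (rule base_D)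
  from tr obtain b c where b: "\<And>\<eta>. tup (b \<eta>)" "\<And>\<eta>. tup (c \<eta>)"
    "\<And>\<eta>. length \<eta> < n \<Longrightarrow> kcon k \<phi> (\<lambda>i. b (\<eta> @ [i])) UNIV"
    "\<And>\<eta>. length \<eta> = n \<Longrightarrow> \<forall>P \<in> \<Delta>. P (c \<eta> \<oplus> z)"
    "\<And>\<eta> i. length \<eta> = n \<Longrightarrow> i < n \<Longrightarrow> \<phi> (c \<eta> \<oplus> b (take (Suc i) \<eta>))" by (rule treeE) blast
  define t where "t = (\<lambda>(\<eta>, v). b \<eta> v) \<oplus> (\<lambda>(\<eta>, x). c \<eta> x)"
  have "tup t" using b(1,2) by (auto simp: t_def tup_def split: sum.split)
  from homog[OF D z this] obtain t' where t': "tup t'" "eqt D (z \<oplus> t) (z' \<oplus> t')" by blast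
  define b' where "b' \<eta> v = t' (Inl (\<eta>, v))" for \<eta> v
  define c' where "c' \<eta> x = t' (Inr (\<eta>, x))" for \<eta> x
  have tb: "tup (b' \<eta>)" "tup (c' \<eta>)" for \<eta> using t'(1) by (auto simp: b'_def c'_def tup_def)
  have e: "eqt D (c \<eta> \<oplus> z) (c' \<eta> \<oplus> z')" for \<eta>
    using eqt_rn[OF t'(2) DU, of "\<lambda>s. (\<lambda>x. s (Inr (Inr (\<eta>, x)))) \<oplus> (\<lambda>x. s (Inl x))", OF rn_jn[OF rn_ren rn_ren]]
    by (simp add: t_def c'_def[symmetric] b'_def[symmetric])
  have e2: "eqt D (c \<eta> \<oplus> b \<nu>) (c' \<eta> \<oplus> b' \<nu>)" for \<eta> \<nu>
    using eqt_rn[OF t'(2) DU, of "\<lambda>s. (\<lambda>x. s (Inr (Inr (\<eta>, x)))) \<oplus> (\<lambda>x. s (Inr (Inl (\<nu>, x))))", OF rn_jn[OF rn_ren rn_ren]]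
    by (simp add: t_def c'_def[symmetric] b'_def[symmetric])
  have e3: "eqt D (sq (\<lambda>i. b (\<eta> @ [i]))) (sq (\<lambda>i. b' (\<eta> @ [i])))" for \<eta>
    using eqt_rn[OF t'(2) DU, of "\<lambda>s q. s (Inr (Inl (\<eta> @ [fst q], snd q)))", OF rn_ren]
    by (simp add: t_def b'_def[symmetric] sq_def case_prod_unfold)
  show ?thesis
  proof (rule treeI[of b' n c'])
    show "kcon k \<phi> (\<lambda>i. b' (\<eta> @ [i])) UNIV" if "length \<eta> < n" for \<eta>
      using kcon_eqt[OF \<phi> DU e3 b(3)[OF that]] .
    show "\<forall>P \<in> \<Delta>. P (c' \<eta> \<oplus> z')" if "length \<eta> = n" for \<eta>
      using b(4)[OF that] eqtD[OF e \<Delta>] by blast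
    show "\<phi> (c' \<eta> \<oplus> b' (take (Suc i) \<eta>))" if "length \<eta> = n" "i < n" for \<eta> i
      using b(5)[OF that] eqtD[OF e2 \<phi>] by blast
  qed (simp_all add: tb)
qed

text \<open>The trees obtained for the \<open>bs j\<close> are hung below a new first level labelled
  by the \<open>bs j\<close>; the value \<open>bs 0\<close> at the empty list is a filler.\<close>

lemma tree_step:
  assumes tr: "\<And>j. tree n k \<phi> (\<lambda>a. Q a \<and> \<phi> (a \<oplus> bs j))"
    and bs: "\<And>j. tup (bs j)" "kcon k \<phi> bs UNIV"
  shows "tree (Suc n) k \<phi> Q"
proof -
  have "\<exists>b c. (\<forall>\<eta>. tup (b \<eta>)) \<and> (\<forall>\<eta>. tup (c \<eta>)) \<and>
    (\<forall>\<eta>. length \<eta> < n \<longrightarrow> kcon k \<phi> (\<lambda>i. b (\<eta> @ [i])) UNIV) \<and>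
    (\<forall>\<eta>. length \<eta> = n \<longrightarrow> Q (c \<eta>) \<and> \<phi> (c \<eta> \<oplus> bs j)) \<and>
    (\<forall>\<eta> i. length \<eta> = n \<longrightarrow> i < n \<longrightarrow> \<phi> (c \<eta> \<oplus> b (take (Suc i) \<eta>)))" for j
    using tr[of j] by (rule treeE) blast
  then obtain b c where b: "\<And>j \<eta>. tup (b j \<eta>)" "\<And>j \<eta>. tup (c j \<eta>)"
    "\<And>j \<eta>. length \<eta> < n \<Longrightarrow> kcon k \<phi> (\<lambda>i. b j (\<eta> @ [i])) UNIV"
    "\<And>j \<eta>. length \<eta> = n \<Longrightarrow> Q (c j \<eta>) \<and> \<phi> (c j \<eta> \<oplus> bs j)"
    "\<And>j \<eta> i. length \<eta> = n \<Longrightarrow> i < n \<Longrightarrow> \<phi> (c j \<eta> \<oplus> b j (take (Suc i) \<eta>))" by metis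
  define b' where "b' \<eta> = (case \<eta> of [] \<Rightarrow> bs 0 | j # \<nu> \<Rightarrow> if \<nu> = [] then bs j else b j \<nu>)" for \<eta>
  define c' where "c' \<eta> = c (hd \<eta>) (tl \<eta>)" for \<eta>
  show ?thesis
  proof (rule treeI[of b' _ c'])
    show "tup (b' \<eta>)" for \<eta> using b(1) bs(1) by (simp add: b'_def split: list.split)
    show "kcon k \<phi> (\<lambda>i. b' (\<eta> @ [i])) UNIV" if "length \<eta> < Suc n" for \<eta>
      using that bs(2) b(3) by (cases \<eta>) (simp_all add: b'_def)
    show "Q (c' \<eta>)" if "length \<eta> = Suc n" for \<eta> using b(4) that by (simp add: c'_def)
    show "\<phi> (c' \<eta> \<oplus> b' (take (Suc i) \<eta>))" if \<eta>: "length \<eta> = Suc n" "i < Suc n" for \<eta> i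
    proof -
      obtain j \<nu> where \<eta>': "\<eta> = j # \<nu>" "length \<nu> = n" using \<eta>(1) by (cases \<eta>) auto
      show ?thesis
      proof (cases i)
        case 0
        then show ?thesis using b(4)[OF \<eta>'(2)] \<eta>' by (simp add: c'_def b'_def)
      next
        case (Suc i')
        then have "take (Suc i') \<nu> \<noteq> []" using \<eta> \<eta>' by auto
        then show ?thesis using b(5)[OF \<eta>'(2), of i'] \<eta> \<eta>' Suc by (simp add: c'_def b'_def)
      qed
    qed
  qed (simp add: c'_def b(2))
qed

text \<open>Each \<open>e i\<close> divides over the later ones. At step \<open>i\<close> there is a
  tree of height \<open>i\<close> whose branches still satisfy \<open>\<phi>\<close> at every
  \<open>e j\<close> with \<open>j \<ge> i\<close>; replacing \<open>e i\<close> by a dividing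
  sequence over the later elements keeps the remaining conditions and adds a level.\<close>

lemma chain_tree:
  fixes \<phi> :: "('x::countable + 'y::countable \<Rightarrow> 'u) \<Rightarrow> bool"
  assumes D: "base D" and \<phi>: "Dfn D \<phi>" and c: "tup c" and e: "\<And>i. tup (e i)"
    and ch: "\<And>i. i < n \<Longrightarrow> \<phi> (c \<oplus> e i)"
      "\<And>i. i < n \<Longrightarrow> kdiv k (D \<union> (\<Union>j \<in> {i<..<n}. range (e j))) \<phi> (e i)"
  shows "tree n k \<phi> (\<lambda>_. True)"
proof -
  have "tree i k \<phi> (\<lambda>x. \<forall>j \<in> {i..<n}. \<phi> (x \<oplus> e j))" if "i \<le> n" for i
    using that
  proof (induction i)
    case 0
    show ?case by (rule treeI[where b="\<lambda>_. e 0" and c="\<lambda>_. c"]) (use e c ch(1) in auto)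
  next
    case (Suc i)
    define D2 where "D2 = D \<union> (\<Union>j \<in> {i<..<n}. range (e j))"
    have D2: "base D2" unfolding D2_def using D e by (intro base_Un base_ranges)
    have "kdiv k D2 \<phi> (e i)" using ch(2) Suc.prems by (simp add: D2_def)
    then obtain bs where bs: "\<And>j. tup (bs j)" "\<And>j. eqt D2 (e i) (bs j)" "kcon k \<phi> bs UNIV"
      by (rule kdivE) blast
    define P where "P = (\<lambda>z. \<forall>j \<in> {Suc i..<n}. \<phi> ((\<lambda>x. z (Inl x :: 'x + 'y)) \<oplus> e j))"
    have "Dfn D2 P" unfolding P_def
    proof (rule Dfn_ball)
      fix j assume "j \<in> {Suc i..<n}"
      then have "range (e j) \<subseteq> D2" by (force simp: D2_def)
      then have "rn D2 (\<lambda>z. (\<lambda>x. z (Inl x :: 'x + 'y)) \<oplus> e j)"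
        by (intro rn_jn[OF rn_ren rn_const])
      then show "Dfn D2 (\<lambda>z. \<phi> ((\<lambda>x. z (Inl x :: 'x + 'y)) \<oplus> e j))"
        by (rule Dfn_rn[OF \<phi> _ base_D[OF D2], rotated]) (simp add: D2_def)
    qed simp
    then have P: "Dfn D2 Q" if "Q \<in> {P, \<phi>}" for Q
      using that Dfn_mono[OF \<phi>, of D2] by (auto simp: D2_def)
    have "{i..<n} = insert i {Suc i..<n}" using Suc.prems by auto
    then have "tree i k \<phi> (\<lambda>x. \<forall>Q \<in> {P, \<phi>}. Q (x \<oplus> e i))"
      using Suc by (simp add: P_def conj_commute)
    from tree_inv[OF D2 _ P bs(2) e bs(1) this] Dfn_mono[OF \<phi>, of D2]
    have "tree i k \<phi> (\<lambda>x. \<forall>Q \<in> {P, \<phi>}. Q (x \<oplus> bs j))" for j by (auto simp: D2_def)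
    then have "tree i k \<phi> (\<lambda>x. (\<forall>j \<in> {Suc i..<n}. \<phi> (x \<oplus> e j)) \<and> \<phi> (x \<oplus> bs j))" for j
      by (simp add: P_def)
    then show ?case by (rule tree_step[OF _ bs(1,3)])
  qed
  from this[of n] show ?thesis by simp
qed

lemma tree_infinite:
  fixes \<phi> :: "('x::countable + 'y::countable \<Rightarrow> 'u) \<Rightarrow> bool"
  assumes D: "base D" and \<phi>: "Dfn D \<phi>" and tr: "\<And>n. tree n k \<phi> (\<lambda>_. True)"
  shows "\<exists>b :: nat list \<Rightarrow> 'y \<Rightarrow> 'u. (\<forall>\<eta>. tup (b \<eta>)) \<and> (\<forall>\<eta>. kcon k \<phi> (\<lambda>i. b (\<eta> @ [i])) UNIV) \<and>
    (\<forall>\<eta>. \<exists>a. tup a \<and> (\<forall>i<length \<eta>. \<phi> (a \<oplus> b (take (Suc i) \<eta>))))"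
proof -
  have DU: "D \<subseteq> U" using D by (rule base_D)
  define I1 :: "(nat list \<times> nat set) set" where "I1 = {(\<eta>, J). finite J \<and> card J = k}"
  define f :: "(nat list \<times> nat set) + nat list \<Rightarrow> (nat list \<times> 'y \<Rightarrow> 'u) \<Rightarrow> bool" where
    "f = case_sum (\<lambda>(\<eta>, J) s. \<not> (\<exists>a. tup a \<and> (\<forall>j \<in> J. \<phi> (a \<oplus> (\<lambda>v. s (\<eta> @ [j], v))))))
      (\<lambda>\<eta> s. \<exists>a. tup a \<and> (\<forall>i \<in> {..<length \<eta>}. \<phi> (a \<oplus> (\<lambda>v. s (take (Suc i) \<eta>, v)))))"
  have "\<exists>s. tup s \<and> (\<forall>i \<in> I1 <+> UNIV. f i s)"
  proof (rule compact[OF D])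
    fix q assume q: "q \<in> I1 <+> (UNIV :: nat list set)"
    show "Dfn D (f q)"
    proof (cases q rule: sum.exhaust)
      case (Inl p)
      obtain \<eta> J where p: "p = (\<eta>, J)" by (cases p rule: prod.exhaust)
      have "finite J" using q Inl p by (auto simp: I1_def)
      then have "Dfn D (\<lambda>z. \<forall>j \<in> J. \<phi> ((\<lambda>x. z (Inl x)) \<oplus> (\<lambda>v. z (Inr (\<eta> @ [j], v)))))"
        by (rule Dfn_ball) (rule Dfn_rn'[OF \<phi> DU], rule rn_jn[OF rn_ren rn_ren])
      from Dfn_not[OF Dfn_exI[OF this]] show ?thesis unfolding Inl p f_def sum.case prod.case .
    next
      case (Inr \<eta>)
      have "Dfn D (\<lambda>z. \<forall>i \<in> {..<length \<eta>}. \<phi> ((\<lambda>x. z (Inl x)) \<oplus> (\<lambda>v. z (Inr (take (Suc i) \<eta>, v)))))"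
        by (rule Dfn_ball[OF finite_lessThan]) (rule Dfn_rn'[OF \<phi> DU], rule rn_jn[OF rn_ren rn_ren])
      from Dfn_exI[OF this] show ?thesis unfolding Inr f_def sum.case .
    qed
  next
    fix K assume K: "K \<subseteq> I1 <+> (UNIV :: nat list set)" "finite K"
    define X where "X = length ` (fst ` (Inl -` K) \<union> Inr -` K)"
    have "finite (Inl -` K)" "finite (Inr -` K)" using K(2) by (auto intro!: finite_vimageI)
    then have "finite X" by (simp add: X_def)
    then obtain n where n: "\<And>x. x \<in> X \<Longrightarrow> x < n" by (metis finite_nat_set_iff_bounded)
    from tr[of n] obtain b c where b: "\<And>\<eta>. tup (b \<eta>)" "\<And>\<eta>. tup (c \<eta>)"
      "\<And>\<eta>. length \<eta> < n \<Longrightarrow> kcon k \<phi> (\<lambda>i. b (\<eta> @ [i])) UNIV"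
      "\<And>\<eta> i. length \<eta> = n \<Longrightarrow> i < n \<Longrightarrow> \<phi> (c \<eta> \<oplus> b (take (Suc i) \<eta>))" by (rule treeE) blast
    have "f q (\<lambda>(\<eta>, v). b \<eta> v)" if q: "q \<in> K" for q
    proof (cases q rule: sum.exhaust)
      case (Inl p)
      obtain \<eta> J where p: "p = (\<eta>, J)" by (cases p rule: prod.exhaust)
      have "length \<eta> \<in> X" using q Inl p by (force simp: X_def)
      then have "kcon k \<phi> (\<lambda>i. b (\<eta> @ [i])) UNIV" using b(3) n by blast
      moreover have "finite J" "card J = k" using q K(1) Inl p by (auto simp: I1_def)
      ultimately show ?thesis by (simp add: Inl p f_def kcon_def)
    next
      case (Inr \<eta>)
      have "length \<eta> \<in> X" using q Inr by (force simp: X_def)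
      then have len: "length \<eta> < n" by (rule n)
      \<comment> \<open>Realizations exist for branches of full length \<open>n\<close>, so
        \<open>\<eta>\<close> is padded with zeros.\<close>
      define \<nu> where "\<nu> = \<eta> @ replicate (n - length \<eta>) 0"
      have "length \<nu> = n" using len by (simp add: \<nu>_def)
      moreover have "take (Suc i) \<nu> = take (Suc i) \<eta>" if "i < length \<eta>" for i
        using that by (simp add: \<nu>_def)
      ultimately have "\<phi> (c \<nu> \<oplus> b (take (Suc i) \<eta>))" if "i < length \<eta>" for i
        using b(4)[of \<nu> i] len that by simp
      then show ?thesis using b(2) by (auto simp: Inr f_def)
    qed
    then show "\<exists>s. tup s \<and> (\<forall>q \<in> K. f q s)"
      using b(1) by (intro exI[of _ "\<lambda>(\<eta>, v). b \<eta> v"]) (auto simp: tup_def)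
  qed
  then obtain s where s: "tup s" "\<And>q. q \<in> I1 <+> UNIV \<Longrightarrow> f q s" by blast
  show ?thesis
  proof (intro exI[of _ "\<lambda>\<eta> v. s (\<eta>, v)"] conjI allI)
    show "tup (\<lambda>v. s (\<eta>, v))" for \<eta> using s(1) by simp
    fix \<eta>
    show "kcon k \<phi> (\<lambda>i v. s (\<eta> @ [i], v)) UNIV" unfolding kcon_def
    proof (intro allI impI)
      fix J :: "nat set" assume "finite J" "card J = k"
      then have "(\<eta>, J) \<in> I1" by (simp add: I1_def)
      from s(2)[OF InlI[OF this]]
      show "\<not> (\<exists>a. tup a \<and> (\<forall>j \<in> J. \<phi> (a \<oplus> (\<lambda>v. s (\<eta> @ [j], v)))))" by (simp add: f_def)
    qed
    from s(2)[OF InrI[OF UNIV_I], of \<eta>]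
    show "\<exists>a. tup a \<and> (\<forall>i<length \<eta>. \<phi> (a \<oplus> (\<lambda>v. s (take (Suc i) \<eta>, v))))" by (auto simp: f_def)
  qed
qed

lemma tree_tree_property:
  fixes \<phi> :: "('x::countable + 'y::countable \<Rightarrow> 'u) \<Rightarrow> bool"
  assumes D: "base D" and \<phi>: "Dfn D \<phi>" and tr: "\<And>n. tree n k \<phi> (\<lambda>_. True)"
  shows "tree_property L S"
proof -
  from tree_infinite[OF assms] obtain b :: "nat list \<Rightarrow> 'y \<Rightarrow> 'u" where b: "\<forall>\<eta>. tup (b \<eta>)"
    "\<forall>\<eta>. kcon k \<phi> (\<lambda>i. b (\<eta> @ [i])) UNIV"
    "\<forall>\<eta>. \<exists>a. tup a \<and> (\<forall>i<length \<eta>. \<phi> (a \<oplus> b (take (Suc i) \<eta>)))" by (elim exE conjE)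
  have "Dfn U \<phi>" using \<phi> D Dfn_mono by (auto simp: base_def)
  from Dfn_abs_nat[OF this U_ne order_refl] obtain d :: "nat \<Rightarrow> 'u" and Q where
    d: "range d \<subseteq> U" "Dfn {} Q" "\<forall>z. \<phi> z \<longleftrightarrow> Q (z \<oplus> d)" by (elim exE conjE)
  obtain \<chi> where \<chi>: "\<chi> \<in> formulas L (UNIV <+> {})"
    "\<forall>z. tup z \<longrightarrow> (Q z \<longleftrightarrow> sat S (case_sum z id) [] \<chi>)" using d(2) unfolding Dfn_def by (elim bexE)
  define g :: "(('x + 'y) + nat) + 'u \<Rightarrow> nat + nat" where
    "g = case_sum (case_sum (case_sum (\<lambda>x. Inl (to_nat x)) (\<lambda>y. Inr (to_nat (Inl y :: 'y + nat))))
       (\<lambda>i. Inr (to_nat (Inr i :: 'y + nat)))) (\<lambda>_. Inl 0)"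
  define \<theta> where "\<theta> = map_fm g \<chi>"
  have \<theta>: "\<theta> \<in> formulas L UNIV" unfolding \<theta>_def by (rule map_formulas[OF \<chi>(1)]) simp
  \<comment> \<open>The tree property has a formula at the root too. The labels are therefore those
    of the subtree above \<open>[0]\<close>, whose root carries one; \<open>d\<close> holds the
    parameters of \<open>\<phi>\<close>.\<close>
  define A where "A \<eta> m = (case from_nat m :: 'y + nat of Inl y \<Rightarrow> b (0 # \<eta>) y | Inr i \<Rightarrow> d i)" for \<eta> m
  have A: "range (A \<eta>) \<subseteq> U" for \<eta>
  proof -
    have "d i \<in> U" for i using d(1) by blast
    then show ?thesis using b(1) by (auto simp: A_def tup_def split: sum.split)
  qed
  have key: "sat S (case_sum a id) [] (inst \<theta> (A \<eta>)) \<longleftrightarrow> \<phi> ((\<lambda>x. a (to_nat x)) \<oplus> b (0 # \<eta>))"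
    if a: "tup a" for a \<eta>
  proof -
    let ?z = "((\<lambda>x. a (to_nat x)) \<oplus> b (0 # \<eta>)) \<oplus> d"
    have "tup ?z" using a b(1) d(1) by (simp add: tup_range[of d])
    from \<chi>(2)[rule_format, OF this]
    have "\<phi> ((\<lambda>x. a (to_nat x)) \<oplus> b (0 # \<eta>)) \<longleftrightarrow> sat S (case_sum ?z id) [] \<chi>"
      by (simp add: d(3))
    also have "\<dots> \<longleftrightarrow> sat S ((case_sum a id \<circ> map_sum id (A \<eta>)) \<circ> g) [] \<chi>"
    proof (rule sat_cong)
      fix v assume "v \<in> set_fm \<chi>"
      then have "v \<in> UNIV <+> {}" using \<chi>(1) by (auto simp: formulas_def)
      then obtain w where v: "v = Inl w" by auto
      show "case_sum ?z id v = ((case_sum a id \<circ> map_sum id (A \<eta>)) \<circ> g) v"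
        unfolding v by (auto simp: g_def A_def split: sum.split)
    qed
    finally show ?thesis by (simp add: inst_def \<theta>_def sat_map)
  qed
  show ?thesis unfolding tree_property_def
  proof (intro bexI[OF _ \<theta>] exI[of _ k] exI[of _ A] conjI allI)
    fix \<eta> :: "nat list"
    show "k_contradictory S k (\<lambda>i. inst \<theta> (A (\<eta> @ [i])))" unfolding k_contradictory_def
    proof (intro allI impI notI)
      fix J :: "nat set" assume J: "finite J" "card J = k"
        "\<exists>a. range a \<subseteq> U \<and> realizes S a ((\<lambda>i. inst \<theta> (A (\<eta> @ [i]))) ` J)"
      then obtain a where a: "range a \<subseteq> U" "realizes S a ((\<lambda>i. inst \<theta> (A (\<eta> @ [i]))) ` J)" by blast
      then have ta: "tup a" by (simp add: tup_range)
      then have "\<forall>j \<in> J. \<phi> ((\<lambda>x. a (to_nat x)) \<oplus> b ((0 # \<eta>) @ [j]))"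
        using a(2) key by (simp add: realizes_def)
      moreover have "tup (\<lambda>x :: 'x. a (to_nat x))" using ta by simp
      ultimately show False using b(2)[rule_format, of "0 # \<eta>"] J(1,2) unfolding kcon_def by blast
    qed
  next
    fix \<eta> :: "nat \<Rightarrow> nat"
    show "consistent S (range (\<lambda>n. inst \<theta> (A (map \<eta> [0..<n]))))" unfolding consistent_def
    proof (intro allI impI)
      fix F assume F: "finite F" "F \<subseteq> range (\<lambda>n. inst \<theta> (A (map \<eta> [0..<n])))"
      then obtain J where J: "finite J" "F = (\<lambda>n. inst \<theta> (A (map \<eta> [0..<n]))) ` J"
        by (meson finite_subset_image)
      obtain N where N: "\<And>j. j \<in> J \<Longrightarrow> j < N" using J(1) by (metis finite_nat_set_iff_bounded)
      define \<nu> where "\<nu> = 0 # map \<eta> [0..<N]"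
      obtain a where a: "tup a" "\<forall>i<length \<nu>. \<phi> (a \<oplus> b (take (Suc i) \<nu>))" using b(3) by blast
      have "\<phi> (a \<oplus> b (0 # map \<eta> [0..<j]))" if "j \<in> J" for j
      proof -
        have "take (Suc j) \<nu> = 0 # map \<eta> [0..<j]" using N[OF that] by (simp add: \<nu>_def take_map)
        then show ?thesis using a(2)[rule_format, of j] N[OF that] by (simp add: \<nu>_def)
      qed
      then have "realizes S (\<lambda>m. a (from_nat m)) F"
        using key[of "\<lambda>m. a (from_nat m)"] a(1) by (auto simp: realizes_def J(2))
      then show "\<exists>a. range a \<subseteq> U \<and> realizes S a F"
        using a(1) by (intro exI[of _ "\<lambda>m. a (from_nat m)"]) (auto simp: tup_def)
    qed
  qed (rule A)
qed

end

section \<open>Ultrafilters, and chains of dividing formulas under simplicity\<close>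

lemma ultrafilter_ex:
  fixes G :: "'z set set"
  assumes "\<And>F. F \<subseteq> G \<Longrightarrow> finite F \<Longrightarrow> \<Inter>F \<noteq> {}"
  shows "\<exists>V. G \<subseteq> V \<and> (\<forall>F \<subseteq> V. finite F \<longrightarrow> \<Inter>F \<noteq> {}) \<and> (\<forall>X. X \<in> V \<or> - X \<in> V)"
proof -
  define \<A> where "\<A> = {V. G \<subseteq> V \<and> (\<forall>F \<subseteq> V. finite F \<longrightarrow> \<Inter>F \<noteq> {})}"
  have "G \<in> \<A>" using assms by (simp add: \<A>_def)
  moreover have "\<Union>\<C> \<in> \<A>" if ne: "\<C> \<noteq> {}" and ch: "subset.chain \<A> \<C>" for \<C>
  proof -
    have sub: "\<C> \<subseteq> \<A>" using ch by (simp add: subset_chain_def)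
    have "\<Inter>F \<noteq> {}" if F: "F \<subseteq> \<Union>\<C>" "finite F" for F
    proof -
      obtain C where "C \<in> \<C>" "F \<subseteq> C"
        using finite_subset_Union_chain[OF F(2,1) ne ch] by metis
      then show ?thesis using sub F(2) by (auto simp: \<A>_def)
    qed
    moreover obtain C where "C \<in> \<C>" using ne by blast
    moreover have "G \<subseteq> C" using sub \<open>C \<in> \<C>\<close> by (auto simp: \<A>_def)
    ultimately show ?thesis by (auto simp: \<A>_def)
  qed
  ultimately obtain V where V: "V \<in> \<A>" and max: "\<forall>X \<in> \<A>. V \<subseteq> X \<longrightarrow> X = V"
    using subset_Zorn_nonempty[of \<A>] by blast
  have "X \<in> V \<or> - X \<in> V" for X
  proof (rule ccontr)
    assume neg: "\<not> (X \<in> V \<or> - X \<in> V)"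
    then have "insert X V \<notin> \<A>" "insert (- X) V \<notin> \<A>" using max by blast+
    then obtain F1 F2 where F: "finite F1" "F1 \<subseteq> insert X V" "\<Inter>F1 = {}"
      "finite F2" "F2 \<subseteq> insert (- X) V" "\<Inter>F2 = {}"
      using V by (auto simp: \<A>_def)
    let ?F = "(F1 - {X}) \<union> (F2 - {- X})"
    have "finite ?F" "?F \<subseteq> V" using F by auto
    then have "\<Inter>?F \<noteq> {}" using V by (simp add: \<A>_def)
    then obtain z where z: "\<And>Y. Y \<in> ?F \<Longrightarrow> z \<in> Y" by blast
    show False
    proof (cases "z \<in> X")
      case True
      then have "z \<in> \<Inter>F1" using z by (metis DiffI InterI UnI1 singletonD)
      then show False using F(3) by blast
    next
      case False
      then have "z \<in> - X" by simp
      then have "z \<in> \<Inter>F2" using z by (metis DiffI InterI UnI2 singletonD)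
      then show False using F(6) by blast
    qed
  qed
  then show ?thesis using V by (auto simp: \<A>_def)
qed

locale simple_monster = monster L S kb
  for L :: "('f, 'r) lang" and S :: "('f, 'r, 'u) struct" and kb :: "'k rel" +
  assumes simple: "simple_theory L S"
begin

lemma no_chain:
  fixes \<phi> :: "('x::countable + 'y::countable \<Rightarrow> 'u) \<Rightarrow> bool"
  assumes D: "base D" and \<phi>: "Dfn D \<phi>"
    and ch: "\<And>n. \<exists>c (e :: nat \<Rightarrow> 'y \<Rightarrow> 'u). tup c \<and> (\<forall>i. tup (e i)) \<and>
      (\<forall>i<n. \<phi> (c \<oplus> e i) \<and> kdiv k (D \<union> (\<Union>j \<in> {i<..<n}. range (e j))) \<phi> (e i))"
  shows False
proof -
  have "tree n k \<phi> (\<lambda>_. True)" for n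
  proof -
    obtain c and e :: "nat \<Rightarrow> 'y \<Rightarrow> 'u" where "tup c" "\<forall>i. tup (e i)"
      "\<forall>i<n. \<phi> (c \<oplus> e i) \<and> kdiv k (D \<union> (\<Union>j \<in> {i<..<n}. range (e j))) \<phi> (e i)"
      using ch[of n] by (elim exE conjE)
    then show ?thesis by (intro chain_tree[OF D \<phi>, of c e]) simp_all
  qed
  from tree_tree_property[OF D \<phi> this] show False using simple by (simp add: simple_theory_def)
qed

lemma no_inf_chain:
  fixes \<phi> :: "('x::countable + 'y::countable \<Rightarrow> 'u) \<Rightarrow> bool" and e :: "nat \<Rightarrow> 'y \<Rightarrow> 'u"
  assumes D: "base D" and \<phi>: "Dfn D \<phi>" and c: "tup c" and e: "\<And>i. tup (e i)"
    and ch: "\<And>i. \<phi> (c \<oplus> e i)" "\<And>i. kdiv k (D \<union> (\<Union>j \<in> {i<..}. range (e j))) \<phi> (e i)"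
  shows False
proof (rule no_chain[OF D \<phi>, of k])
  fix n :: nat
  have "kdiv k (D \<union> (\<Union>j \<in> {i<..<n}. range (e j))) \<phi> (e i)" for i
    by (rule kdiv_mono[OF ch(2)]) auto
  then show "\<exists>c (e :: nat \<Rightarrow> 'y \<Rightarrow> 'u). tup c \<and> (\<forall>i. tup (e i)) \<and>
      (\<forall>i<n. \<phi> (c \<oplus> e i) \<and> kdiv k (D \<union> (\<Union>j \<in> {i<..<n}. range (e j))) \<phi> (e i))"
    using c e ch(1) by (intro exI[of _ c] exI[of _ e]) simp
qed


section \<open>Coheirs over models\<close>

text \<open>The Tarski-Vaught test with countable tuples of witnesses; \<open>elem_mod\<close>,
  \<open>mod_skolem\<close> and \<open>skolem_elem_sub\<close> connect it with elementary
  submodels.\<close>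

definition is_mod :: "'u set \<Rightarrow> bool" where
  "is_mod M \<longleftrightarrow> M \<subseteq> U \<and> M \<noteq> {} \<and>
    (\<forall>P. Dfn M P \<longrightarrow> (\<exists>a :: nat \<Rightarrow> 'u. tup a \<and> P a) \<longrightarrow> (\<exists>a. range a \<subseteq> M \<and> P a))"

lemma mod_U: "is_mod M \<Longrightarrow> M \<subseteq> U"
  by (simp add: is_mod_def)

lemma mod_ne: "is_mod M \<Longrightarrow> M \<noteq> {}"
  by (simp add: is_mod_def)

lemma mod_ex:
  fixes a :: "'x::countable \<Rightarrow> 'u"
  assumes M: "is_mod M" and P: "Dfn M P" "tup a" "P a"
  shows "\<exists>a. range a \<subseteq> M \<and> P a"
proof -
  have "Dfn M (\<lambda>s. P (\<lambda>x. s (to_nat x)))" by (rule Dfn_comp[OF P(1) mod_U[OF M]])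
  moreover have "tup (\<lambda>n. a (from_nat n))" using P(2) by simp
  moreover have "P (\<lambda>x. a (from_nat (to_nat x)))" using P(3) by simp
  then have "\<exists>s. tup s \<and> P (\<lambda>x. s (to_nat x))"
    using \<open>tup (\<lambda>n. a (from_nat n))\<close> by (intro exI[of _ "\<lambda>n. a (from_nat n)"]) simp
  ultimately have "\<exists>s. range s \<subseteq> M \<and> P (\<lambda>x. s (to_nat x))"
    using M[unfolded is_mod_def, THEN conjunct2, THEN conjunct2, rule_format, of "\<lambda>s. P (\<lambda>x. s (to_nat x))"]
    by simp
  then obtain s :: "nat \<Rightarrow> 'u" where "range s \<subseteq> M" "P (\<lambda>x. s (to_nat x))" by (elim exE conjE)
  then show ?thesis by (intro exI[of _ "\<lambda>x. s (to_nat x)"]) auto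
qed

text \<open>\<open>V\<close> is an ultrafilter on tuples that is concentrated on tuples from
  \<open>M\<close> and contains the type of \<open>b\<close> over \<open>M\<close>; it determines a
  global coheir of that type.\<close>

definition coheir :: "'u set \<Rightarrow> ('y \<Rightarrow> 'u) set set \<Rightarrow> ('y \<Rightarrow> 'u) \<Rightarrow> bool" where
  "coheir M V b \<longleftrightarrow> (\<forall>F \<subseteq> V. finite F \<longrightarrow> \<Inter>F \<noteq> {}) \<and> (\<forall>X. X \<in> V \<or> - X \<in> V) \<and>
    {m. range m \<subseteq> M} \<in> V \<and> (\<forall>P. Dfn M P \<longrightarrow> P b \<longrightarrow> {m. P m} \<in> V)"

text \<open>\<open>g\<close> realizes the restriction to \<open>W\<close> of the global type
  determined by \<open>V\<close>.\<close>

definition coh :: "('y \<Rightarrow> 'u) set set \<Rightarrow> 'u set \<Rightarrow> ('y \<Rightarrow> 'u) \<Rightarrow> bool" where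
  "coh V W g \<longleftrightarrow> tup g \<and> (\<forall>P. Dfn W P \<longrightarrow> (P g \<longleftrightarrow> {m. P m} \<in> V))"

lemma coheir_ex:
  fixes b :: "'y::countable \<Rightarrow> 'u"
  assumes M: "is_mod M" and b: "tup b"
  shows "\<exists>V. coheir M V b"
proof -
  define G where "G = insert {m. range m \<subseteq> M} (Collect ` {P. Dfn M P \<and> P b})"
  have "\<Inter>F \<noteq> {}" if F: "F \<subseteq> G" "finite F" for F
  proof -
    have "F - {{m. range m \<subseteq> M}} \<subseteq> Collect ` {P. Dfn M P \<and> P b}" "finite (F - {{m. range m \<subseteq> M}})"
      using F by (auto simp: G_def)
    then obtain J where J: "J \<subseteq> {P. Dfn M P \<and> P b}" "finite J" "F - {{m. range m \<subseteq> M}} = Collect ` J"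
      by (meson finite_subset_image)
    have "Dfn M (\<lambda>s. \<forall>P \<in> J. P s)" using J by (intro Dfn_ball) auto
    moreover have "\<forall>P \<in> J. P b" using J by auto
    ultimately have "\<exists>m. range m \<subseteq> M \<and> (\<forall>P \<in> J. P m)" by (rule mod_ex[OF M _ b])
    then obtain m where m: "range m \<subseteq> M" "\<forall>P \<in> J. P m" by (elim exE conjE)
    have "m \<in> X" if "X \<in> F" for X
    proof (cases "X = {m. range m \<subseteq> M}")
      case False
      then have "X \<in> Collect ` J" using that J(3) by blast
      then obtain P where "P \<in> J" "X = Collect P" by (elim imageE)
      then show ?thesis using m(2)[rule_format, of P] by simp
    qed (simp add: m(1))
    then show ?thesis by blast
  qed
  then have "\<exists>V. G \<subseteq> V \<and> (\<forall>F \<subseteq> V. finite F \<longrightarrow> \<Inter>F \<noteq> {}) \<and> (\<forall>X. X \<in> V \<or> - X \<in> V)"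
    by (rule ultrafilter_ex)
  then obtain V where V: "G \<subseteq> V"
    "\<forall>F \<subseteq> V. finite F \<longrightarrow> \<Inter>F \<noteq> {}" "\<forall>X. X \<in> V \<or> - X \<in> V" by (elim exE conjE)
  then have "coheir M V b" unfolding coheir_def G_def by auto
  then show ?thesis by blast
qed

lemma coheir_compl: "coheir M V b \<Longrightarrow> - X \<in> V \<longleftrightarrow> X \<notin> V"
proof -
  assume c: "coheir M V b"
  then have "X \<in> V \<or> - X \<in> V" by (simp add: coheir_def)
  moreover have "\<not> (X \<in> V \<and> - X \<in> V)"
  proof
    assume "X \<in> V \<and> - X \<in> V"
    then have "{X, - X} \<subseteq> V" by simp
    then have "\<Inter>{X, - X} \<noteq> {}" using c unfolding coheir_def by (metis finite.emptyI finite.insertI)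
    then show False by simp
  qed
  ultimately show ?thesis by blast
qed

lemma coheir_meet:
  assumes "coheir M V b" "finite F" "F \<subseteq> V"
  shows "\<exists>m. range m \<subseteq> M \<and> (\<forall>X \<in> F. m \<in> X)"
proof -
  have "\<forall>F \<subseteq> V. finite F \<longrightarrow> \<Inter>F \<noteq> {}" "{m. range m \<subseteq> M} \<in> V"
    using assms(1) by (simp_all add: coheir_def)
  from this(1)[rule_format, of "insert {m. range m \<subseteq> M} F"] this(2)
  have "\<Inter>(insert {m. range m \<subseteq> M} F) \<noteq> {}" using assms(2,3) by blast
  then show ?thesis by auto
qed

lemma coh_tup: "coh V W g \<Longrightarrow> tup g"
  by (simp add: coh_def)

lemma coh_mono: "coh V W g \<Longrightarrow> W' \<subseteq> W \<Longrightarrow> coh V W' g"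
  unfolding coh_def using Dfn_mono by blast

lemma coh_ex:
  fixes b :: "'y::countable \<Rightarrow> 'u"
  assumes c: "coheir M V b" and M: "M \<subseteq> U" and W: "base W"
  shows "\<exists>g. coh V W g"
proof -
  have "\<exists>g. tup g \<and> (\<forall>P \<in> {P. Dfn W P \<and> {m. P m} \<in> V}. P g)"
  proof (rule compact[OF W])
    fix J assume J: "J \<subseteq> {P. Dfn W P \<and> {m. P m} \<in> V}" "finite J"
    have "Collect ` J \<subseteq> V" "finite (Collect ` J)" using J by auto
    from coheir_meet[OF c this(2,1)] obtain m where "range m \<subseteq> M" "\<forall>P \<in> J. P m" by auto
    then show "\<exists>g. tup g \<and> (\<forall>P \<in> J. P g)" using M by (intro exI[of _ m]) (auto simp: tup_range)
  qed simp
  then obtain g where g: "tup g" "\<And>P. Dfn W P \<Longrightarrow> {m. P m} \<in> V \<Longrightarrow> P g" by blast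
  have "P g \<longleftrightarrow> {m. P m} \<in> V" if P: "Dfn W P" for P
  proof
    assume Pg: "P g"
    show "{m. P m} \<in> V"
    proof (rule ccontr)
      assume "{m. P m} \<notin> V"
      then have "{m. \<not> P m} \<in> V" using coheir_compl[OF c, of "{m. P m}"] by (simp add: Collect_neg_eq)
      then show False using g(2)[OF Dfn_not[OF P]] Pg by blast
    qed
  qed (rule g(2)[OF P])
  then show ?thesis using g(1) unfolding coh_def by blast
qed

lemma coh_self:
  fixes b :: "'y \<Rightarrow> 'u"
  assumes c: "coheir M V b" and b: "tup b"
  shows "coh V M b"
  unfolding coh_def
proof (intro conjI allI impI)
  fix P :: "('y \<Rightarrow> 'u) \<Rightarrow> bool" assume P: "Dfn M P"
  have *: "\<And>P. Dfn M P \<Longrightarrow> P b \<Longrightarrow> {m. P m} \<in> V" using c by (simp add: coheir_def)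
  show "P b \<longleftrightarrow> {m. P m} \<in> V"
    using *[OF P] *[OF Dfn_not[OF P]] coheir_compl[OF c, of "{m. P m}"] by (auto simp: Collect_neg_eq)
qed (rule b)

text \<open>The global type of a coheir is invariant over \<open>M\<close>: if \<open>V\<close>
  decided \<open>P(f, y)\<close> and \<open>P(f', y)\<close> differently, a tuple \<open>m\<close>
  from \<open>M\<close> would tell \<open>f\<close> and \<open>f'\<close> apart over
  \<open>M\<close>.\<close>

lemma coh_inv:
  assumes c: "coheir M V b" and M: "M \<subseteq> U" and f: "eqt M f f'" "tup f" "tup f'"
    and g: "coh V (M \<union> range f) g" "coh V (M \<union> range f') g'"
  shows "eqt M (f \<oplus> g) (f' \<oplus> g')"
  unfolding eqt_def
proof (intro allI impI)
  fix P assume P: "Dfn M P" "P (f \<oplus> g)"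
  have D: "Dfn (M \<union> range f) (\<lambda>m. P (f \<oplus> m))" if "tup f" for f
    using that M by (intro Dfn_rn[OF P(1)] rn_jn rn_const rn_id) (auto simp: tup_range)
  have 1: "{m. P (f \<oplus> m)} \<in> V" using g(1) D[OF f(2)] P(2) unfolding coh_def by blast
  have "{m. P (f' \<oplus> m)} \<in> V"
  proof (rule ccontr)
    assume "{m. P (f' \<oplus> m)} \<notin> V"
    then have "- {m. P (f' \<oplus> m)} \<in> V" using coheir_compl[OF c] by blast
    with 1 have "{{m. P (f \<oplus> m)}, - {m. P (f' \<oplus> m)}} \<subseteq> V" by simp
    from coheir_meet[OF c _ this] obtain m where m: "range m \<subseteq> M" "P (f \<oplus> m)" "\<not> P (f' \<oplus> m)" by auto
    have "Dfn M (\<lambda>s. P (s \<oplus> m))" using m(1) M by (intro Dfn_rn[OF P(1)] rn_jn rn_const rn_id) auto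
    from eqtD[OF f(1) this] m show False by blast
  qed
  then show "P (f' \<oplus> g')" using g(2) D[OF f(3)] unfolding coh_def by blast
qed

lemma coh_eqt: "coh V M g \<Longrightarrow> coh V M g' \<Longrightarrow> eqt M g g'"
  unfolding coh_def eqt_def by blast

text \<open>A formula in the type of \<open>g\<close> is satisfied by some tuple \<open>m\<close>
  from \<open>M\<close>, and \<open>ind_refl\<close> for \<open>m\<close> shows that it does not
  divide.\<close>

lemma coh_ind:
  assumes c: "coheir M V b" and M: "M \<subseteq> U" and w: "tup w" and g: "coh V (M \<union> range w) g"
  shows "ind M g w"
  unfolding ind_def
proof (intro allI impI)
  fix \<phi> k assume \<phi>: "Dfn M \<phi>" "\<phi> (g \<oplus> w)"
  have "Dfn (M \<union> range w) (\<lambda>m. \<phi> (m \<oplus> w))"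
    using w M by (intro Dfn_rn[OF \<phi>(1)] rn_jn rn_const rn_id) (auto simp: tup_range)
  then have "{m. \<phi> (m \<oplus> w)} \<in> V" using g \<phi>(2) unfolding coh_def by blast
  from coheir_meet[OF c, of "{{m. \<phi> (m \<oplus> w)}}"] this obtain m where m: "range m \<subseteq> M" "\<phi> (m \<oplus> w)" by auto
  show "\<not> kdiv k M \<phi> w" using indD[OF ind_refl[OF m(1) M] \<phi>(1) m(2)] .
qed

text \<open>A Morley sequence of the coheir: each entry realizes it over \<open>W\<close> and all
  earlier entries.\<close>

definition cohs :: "('y \<Rightarrow> 'u) set set \<Rightarrow> 'u set \<Rightarrow> (nat \<Rightarrow> 'y \<Rightarrow> 'u) \<Rightarrow> bool" where
  "cohs V W e \<longleftrightarrow> (\<forall>i. coh V (W \<union> (\<Union>j \<in> {..<i}. range (e j))) (e i))"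

lemma sequence_ex:
  fixes R :: "'u set \<Rightarrow> ('y::countable \<Rightarrow> 'u) \<Rightarrow> bool"
  assumes W0: "base W0" and R: "\<And>W. base W \<Longrightarrow> W0 \<subseteq> W \<Longrightarrow> \<exists>g. tup g \<and> R W g"
  shows "\<exists>e :: nat \<Rightarrow> 'y \<Rightarrow> 'u. \<forall>i. tup (e i) \<and> R (W0 \<union> (\<Union>j \<in> {..<i}. range (e j))) (e i)"
proof -
  have "\<forall>W. \<exists>g. base W \<longrightarrow> W0 \<subseteq> W \<longrightarrow> tup g \<and> R W g" using R by blast
  then obtain g where "\<forall>W. base W \<longrightarrow> W0 \<subseteq> W \<longrightarrow> tup (g W) \<and> R W (g W)" by (rule choice[THEN exE])
  then have g: "\<And>W. base W \<Longrightarrow> W0 \<subseteq> W \<Longrightarrow> tup (g W) \<and> R W (g W)" by blast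
  define Wn where "Wn = rec_nat W0 (\<lambda>_ W. W \<union> range (g W))"
  define e where "e i = g (Wn i)" for i
  have Wn: "Wn 0 = W0" "\<And>n. Wn (Suc n) = Wn n \<union> range (e n)" by (simp_all add: Wn_def e_def)
  have b: "base (Wn n) \<and> W0 \<subseteq> Wn n" for n
  proof (induction n)
    case (Suc n)
    then have "tup (e n)" using g by (simp add: e_def)
    then show ?case using Suc Wn(2) base_Un_range by auto
  qed (simp add: Wn W0)
  have eq: "Wn n = W0 \<union> (\<Union>j \<in> {..<n}. range (e j))" for n
    by (induction n) (auto simp: Wn lessThan_Suc)
  show ?thesis
  proof (intro exI[of _ e] allI)
    fix i
    have "tup (g (Wn i)) \<and> R (Wn i) (g (Wn i))" using g b by blast
    then show "tup (e i) \<and> R (W0 \<union> (\<Union>j \<in> {..<i}. range (e j))) (e i)"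
      unfolding eq[symmetric] by (simp only: e_def)
  qed
qed

lemma cohs_tup: "cohs V W e \<Longrightarrow> tup (e i)"
  unfolding cohs_def using coh_tup by blast

lemma cohs_ex:
  fixes b :: "'y::countable \<Rightarrow> 'u"
  assumes "coheir M V b" "M \<subseteq> U" "base W"
  shows "\<exists>e. cohs V W e"
  using sequence_ex[OF assms(3), of "coh V"] coh_ex[OF assms(1,2)] coh_tup unfolding cohs_def by blast

lemma cohs_mono: "cohs V W e \<Longrightarrow> W' \<subseteq> W \<Longrightarrow> cohs V W' e"
  unfolding cohs_def by (blast intro: coh_mono)

lemma cohs_sub:
  assumes "cohs V W e" "strict_mono h" "W' \<subseteq> W \<union> (\<Union>j \<in> {..<h 0}. range (e j))"
  shows "cohs V W' (\<lambda>i. e (h i))"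
  unfolding cohs_def
proof
  fix i
  have "coh V (W \<union> (\<Union>j \<in> {..<h i}. range (e j))) (e (h i))" using assms(1) by (simp add: cohs_def)
  moreover have "h 0 \<le> h i" "\<And>j. j < i \<Longrightarrow> h j < h i"
    using assms(2) by (auto simp: strict_mono_less_eq strict_mono_less)
  ultimately show "coh V (W' \<union> (\<Union>j \<in> {..<i}. range (e (h j)))) (e (h i))"
    using assms(3) by (elim coh_mono) fastforce
qed

lemma cohs_eqt:
  assumes c: "coheir M V b" and M: "is_mod M" and f: "eqt M f f'" "tup f" "tup f'"
    and e: "cohs V (M \<union> range f) e" "cohs V (M \<union> range f') e'"
  shows "eqt M (f \<oplus> sq e) (f' \<oplus> sq e')"
proof -
  have MU: "M \<subseteq> U" using M by (rule mod_U)
  obtain m0 where m0: "m0 \<in> M" using mod_ne[OF M] by blast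
  \<comment> \<open>Entries from \<open>n\<close> on are replaced by a constant of \<open>M\<close>,
    so that initial segments are total tuples of one index type and the induction can run on
    \<open>n\<close>.\<close>
  define tr where "tr n e = (\<lambda>(i, v). if i < n then e i v else m0)" for n :: nat and e :: "nat \<Rightarrow> 'a \<Rightarrow> 'u"
  have ttr: "tup (tr n e)" if "\<And>i. tup (e i)" for n e
    using that m0 MU by (auto simp: tr_def tup_def)
  have rtr: "range (f \<oplus> tr n e) \<subseteq> M \<union> range f \<union> (\<Union>j \<in> {..<n}. range (e j))" for f :: "'b \<Rightarrow> 'u" and n e
    using m0 by (auto simp: range_jn tr_def split: if_splits)
  have main: "eqt M (f \<oplus> tr n e) (f' \<oplus> tr n e')" for n
  proof (induction n)
    case 0
    have "rn M (\<lambda>s. s \<oplus> (\<lambda>_ :: nat \<times> 'a. m0))" using m0 by (intro rn_jn rn_id rn_const) auto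
    from eqt_rn[OF f(1) MU this]
    have "eqt M (f \<oplus> (\<lambda>_ :: nat \<times> 'a. m0)) (f' \<oplus> (\<lambda>_ :: nat \<times> 'a. m0))" .
    moreover have "tr 0 e = (\<lambda>_. m0)" for e by (auto simp: tr_def)
    ultimately show ?case by metis
  next
    case (Suc n)
    have "coh V (M \<union> range (f \<oplus> tr n e)) (e n)"
      using e(1)[unfolded cohs_def, rule_format, of n] by (rule coh_mono) (use rtr[of f n e] in blast)
    moreover have "coh V (M \<union> range (f' \<oplus> tr n e')) (e' n)"
      using e(2)[unfolded cohs_def, rule_format, of n] by (rule coh_mono) (use rtr[of f' n e'] in blast)
    ultimately have "eqt M ((f \<oplus> tr n e) \<oplus> e n) ((f' \<oplus> tr n e') \<oplus> e' n)"
      using f cohs_tup[OF e(1)] cohs_tup[OF e(2)] by (intro coh_inv[OF c MU Suc.IH]) (auto intro: ttr)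
    moreover define g :: "nat \<times> 'a \<Rightarrow> ('b + nat \<times> 'a) + 'a" where
      "g q = (if fst q = n then Inr (snd q) else Inl (Inr q))" for q
    have "rn M (\<lambda>z. (\<lambda>x :: 'b. z (Inl (Inl x)) :: 'u) \<oplus> (\<lambda>q. z (g q)))" by (rule rn_jn[OF rn_ren rn_ren])
    ultimately have "eqt M (f \<oplus> (\<lambda>q. ((f \<oplus> tr n e) \<oplus> e n) (g q))) (f' \<oplus> (\<lambda>q. ((f' \<oplus> tr n e') \<oplus> e' n) (g q)))"
      using eqt_rn[OF _ MU] by fastforce
    moreover have "(\<lambda>q. ((f \<oplus> tr n e) \<oplus> e n) (g q)) = tr (Suc n) e" for f :: "'b \<Rightarrow> 'u" and e
      by (auto simp: g_def tr_def fun_eq_iff)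
    ultimately show ?case by simp
  qed
  show ?thesis unfolding eqt_def
  proof (intro allI impI)
    fix P assume P: "Dfn M P" "P (f \<oplus> sq e)"
    obtain X where X: "finite X" "\<forall>a a'. tup a \<longrightarrow> tup a' \<longrightarrow> (\<forall>v \<in> X. a v = a' v) \<longrightarrow> P a = P a'"
      using Dfn_support[OF P(1)] by (elim exE conjE)
    have "finite (fst ` (Inr -` X))" using X(1) by (intro finite_imageI finite_vimageI) auto
    then obtain n where n: "\<And>i. i \<in> fst ` (Inr -` X) \<Longrightarrow> i < n" by (metis finite_nat_set_iff_bounded)
    have *: "P (f \<oplus> tr n e) = P (f \<oplus> sq e)" if f: "tup f" and e: "\<And>i. tup (e i)" for f e
    proof (rule X(2)[rule_format])
      show "tup (f \<oplus> tr n e)" "tup (f \<oplus> sq e)" using that ttr by auto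
      fix v assume v: "v \<in> X"
      show "(f \<oplus> tr n e) v = (f \<oplus> sq e) v"
      proof (cases v rule: sum.exhaust)
        case (Inr q)
        then have "fst q < n" using n v by force
        then show ?thesis using Inr by (cases q) (simp add: tr_def)
      qed simp
    qed
    show "P (f' \<oplus> sq e')"
      using P(2) *[of f e, OF f(2) cohs_tup[OF e(1)]] *[of f' e', OF f(3) cohs_tup[OF e(2)]] eqtD[OF main P(1)] by blast
  qed
qed

lemma cohs_indisc:
  assumes c: "coheir M V b" and M: "is_mod M" and e: "cohs V M e"
  shows "indisc M e"
  unfolding indisc_def
proof (intro allI impI)
  fix h :: "nat \<Rightarrow> nat" assume h: "strict_mono h"
  obtain m0 where m0: "m0 \<in> M" using mod_ne[OF M] by blast
  define f where "f = (\<lambda>_ :: nat. m0)"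
  have r: "M \<union> range f = M" using m0 by (auto simp: f_def)
  have "tup f" using m0 mod_U[OF M] by (auto simp: f_def tup_def)
  moreover have "cohs V M (\<lambda>i. e (h i))" by (rule cohs_sub[OF e h]) blast
  ultimately have "eqt M (f \<oplus> sq e) (f \<oplus> sq (\<lambda>i. e (h i)))"
    using e by (intro cohs_eqt[OF c M]) (simp_all add: r)
  then show "eqt M (sq e) (sq (\<lambda>i. e (h i)))" by (rule eqt_jnD(2)[OF _ mod_U[OF M]])
qed

lemma range_sq: "range (sq e) = (\<Union>j. range (e j))"
  by (auto simp: sq_def image_iff)

text \<open>Choose a Morley sequence \<open>e'\<close> over the whole dividing sequence. By
  invariance each \<open>(bs j, e')\<close> has the type of \<open>(f, e)\<close> over
  \<open>M\<close>; moving \<open>e'\<close> to \<open>e\<close> makes the members of the dividing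
  sequence conjugate over \<open>e\<close> as well.\<close>

lemma kdiv_coh:
  fixes f :: "'y::countable \<Rightarrow> 'u" and b :: "'z::countable \<Rightarrow> 'u"
  assumes c: "coheir M V b" and M: "is_mod M" "base M" and \<phi>: "Dfn M \<phi>" and k: "kdiv k M \<phi> f"
    and f: "tup f" and e: "cohs V (M \<union> range f) e"
  shows "kdiv k (M \<union> (\<Union>j. range (e j))) \<phi> f"
proof -
  have MU: "M \<subseteq> U" using M(1) by (rule mod_U)
  from k obtain bs where bs: "\<And>j. tup (bs j)" "\<And>j. eqt M f (bs j)" "kcon k \<phi> bs UNIV"
    by (rule kdivE) blast
  have "base (M \<union> (\<Union>j \<in> UNIV. range (bs j)))" using M(2) bs(1) by (intro base_Un base_ranges)
  from cohs_ex[OF c MU this] obtain e' where e': "cohs V (M \<union> (\<Union>j \<in> UNIV. range (bs j))) e'" by blast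
  have te: "tup (sq e)" "tup (sq e')" using cohs_tup[OF e] cohs_tup[OF e'] by simp_all
  have 1: "eqt M (f \<oplus> sq e) (bs j \<oplus> sq e')" for j
    using f bs(1) cohs_mono[OF e', of "M \<union> range (bs j)"] by (intro cohs_eqt[OF c M(1) bs(2) _ _ e]) auto
  have "eqt M (sq e') (sq e)" using eqt_sym[OF eqt_jnD(2)[OF 1 MU]] .
  from homog[OF M(2) this te(2,1), of "sq bs"] bs(1) obtain s where
    s: "tup s" "eqt M (sq e' \<oplus> sq bs) (sq e \<oplus> s)" by auto
  define bs' where "bs' j v = s (j, v)" for j v
  have sb: "s = sq bs'" by (auto simp: bs'_def sq_def)
  have "eqt M (bs j \<oplus> sq e') (bs' j \<oplus> sq e)" for j
    using eqt_rn[OF s(2) MU, of "\<lambda>z. (\<lambda>v. z (Inr (j, v))) \<oplus> (\<lambda>x. z (Inl x))", OF rn_jn[OF rn_ren rn_ren]]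
    by (simp add: sb)
  then have e2: "eqt M (f \<oplus> sq e) (bs' j \<oplus> sq e)" for j using 1 eqt_trans by blast
  show ?thesis
  proof (rule kdivI)
    show "tup (bs' j)" for j using s(1) by (simp add: sb)
    show "eqt (M \<union> (\<Union>j. range (e j))) f (bs' j)" for j
      using e2 by (simp add: range_sq[symmetric] eqt_base[OF MU te(1)])
    show "kcon k \<phi> bs' UNIV"
      using eqt_jnD(2)[OF s(2) MU] bs(3) unfolding sb by (rule kcon_eqt[OF \<phi> MU])
  qed
qed


section \<open>Extension, symmetry and transitivity over models\<close>

text \<open>Otherwise some nondividing \<open>\<phi>(x, b)\<close> implies a finite disjunction of
  dividing formulas. Along a Morley sequence of a coheir of all the parameters, one \<open>c\<close>
  satisfies every copy of \<open>\<phi>\<close>, so some disjunct \<open>l\<close> holds infinitely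
  often; each of these instances divides over the later ones by \<open>kdiv_coh\<close>, against
  simplicity.\<close>

lemma ext_nd:
  fixes G :: "(('x::countable \<Rightarrow> 'u) \<Rightarrow> bool) set"
  assumes M: "is_mod M" "base M" and W: "base W" "M \<subseteq> W" and G: "\<And>P. P \<in> G \<Longrightarrow> Dfn W P"
    and fin: "\<And>F. F \<subseteq> G \<Longrightarrow> finite F \<Longrightarrow> \<exists>\<phi> (b :: 'y::countable \<Rightarrow> 'u). range b \<subseteq> W \<and> Dfn M \<phi> \<and>
      (\<forall>k. \<not> kdiv k M \<phi> b) \<and> (\<forall>a. tup a \<longrightarrow> \<phi> (a \<oplus> b) \<longrightarrow> (\<forall>P \<in> F. P a))"
  shows "\<exists>c. tup c \<and> (\<forall>P \<in> G. P c) \<and> Ind M c W"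
proof -
  have MU: "M \<subseteq> U" and WU: "W \<subseteq> U" by (rule mod_U[OF M(1)], rule base_D[OF W(1)])
  define I2 where "I2 = {(\<psi> :: ('x + nat \<Rightarrow> 'u) \<Rightarrow> bool, w :: nat \<Rightarrow> 'u, k). Dfn M \<psi> \<and> range w \<subseteq> W \<and> kdiv k M \<psi> w}"
  define f where "f = case_sum (\<lambda>P. P) (\<lambda>(\<psi> :: ('x + nat \<Rightarrow> 'u) \<Rightarrow> bool, w :: nat \<Rightarrow> 'u, k :: nat) a. \<not> \<psi> (a \<oplus> w))"
  have "\<exists>c. tup c \<and> (\<forall>q \<in> G <+> I2. f q c)"
  proof (rule compact[OF W(1)])
    fix q assume q: "q \<in> G <+> I2"
    show "Dfn W (f q)"
    proof (cases q rule: sum.exhaust)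
      case (Inl P)
      then show ?thesis using q G by (auto simp: f_def)
    next
      case (Inr p)
      obtain \<psi> w k where p: "p = (\<psi>, w, k)" by (cases p rule: prod_cases3)
      have "Dfn M \<psi>" and w: "range w \<subseteq> W" using q Inr p by (auto simp: I2_def)
      then have "Dfn W (\<lambda>a. \<psi> (a \<oplus> w))"
        by (intro Dfn_rn[OF _ W(2) WU] rn_jn[OF rn_id rn_const])
      from Dfn_not[OF this] show ?thesis by (simp add: f_def Inr p)
    qed
  next
    fix K assume K: "K \<subseteq> G <+> I2" "finite K"
    show "\<exists>c. tup c \<and> (\<forall>q \<in> K. f q c)"
    proof (rule ccontr)
      assume no: "\<not> ?thesis"
      define F where "F = Inl -` K"
      define Z where "Z = Inr -` K"
      have FZ: "finite F" "finite Z" "F \<subseteq> G" "Z \<subseteq> I2"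
        using K by (auto simp: F_def Z_def intro!: finite_vimageI)
      obtain \<phi> and b :: "'y \<Rightarrow> 'u" where b: "range b \<subseteq> W" "Dfn M \<phi>" "\<forall>k. \<not> kdiv k M \<phi> b"
        "\<forall>a. tup a \<longrightarrow> \<phi> (a \<oplus> b) \<longrightarrow> (\<forall>P \<in> F. P a)" using fin[OF FZ(3,1)] by (elim exE conjE)
      obtain zs where zs: "set zs = Z" using FZ(2) finite_list by blast
      define r where "r = length zs"
      define fs where "fs l = fst (zs ! l)" for l
      define ws where "ws l = fst (snd (zs ! l))" for l
      define ks where "ks l = snd (snd (zs ! l))" for l
      have zl: "Dfn M (fs l)" "range (ws l) \<subseteq> W" "kdiv (ks l) M (fs l) (ws l)" if "l < r" for l
      proof -
        have "zs ! l \<in> I2" using that zs FZ(4) by (auto simp: r_def)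
        then show "Dfn M (fs l)" "range (ws l) \<subseteq> W" "kdiv (ks l) M (fs l) (ws l)"
          by (auto simp: I2_def fs_def ws_def ks_def)
      qed
      obtain m0 where m0: "m0 \<in> M" using mod_ne[OF M(1)] by blast
      \<comment> \<open>All parameters are collected in one tuple, since they must move together
        along the Morley sequence.\<close>
      define e where "e = b \<oplus> (\<lambda>(l, v). if l < r then ws l v else m0)"
      have tb: "tup b" unfolding tup_range using b(1) WU by (rule order_trans)
      have "ws l v \<in> U" if "l < r" for l v using zl(2)[OF that] WU by blast
      then have "tup (\<lambda>(l, v). if l < r then ws l v else m0)" using m0 MU by (auto simp: tup_def)
      then have te: "tup e" using tb by (simp add: e_def)
      have cover: "\<exists>l \<in> {..<r}. fs l (a \<oplus> (\<lambda>v. e (Inr (l, v))))" if a: "tup a" "\<phi> (a \<oplus> (\<lambda>v. e (Inl v)))" for a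
      proof -
        have "\<phi> (a \<oplus> b)" using a(2) by (simp add: e_def)
        then have "\<forall>P \<in> F. P a" using b(4) a(1) by blast
        then have *: "f q a" if "q \<in> K" "q \<in> range Inl" for q using that by (auto simp: f_def F_def)
        obtain q where q: "q \<in> K" "\<not> f q a" using no a(1) by blast
        then obtain p where p: "q = Inr p" using * by (cases q rule: sum.exhaust) auto
        then have "p \<in> Z" using q by (simp add: Z_def)
        then obtain l where l: "l < r" "p = zs ! l" using zs by (auto simp: r_def in_set_conv_nth)
        have "fs l (a \<oplus> ws l)" using q(2) l by (simp add: f_def p fs_def ws_def case_prod_unfold)
        then show ?thesis using l(1) by (intro bexI[of _ l]) (simp_all add: e_def)
      qed
      obtain V where V: "coheir M V e" using coheir_ex[OF M(1) te] by blast
      obtain es where es: "cohs V M es" using cohs_ex[OF V MU M(2)] by blast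
      have tes: "tup (es j)" for j using cohs_tup[OF es] .
      have ind_es: "indisc M es" by (rule cohs_indisc[OF V M(1) es])
      have "eqt M e (es 0)"
        using coh_self[OF V te] es[unfolded cohs_def, rule_format, of 0] by (intro coh_eqt) simp_all
      then have eqe: "eqt M e (es j)" for j using indisc_eqt[OF ind_es MU] eqt_trans by blast
      define bs where "bs j v = es j (Inl v)" for j v
      have "indisc M bs" unfolding indisc_def
      proof (intro allI impI)
        fix h :: "nat \<Rightarrow> nat" assume "strict_mono h"
        then have "eqt M (sq es) (sq (\<lambda>i. es (h i)))" using ind_es by (simp add: indisc_def)
        from eqt_comp[OF this MU, of "\<lambda>q. (fst q, Inl (snd q))"]
        show "eqt M (sq bs) (sq (\<lambda>i. bs (h i)))" by (simp add: sq_def bs_def case_prod_unfold)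
      qed
      moreover have "eqt M b (bs 0)"
        using eqt_comp[OF eqe[of 0] MU, of Inl] by (simp add: e_def bs_def[abs_def])
      moreover have "tup (bs j)" for j using tes[of j] by (simp add: bs_def[abs_def])
      ultimately obtain c where c: "tup c" "\<forall>j. \<phi> (c \<oplus> bs j)"
        using nd_seq[OF M(2) b(2)] b(3) by blast
      \<comment> \<open>That \<open>\<phi>\<close> implies the disjunction is a property of
        \<open>e\<close> definable over \<open>M\<close>, hence passes to all
        \<open>es j\<close>.\<close>
      define R where "R s \<longleftrightarrow> \<not> (\<exists>a. tup a \<and> (\<phi> (a \<oplus> (\<lambda>v. s (Inl v))) \<and>
        \<not> (\<exists>l \<in> {..<r}. fs l (a \<oplus> (\<lambda>v. s (Inr (l, v)))))))" for s
      have "Dfn M (\<lambda>z. \<phi> ((\<lambda>x. z (Inl x)) \<oplus> (\<lambda>v. z (Inr (Inl v)))) \<and>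
        \<not> (\<exists>l \<in> {..<r}. fs l ((\<lambda>x. z (Inl x)) \<oplus> (\<lambda>v. z (Inr (Inr (l, v)))))))"
        by (intro Dfn_conj[OF _ Dfn_not[OF Dfn_bex]])
          (auto intro!: Dfn_rn'[OF b(2) MU] Dfn_rn'[OF zl(1) MU] rn_jn[OF rn_ren rn_ren])
      from Dfn_not[OF Dfn_exI[OF this]] have "Dfn M R" unfolding R_def .
      moreover have "R e" unfolding R_def using cover by blast
      ultimately have "R (es j)" for j using eqtD[OF eqe] by blast
      then have "\<exists>l \<in> {..<r}. fs l (c \<oplus> (\<lambda>v. es j (Inr (l, v))))" for j
        using c unfolding R_def bs_def by blast
      then obtain l where l: "l < r" "infinite {j. fs l (c \<oplus> (\<lambda>v. es j (Inr (l, v))))}"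
        using pigeonhole_infinite_rel[of "UNIV :: nat set" "{..<r}" "\<lambda>j l. fs l (c \<oplus> (\<lambda>v. es j (Inr (l, v))))"]
        by auto
      define h where "h = enumerate {j. fs l (c \<oplus> (\<lambda>v. es j (Inr (l, v))))}"
      have h: "strict_mono h" using l(2) by (simp add: h_def strict_mono_enumerate)
      have h2: "fs l (c \<oplus> (\<lambda>v. es (h i) (Inr (l, v))))" for i
        using enumerate_in_set[OF l(2), of i] by (simp add: h_def)
      define \<psi> :: "('x + 'y + nat \<times> nat \<Rightarrow> 'u) \<Rightarrow> bool" where "\<psi> z \<longleftrightarrow> fs l ((\<lambda>x. z (Inl x)) \<oplus> (\<lambda>v. z (Inr (Inr (l, v)))))" for z
      have \<psi>: "Dfn M \<psi>" unfolding \<psi>_def by (intro Dfn_rn'[OF zl(1)[OF l(1)] MU] rn_jn[OF rn_ren rn_ren])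
      have "(\<lambda>v. e (Inr (l, v))) = ws l" using l(1) by (simp add: e_def)
      then have "kdiv (ks l) M \<psi> e"
        using kdiv_lift[OF M(2) _ te, of "\<lambda>s v. s (Inr (l, v))" "ks l" "fs l", OF rn_ren] zl(3)[OF l(1)]
        by (simp add: \<psi>_def[abs_def])
      then have kd: "kdiv (ks l) M \<psi> (es (h i))" for i using kdiv_eqt eqe by blast
      show False
      proof (rule no_inf_chain[OF M(2) \<psi> c(1), of "\<lambda>i. es (h i)"])
        show "tup (es (h i))" for i by (rule tes)
        show "\<psi> (c \<oplus> es (h i))" for i using h2 by (simp add: \<psi>_def)
        fix i
        have "cohs V (M \<union> range (es (h i))) (\<lambda>n. es (h (i + 1 + n)))"
        proof (rule cohs_sub[OF es])
          show "strict_mono (\<lambda>n. h (i + 1 + n))" using h by (simp add: strict_mono_def)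
          have "h i < h (i + 1 + 0)" using h by (simp add: strict_mono_def)
          then show "M \<union> range (es (h i)) \<subseteq> M \<union> (\<Union>j \<in> {..<h (i + 1 + 0)}. range (es j))" by blast
        qed
        from kdiv_coh[OF V M \<psi> kd tes this]
        show "kdiv (ks l) (M \<union> (\<Union>j \<in> {i<..}. range (es (h j)))) \<psi> (es (h i))"
        proof (rule kdiv_mono, intro Un_mono order_refl UN_least)
          fix j assume "j \<in> {i<..}"
          then have "j = i + 1 + (j - i - 1)" by simp
          moreover have "range (es (h (i + 1 + n))) \<subseteq> (\<Union>n. range (es (h (i + 1 + n))))" for n by blast
          ultimately show "range (es (h j)) \<subseteq> (\<Union>n. range (es (h (i + 1 + n))))" by metis
        qed
      qed
    qed
  qed
  then obtain c where c: "tup c" "\<And>q. q \<in> G <+> I2 \<Longrightarrow> f q c" by blast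
  have "P c" if "P \<in> G" for P using c(2)[OF InlI[OF that]] by (simp add: f_def)
  moreover have "Ind M c W" unfolding Ind_def ind_def
  proof (intro allI impI notI)
    fix w :: "nat \<Rightarrow> 'u" and \<psi> k assume "range w \<subseteq> W" "Dfn M \<psi>" "\<psi> (c \<oplus> w)" "kdiv k M \<psi> w"
    then have "(\<psi>, w, k) \<in> I2" by (simp add: I2_def)
    from c(2)[OF InrI[OF this]] \<open>\<psi> (c \<oplus> w)\<close> show False by (simp add: f_def)
  qed
  ultimately show ?thesis using c(1) by blast
qed

lemma ext_Ind:
  fixes c :: "'x::countable \<Rightarrow> 'u"
  assumes M: "is_mod M" "base M" and W: "base W" "M \<subseteq> W0" "W0 \<subseteq> W" and c: "Ind M c W0"
  shows "\<exists>c'. tup c' \<and> eqt W0 c c' \<and> Ind M c' W"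
proof -
  have W0: "W0 \<noteq> {}" "W0 \<subseteq> U" using W mod_ne[OF M(1)] base_D[OF W(1)] by auto
  have "\<exists>c'. tup c' \<and> (\<forall>P \<in> {P. Dfn W0 P \<and> P c}. P c') \<and> Ind M c' W"
  proof (rule ext_nd[OF M W(1)])
    fix F assume F: "F \<subseteq> {P. Dfn W0 P \<and> P c}" "finite F"
    have "Dfn W0 (\<lambda>s. \<forall>P \<in> F. P s)" using F by (intro Dfn_ball) auto
    from Dfn_abs_nat[OF this W0] obtain d :: "nat \<Rightarrow> 'u" and Q where
      d: "range d \<subseteq> W0" "Dfn {} Q" "\<forall>z. (\<forall>P \<in> F. P z) \<longleftrightarrow> Q (z \<oplus> d)" by (elim exE conjE)
    have Q: "Dfn M Q" using d(2) by (rule Dfn_mono) simp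
    have "Q (c \<oplus> d)" using d(3) F(1) by blast
    then have "\<not> kdiv k M Q d" for k using c d(1) Q unfolding Ind_def ind_def by blast
    then show "\<exists>\<phi> (b :: nat \<Rightarrow> 'u). range b \<subseteq> W \<and> Dfn M \<phi> \<and> (\<forall>k. \<not> kdiv k M \<phi> b) \<and>
      (\<forall>a. tup a \<longrightarrow> \<phi> (a \<oplus> b) \<longrightarrow> (\<forall>P \<in> F. P a))"
      using d(1,3) W(3) Q by (intro exI[of _ Q] exI[of _ d]) auto
  qed (use W Dfn_mono in auto)
  then show ?thesis unfolding eqt_def by blast
qed

lemma ind_Ind:
  fixes b :: "'y::countable \<Rightarrow> 'u"
  assumes "base D" "ind D c b" "tup b" shows "Ind D c (D \<union> range b)"
  unfolding Ind_def using ind_sub_right[OF assms] by blast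

text \<open>Later entries are added to the base one at a time by \<open>kdiv_base\<close>; a formula
  over all later entries uses only finitely many of them.\<close>

lemma kdiv_later:
  fixes z :: "nat \<Rightarrow> 'z::countable \<Rightarrow> 'u" and f :: "'y::countable \<Rightarrow> 'u"
  assumes D: "base D" "D \<noteq> {}" "D \<subseteq> B" "base B" and z: "\<And>l. tup (z l)"
    "\<And>l. Ind D (z l) (B \<union> (\<Union>j \<in> {..<l}. range (z j)))"
    and f: "range f \<subseteq> B \<union> (\<Union>j \<in> {..m}. range (z j))" and \<phi>: "Dfn D \<phi>" and k: "kdiv k D \<phi> f"
  shows "kdiv k (D \<union> (\<Union>j \<in> {m<..}. range (z j))) \<phi> f"
proof -
  have bz: "base (\<Union>j \<in> J. range (z j))" for J using z(1) by (rule base_ranges)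
  have tf: "tup f" unfolding tup_range using f base_D[OF base_Un[OF D(4) bz]] by (rule order_trans)
  have fin: "kdiv k (D \<union> (\<Union>j \<in> {m<..<n}. range (z j))) \<phi> f" for n
  proof (induction n)
    case 0
    show ?case using k by simp
  next
    case (Suc n)
    show ?case
    proof (cases "m < n")
      case False
      then have "{m<..<Suc n} = {}" by auto
      then show ?thesis using k by simp
    next
      case True
      let ?Dn = "D \<union> (\<Union>j \<in> {m<..<n}. range (z j))" and ?W = "B \<union> (\<Union>j \<in> {..<n}. range (z j))"
      have W: "?W \<subseteq> U" using base_D[OF base_Un[OF D(4) bz]] .
      have bD: "base ?Dn" using base_Un[OF D(1) bz] .
      have "Ind ?Dn (z n) ?W" by (rule Ind_base_mono[OF z(2)]) (use D bD W in auto)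
      moreover have "range f \<subseteq> ?W" using f True by fastforce
      ultimately have "ind ?Dn (z n) f" by (rule IndD[OF bD _ _ W])
      from kdiv_base[OF bD this z(1) tf Dfn_mono[OF \<phi>] Suc.IH]
      have "kdiv k (?Dn \<union> range (z n)) \<phi> f" by blast
      moreover have "{m<..<Suc n} = insert n {m<..<n}" using True by auto
      ultimately show ?thesis by (elim kdiv_mono) auto
    qed
  qed
  show ?thesis
  proof (rule kdiv_approx[OF base_Un[OF D(1) bz] Dfn_mono[OF \<phi>] tf])
    fix Q N assume Q: "Dfn (D \<union> (\<Union>j \<in> {m<..}. range (z j))) Q" "Q f"
    obtain D0 where D0: "D0 \<subseteq> D \<union> (\<Union>j \<in> {m<..}. range (z j))" "finite D0" "Dfn D0 Q"
      using Dfn_params[OF Q(1)] by blast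
    have "\<exists>n. D0 \<subseteq> D \<union> (\<Union>j \<in> {m<..<n}. range (z j))"
      using D0(2,1)
    proof (induction rule: finite_induct)
      case (insert x D0)
      then obtain n where n: "D0 \<subseteq> D \<union> (\<Union>j \<in> {m<..<n}. range (z j))" by auto
      show ?case
      proof (cases "x \<in> D")
        case False
        then obtain j where j: "m < j" "x \<in> range (z j)" using insert.prems by auto
        have "D0 \<subseteq> D \<union> (\<Union>j \<in> {m<..<max n (Suc j)}. range (z j))" using n by fastforce
        moreover have "x \<in> (\<Union>j \<in> {m<..<max n (Suc j)}. range (z j))" using j by force
        ultimately show ?thesis by blast
      qed (use n in blast)
    qed simp
    then obtain n where n: "D0 \<subseteq> D \<union> (\<Union>j \<in> {m<..<n}. range (z j))" by blast
    from fin[of n] obtain bs where bs: "\<And>j. tup (bs j)"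
      "\<And>j. eqt (D \<union> (\<Union>j \<in> {m<..<n}. range (z j))) f (bs j)" "kcon k \<phi> bs UNIV" by (rule kdivE) blast
    have "Q (bs j)" for j using eqtD[OF bs(2) Dfn_mono[OF D0(3) n]] Q(2) by blast
    then show "\<exists>bs. (\<forall>j. tup (bs j)) \<and> (\<forall>j<N. Q (bs j)) \<and> kcon k \<phi> bs {..<N}"
      using bs(1,3) by (intro exI[of _ bs]) (auto simp: kcon_def)
  qed blast
qed

text \<open>If \<open>\<phi>(b, a)\<close> held and \<open>\<phi>(x, a)\<close> divided over
  \<open>M\<close>, take an independent sequence \<open>e\<close> of realizations of the type of
  \<open>a\<close> over \<open>M\<close> and \<open>b\<close>. Then \<open>b\<close> satisfies all
  \<open>\<phi>(x, e i)\<close>, each of which divides over the later entries, against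
  simplicity.\<close>

lemma ind_sym:
  fixes a :: "'x::countable \<Rightarrow> 'u" and b :: "'y::countable \<Rightarrow> 'u"
  assumes M: "is_mod M" "base M" and t: "tup a" "tup b" and i: "ind M a b"
  shows "ind M b a"
  unfolding ind_def
proof (intro allI impI notI)
  fix \<phi> k assume \<phi>: "Dfn M \<phi>" "\<phi> (b \<oplus> a)" "kdiv k M \<phi> a"
  have MU: "M \<subseteq> U" using M(1) by (rule mod_U)
  have bb: "base (M \<union> range b)" using M(2) t(2) by (rule base_Un_range)
  have "\<exists>g. tup g \<and> (eqt (M \<union> range b) a g \<and> Ind M g W)" if "base W" "M \<union> range b \<subseteq> W" for W
    using ext_Ind[OF M that(1) _ that(2) ind_Ind[OF M(2) i t(2)]] by blast
  then have "\<exists>e :: nat \<Rightarrow> 'x \<Rightarrow> 'u. \<forall>i. tup (e i) \<and> (eqt (M \<union> range b) a (e i) \<and>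
      Ind M (e i) (M \<union> range b \<union> (\<Union>j \<in> {..<i}. range (e j))))"
    by (rule sequence_ex[where R="\<lambda>W g. eqt (M \<union> range b) a g \<and> Ind M g W", OF bb])
  then obtain e :: "nat \<Rightarrow> 'x \<Rightarrow> 'u" where
    "\<forall>i. tup (e i) \<and> (eqt (M \<union> range b) a (e i) \<and> Ind M (e i) (M \<union> range b \<union> (\<Union>j \<in> {..<i}. range (e j))))"
    by (elim exE)
  then have e: "\<And>i. tup (e i)" "\<And>i. eqt (M \<union> range b) a (e i)"
    "\<And>i. Ind M (e i) (M \<union> range b \<union> (\<Union>j \<in> {..<i}. range (e j)))" by blast+
  have D: "Dfn (M \<union> range b) (\<lambda>s. \<phi> (b \<oplus> s))"
    using base_D[OF bb] by (intro Dfn_rn[OF \<phi>(1)] rn_jn rn_const rn_id) auto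
  show False
  proof (rule no_inf_chain[OF M(2) \<phi>(1) t(2) e(1)])
    show "\<phi> (b \<oplus> e i)" for i using eqtD[OF e(2) D] \<phi>(2) by blast
    show "kdiv k (M \<union> (\<Union>j \<in> {i<..}. range (e j))) \<phi> (e i)" for i
    proof (rule kdiv_later[where B="M \<union> range b"])
      show "kdiv k M \<phi> (e i)" using kdiv_eqt[OF \<phi>(3) eqt_mono[OF e(2)]] by blast
      show "Ind M (e l) (M \<union> range b \<union> (\<Union>j \<in> {..<l}. range (e j)))" for l by (rule e(3))
      show "tup (e l)" for l by (rule e(1))
    qed (use M mod_ne bb \<phi> in auto)
  qed
qed

text \<open>Symmetry exchanges the roles: tuples from \<open>D\<close> are independent from
  \<open>c\<close> over \<open>M0\<close>, so by \<open>kdiv_set\<close> a formula that divides at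
  \<open>c\<close> over \<open>M0\<close> still divides over \<open>D\<close>, where
  \<open>w\<close> is independent from \<open>c\<close>.\<close>

lemma Ind_trans:
  fixes c :: "'x::countable \<Rightarrow> 'u"
  assumes M0: "is_mod M0" "is_mod D" and W: "M0 \<subseteq> D" "D \<subseteq> W" "base W" and c: "tup c"
    and i: "Ind M0 c D" "Ind D c W"
  shows "Ind M0 c W"
  unfolding Ind_def
proof (intro allI impI)
  fix w :: "nat \<Rightarrow> 'u" assume w: "range w \<subseteq> W"
  have b: "base D" "base M0" using W base_subset by (blast, blast)
  have tw: "tup w" using w base_D[OF W(3)] by (auto simp: tup_range)
  have "ind D c w" using i(2) w by (simp add: Ind_def)
  then have "ind D w c" by (rule ind_sym[OF M0(2) b(1) c tw])
  have "ind M0 w c" unfolding ind_def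
  proof (intro allI impI notI)
    fix \<phi> k assume \<phi>: "Dfn M0 \<phi>" "\<phi> (w \<oplus> c)" "kdiv k M0 \<phi> c"
    have "kdiv k D \<phi> c"
    proof (rule kdiv_set[OF b(1) mod_ne[OF M0(2)] W(1) c \<phi>(1) _ \<phi>(3)])
      fix d :: "nat \<Rightarrow> 'u" assume d: "range d \<subseteq> D"
      then have "tup d" using mod_U[OF M0(2)] by (auto simp: tup_range)
      moreover have "ind M0 c d" using i(1) d by (simp add: Ind_def)
      ultimately show "ind M0 d c" by (rule ind_sym[OF M0(1) b(2) c])
    qed
    then show False using indD[OF \<open>ind D w c\<close> Dfn_mono[OF \<phi>(1) W(1)] \<phi>(2)] by blast
  qed
  then show "ind M0 c w" by (rule ind_sym[OF M0(1) b(2) tw c])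
qed

end

context simple_monster
begin

section \<open>The independence theorem over models\<close>

text \<open>For \<open>ext_nd\<close>, finite parts of the required type must not divide. A
  conjunction \<open>\<Phi>\<close> of \<open>\<theta>\<close> over \<open>N\<close> entries of the
  sequence is satisfied by \<open>c1\<close> on all consecutive blocks of length \<open>N\<close>;
  if it divided, the blocks would form a forbidden infinite chain.\<close>

lemma cohs_realize:
  fixes c :: "'x::countable \<Rightarrow> 'u" and b :: "'y::countable \<Rightarrow> 'u"
  assumes D: "is_mod D" "base D" and V: "coheir D V b0" and e: "cohs V D e" and t: "tup b"
    and i: "ind D c b" "eqt D b (e 0)" and W: "base W" "D \<subseteq> W"
  shows "\<exists>c'. tup c' \<and> (\<forall>i. eqt D (c \<oplus> b) (c' \<oplus> e i)) \<and> Ind D c' W"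
proof -
  have DU: "D \<subseteq> U" using D(1) by (rule mod_U)
  have te: "tup (e i)" for i using cohs_tup[OF e] .
  have ie: "indisc D e" by (rule cohs_indisc[OF V D(1) e])
  obtain c1 where c1: "tup c1" "\<forall>i. eqt D (c \<oplus> b) (c1 \<oplus> e i)"
    using ind_seq[OF D(2) i(1) te ie i(2)] by blast
  define W' where "W' = W \<union> (\<Union>j \<in> UNIV. range (e j))"
  have W': "base W'" unfolding W'_def using W(1) te by (intro base_Un base_ranges)
  define T where "T = {\<phi>. Dfn D \<phi> \<and> \<phi> (c \<oplus> b)}"
  define at where "at = (\<lambda>(\<phi> :: ('x + 'y \<Rightarrow> 'u) \<Rightarrow> bool, i) x. \<phi> (x \<oplus> e i))"
  have "\<exists>c'. tup c' \<and> (\<forall>P \<in> at ` (T \<times> UNIV). P c') \<and> Ind D c' W'"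
  proof (rule ext_nd[OF D W'])
    show "D \<subseteq> W'" using W(2) by (auto simp: W'_def)
    fix P assume "P \<in> at ` (T \<times> UNIV)"
    then obtain \<phi> i where P: "Dfn D \<phi>" "P = (\<lambda>x. \<phi> (x \<oplus> e i))" by (auto simp: at_def T_def)
    have "range (e i) \<subseteq> W'" by (auto simp: W'_def)
    then show "Dfn W' P" unfolding P(2)
      using base_D[OF W'] W(2) by (intro Dfn_rn[OF P(1)] rn_jn[OF rn_id rn_const]) (auto simp: W'_def)
  next
    fix F assume "F \<subseteq> at ` (T \<times> UNIV)" "finite F"
    then obtain J where J: "J \<subseteq> T \<times> UNIV" "finite J" "F = at ` J" by (meson finite_subset_image)
    have "finite (snd ` J)" using J(2) by simp
    then obtain N0 where N0: "\<And>i. i \<in> snd ` J \<Longrightarrow> i < N0" by (metis finite_nat_set_iff_bounded)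
    define N where "N = Suc N0"
    have N: "\<And>i. i \<in> snd ` J \<Longrightarrow> i < N" "N > 0" using N0 by (force simp: N_def)+
    define \<theta> where "\<theta> z \<longleftrightarrow> (\<forall>\<phi> \<in> fst ` J. \<phi> z)" for z
    have \<theta>: "Dfn D \<theta>" unfolding \<theta>_def using J by (intro Dfn_ball) (auto simp: T_def)
    have "\<theta> (c \<oplus> b)" using J by (auto simp: \<theta>_def T_def)
    then have \<theta>1: "\<theta> (c1 \<oplus> e i)" for i using eqtD[OF c1(2)[rule_format] \<theta>] by blast
    define \<Phi> where "\<Phi> z \<longleftrightarrow> (\<forall>i \<in> {..<N}. \<theta> ((\<lambda>x. z (Inl x :: 'x + nat \<times> 'y)) \<oplus> (\<lambda>v. z (Inr (i, v)))))" for z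
    have \<Phi>: "Dfn D \<Phi>" unfolding \<Phi>_def
      by (rule Dfn_ball[OF finite_lessThan]) (rule Dfn_rn'[OF \<theta> DU], rule rn_jn[OF rn_ren rn_ren])
    \<comment> \<open>The entries \<open>l * N\<close> to \<open>l * N + N - 1\<close>, repeated
      periodically to fill a tuple indexed by all natural numbers.\<close>
    define blk where "blk l = sq (\<lambda>i. e (l * N + i mod N))" for l
    have tblk: "tup (blk l)" for l using te by (simp add: blk_def)
    have nd: "\<not> kdiv k D \<Phi> (blk 0)" for k
    proof
      assume k: "kdiv k D \<Phi> (blk 0)"
      have kl: "kdiv k D \<Phi> (blk l)" for l
      proof (rule kdiv_eqt[OF k])
        have "eqt D (sq e) (sq (\<lambda>i. e (l * N + i)))"
          using ie by (simp add: indisc_def strict_mono_def)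
        from eqt_comp[OF this DU, of "\<lambda>q. (fst q mod N, snd q)"]
        show "eqt D (blk 0) (blk l)" by (simp add: blk_def sq_def case_prod_unfold)
      qed
      show False
      proof (rule no_inf_chain[OF D(2) \<Phi> c1(1) tblk])
        show "\<Phi> (c1 \<oplus> blk l)" for l using \<theta>1 by (simp add: \<Phi>_def blk_def)
        fix l
        have "cohs V (D \<union> range (blk l)) (\<lambda>n. e (Suc l * N + n))"
        proof (rule cohs_sub[OF e])
          have "l * N + i mod N < Suc l * N + 0" for i using N(2) by simp
          then show "D \<union> range (blk l) \<subseteq> D \<union> (\<Union>j \<in> {..<Suc l * N + 0}. range (e j))"
            unfolding blk_def range_sq by blast
        qed (simp add: strict_mono_def)
        from kdiv_coh[OF V D \<Phi> kl tblk this]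
        show "kdiv k (D \<union> (\<Union>j \<in> {l<..}. range (blk j))) \<Phi> (blk l)"
        proof (rule kdiv_mono, intro Un_mono order_refl UN_least)
          fix j assume "j \<in> {l<..}"
          define d where "d = j - Suc l"
          have d: "j = Suc l + d" using \<open>j \<in> {l<..}\<close> by (simp add: d_def)
          have "range (e (j * N + i mod N)) \<subseteq> (\<Union>n. range (e (Suc l * N + n)))" for i
          proof -
            have "j * N + i mod N = Suc l * N + (d * N + i mod N)"
              unfolding d by (simp only: add_mult_distrib add.assoc)
            then have "e (j * N + i mod N) = e (Suc l * N + (d * N + i mod N))" by (rule arg_cong)
            then show ?thesis by (simp only:) blast
          qed
          then show "range (blk j) \<subseteq> (\<Union>n. range (e (Suc l * N + n)))"
            unfolding blk_def range_sq by blast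
        qed
      qed
    qed
    have PaI: "P a" if a: "\<Phi> (a \<oplus> blk 0)" "P \<in> F" for a P
    proof -
      obtain \<phi> i where P: "(\<phi>, i) \<in> J" "P = (\<lambda>x. \<phi> (x \<oplus> e i))" using a(2) J(3) by (auto simp: at_def)
      have "i < N" using N(1) P(1) by force
      then have "\<theta> (a \<oplus> e i)" using a(1) by (simp add: \<Phi>_def blk_def)
      then show ?thesis using P by (force simp: \<theta>_def)
    qed
    have cov: "\<forall>a. tup a \<longrightarrow> \<Phi> (a \<oplus> blk 0) \<longrightarrow> (\<forall>P \<in> F. P a)"
      by (intro allI impI ballI) (rule PaI)
    have rb: "range (blk 0) \<subseteq> W'" unfolding blk_def range_sq W'_def by blast
    show "\<exists>\<phi> (b :: nat \<times> 'y \<Rightarrow> 'u). range b \<subseteq> W' \<and> Dfn D \<phi> \<and>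
      (\<forall>k. \<not> kdiv k D \<phi> b) \<and> (\<forall>a. tup a \<longrightarrow> \<phi> (a \<oplus> b) \<longrightarrow> (\<forall>P \<in> F. P a))"
      by (intro exI[of _ \<Phi>] exI[of _ "blk 0"] conjI rb \<Phi> cov allI nd)
  qed
  then obtain c' where c': "tup c'" "\<forall>P \<in> at ` (T \<times> UNIV). P c'" "Ind D c' W'" by (elim exE conjE)
  have "eqt D (c \<oplus> b) (c' \<oplus> e i)" for i unfolding eqt_def
  proof (intro allI impI)
    fix P assume "Dfn D P" "P (c \<oplus> b)"
    then have "at (P, i) \<in> at ` (T \<times> UNIV)" by (simp add: T_def)
    then have "at (P, i) c'" using c'(2) by blast
    then show "P (c' \<oplus> e i)" by (simp add: at_def)
  qed
  moreover have "Ind D c' W" using c'(3) by (rule Ind_mono) (auto simp: W'_def)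
  ultimately show ?thesis using c'(1) by blast
qed

lemma kdiv_EM:
  fixes g :: "nat \<Rightarrow> 'z::countable \<Rightarrow> 'u" and \<rho> :: "'p::countable \<Rightarrow> nat \<times> 'z"
  assumes D: "base D" and g: "\<And>j. tup (g j)" and g': "\<And>j. tup (g' j)" and \<chi>: "Dfn D \<chi>"
    and EM: "\<And>P. Dfn D P \<Longrightarrow> (\<And>h. strict_mono h \<Longrightarrow> P (sq (\<lambda>i. g (h i)))) \<Longrightarrow> P (sq g')"
    and k: "\<And>h. strict_mono h \<Longrightarrow>
      kdiv k (D \<union> (\<Union>l \<in> {m<..}. range (g (h l)))) \<chi> (\<lambda>v. sq (\<lambda>i. g (h i)) (\<rho> v))"
  shows "kdiv k (D \<union> (\<Union>l \<in> {m<..}. range (g' l))) \<chi> (\<lambda>v. sq g' (\<rho> v))"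
proof -
  have DU: "D \<subseteq> U" using D by (rule base_D)
  define tail :: "(nat \<times> 'z \<Rightarrow> 'u) \<Rightarrow> nat \<times> 'z \<Rightarrow> 'u" where
    "tail s q = s (Suc m + fst q, snd q)" for s q
  have rtail: "range (tail (sq f)) = (\<Union>l \<in> {m<..}. range (f l))" for f
  proof -
    have "l \<in> range (\<lambda>n. Suc m + n)" if "m < l" for l
      using that by (intro image_eqI[of _ _ "l - Suc m"]) auto
    then have "{m<..} = range (\<lambda>n. Suc m + n)" by auto
    then have "(\<Union>l \<in> {m<..}. range (f l)) = (\<Union>n. range (f (Suc m + n)))" by simp
    moreover have "tail (sq f) = sq (\<lambda>n. f (Suc m + n))" by (auto simp: tail_def sq_def fun_eq_iff)
    ultimately show ?thesis by (simp add: range_sq)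
  qed
  have bl: "base (D \<union> (\<Union>l \<in> {m<..}. range (g' l)))" using D g' by (intro base_Un base_ranges)
  show ?thesis
  proof (rule kdiv_approx[OF bl Dfn_mono[OF \<chi> Un_upper1]])
    show "tup (\<lambda>v. sq g' (\<rho> v))" using g' by simp
    fix Q and N :: nat assume Q: "Dfn (D \<union> (\<Union>l \<in> {m<..}. range (g' l))) Q" "Q (\<lambda>v. sq g' (\<rho> v))"
    have "tup (tail (sq g'))" using g' by (simp add: tail_def tup_def)
    from Dfn_abs[OF Q(1) _ DU this] obtain Q' where Q': "Dfn D Q'" "\<forall>b. Q b \<longleftrightarrow> Q' (b \<oplus> tail (sq g'))"
      by (auto simp: rtail)
    define R where "R s \<longleftrightarrow> (Q' ((\<lambda>v. s (\<rho> v)) \<oplus> tail s) \<longrightarrow> (\<exists>t. tup t \<and>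
      ((\<forall>j \<in> {..<N}. Q' ((\<lambda>v. t (j, v)) \<oplus> tail s)) \<and>
       (\<forall>J \<in> {J. J \<subseteq> {..<N} \<and> card J = k}. \<not> (\<exists>a. tup a \<and> (\<forall>j \<in> J. \<chi> (a \<oplus> (\<lambda>v. t (j, v)))))))))" for s
    have "Dfn D (\<lambda>z. (\<forall>j \<in> {..<N}. Q' ((\<lambda>v. z (Inl (j, v))) \<oplus> tail (\<lambda>y. z (Inr y)))) \<and>
       (\<forall>J \<in> {J. J \<subseteq> {..<N} \<and> card J = k}. \<not> (\<exists>a. tup a \<and> (\<forall>j \<in> J. \<chi> (a \<oplus> (\<lambda>v. z (Inl (j, v))))))))"
    proof (rule Dfn_conj)
      show "Dfn D (\<lambda>z. \<forall>j \<in> {..<N}. Q' ((\<lambda>v. z (Inl (j, v))) \<oplus> tail (\<lambda>y. z (Inr y))))"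
        unfolding tail_def[abs_def]
        by (rule Dfn_ball[OF finite_lessThan]) (rule Dfn_rn'[OF Q'(1) DU], rule rn_jn[OF rn_ren rn_ren])
      show "Dfn D (\<lambda>z. \<forall>J \<in> {J. J \<subseteq> {..<N} \<and> card J = k}.
        \<not> (\<exists>a. tup a \<and> (\<forall>j \<in> J. \<chi> (a \<oplus> (\<lambda>v. z (Inl (j, v)))))))"
      proof (rule Dfn_ball)
        show "finite {J. J \<subseteq> {..<N} \<and> card J = k}" by simp
        fix J assume "J \<in> {J. J \<subseteq> {..<N} \<and> card J = k}"
        then have "finite J" using finite_subset by auto
        from Dfn_comp[OF Dfn_not[OF Dfn_real[OF \<chi> DU this]] DU, of Inl]
        show "Dfn D (\<lambda>z. \<not> (\<exists>a. tup a \<and> (\<forall>j \<in> J. \<chi> (a \<oplus> (\<lambda>v. z (Inl (j, v)))))))" .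
      qed
    qed
    from Dfn_exI[OF this]
    have "Dfn D (\<lambda>s. \<exists>t. tup t \<and> ((\<forall>j \<in> {..<N}. Q' ((\<lambda>v. t (j, v)) \<oplus> tail s)) \<and>
       (\<forall>J \<in> {J. J \<subseteq> {..<N} \<and> card J = k}. \<not> (\<exists>a. tup a \<and> (\<forall>j \<in> J. \<chi> (a \<oplus> (\<lambda>v. t (j, v))))))))" .
    moreover have "Dfn D (\<lambda>s. Q' ((\<lambda>v. s (\<rho> v)) \<oplus> tail s))" unfolding tail_def[abs_def]
      by (rule Dfn_rn'[OF Q'(1) DU], rule rn_jn[OF rn_ren rn_ren])
    ultimately have "Dfn D R" unfolding R_def by (intro Dfn_imp)
    moreover have "R (sq (\<lambda>i. g (h i)))" if h: "strict_mono h" for h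
      unfolding R_def
    proof
      let ?s = "sq (\<lambda>i. g (h i))"
      assume q: "Q' ((\<lambda>v. ?s (\<rho> v)) \<oplus> tail ?s)"
      from k[OF h] obtain bs where bs: "\<And>j. tup (bs j)"
        "\<And>j. eqt (D \<union> (\<Union>l \<in> {m<..}. range (g (h l)))) (\<lambda>v. ?s (\<rho> v)) (bs j)" "kcon k \<chi> bs UNIV"
        by (rule kdivE) blast
      have q2: "Q' (bs j \<oplus> tail ?s)" for j
      proof -
        have "eqt D ((\<lambda>v. ?s (\<rho> v)) \<oplus> tail ?s) (bs j \<oplus> tail ?s)"
        proof (rule eqt_absorb[OF bs(2) Un_upper1])
          show "range (tail ?s) \<subseteq> D \<union> (\<Union>l \<in> {m<..}. range (g (h l)))" by (simp add: rtail)
          show "D \<union> (\<Union>l \<in> {m<..}. range (g (h l))) \<subseteq> U"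
            using base_D[OF base_Un[OF D base_ranges[of "\<lambda>l. g (h l)"]]] g by blast
        qed
        then show ?thesis using eqtD[OF _ Q'(1)] q by blast
      qed
      show "\<exists>t. tup t \<and> ((\<forall>j \<in> {..<N}. Q' ((\<lambda>v. t (j, v)) \<oplus> tail ?s)) \<and>
        (\<forall>J \<in> {J. J \<subseteq> {..<N} \<and> card J = k}. \<not> (\<exists>a. tup a \<and> (\<forall>j \<in> J. \<chi> (a \<oplus> (\<lambda>v. t (j, v)))))))"
      proof (intro exI[of _ "sq bs"] conjI ballI)
        fix J assume J: "J \<in> {J. J \<subseteq> {..<N} \<and> card J = k}"
        then have "finite J" using finite_subset by auto
        then show "\<not> (\<exists>a. tup a \<and> (\<forall>j \<in> J. \<chi> (a \<oplus> (\<lambda>v. sq bs (j, v)))))"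
          using bs(3)[unfolded kcon_def, rule_format, of J] J by simp
      qed (use bs(1) q2 in auto)
    qed
    ultimately have "R (sq g')" by (rule EM)
    then obtain t where t: "tup t" "\<forall>j \<in> {..<N}. Q' ((\<lambda>v. t (j, v)) \<oplus> tail (sq g'))"
      "\<forall>J \<in> {J. J \<subseteq> {..<N} \<and> card J = k}. \<not> (\<exists>a. tup a \<and> (\<forall>j \<in> J. \<chi> (a \<oplus> (\<lambda>v. t (j, v)))))"
      unfolding R_def using Q(2) Q'(2) by blast
    show "\<exists>bs. (\<forall>j. tup (bs j)) \<and> (\<forall>j<N. Q (bs j)) \<and> kcon k \<chi> bs {..<N}"
    proof (intro exI[of _ "\<lambda>j v. t (j, v)"] conjI allI impI)
      show "tup (\<lambda>v. t (j, v))" for j using t(1) by simp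
      show "Q (\<lambda>v. t (j, v))" if "j < N" for j using t(2) Q'(2) that by simp
      show "kcon k \<chi> (\<lambda>j v. t (j, v)) {..<N}" unfolding kcon_def using t(3) by blast
    qed
  qed
qed

text \<open>In an indiscernible copy \<open>(A', E')\<close> the good pairs
  \<open>A' (2 * n + p)\<close>, \<open>E' (2 * n + q)\<close> form an indiscernible sequence, so
  one \<open>c\<close> satisfies \<open>\<phi>1\<close> at \<open>A'\<close> on positions of the
  parity of \<open>p\<close> and \<open>\<phi>2\<close> at \<open>E'\<close> on those of the parity
  of \<open>q\<close>. Pairs with these parities but in the opposite order are bad, yet
  \<open>c\<close> satisfies \<open>\<chi>\<close> there, as \<open>\<chi>\<close> splits into two
  conjuncts. They give a forbidden chain.\<close>

lemma link_core:
  fixes A :: "nat \<Rightarrow> 'p::countable \<Rightarrow> 'u" and E :: "nat \<Rightarrow> 'y::countable \<Rightarrow> 'u"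
    and \<phi>1 :: "('x::countable + 'p \<Rightarrow> 'u) \<Rightarrow> bool" and \<phi>2 :: "('x + 'y \<Rightarrow> 'u) \<Rightarrow> bool"
  assumes D: "base D" "D \<noteq> {}" and t: "\<And>n. tup (A n)" "\<And>n. tup (E n)"
    and i: "\<And>n. Ind D (A n \<oplus> E n) (D \<union> (\<Union>j \<in> {..<n}. range (A j \<oplus> E j)))"
    and \<phi>: "Dfn D \<phi>1" "Dfn D \<phi>2"
    and \<chi>_def: "\<chi> = (\<lambda>z. \<phi>1 ((\<lambda>x. z (Inl x)) \<oplus> (\<lambda>v. z (Inr (Inl v)))) \<and>
      \<phi>2 ((\<lambda>x. z (Inl x)) \<oplus> (\<lambda>v. z (Inr (Inr v)))))"
    and pq: "p = 0 \<and> q = 1 \<or> p = 1 \<and> q = (0::nat)"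
    and G: "\<And>i j. p < q \<and> i < j \<or> q < p \<and> j < i \<Longrightarrow> eqt D pg (A i \<oplus> E j)"
    and B: "\<And>i j. p < q \<and> j < i \<or> q < p \<and> i < j \<Longrightarrow> eqt D pb (A i \<oplus> E j)"
    and nd: "\<And>k. \<not> kdiv k D \<chi> pg" and k: "kdiv k D \<chi> pb"
  shows False
proof -
  have DU: "D \<subseteq> U" by (rule base_D[OF D(1)])
  have \<chi>: "Dfn D \<chi>" unfolding \<chi>_def
    by (rule Dfn_conj) (rule Dfn_rn'[OF \<phi>(1) DU], rule rn_jn[OF rn_ren rn_ren],
      rule Dfn_rn'[OF \<phi>(2) DU], rule rn_jn[OF rn_ren rn_ren])
  define g where "g n = A n \<oplus> E n" for n
  have tg: "tup (g n)" for n using t by (simp add: g_def)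
  from extract_indisc[where b=g, OF D(1) tg] obtain g' where g': "\<forall>j. tup (g' j)" "indisc D g'"
    "\<forall>P. Dfn D P \<longrightarrow> (\<forall>h. strict_mono h \<longrightarrow> P (sq (\<lambda>i. g (h i)))) \<longrightarrow> P (sq g')"
    by (elim exE conjE)
  have EM: "P (sq (\<lambda>i. g' (s + i)))"
    if P: "Dfn D P" "\<And>h. strict_mono h \<Longrightarrow> P (sq (\<lambda>i. g (h i)))" for P and s :: nat
  proof -
    have "eqt D (sq g') (sq (\<lambda>i. g' (s + i)))" using g'(2) by (simp add: indisc_def strict_mono_def)
    moreover have "P (sq g')" using g'(3) P by blast
    ultimately show ?thesis using eqtD[OF _ P(1)] by blast
  qed
  have eqt_EM: "eqt D w (\<lambda>v. sq (\<lambda>i. g' (s + i)) (\<rho> v))"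
    if "\<And>h. strict_mono h \<Longrightarrow> eqt D w (\<lambda>v. sq (\<lambda>i. g (h i)) (\<rho> v))"
    for w :: "'p + 'y \<Rightarrow> 'u" and \<rho> and s
    unfolding eqt_def
  proof (intro allI impI)
    fix P assume P: "Dfn D P" "P w"
    show "P (\<lambda>v. sq (\<lambda>i. g' (s + i)) (\<rho> v))"
      by (rule EM[OF Dfn_comp[OF P(1) DU]]) (use that eqtD[OF _ P(1)] P(2) in blast)
  qed
  define \<rho> :: "nat \<Rightarrow> nat \<Rightarrow> 'p + 'y \<Rightarrow> nat \<times> ('p + 'y)" where
    "\<rho> i j = case_sum (\<lambda>v. (i, Inl v)) (\<lambda>v. (j, Inr v))" for i j
  have \<rho>: "(\<lambda>v. sq f (\<rho> i j v)) = (\<lambda>v. f i (Inl v)) \<oplus> (\<lambda>v. f j (Inr v))"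
    for f :: "nat \<Rightarrow> 'p + 'y \<Rightarrow> 'u" and i j
    by (auto simp: \<rho>_def fun_eq_iff split: sum.split)
  define A' where "A' n v = g' n (Inl v)" for n v
  define E' where "E' n v = g' n (Inr v)" for n v
  have tA: "tup (A' n)" "tup (E' n)" for n using g'(1) by (simp_all add: A'_def[abs_def] E'_def[abs_def])
  have \<rho>g: "(\<lambda>v. sq (\<lambda>i. g (h i)) (\<rho> i j v)) = A (h i) \<oplus> E (h j)" for h i j
    by (simp add: \<rho> g_def)
  have \<rho>g': "(\<lambda>v. sq (\<lambda>i. g' (s + i)) (\<rho> i j v)) = A' (s + i) \<oplus> E' (s + j)" for s i j
    by (simp add: \<rho> A'_def[abs_def] E'_def[abs_def])
  define f where "f n = A' (2 * n + p) \<oplus> E' (2 * n + q)" for n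
  have tf: "tup (f n)" for n using tA by (simp add: f_def)
  have "eqt D pg (\<lambda>v. sq (\<lambda>i. g' (0 + i)) (\<rho> p q v))"
  proof (rule eqt_EM)
    fix h :: "nat \<Rightarrow> nat" assume h: "strict_mono h"
    have "h 0 < h 1" using h by (simp add: strict_mono_def)
    then show "eqt D pg (\<lambda>v. sq (\<lambda>i. g (h i)) (\<rho> p q v))"
      unfolding \<rho>g using pq by (intro G) auto
  qed
  then have f0: "eqt D pg (f 0)" unfolding \<rho>g' by (simp add: f_def)
  have "indisc D f" unfolding indisc_def
  proof (intro allI impI)
    fix h :: "nat \<Rightarrow> nat" assume h: "strict_mono h"
    \<comment> \<open>Stretches \<open>h\<close> to pairs of neighbours: positions
      \<open>2 * n\<close> and \<open>2 * n + 1\<close> go to \<open>2 * h n\<close> and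
      \<open>2 * h n + 1\<close>.\<close>
    define h' where "h' i = 2 * h (i div 2) + i mod 2" for i
    have "strict_mono h'"
    proof (rule strict_monoI)
      fix i j :: nat assume ij: "i < j"
      show "h' i < h' j"
      proof (cases "i div 2 = j div 2")
        case True
        then have "i mod 2 < j mod 2"
          using ij div_mult_mod_eq[of i 2] div_mult_mod_eq[of j 2] by linarith
        then show ?thesis using True by (simp add: h'_def)
      next
        case False
        moreover have "i div 2 \<le> j div 2" using ij by (intro div_le_mono) simp
        ultimately have "i div 2 < j div 2" by simp
        then have "h (i div 2) < h (j div 2)" using h by (simp add: strict_mono_def)
        moreover have "i mod 2 < 2" by simp
        ultimately show ?thesis unfolding h'_def by linarith
      qed
    qed
    then have "eqt D (sq g') (sq (\<lambda>i. g' (h' i)))" using g'(2) by (simp add: indisc_def)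
    from eqt_comp[OF this DU, of "\<lambda>(n, z). case z of Inl v \<Rightarrow> (2 * n + p, Inl v) | Inr v \<Rightarrow> (2 * n + q, Inr v)"]
    have *: "eqt D (\<lambda>x. sq g' (case x of (n, z) \<Rightarrow> case z of Inl v \<Rightarrow> (2 * n + p, Inl v) | Inr v \<Rightarrow> (2 * n + q, Inr v)))
      (\<lambda>x. sq (\<lambda>i. g' (h' i)) (case x of (n, z) \<Rightarrow> case z of Inl v \<Rightarrow> (2 * n + p, Inl v) | Inr v \<Rightarrow> (2 * n + q, Inr v)))" .
    have hp: "h' (2 * n + p) = 2 * h n + p" "h' (2 * n + q) = 2 * h n + q" for n
      using pq by (auto simp: h'_def)
    have e1: "(\<lambda>x. sq g' (case x of (n, z) \<Rightarrow> case z of Inl v \<Rightarrow> (2 * n + p, Inl v) | Inr v \<Rightarrow> (2 * n + q, Inr v))) = sq f"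
      by (auto simp: fun_eq_iff f_def A'_def E'_def split: sum.split)
    have e2: "(\<lambda>x. sq (\<lambda>i. g' (h' i)) (case x of (n, z) \<Rightarrow> case z of Inl v \<Rightarrow> (2 * n + p, Inl v) | Inr v \<Rightarrow> (2 * n + q, Inr v))) = sq (\<lambda>n. f (h n))"
      by (auto simp: fun_eq_iff f_def A'_def E'_def hp split: sum.split)
    show "eqt D (sq f) (sq (\<lambda>i. f (h i)))" using * unfolding e1 e2 .
  qed
  from nd_seq[OF D(1) \<chi> tf this f0 nd] obtain c where c: "tup c" "\<forall>n. \<chi> (c \<oplus> f n)" by blast
  have c1: "\<phi>1 (c \<oplus> A' (2 * n + p))" and c2: "\<phi>2 (c \<oplus> E' (2 * n + q))" for n
    using c(2)[rule_format, of n] by (simp_all add: \<chi>_def f_def)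
  \<comment> \<open>Since \<open>p + q = 1\<close>, the offset \<open>1 + q\<close> has the parity
    of \<open>p\<close> and \<open>1 + p\<close> that of \<open>q\<close>. The offsets are 1 and 2
    in the bad order, and the factor 4 puts all later pairs beyond position
    \<open>4 * n + 2\<close>.\<close>
  define bd where "bd n = A' (4 * n + (1 + q)) \<oplus> E' (4 * n + (1 + p))" for n
  show False
  proof (rule no_inf_chain[OF D(1) \<chi> c(1), of bd])
    fix n
    show "tup (bd n)" using tA by (simp add: bd_def)
    have "\<exists>m. 4 * n + (1 + q) = 2 * m + p" "\<exists>m. 4 * n + (1 + p) = 2 * m + q" using pq by presburger+
    then have "\<phi>1 (c \<oplus> A' (4 * n + (1 + q)))" "\<phi>2 (c \<oplus> E' (4 * n + (1 + p)))" using c1 c2 by metis+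
    then show "\<chi> (c \<oplus> bd n)" by (simp add: \<chi>_def bd_def)
    have "kdiv k (D \<union> (\<Union>l \<in> {2<..}. range (g' (4 * n + l)))) \<chi>
      (\<lambda>v. sq (\<lambda>i. g' (4 * n + i)) (\<rho> (1 + q) (1 + p) v))"
    proof (rule kdiv_EM[where g=g, OF D(1) tg _ \<chi>])
      show "tup (g' (4 * n + j))" for j using g'(1) by simp
      show "P (sq (\<lambda>i. g' (4 * n + i)))"
        if "Dfn D P" "\<And>h. strict_mono h \<Longrightarrow> P (sq (\<lambda>i. g (h i)))" for P using EM[OF that] .
      fix h :: "nat \<Rightarrow> nat" assume h: "strict_mono h"
      have "h 1 < h 2" using h by (simp add: strict_mono_def)
      have pb: "eqt D pb (A (h (1 + q)) \<oplus> E (h (1 + p)))"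
        using pq \<open>h 1 < h 2\<close> by (intro B) (auto simp: numeral_2_eq_2)
      have "kdiv k (D \<union> (\<Union>j \<in> {h 2<..}. range (g j))) \<chi> (A (h (1 + q)) \<oplus> E (h (1 + p)))"
      proof (rule kdiv_later[where B=D, OF D order_refl D(1) tg _ _ \<chi>])
        show "Ind D (g l) (D \<union> (\<Union>j \<in> {..<l}. range (g j)))" for l using i by (simp add: g_def)
        have "h (1 + q) \<le> h 2" "h (1 + p) \<le> h 2"
          using pq h by (auto simp: strict_mono_less_eq)
        then show "range (A (h (1 + q)) \<oplus> E (h (1 + p))) \<subseteq> D \<union> (\<Union>j \<in> {..h 2}. range (g j))"
          unfolding range_jn g_def by blast
        show "kdiv k D \<chi> (A (h (1 + q)) \<oplus> E (h (1 + p)))" using kdiv_eqt[OF k pb] .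
      qed
      then show "kdiv k (D \<union> (\<Union>l \<in> {2<..}. range (g (h l)))) \<chi> (\<lambda>v. sq (\<lambda>i. g (h i)) (\<rho> (1 + q) (1 + p) v))"
        unfolding \<rho>g
      proof (rule kdiv_mono, intro Un_mono order_refl UN_least)
        fix l :: nat assume "l \<in> {2<..}"
        then have "h l \<in> {h 2<..}" using h by (simp add: strict_mono_less)
        then show "range (g (h l)) \<subseteq> (\<Union>j \<in> {h 2<..}. range (g j))" by blast
      qed
    qed
    then have "kdiv k (D \<union> (\<Union>l \<in> {2<..}. range (g' (4 * n + l)))) \<chi> (bd n)"
      unfolding \<rho>g' bd_def .
    then show "kdiv k (D \<union> (\<Union>j \<in> {n<..}. range (bd j))) \<chi> (bd n)"
    proof (rule kdiv_mono, intro Un_mono order_refl UN_least)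
      fix j assume "j \<in> {n<..}"
      then have j: "n < j" by simp
      have j4: "4 * j + x = 4 * n + (4 * (j - n) + x)" for x using j by simp
      have *: "range (g' (4 * n + l)) \<subseteq> (\<Union>l \<in> {2<..}. range (g' (4 * n + l)))" if "2 < l" for l
        using that by (intro UN_upper) simp
      have sub: "range (A' m) \<subseteq> range (g' m)" "range (E' m) \<subseteq> range (g' m)" for m
        by (auto simp: A'_def E'_def)
      have "range (A' (4 * j + (1 + q))) \<subseteq> (\<Union>l \<in> {2<..}. range (g' (4 * n + l)))"
        unfolding j4 by (rule order_trans[OF sub(1) *]) (use j in linarith)
      moreover have "range (E' (4 * j + (1 + p))) \<subseteq> (\<Union>l \<in> {2<..}. range (g' (4 * n + l)))"
        unfolding j4 by (rule order_trans[OF sub(2) *]) (use j in linarith)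
      ultimately show "range (bd j) \<subseteq> (\<Union>l \<in> {2<..}. range (g' (4 * n + l)))"
        unfolding bd_def range_jn by (rule Un_least)
    qed
  qed
qed

text \<open>\<open>A n\<close> stands to every earlier \<open>E i\<close> as \<open>a\<close> to
  \<open>b0\<close>, while \<open>E n\<close> realizes the coheir over \<open>A n\<close> and
  everything before. Thus the order of \<open>i\<close> and \<open>j\<close> decides which of two
  types the pair \<open>(A i, E j)\<close> has.\<close>

lemma link_sequence:
  fixes a :: "'p::countable \<Rightarrow> 'u" and b b0 :: "'y::countable \<Rightarrow> 'u"
  assumes D: "is_mod D" "base D" and V: "coheir D V b" and t: "tup b" "tup b0"
    and i: "ind D a b0" "eqt D b b0"
  shows "\<exists>(A :: nat \<Rightarrow> 'p \<Rightarrow> 'u) (E :: nat \<Rightarrow> 'y \<Rightarrow> 'u). \<forall>n. tup (A n) \<and> tup (E n) \<and> eqt D a (A n) \<and>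
    (\<forall>i<n. eqt D (a \<oplus> b0) (A n \<oplus> E i)) \<and>
    Ind D (A n) (D \<union> (\<Union>j \<in> {..<n}. range (A j \<oplus> E j))) \<and>
    coh V (D \<union> (\<Union>j \<in> {..<n}. range (A j \<oplus> E j)) \<union> range (A n)) (E n)"
proof -
  have DU: "D \<subseteq> U" using D(1) by (rule mod_U)
  define Wn where "Wn f n = D \<union> (\<Union>j \<in> {..<n}. range (fst (f j) \<oplus> snd (f j)))"
    for f :: "nat \<Rightarrow> ('p \<Rightarrow> 'u) \<times> ('y \<Rightarrow> 'u)" and n
  define P where "P f n r \<longleftrightarrow> tup (fst r) \<and> tup (snd r) \<and> eqt D a (fst r) \<and>
    (\<forall>i<n. eqt D (a \<oplus> b0) (fst r \<oplus> snd (f i))) \<and> Ind D (fst r) (Wn f n) \<and>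
    coh V (Wn f n \<union> range (fst r)) (snd r)" for f n r
  have "\<exists>f. \<forall>n. P f n (f n)"
  proof (rule dependent_wf_choice[OF wf_less_than])
    fix f g :: "nat \<Rightarrow> ('p \<Rightarrow> 'u) \<times> ('y \<Rightarrow> 'u)" and n r
    assume fg: "\<And>m. (m, n) \<in> less_than \<Longrightarrow> f m = g m"
    have "(\<Union>j \<in> {..<n}. range (fst (f j) \<oplus> snd (f j))) = (\<Union>j \<in> {..<n}. range (fst (g j) \<oplus> snd (g j)))"
    proof (rule SUP_cong[OF refl])
      fix j assume "j \<in> {..<n}"
      then have "f j = g j" using fg by simp
      then show "range (fst (f j) \<oplus> snd (f j)) = range (fst (g j) \<oplus> snd (g j))" by (simp only:)
    qed
    then have "Wn f n = Wn g n" by (simp add: Wn_def)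
    then show "P f n r = P g n r" using fg by (simp add: P_def)
  next
    fix n f assume "\<And>m. (m, n) \<in> less_than \<Longrightarrow> P f m (f m)"
    then have pre: "\<And>m. m < n \<Longrightarrow> P f m (f m)" by simp
    have tf: "tup (fst (f m) \<oplus> snd (f m))" if "m < n" for m using pre[OF that] by (simp add: P_def)
    have bW: "base (Wn f n)"
    proof -
      obtain u where u: "tup (u :: 'p + 'y \<Rightarrow> 'u)" using ex_tup by blast
      define f' where "f' m = (if m < n then fst (f m) \<oplus> snd (f m) else u)" for m
      have "base (\<Union>j \<in> {..<n}. range (f' j))" by (rule base_ranges) (use tf u in \<open>simp add: f'_def\<close>)
      then show ?thesis unfolding Wn_def using D(2) by (intro base_Un) (auto simp: f'_def)
    qed
    have bE: "base (D \<union> (\<Union>j \<in> {..<n}. range (snd (f j))))"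
      by (rule base_subset[OF bW]) (auto simp: Wn_def range_jn)
    from cohs_ex[OF V DU bE] obtain g where
      g: "cohs V (D \<union> (\<Union>j \<in> {..<n}. range (snd (f j)))) g" by blast
    \<comment> \<open>\<open>cohs_realize\<close> expects an infinite Morley sequence, so the
      \<open>n\<close> entries constructed so far are continued by \<open>g\<close>.\<close>
    define E where "E i = (if i < n then snd (f i) else g (i - n))" for i
    have E: "cohs V D E" unfolding cohs_def
    proof
      fix i
      show "coh V (D \<union> (\<Union>j \<in> {..<i}. range (E j))) (E i)"
      proof (cases "i < n")
        case True
        then have "coh V (Wn f i \<union> range (fst (f i))) (snd (f i))" using pre by (simp add: P_def)
        then have "coh V (D \<union> (\<Union>j \<in> {..<i}. range (E j))) (snd (f i))"
          by (rule coh_mono) (use True in \<open>auto simp: Wn_def E_def range_jn\<close>)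
        then show ?thesis using True by (simp add: E_def)
      next
        case False
        have rE: "range (E j) \<subseteq> D \<union> (\<Union>j \<in> {..<n}. range (snd (f j))) \<union> (\<Union>j \<in> {..<i - n}. range (g j))"
          if "j < i" for j
        proof (cases "j < n")
          case False
          then have "j - n < i - n" using that by simp
          then show ?thesis using False unfolding E_def by auto
        qed (auto simp: E_def)
        have "D \<union> (\<Union>j \<in> {..<i}. range (E j)) \<subseteq>
          D \<union> (\<Union>j \<in> {..<n}. range (snd (f j))) \<union> (\<Union>j \<in> {..<i - n}. range (g j))"
        proof (intro Un_least UN_least)
          show "range (E j) \<subseteq> D \<union> (\<Union>j \<in> {..<n}. range (snd (f j))) \<union> (\<Union>j \<in> {..<i - n}. range (g j))"
            if "j \<in> {..<i}" for j using that by (intro rE) simp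
        qed blast
        with g[unfolded cohs_def, rule_format, of "i - n"]
        have "coh V (D \<union> (\<Union>j \<in> {..<i}. range (E j))) (g (i - n))" by (rule coh_mono)
        then show ?thesis using False by (simp add: E_def)
      qed
    qed
    have "coh V D (E 0)" using E[unfolded cohs_def, rule_format, of 0] by simp
    then have "eqt D b (E 0)" using coh_self[OF V t(1)] by (intro coh_eqt)
    then have "eqt D b0 (E 0)" using i(2) eqt_sym eqt_trans by blast
    moreover have "D \<subseteq> Wn f n" by (simp add: Wn_def)
    ultimately obtain a' where
      a': "tup a'" "\<forall>i. eqt D (a \<oplus> b0) (a' \<oplus> E i)" "Ind D a' (Wn f n)"
      using cohs_realize[OF D V E t(2) i(1) _ bW] by blast
    obtain e' where e': "coh V (Wn f n \<union> range a') e'"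
      using coh_ex[OF V DU base_Un_range[OF bW a'(1)]] by blast
    have "eqt D (a \<oplus> b0) (a' \<oplus> snd (f i))" if "i < n" for i
      using a'(2)[rule_format, of i] that by (simp add: E_def)
    then have "P f n (a', e')"
      using a' e' coh_tup[OF e'] eqt_jnD(1)[OF a'(2)[rule_format] DU] by (simp add: P_def)
    then show "\<exists>r. P f n r" by blast
  qed
  then obtain f where "\<forall>n. P f n (f n)" by (elim exE)
  then show ?thesis
    by (intro exI[of _ "\<lambda>n. fst (f n)"] exI[of _ "\<lambda>n. snd (f n)"]) (simp add: P_def Wn_def)
qed

text \<open>The pair \<open>(a, e)\<close> does not depend on \<open>b0\<close>; it is the common
  term of comparison for all \<open>b0\<close> that have the type of \<open>b\<close> and from which
  \<open>a\<close> is independent.\<close>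

lemma link:
  fixes a :: "'p::countable \<Rightarrow> 'u" and b b0 e :: "'y::countable \<Rightarrow> 'u"
    and \<phi>1 :: "('x::countable + 'p \<Rightarrow> 'u) \<Rightarrow> bool" and \<phi>2 :: "('x + 'y \<Rightarrow> 'u) \<Rightarrow> bool"
  assumes D: "is_mod D" "base D" and V: "coheir D V b" and t: "tup a" "tup b" "tup b0"
    and i: "ind D a b0" "eqt D b b0" and e: "coh V (D \<union> range a) e"
    and \<phi>: "Dfn D \<phi>1" "Dfn D \<phi>2"
    and \<chi>_def: "\<chi> = (\<lambda>z. \<phi>1 ((\<lambda>x. z (Inl x)) \<oplus> (\<lambda>v. z (Inr (Inl v)))) \<and>
      \<phi>2 ((\<lambda>x. z (Inl x)) \<oplus> (\<lambda>v. z (Inr (Inr v)))))"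
  shows "(\<forall>k. \<not> kdiv k D \<chi> (a \<oplus> b0)) \<longleftrightarrow> (\<forall>k. \<not> kdiv k D \<chi> (a \<oplus> e))"
proof -
  have DU: "D \<subseteq> U" using D(1) by (rule mod_U)
  from link_sequence[OF D V t(2,3) i] obtain A :: "nat \<Rightarrow> 'p \<Rightarrow> 'u" and E :: "nat \<Rightarrow> 'y \<Rightarrow> 'u" where
    AE: "\<forall>n. tup (A n) \<and> tup (E n) \<and> eqt D a (A n) \<and>
      (\<forall>i<n. eqt D (a \<oplus> b0) (A n \<oplus> E i)) \<and>
      Ind D (A n) (D \<union> (\<Union>j \<in> {..<n}. range (A j \<oplus> E j))) \<and>
      coh V (D \<union> (\<Union>j \<in> {..<n}. range (A j \<oplus> E j)) \<union> range (A n)) (E n)" by (elim exE)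
  have tA: "tup (A n)" and tE: "tup (E n)" and eA: "eqt D a (A n)" for n using AE by blast+
  have t0: "eqt D (a \<oplus> b0) (A n \<oplus> E i)" if "i < n" for i n using AE that by blast
  have iA: "Ind D (A n) (D \<union> (\<Union>j \<in> {..<n}. range (A j \<oplus> E j)))" for n using AE by blast
  have cE: "coh V (D \<union> (\<Union>j \<in> {..<n}. range (A j \<oplus> E j)) \<union> range (A n)) (E n)" for n using AE by blast
  have t1: "eqt D (a \<oplus> e) (A j \<oplus> E n)" if "j < n" for j n
  proof (rule coh_inv[OF V DU eA t(1) tA e])
    show "coh V (D \<union> range (A j)) (E n)"
      by (rule coh_mono[OF cE]) (use that in \<open>auto simp: range_jn\<close>)
  qed
  have iAE: "Ind D (A n \<oplus> E n) (D \<union> (\<Union>j \<in> {..<n}. range (A j \<oplus> E j)))" (is "Ind D _ ?W") for n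
    unfolding Ind_def
  proof (intro allI impI)
    let ?W = "D \<union> (\<Union>j \<in> {..<n}. range (A j \<oplus> E j))"
    fix w :: "nat \<Rightarrow> 'u" assume w: "range w \<subseteq> ?W"
    have bW: "base ?W" using D(2) tA tE by (intro base_Un base_ranges) simp_all
    have tw: "tup w" unfolding tup_range using w base_D[OF bW] by (rule order_trans)
    have "Ind D (E n) (?W \<union> range (A n))" unfolding Ind_def
    proof (intro allI impI)
      fix v :: "nat \<Rightarrow> 'u" assume v: "range v \<subseteq> ?W \<union> range (A n)"
      have "tup v" unfolding tup_range using v base_D[OF base_Un_range[OF bW tA]] by (rule order_trans)
      moreover have "coh V (D \<union> range v) (E n)" by (rule coh_mono[OF cE]) (use v in blast)
      ultimately show "ind D (E n) v" by (rule coh_ind[OF V DU])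
    qed
    then have "Ind (D \<union> range (A n)) (E n) (?W \<union> range (A n))"
    proof (rule Ind_base_mono)
      show "base (D \<union> range (A n))" by (rule base_Un_range[OF D(2) tA])
      show "?W \<union> range (A n) \<subseteq> U" by (rule base_D[OF base_Un_range[OF bW tA]])
    qed (use mod_ne[OF D(1)] in blast)+
    then have "ind (D \<union> range (A n)) (E n) w" using w unfolding Ind_def by blast
    moreover have "ind D (A n) w" using iA w unfolding Ind_def by blast
    ultimately show "ind D (A n \<oplus> E n) w" by (rule ind_left_trans[OF D(2) _ _ tA tw, rotated])
  qed
  have D_ne: "D \<noteq> {}" using D(1) by (rule mod_ne)
  show ?thesis
  proof (intro iffI allI notI)
    fix k assume nd: "\<forall>k. \<not> kdiv k D \<chi> (a \<oplus> b0)" and k: "kdiv k D \<chi> (a \<oplus> e)"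
    show False
      by (rule link_core[OF D(2) D_ne tA tE iAE \<phi> \<chi>_def, of 1 0 "a \<oplus> b0" "a \<oplus> e" k])
        (use nd k t0 t1 in auto)
  next
    fix k assume nd: "\<forall>k. \<not> kdiv k D \<chi> (a \<oplus> e)" and k: "kdiv k D \<chi> (a \<oplus> b0)"
    show False
      by (rule link_core[OF D(2) D_ne tA tE iAE \<phi> \<chi>_def, of 0 1 "a \<oplus> e" "a \<oplus> b0" k])
        (use nd k t0 t1 in auto)
  qed
qed

text \<open>Conjugating \<open>b\<close> over \<open>D\<close> and extending yields
  \<open>b2\<close> with \<open>\<phi>2(c1, b2)\<close> and \<open>c1\<close> independent from
  \<open>(a, b2)\<close>, so that \<open>\<chi>\<close> does not divide at \<open>(a, b2)\<close>.
  Two applications of \<open>link\<close> carry this over to \<open>(a, b)\<close>.\<close>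

theorem independence_theorem:
  fixes c1 c2 :: "'x::countable \<Rightarrow> 'u" and a :: "'p::countable \<Rightarrow> 'u" and b :: "'y::countable \<Rightarrow> 'u"
  assumes D: "is_mod D" "base D" and t: "tup c1" "tup c2" "tup a" "tup b"
    and c: "eqt D c1 c2" and i: "ind D c1 a" "ind D c2 b" "ind D a b"
    and \<phi>: "Dfn D \<phi>1" "Dfn D \<phi>2" "\<phi>1 (c1 \<oplus> a)" "\<phi>2 (c2 \<oplus> b)"
    and \<chi>_def: "\<chi> = (\<lambda>z. \<phi>1 ((\<lambda>x. z (Inl x)) \<oplus> (\<lambda>v. z (Inr (Inl v)))) \<and>
      \<phi>2 ((\<lambda>x. z (Inl x)) \<oplus> (\<lambda>v. z (Inr (Inr v)))))"
  shows "\<not> kdiv k D \<chi> (a \<oplus> b)"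
proof -
  have DU: "D \<subseteq> U" using D(1) by (rule mod_U)
  have \<chi>: "Dfn D \<chi>" unfolding \<chi>_def
    by (rule Dfn_conj) (rule Dfn_rn'[OF \<phi>(1) DU], rule rn_jn[OF rn_ren rn_ren],
      rule Dfn_rn'[OF \<phi>(2) DU], rule rn_jn[OF rn_ren rn_ren])
  obtain b1 where b1: "tup b1" "eqt D (c2 \<oplus> b) (c1 \<oplus> b1)"
    using homog[OF D(2) eqt_sym[OF c] t(2,1,4)] by blast
  have "ind D c1 b1" using ind_eqt[OF i(2) b1(2) DU] .
  then have "ind D b1 c1" by (rule ind_sym[OF D t(1) b1(1)])
  from ext_Ind[OF D base_Un_range[OF base_Un_range[OF D(2) t(1)] t(3)] _ _ ind_Ind[OF D(2) this t(1)]]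
  obtain b2 where b2: "tup b2" "eqt (D \<union> range c1) b1 b2" "Ind D b2 (D \<union> range c1 \<union> range a)" by auto
  have eq2: "eqt D (c1 \<oplus> b1) (c1 \<oplus> b2)"
    using eqt_swap[OF _ DU] b2(2) unfolding eqt_base[OF DU t(1)] by blast
  have \<phi>2: "\<phi>2 (c1 \<oplus> b2)" using eqtD[OF eqt_trans[OF b1(2) eq2] \<phi>(2)] \<phi>(4) by blast
  have eqb: "eqt D b b2" using eqt_jnD(2)[OF eqt_trans[OF b1(2) eq2] DU] .
  have bW: "base (D \<union> range c1 \<union> range a)" using D(2) t by (intro base_Un_range)
  have "Ind (D \<union> range a) b2 (D \<union> range c1 \<union> range a)"
  proof (rule Ind_base_mono[OF b2(3)])
    show "base (D \<union> range a)" by (rule base_Un_range[OF D(2) t(3)])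
    show "D \<union> range c1 \<union> range a \<subseteq> U" by (rule base_D[OF bW])
  qed (use mod_ne[OF D(1)] in blast)+
  then have bc: "ind (D \<union> range a) b2 c1"
    by (rule IndD[OF base_Un_range[OF D(2) t(3)] _ _ base_D[OF bW]]) blast
  have "ind D (a \<oplus> b2) c1" by (rule ind_left_trans[OF D(2) ind_sym[OF D t(1,3) i(1)] bc t(3,1)])
  then have "ind D c1 (a \<oplus> b2)" by (rule ind_sym[OF D _ t(1), rotated]) (simp add: t b2(1))
  moreover have "\<chi> (c1 \<oplus> (a \<oplus> b2))" using \<phi>(3) \<phi>2 by (simp add: \<chi>_def)
  ultimately have nd: "\<forall>k. \<not> kdiv k D \<chi> (a \<oplus> b2)" using indD[OF _ \<chi>] by blast
  have "ind D b2 a" by (rule IndD[OF D(2) b2(3) _ base_D[OF bW]]) blast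
  then have iab: "ind D a b2" by (rule ind_sym[OF D b2(1) t(3)])
  obtain V where V: "coheir D V b" using coheir_ex[OF D(1) t(4)] by blast
  obtain e where e: "coh V (D \<union> range a) e" using coh_ex[OF V DU base_Un_range[OF D(2) t(3)]] by blast
  have "\<forall>k. \<not> kdiv k D \<chi> (a \<oplus> e)"
    using link[OF D V t(3,4) b2(1) iab eqb e \<phi>(1,2) \<chi>_def] nd by blast
  then have "\<forall>k. \<not> kdiv k D \<chi> (a \<oplus> b)"
    using link[OF D V t(3,4,4) i(3) eqt_refl e \<phi>(1,2) \<chi>_def] by blast
  then show ?thesis by blast
qed

end

section \<open>Weak dividing and dividing\<close>

context monster
begin

lemma kdiv_absorb:
  fixes b :: "'y::countable \<Rightarrow> 'u" and \<phi> :: "('x + 'y \<Rightarrow> 'u) \<Rightarrow> bool"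
  assumes D: "base D" "D \<noteq> {}" and \<phi>: "Dfn D \<phi>" and k: "kdiv k D \<phi> b"
  shows "\<exists>(d :: nat \<Rightarrow> 'u) \<theta>. range d \<subseteq> D \<and> Dfn {} \<theta> \<and> (\<forall>a. \<theta> (a \<oplus> (b \<oplus> d)) \<longleftrightarrow> \<phi> (a \<oplus> b)) \<and>
    kdiv k D \<theta> (b \<oplus> d)"
proof -
  have DU: "D \<subseteq> U" using D(1) by (rule base_D)
  obtain d :: "nat \<Rightarrow> 'u" and Q where d: "range d \<subseteq> D" "Dfn {} Q" "\<forall>z. \<phi> z \<longleftrightarrow> Q (z \<oplus> d)"
    using Dfn_abs_nat[OF \<phi> D(2) DU] by (elim exE conjE)
  define \<theta> where "\<theta> z = Q (((\<lambda>x :: 'x. z (Inl x)) \<oplus> (\<lambda>y :: 'y. z (Inr (Inl y)))) \<oplus> (\<lambda>i :: nat. z (Inr (Inr i))))" for z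
  from k obtain bs where bs: "\<And>j. tup (bs j)" "\<And>j. eqt D b (bs j)" "kcon k \<phi> bs UNIV"
    by (rule kdivE) blast
  have \<theta>: "\<theta> (a \<oplus> (b' \<oplus> d)) \<longleftrightarrow> \<phi> (a \<oplus> b')" for a b' by (simp add: \<theta>_def d(3))
  have "kdiv k D \<theta> (b \<oplus> d)"
  proof (rule kdivI)
    show "tup (bs j \<oplus> d)" for j using bs(1) d(1) DU by (auto simp: tup_range[of d])
    show "eqt D (b \<oplus> d) (bs j \<oplus> d)" for j using eqt_absorb[OF bs(2) order_refl d(1) DU] .
    show "kcon k \<theta> (\<lambda>j. bs j \<oplus> d) UNIV"
      by (rule kcon_weaken[OF bs(3), where h="\<lambda>a. a"]) (simp add: \<theta>)
  qed
  moreover have "Dfn {} \<theta>" unfolding \<theta>_def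
    by (rule Dfn_rn'[OF d(2)]) (auto intro!: rn_jn[OF rn_jn[OF rn_ren rn_ren] rn_ren])
  ultimately show ?thesis using d(1) \<theta> by blast
qed

lemma tree_True:
  assumes "tree n k \<phi> Q" shows "tree n k \<phi> (\<lambda>_. True)"
proof -
  from assms obtain b c where "\<And>\<eta>. tup (b \<eta>)" "\<And>\<eta>. tup (c \<eta>)"
    "\<And>\<eta>. length \<eta> < n \<Longrightarrow> kcon k \<phi> (\<lambda>i. b (\<eta> @ [i])) UNIV"
    "\<And>\<eta> i. length \<eta> = n \<Longrightarrow> i < n \<Longrightarrow> \<phi> (c \<eta> \<oplus> b (take (Suc i) \<eta>))" by (rule treeE) blast
  then show ?thesis by (intro treeI[of b n c]) simp_all
qed

text \<open>Semantic form of weak nondividing: \<open>\<rho>\<close> sends the variables of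
  \<open>\<Psi>\<close> into the \<open>n\<close> copies, and \<open>s\<close> witnesses that
  \<open>\<Psi>\<close> is consistent with the copies of \<open>r\<close>.\<close>

lemma nwd_realize:
  fixes s :: "nat \<times> 'x \<Rightarrow> 'u" and \<rho> :: "'v \<Rightarrow> nat \<times> 'x"
  assumes nwd: "not_weakly_divides L S I p r B" and \<Psi>: "Dfn B \<Psi>"
    and \<rho>: "\<And>v. \<rho> v \<in> {..<n} \<times> I" and s: "tup s" "\<Psi> (\<lambda>v. s (\<rho> v))"
      "\<And>l. l < n \<Longrightarrow> realizes S (\<lambda>i. s (l, i)) r"
    and F: "F \<subseteq> p" "finite F"
  shows "\<exists>s'. tup s' \<and> \<Psi> (\<lambda>v. s' (\<rho> v)) \<and> (\<forall>l<n. realizes S (\<lambda>i. s' (l, i)) F)"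
proof -
  obtain \<psi>0 where \<psi>0: "\<psi>0 \<in> formulas L (UNIV <+> B)"
    "\<forall>a. tup a \<longrightarrow> (\<Psi> a \<longleftrightarrow> sat S (case_sum a id) [] \<psi>0)" using \<Psi> unfolding Dfn_def by (elim bexE)
  define \<psi> where "\<psi> = map_fm (map_sum \<rho> id) \<psi>0"
  have \<psi>: "\<psi> \<in> formulas L (({..<n} \<times> I) <+> B)" unfolding \<psi>_def
    by (rule map_formulas[OF \<psi>0(1)]) (use \<psi>0(1) \<rho> in \<open>fastforce simp: formulas_def\<close>)
  have sat\<psi>: "sat S (case_sum s id) [] \<psi> \<longleftrightarrow> \<Psi> (\<lambda>v. s (\<rho> v))" if "tup s" for s
  proof -
    have "sat S (case_sum s id) [] \<psi> \<longleftrightarrow> sat S (case_sum (\<lambda>v. s (\<rho> v)) id) [] \<psi>0"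
      unfolding \<psi>_def sat_map by (rule sat_cong) (auto split: sum.split)
    then show ?thesis using \<psi>0(2) that by simp
  qed
  have sat_copy: "sat S (case_sum s id) [] (map_fm (map_sum (Pair l) id) \<phi>) \<longleftrightarrow>
      sat S (case_sum (\<lambda>i. s (l, i)) id) [] \<phi>" for s l and \<phi> :: "('f, 'r, 'x + 'u) fm"
    unfolding sat_map by (rule sat_cong) (auto split: sum.split)
  have "consistent S (copies n \<psi> r)" unfolding consistent_def
  proof (intro allI impI)
    fix F' assume "finite F'" "F' \<subseteq> copies n \<psi> r"
    moreover have "realizes S s (copies n \<psi> r)"
      unfolding realizes_def
    proof
      fix \<phi> assume "\<phi> \<in> copies n \<psi> r"
      then consider "\<phi> = \<psi>" | l \<phi>' where "l < n" "\<phi>' \<in> r" "\<phi> = map_fm (map_sum (Pair l) id) \<phi>'"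
        unfolding copies_def by blast
      then show "sat S (case_sum s id) [] \<phi>"
      proof cases
        case 1
        then show ?thesis using sat\<psi>[OF s(1)] s(2) by simp
      next
        case 2
        then show ?thesis unfolding 2(3) sat_copy using s(3)[OF 2(1)] by (simp add: realizes_def)
      qed
    qed
    ultimately show "\<exists>a. range a \<subseteq> U \<and> realizes S a F'"
      using s(1) by (intro exI[of _ s]) (auto simp: realizes_def tup_range)
  qed
  then have con: "consistent S (copies n \<psi> (r \<union> p))"
    using nwd \<psi> unfolding not_weakly_divides_def by blast
  have "finite (copies n \<psi> F)" "copies n \<psi> F \<subseteq> copies n \<psi> (r \<union> p)"
    using F by (auto simp: copies_def)
  then obtain s' where s': "range s' \<subseteq> U" "realizes S s' (copies n \<psi> F)" by (rule consistentD[OF con])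
  have "tup s'" using s'(1) by (simp add: tup_range)
  moreover have "\<Psi> (\<lambda>v. s' (\<rho> v))"
    using s'(2) sat\<psi>[OF \<open>tup s'\<close>] by (simp add: copies_def realizes_def)
  moreover have "realizes S (\<lambda>i. s' (l, i)) F" if "l < n" for l
  proof -
    have "sat S (case_sum s' id) [] (map_fm (map_sum (Pair l) id) \<phi>)" if "\<phi> \<in> F" for \<phi>
      using s'(2) that \<open>l < n\<close> by (auto simp: copies_def realizes_def)
    then show ?thesis unfolding realizes_def sat_copy by blast
  qed
  ultimately show ?thesis by blast
qed

text \<open>An \<open>m\<close>-tuple, \<open>m > 0\<close>, is represented by an infinite sequence that repeats its first
  entry from position \<open>m\<close> on.\<close>

definition trunc :: "nat \<Rightarrow> nat \<Rightarrow> nat" where "trunc m i = (if i < m then i else 0)"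

lemma trunc_less: "0 < m \<Longrightarrow> trunc m i < m"
  by (simp add: trunc_def)

lemma Dfn_sat: "\<phi> \<in> formulas L (I <+> A) \<Longrightarrow> Dfn A (\<lambda>a. sat S (case_sum a id) [] \<phi>)"
  by (rule DfnI[OF subsetD[OF formulas_mono]]) auto

lemma type_eqt:
  assumes m: "0 < m" and p: "p \<in> complete_types L S {..<m} A" "B \<subseteq> A"
    and c0: "tup c0" "realizes S c0 p" "\<And>i. c0 (trunc m i) = c0 i"
    and c: "tup c" "realizes S c (restrict_type p B)" "\<And>i. c (trunc m i) = c i"
  shows "eqt B c0 c"
  unfolding eqt_def
proof (intro allI impI)
  fix Q assume Q: "Dfn B Q" "Q c0"
  obtain \<chi> where \<chi>: "\<chi> \<in> formulas L (UNIV <+> B)"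
    "\<forall>a. tup a \<longrightarrow> (Q a \<longleftrightarrow> sat S (case_sum a id) [] \<chi>)" using Q(1) unfolding Dfn_def by (elim bexE)
  define \<chi>' where "\<chi>' = map_fm (map_sum (trunc m) id) \<chi>"
  have \<chi>': "\<chi>' \<in> formulas L ({..<m} <+> B)" unfolding \<chi>'_def
    by (rule map_formulas[OF \<chi>(1)]) (use \<chi>(1) trunc_less[OF m] in \<open>fastforce simp: formulas_def\<close>)
  have s: "sat S (case_sum a id) [] \<chi>' \<longleftrightarrow> Q a" if "tup a" "\<And>i. a (trunc m i) = a i" for a
  proof -
    have "sat S (case_sum a id) [] \<chi>' \<longleftrightarrow> sat S (case_sum a id) [] \<chi>"
      unfolding \<chi>'_def sat_map by (rule sat_cong) (auto simp: that(2) split: sum.split)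
    then show ?thesis using \<chi>(2) that(1) by simp
  qed
  have "\<chi>' \<in> formulas L ({..<m} <+> A)" using \<chi>' formulas_mono[of "{..<m} <+> B" "{..<m} <+> A" L] p(2) by blast
  then have "\<chi>' \<in> p \<or> Neg \<chi>' \<in> p" using p(1) by (auto simp: complete_types_def)
  moreover have "Neg \<chi>' \<notin> p"
  proof
    assume "Neg \<chi>' \<in> p"
    then have "sat S (case_sum c0 id) [] (Neg \<chi>')" using c0(2) unfolding realizes_def by blast
    then show False using s[OF c0(1,3)] Q(2) by simp
  qed
  ultimately have "\<chi>' \<in> restrict_type p B" using \<chi>' by (auto simp: restrict_type_def formulas_def)
  then have "sat S (case_sum c id) [] \<chi>'" using c(2) unfolding realizes_def by blast
  then show "Q c" using s[OF c(1,3)] by simp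
qed

text \<open>Weak nondividing is applied to finite parts of the type of the whole family
  \<open>c\<close>: all members move at once to realizations of \<open>p\<close>, and their joint
  type over the empty set is kept.\<close>

lemma nwd_family:
  fixes c :: "nat \<Rightarrow> nat \<Rightarrow> 'u"
  assumes m: "0 < m" and A: "base A" and p: "p \<subseteq> formulas L ({..<m} <+> A)"
    and nwd: "not_weakly_divides L S {..<m} p r {}"
    and c: "\<And>l. tup (c l)" "\<And>l i. c l (trunc m i) = c l i" "\<And>l. realizes S (c l) r"
  shows "\<exists>c'. (\<forall>l. tup (c' l)) \<and> eqt {} (sq c) (sq c') \<and> (\<forall>l. realizes S (c' l) p) \<and>
    (\<forall>l i. c' l (trunc m i) = c' l i)"
proof -
  have AU: "A \<subseteq> U" using A by (rule base_D)
  define I1 where "I1 = {\<Psi>. Dfn {} \<Psi> \<and> \<Psi> (sq c)}"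
  define f where "f = case_sum (\<lambda>\<Psi>. \<Psi>)
    (\<lambda>(\<phi> :: ('f, 'r, nat + 'u) fm, l) (s :: nat \<times> nat \<Rightarrow> 'u). sat S (case_sum (\<lambda>i. s (l, i)) id) [] \<phi>)"
  have "\<exists>s. tup s \<and> (\<forall>q \<in> I1 <+> (p \<times> UNIV). f q s)"
  proof (rule compact[OF A])
    fix q assume q: "q \<in> I1 <+> (p \<times> (UNIV :: nat set))"
    show "Dfn A (f q)"
    proof (cases q rule: sum.exhaust)
      case (Inl \<Psi>)
      then show ?thesis using q by (auto simp: f_def I1_def intro: Dfn_mono)
    next
      case (Inr y)
      obtain \<phi> l where y: "y = (\<phi>, l)" by (cases y rule: prod.exhaust)
      have "\<phi> \<in> formulas L ({..<m} <+> A)" using q Inr y p by auto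
      from Dfn_comp[OF Dfn_sat[OF this] AU, of "\<lambda>i. (l, i)"] show ?thesis by (simp add: f_def Inr y)
    qed
  next
    fix K assume K: "K \<subseteq> I1 <+> (p \<times> (UNIV :: nat set))" "finite K"
    define J1 where "J1 = Inl -` K"
    define J2 where "J2 = Inr -` K"
    have J: "finite J1" "finite J2" "J1 \<subseteq> I1" "J2 \<subseteq> p \<times> UNIV"
      using K by (auto simp: J1_def J2_def intro!: finite_vimageI)
    define \<Psi> where "\<Psi> s \<longleftrightarrow> (\<forall>\<Psi> \<in> J1. \<Psi> s)" for s
    have \<Psi>: "Dfn {} \<Psi>" unfolding \<Psi>_def using J by (intro Dfn_ball) (auto simp: I1_def)
    have \<Psi>c: "\<Psi> (sq c)" using J(3) by (auto simp: \<Psi>_def I1_def)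
    obtain V where V: "finite V" "\<forall>a a'. tup a \<longrightarrow> tup a' \<longrightarrow> (\<forall>v \<in> V. a v = a' v) \<longrightarrow> \<Psi> a = \<Psi> a'"
      using Dfn_support[OF \<Psi>] by (elim exE conjE)
    have "finite (fst ` V \<union> snd ` J2)" using V(1) J(2) by simp
    then obtain n0 where n0: "\<And>l. l \<in> fst ` V \<union> snd ` J2 \<Longrightarrow> l < n0" by (metis finite_nat_set_iff_bounded)
    define n where "n = Suc n0"
    have n: "\<And>l. l \<in> fst ` V \<union> snd ` J2 \<Longrightarrow> l < n" "0 < n" using n0 by (auto simp: n_def less_Suc_eq)
    \<comment> \<open>Copies from \<open>n\<close> on are sent to copy 0 and coordinates from
      \<open>m\<close> on to coordinate 0, to stay within the available variables; the values of
      \<open>c\<close> on the support of \<open>\<Psi>\<close> do not change.\<close>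
    define \<rho> where "\<rho> = (\<lambda>(l, i). (trunc n l, trunc m i))"
    have \<rho>: "\<rho> v \<in> {..<n} \<times> {..<m}" for v
      using trunc_less[OF m] trunc_less[OF n(2)] by (cases v) (simp add: \<rho>_def)
    have ts: "tup (sq c)" using c(1) by simp
    have "\<Psi> (\<lambda>v. sq c (\<rho> v)) = \<Psi> (sq c)"
    proof (rule V(2)[rule_format])
      fix v assume "v \<in> V"
      then have "fst v < n" using n(1) by blast
      then show "sq c (\<rho> v) = sq c v" by (cases v) (simp add: \<rho>_def trunc_def[of n] c(2))
    qed (use ts in auto)
    then have 1: "\<Psi> (\<lambda>v. sq c (\<rho> v))" using \<Psi>c by simp
    have 2: "realizes S (\<lambda>i. sq c (l, i)) r" for l using c(3) by simp
    have 3: "fst ` J2 \<subseteq> p" "finite (fst ` J2)" using J by auto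
    from nwd_realize[OF nwd \<Psi> \<rho> ts 1 2 3] obtain s where
      s: "tup s" "\<Psi> (\<lambda>v. s (\<rho> v))" "\<forall>l<n. realizes S (\<lambda>i. s (l, i)) (fst ` J2)"
      by (elim exE conjE)
    have "f q (\<lambda>v. s (\<rho> v))" if q: "q \<in> K" for q
    proof (cases q rule: sum.exhaust)
      case (Inl \<Psi>')
      then have "\<Psi>' \<in> J1" using q by (simp add: J1_def)
      then show ?thesis using s(2)[unfolded \<Psi>_def, rule_format, of \<Psi>'] Inl by (simp add: f_def)
    next
      case (Inr y)
      obtain \<phi> l where y: "y = (\<phi>, l)" by (cases y rule: prod.exhaust)
      have yJ: "(\<phi>, l) \<in> J2" using q Inr y by (simp add: J2_def)
      then have l: "l < n" using n(1) by force
      have "sat S (case_sum (\<lambda>i. s (l, i)) id) [] \<phi>"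
        using s(3)[rule_format, OF l] yJ by (force simp: realizes_def)
      also have "sat S (case_sum (\<lambda>i. s (l, i)) id) [] \<phi> = sat S (case_sum (\<lambda>i. s (\<rho> (l, i))) id) [] \<phi>"
      proof (rule sat_cong)
        fix v assume "v \<in> set_fm \<phi>"
        moreover have "set_fm \<phi> \<subseteq> {..<m} <+> A" using yJ J(4) p by (auto simp: formulas_def)
        ultimately show "case_sum (\<lambda>i. s (l, i)) id v = case_sum (\<lambda>i. s (\<rho> (l, i))) id v"
          using l by (auto simp: \<rho>_def trunc_def)
      qed
      finally show ?thesis by (simp add: f_def Inr y)
    qed
    then show "\<exists>s. tup s \<and> (\<forall>q \<in> K. f q s)" using s(1) by (intro exI[of _ "\<lambda>v. s (\<rho> v)"]) simp
  qed
  then obtain s where s: "tup s" "\<And>q. q \<in> I1 <+> (p \<times> UNIV) \<Longrightarrow> f q s" by blast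
  define c' where "c' l i = s (l, i)" for l i
  have sc: "s = sq c'" by (auto simp: c'_def sq_def)
  have e: "eqt {} (sq c) (sq c')" unfolding eqt_def
  proof (intro allI impI)
    fix \<Psi> assume "Dfn {} \<Psi>" "\<Psi> (sq c)"
    then have "\<Psi> \<in> I1" by (simp add: I1_def)
    from s(2)[OF InlI[OF this]] show "\<Psi> (sq c')" by (simp add: f_def sc)
  qed
  have "realizes S (c' l) p" for l unfolding realizes_def
  proof
    fix \<phi> assume "\<phi> \<in> p"
    then have "(\<phi>, l) \<in> p \<times> UNIV" by simp
    from s(2)[OF InrI[OF this]] show "sat S (case_sum (c' l) id) [] \<phi>" by (simp add: f_def sc)
  qed
  moreover have "c' l (trunc m i) = c' l i" for l i
    using eqtD[OF e Dfn_eq[of "{}" "(l, trunc m i)" "(l, i)"]] c(2) by simp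
  moreover have "tup (c' l)" for l using s(1) by (simp add: sc)
  ultimately show ?thesis using e by blast
qed

end

context simple_monster
begin

text \<open>Trees of every height are built with branches realizing the type of \<open>c0\<close>
  over \<open>B\<close>. By \<open>nwd_family\<close> all branches move at once to realizations of
  \<open>p\<close>, so each satisfies \<open>\<phi>(x, a)\<close>; conjugating \<open>a\<close> to
  the dividing sequence and gluing adds a level. \<open>\<phi>\<close> has no parameters because the
  nodes are moved over the empty set only.\<close>

lemma nwd_ind_aux:
  fixes \<phi> :: "(nat + 'y::countable \<Rightarrow> 'u) \<Rightarrow> bool"
  assumes m: "0 < m" and A: "base A" and p: "p \<in> complete_types L S {..<m} A" and B: "B \<subseteq> A"
    and nwd: "not_weakly_divides L S {..<m} p (restrict_type p B) {}"
    and c0: "tup c0" "realizes S c0 p" "\<And>i. c0 (trunc m i) = c0 i"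
    and \<phi>: "Dfn {} \<phi>" and a: "range a \<subseteq> A" and \<phi>c: "\<phi> (c0 \<oplus> a)"
  shows "\<not> kdiv k B \<phi> a"
proof
  assume k: "kdiv k B \<phi> a"
  have AU: "A \<subseteq> U" using A by (rule base_D)
  have bB: "base B" using A B by (rule base_subset)
  have BU: "B \<subseteq> U" using bB by (rule base_D)
  have ta: "tup a" using a AU by (auto simp: tup_range)
  have \<phi>B: "Dfn B \<phi>" using \<phi> by (rule Dfn_mono) simp
  from k obtain bs where bs: "\<And>j. tup (bs j)" "\<And>j. eqt B a (bs j)" "kcon k \<phi> bs UNIV"
    by (rule kdivE) blast
  have pF: "p \<subseteq> formulas L ({..<m} <+> A)" using p by (simp add: complete_types_def)
  define T where "T = {P. Dfn B P \<and> P c0}"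
  have T: "(\<forall>P \<in> T. P x) \<longleftrightarrow> eqt B c0 x" for x by (auto simp: T_def eqt_def)
  have tr: "tree n k \<phi> (\<lambda>x. eqt B c0 x)" for n
  proof (induction n)
    case 0
    show ?case by (rule treeI[where b="\<lambda>_. a" and c="\<lambda>_. c0"]) (use ta c0 in auto)
  next
    case (Suc n)
    from Suc obtain b c where b: "\<And>\<eta>. tup (b \<eta>)" "\<And>\<eta>. tup (c \<eta>)"
      "\<And>\<eta>. length \<eta> < n \<Longrightarrow> kcon k \<phi> (\<lambda>i. b (\<eta> @ [i])) UNIV"
      "\<And>\<eta>. length \<eta> = n \<Longrightarrow> eqt B c0 (c \<eta>)"
      "\<And>\<eta> i. length \<eta> = n \<Longrightarrow> i < n \<Longrightarrow> \<phi> (c \<eta> \<oplus> b (take (Suc i) \<eta>))" by (rule treeE) blast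
    \<comment> \<open>Branches are numbered by coding lists; the codes of lists of other lengths get
      \<open>c0\<close>.\<close>
    define cc where "cc l = (if length (from_nat l :: nat list) = n then c (from_nat l) else c0)" for l
    have cc: "tup (cc l)" "eqt B c0 (cc l)" for l using b(2,4) c0(1) by (simp_all add: cc_def)
    have cct: "cc l (trunc m i) = cc l i" for l i
      using eqtD[OF cc(2) Dfn_eq[of B "trunc m i" i]] c0(3) by simp
    have ccr: "realizes S (cc l) (restrict_type p B)" for l unfolding realizes_def
    proof
      fix \<chi> assume \<chi>: "\<chi> \<in> restrict_type p B"
      then have "\<chi> \<in> formulas L ({..<m} <+> B)" using pF
        by (fastforce simp: restrict_type_def formulas_def)
      moreover have "sat S (case_sum c0 id) [] \<chi>"
        using \<chi> c0(2) by (simp add: restrict_type_def realizes_def)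
      ultimately show "sat S (case_sum (cc l) id) [] \<chi>" using eqtD[OF cc(2) Dfn_sat] by blast
    qed
    from nwd_family[where c=cc, OF m A pF nwd cc(1) cct ccr] obtain c' where
      c': "\<forall>l. tup (c' l)" "eqt {} (sq cc) (sq c')" "\<forall>l. realizes S (c' l) p"
        "\<forall>l i. c' l (trunc m i) = c' l i" by (elim exE conjE)
    have "restrict_type p A = p" using pF by (fastforce simp: restrict_type_def formulas_def)
    then have c'A: "eqt A c0 (c' l)" for l
      using c' c0 by (intro type_eqt[OF m p order_refl]) simp_all
    define t where "t = (\<lambda>(\<eta>, v). b \<eta> v)"
    have "tup t" using b(1) by (auto simp: t_def tup_def)
    with homog[OF base_empty c'(2), of t] obtain t' where
      t': "tup t'" "eqt {} (sq cc \<oplus> t) (sq c' \<oplus> t')" using cc(1) c'(1) by auto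
    define b' where "b' \<eta> v = t' (\<eta>, v)" for \<eta> v
    have e3: "eqt {} (sq (\<lambda>i. b (\<eta> @ [i]))) (sq (\<lambda>i. b' (\<eta> @ [i])))" for \<eta>
      using eqt_rn[OF t'(2), of "\<lambda>s q. s (Inr (\<eta> @ [fst q], snd q))", OF _ rn_ren]
      by (simp add: t_def b'_def[symmetric] sq_def case_prod_unfold)
    have e2: "eqt {} (cc l \<oplus> b \<nu>) (c' l \<oplus> b' \<nu>)" for l \<nu>
      using eqt_rn[OF t'(2), of "\<lambda>s. (\<lambda>x. s (Inl (l, x))) \<oplus> (\<lambda>x. s (Inr (\<nu>, x)))", OF _ rn_jn[OF rn_ren rn_ren]]
      by (simp add: t_def b'_def[symmetric])
    define T' where "T' = insert \<phi> ((\<lambda>P z. P (\<lambda>x. z (Inl x :: nat + 'y))) ` T)"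
    have T': "(\<forall>P \<in> T'. P (x \<oplus> w)) \<longleftrightarrow> \<phi> (x \<oplus> w) \<and> eqt B c0 x" for x w
      unfolding T'_def T[symmetric] by simp
    have "tree n k \<phi> (\<lambda>x. \<forall>P \<in> T'. P (x \<oplus> a))"
    proof (rule treeI[of b' n "\<lambda>\<eta>. c' (to_nat \<eta>)"])
      show "tup (b' \<eta>)" for \<eta> using t'(1) by (simp add: b'_def[abs_def])
      show "tup (c' (to_nat \<eta>))" for \<eta> :: "nat list" using c'(1) by simp
      show "kcon k \<phi> (\<lambda>i. b' (\<eta> @ [i])) UNIV" if "length \<eta> < n" for \<eta>
        using kcon_eqt[OF \<phi> _ e3 b(3)[OF that]] by simp
      show "\<forall>P \<in> T'. P (c' (to_nat \<eta>) \<oplus> a)" for \<eta> :: "nat list"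
      proof -
        have "Dfn A (\<lambda>x. \<phi> (x \<oplus> a))"
          by (rule Dfn_rn[OF \<phi> _ AU rn_jn[OF rn_id rn_const[OF a]]]) simp
        then have "\<phi> (c' (to_nat \<eta>) \<oplus> a)" using eqtD[OF c'A] \<phi>c by blast
        then show ?thesis unfolding T' using eqt_mono[OF c'A B] by simp
      qed
      show "\<phi> (c' (to_nat \<eta>) \<oplus> b' (take (Suc i) \<eta>))" if \<eta>: "length \<eta> = n" "i < n" for \<eta> i
      proof -
        have "cc (to_nat \<eta>) = c \<eta>" using \<eta>(1) by (simp add: cc_def)
        then have "\<phi> (cc (to_nat \<eta>) \<oplus> b (take (Suc i) \<eta>))" using b(5)[OF \<eta>] by simp
        then show ?thesis using eqtD[OF e2 \<phi>] by blast
      qed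
    qed
    moreover have "Dfn B P" if "P \<in> T'" for P
      using that \<phi>B BU by (auto simp: T'_def T_def intro: Dfn_comp)
    ultimately have "tree n k \<phi> (\<lambda>x. \<forall>P \<in> T'. P (x \<oplus> bs j))" for j
      by (intro tree_inv[OF bB \<phi>B _ bs(2) ta bs(1)])
    then have "tree n k \<phi> (\<lambda>x. eqt B c0 x \<and> \<phi> (x \<oplus> bs j))" for j unfolding T' by (simp add: conj_commute)
    then show ?case by (rule tree_step[OF _ bs(1,3)])
  qed
  have "tree n k \<phi> (\<lambda>_. True)" for n
    using tr by (rule tree_True)
  from tree_tree_property[OF bB \<phi>B this] show False using simple by (simp add: simple_theory_def)
qed

lemma nwd_Ind:
  assumes m: "0 < m" and A: "base A" and p: "p \<in> complete_types L S {..<m} A" and B: "B \<subseteq> A"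
    and nwd: "not_weakly_divides L S {..<m} p (restrict_type p B) {}"
    and c0: "tup c0" "realizes S c0 p" "\<And>i. c0 (trunc m i) = c0 i"
  shows "Ind B c0 A"
  unfolding Ind_def ind_def
proof (intro allI impI notI)
  fix w :: "nat \<Rightarrow> 'u" and \<phi> k assume w: "range w \<subseteq> A" "Dfn B \<phi>" "\<phi> (c0 \<oplus> w)" "kdiv k B \<phi> w"
  note aux = nwd_ind_aux[OF m A p B nwd c0]
  show False
  proof (cases "B = {}")
    case True
    then have "Dfn {} \<phi>" using w(2) by simp
    from aux[OF this w(1,3)] w(4) show False by (rule notE)
  next
    case False
    from kdiv_absorb[OF base_subset[OF A B] False w(2,4)] obtain d :: "nat \<Rightarrow> 'u" and \<theta> where
      d: "range d \<subseteq> B" "Dfn {} \<theta>" "\<forall>a. \<theta> (a \<oplus> (w \<oplus> d)) \<longleftrightarrow> \<phi> (a \<oplus> w)" "kdiv k B \<theta> (w \<oplus> d)"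
      by (elim exE conjE)
    have wd: "range (w \<oplus> d) \<subseteq> A" using w(1) d(1) B by (auto simp: range_jn)
    have "\<theta> (c0 \<oplus> (w \<oplus> d))" using d(3) w(3) by simp
    from aux[OF d(2) wd this] d(4) show False by (rule notE)
  qed
qed


section \<open>Local character\<close>

text \<open>By simplicity, chains for \<open>\<phi>\<close> and \<open>k\<close> in \<open>W\<close>
  have bounded length. The elements of a longest one form \<open>D\<close>: a tuple \<open>w\<close>
  at which \<open>\<phi>\<close> holds and divides over \<open>D\<close> could be put in
  front.\<close>

lemma chain_bound:
  fixes e :: "'x::countable \<Rightarrow> 'u" and \<phi> :: "('x + 'y::countable \<Rightarrow> 'u) \<Rightarrow> bool"
  assumes W: "W \<subseteq> U" "W \<noteq> {}" and e: "tup e" and \<phi>: "Dfn {} \<phi>"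
  shows "\<exists>D. D \<subseteq> W \<and> countable D \<and> (\<forall>w :: 'y \<Rightarrow> 'u. range w \<subseteq> W \<longrightarrow> \<phi> (e \<oplus> w) \<longrightarrow> \<not> kdiv k D \<phi> w)"
proof -
  define C where "C n es \<longleftrightarrow> (\<forall>i. range (es i) \<subseteq> W) \<and>
    (\<forall>i<n. \<phi> (e \<oplus> es i) \<and> kdiv k (\<Union>j \<in> {i<..<n}. range (es j)) \<phi> (es i))"
    for n and es :: "nat \<Rightarrow> 'y \<Rightarrow> 'u"
  have "\<not> (\<forall>n. \<exists>es. C n es)"
  proof
    assume all: "\<forall>n. \<exists>es. C n es"
    show False
    proof (rule no_chain[OF base_empty \<phi>, of k])
      fix n
      obtain es where es: "C n es" using all by blast
      then have "tup (es i)" for i using W(1) by (auto simp: C_def tup_range)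
      then show "\<exists>c (e :: nat \<Rightarrow> 'y \<Rightarrow> 'u). tup c \<and> (\<forall>i. tup (e i)) \<and>
        (\<forall>i<n. \<phi> (c \<oplus> e i) \<and> kdiv k ({} \<union> (\<Union>j \<in> {i<..<n}. range (e j))) \<phi> (e i))"
        using es e by (intro exI[of _ e] exI[of _ es]) (simp add: C_def)
    qed
  qed
  then obtain n0 where n0: "\<not> (\<exists>es. C n0 es)" by blast
  obtain w0 where w0: "w0 \<in> W" using W(2) by blast
  have "C 0 (\<lambda>_ _. w0)" using w0 by (auto simp: C_def)
  then have C0: "\<exists>es. C 0 es" by blast
  have "\<exists>n. (\<exists>es. C n es) \<and> \<not> (\<exists>es. C (Suc n) es)"
  proof (rule ccontr)
    assume no: "\<not> ?thesis"
    have "\<exists>es. C n es" for n by (induction n) (use C0 no in blast)+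
    then show False using n0 by blast
  qed
  then obtain n es where es: "C n es" and max: "\<not> (\<exists>es. C (Suc n) es)" by blast
  define D where "D = (\<Union>j \<in> {..<n}. range (es j))"
  have "\<not> kdiv k D \<phi> w" if w: "range w \<subseteq> W" "\<phi> (e \<oplus> w)" for w
  proof
    assume k: "kdiv k D \<phi> w"
    define es' where "es' = case_nat w es"
    have later: "(\<Union>j \<in> {Suc i<..<Suc n}. range (es' j)) = (\<Union>j \<in> {i<..<n}. range (es j))" for i
    proof -
      have "{Suc i<..<Suc n} = Suc ` {i<..<n}"
      proof (intro equalityI subsetI)
        fix j assume "j \<in> {Suc i<..<Suc n}"
        then show "j \<in> Suc ` {i<..<n}" by (cases j) auto
      qed auto
      then show ?thesis by (simp add: es'_def)
    qed
    have "{0<..<Suc n} = Suc ` {..<n}"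
    proof (intro equalityI subsetI)
      fix j assume "j \<in> {0<..<Suc n}"
      then show "j \<in> Suc ` {..<n}" by (cases j) auto
    qed auto
    then have "(\<Union>j \<in> {0<..<Suc n}. range (es' j)) = D" by (simp add: es'_def D_def)
    moreover have "\<phi> (e \<oplus> es' i) \<and> kdiv k (\<Union>j \<in> {i<..<Suc n}. range (es' j)) \<phi> (es' i)"
      if "i < Suc n" for i
    proof (cases i)
      case 0
      then show ?thesis using w(2) k calculation by (simp add: es'_def)
    next
      case (Suc i')
      have "\<phi> (e \<oplus> es i') \<and> kdiv k (\<Union>j \<in> {i'<..<n}. range (es j)) \<phi> (es i')"
        using es that Suc by (simp add: C_def)
      then show ?thesis using later[of i'] Suc by (simp add: es'_def)
    qed
    moreover have "range (es' i) \<subseteq> W" for i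
      using w(1) es by (cases i) (auto simp: es'_def C_def)
    ultimately have "C (Suc n) es'" unfolding C_def by blast
    then show False using max by blast
  qed
  moreover have "D \<subseteq> W" using es by (auto simp: D_def C_def)
  moreover have "countable D" unfolding D_def by (intro countable_UN) auto
  ultimately show ?thesis by blast
qed

text \<open>\<open>chain_bound\<close> supplies a countable set \<open>X q\<close> for each
  parameter-free formula and each \<open>k\<close>. Parameters from \<open>D\<close> are absorbed
  into the right-hand tuple, so these formulas cover all others.\<close>

lemma local_character:
  fixes e :: "'x::countable \<Rightarrow> 'u"
  assumes W: "base W" "W \<noteq> {}" and e: "tup e"
  shows "\<exists>X :: ('f, 'r, ('x + nat) + 'u) fm \<times> nat \<Rightarrow> 'u set. (\<forall>q. countable (X q) \<and> X q \<subseteq> W) \<and>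
    (\<forall>D. (\<Union>q \<in> formulas L (UNIV <+> {}) \<times> UNIV. X q) \<subseteq> D \<longrightarrow> D \<subseteq> W \<longrightarrow> D \<noteq> {} \<longrightarrow> Ind D e W)"
proof -
  have WU: "W \<subseteq> U" using W(1) by (rule base_D)
  define good where "good X q \<longleftrightarrow> X \<subseteq> W \<and> countable X \<and> (\<forall>w :: nat \<Rightarrow> 'u. range w \<subseteq> W \<longrightarrow>
    sat S (case_sum (e \<oplus> w) id) [] (fst q) \<longrightarrow>
    \<not> kdiv (snd q) X (\<lambda>z. sat S (case_sum z id) [] (fst q)) w)" for X and q :: "('f, 'r, ('x + nat) + 'u) fm \<times> nat"
  have "\<exists>X. X \<subseteq> W \<and> countable X \<and> (q \<in> formulas L (UNIV <+> {}) \<times> UNIV \<longrightarrow> good X q)" for q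
  proof (cases "q \<in> formulas L (UNIV <+> {}) \<times> (UNIV :: nat set)")
    case True
    then have "fst q \<in> formulas L (UNIV <+> {})" by auto
    then have "Dfn {} (\<lambda>z. sat S (case_sum z id) [] (fst q))" by (rule Dfn_sat)
    from chain_bound[OF WU W(2) e this, of "snd q"] show ?thesis
      unfolding good_def by blast
  qed auto
  then have "\<forall>q. \<exists>X. X \<subseteq> W \<and> countable X \<and> (q \<in> formulas L (UNIV <+> {}) \<times> UNIV \<longrightarrow> good X q)" by blast
  then obtain X where "\<forall>q. X q \<subseteq> W \<and> countable (X q) \<and>
    (q \<in> formulas L (UNIV <+> {}) \<times> UNIV \<longrightarrow> good (X q) q)" by (rule choice[THEN exE])
  then have X: "\<And>q. X q \<subseteq> W \<and> countable (X q)" "\<And>q. q \<in> formulas L (UNIV <+> {}) \<times> UNIV \<Longrightarrow> good (X q) q"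
    by blast+
  have "Ind D e W" if D: "(\<Union>q \<in> formulas L (UNIV <+> {}) \<times> UNIV. X q) \<subseteq> D" "D \<subseteq> W" "D \<noteq> {}" for D
    unfolding Ind_def ind_def
  proof (intro allI impI notI)
    have bD: "base D" using W(1) D(2) by (rule base_subset)
    fix w :: "nat \<Rightarrow> 'u" and \<psi> k assume w: "range w \<subseteq> W" "Dfn D \<psi>" "\<psi> (e \<oplus> w)" "kdiv k D \<psi> w"
    from kdiv_absorb[OF bD D(3) w(2,4)] obtain d :: "nat \<Rightarrow> 'u" and \<theta> where
      d: "range d \<subseteq> D" "Dfn {} \<theta>" "\<forall>a. \<theta> (a \<oplus> (w \<oplus> d)) \<longleftrightarrow> \<psi> (a \<oplus> w)" "kdiv k D \<theta> (w \<oplus> d)"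
      by (elim exE conjE)
    define w' where "w' n = (w \<oplus> d) (from_nat n)" for n
    have rw: "range w' \<subseteq> W"
    proof -
      have "range w' \<subseteq> range (w \<oplus> d)" by (auto simp: w'_def)
      then show ?thesis using w(1) d(1) D(2) unfolding range_jn by blast
    qed
    have tw: "tup w'" using rw WU by (auto simp: tup_range)
    have ww: "(\<lambda>z. w' (to_nat z)) = w \<oplus> d" by (auto simp: w'_def)
    define \<theta>' where "\<theta>' z = \<theta> ((\<lambda>x :: 'x. z (Inl x)) \<oplus> (\<lambda>y :: nat + nat. z (Inr (to_nat y))))" for z
    have k': "kdiv k D \<theta>' w'"
      using kdiv_lift[OF bD _ tw, of "\<lambda>s z. s (to_nat z)" k \<theta>, OF rn_ren] d(4) unfolding ww \<theta>'_def by blast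
    have "Dfn {} \<theta>'" unfolding \<theta>'_def by (rule Dfn_rn'[OF d(2)]) (auto intro!: rn_jn[OF rn_ren rn_ren])
    then obtain \<chi> where \<chi>: "\<chi> \<in> formulas L (UNIV <+> {})"
      "\<forall>z. tup z \<longrightarrow> (\<theta>' z \<longleftrightarrow> sat S (case_sum z id) [] \<chi>)" unfolding Dfn_def by (elim bexE)
    have q: "(\<chi>, k) \<in> formulas L (UNIV <+> {}) \<times> UNIV" using \<chi>(1) by simp
    have "\<theta>' (e \<oplus> w')" using d(3) w(3) ww by (simp add: \<theta>'_def)
    then have "sat S (case_sum (e \<oplus> w') id) [] \<chi>" using \<chi>(2) e tw by simp
    then have no: "\<not> kdiv k (X (\<chi>, k)) (\<lambda>z. sat S (case_sum z id) [] \<chi>) w'"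
      using X(2)[OF q] rw by (simp add: good_def)
    have "kdiv k (X (\<chi>, k)) \<theta>' w'" using k' by (rule kdiv_mono) (use D(1) q in blast)
    then obtain bs where bs: "\<And>j. tup (bs j)" "\<And>j. eqt (X (\<chi>, k)) w' (bs j)" "kcon k \<theta>' bs UNIV"
      by (rule kdivE) blast
    have "kdiv k (X (\<chi>, k)) (\<lambda>z. sat S (case_sum z id) [] \<chi>) w'"
    proof (rule kdivI[OF bs(1,2)])
      show "kcon k (\<lambda>z. sat S (case_sum z id) [] \<chi>) bs UNIV"
        by (rule kcon_weaken[OF bs(3), where h="\<lambda>a. a"]) (simp add: \<chi>(2) bs(1))
    qed
    then show False using no by blast
  qed
  then show ?thesis using X(1) by blast
qed

end

section \<open>Elementary submodels and Skolem hulls\<close>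

text \<open>\<open>elem_sub\<close> speaks of variables indexed by natural numbers; the finitely
  many variables of \<open>\<phi>\<close> are renamed injectively.\<close>

lemma elem_sub_sat:
  fixes \<phi> :: "('f, 'r, 'v) fm" and s :: "'v \<Rightarrow> 'u"
  assumes e: "elem_sub L M N" and \<phi>: "\<phi> \<in> formulas L UNIV" and s: "\<And>v. v \<in> set_fm \<phi> \<Longrightarrow> s v \<in> Dom M"
  shows "sat M s [] \<phi> \<longleftrightarrow> sat N s [] \<phi>"
proof -
  obtain g :: "'v \<Rightarrow> nat" where g: "inj_on g (set_fm \<phi>)"
    using finite_imp_inj_to_nat_seg[of "set_fm \<phi>"] by auto
  have "Dom M \<noteq> {}" using e by (simp add: elem_sub_def structure_of_def)
  then obtain m0 where m0: "m0 \<in> Dom M" by blast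
  define s' where "s' n = (if n \<in> g ` set_fm \<phi> then s (inv_into (set_fm \<phi>) g n) else m0)" for n
  have "range s' \<subseteq> Dom M"
    using s m0 inv_into_into[of _ g "set_fm \<phi>"] by (auto simp: s'_def)
  moreover have "map_fm g \<phi> \<in> formulas L UNIV" by (rule map_formulas[OF \<phi>]) simp
  ultimately have "sat M s' [] (map_fm g \<phi>) \<longleftrightarrow> sat N s' [] (map_fm g \<phi>)"
    using e unfolding elem_sub_def by blast
  moreover have "sat S s' [] (map_fm g \<phi>) \<longleftrightarrow> sat S s [] \<phi>" for S :: "('f, 'r, 'u) struct"
    unfolding sat_map by (rule sat_cong) (simp add: s'_def g)
  ultimately show ?thesis by simp
qed

text \<open>Turns dangling bound variables into free ones, so that asking for a witness of a bound
  variable becomes a question about a definable predicate.\<close>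

fun ub_tm :: "nat \<Rightarrow> ('f, 'v) tm \<Rightarrow> ('f, 'v + nat) tm" where
  "ub_tm d (Free v) = Free (Inl v)"
| "ub_tm d (Bound i) = (if i < d then Bound i else Free (Inr (i - d)))"
| "ub_tm d (App f ts) = App f (map (ub_tm d) ts)"

fun ub_fm :: "nat \<Rightarrow> ('f, 'r, 'v) fm \<Rightarrow> ('f, 'r, 'v + nat) fm" where
  "ub_fm d (Eql s t) = Eql (ub_tm d s) (ub_tm d t)"
| "ub_fm d (Rel R ts) = Rel R (map (ub_tm d) ts)"
| "ub_fm d (Neg \<phi>) = Neg (ub_fm d \<phi>)"
| "ub_fm d (Conj \<phi> \<psi>) = Conj (ub_fm d \<phi>) (ub_fm d \<psi>)"
| "ub_fm d (Exist \<phi>) = Exist (ub_fm (Suc d) \<phi>)"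

lemma val_ub: "val S (case_sum s (\<lambda>i. e2 ! i)) e1 (ub_tm (length e1) t) = val S s (e1 @ e2) t"
  by (induction t) (auto simp: nth_append intro!: arg_cong[where f="FunI S _"])

lemma sat_ub: "sat S (case_sum s (\<lambda>i. e2 ! i)) e1 (ub_fm (length e1) \<phi>) = sat S s (e1 @ e2) \<phi>"
proof (induction \<phi> arbitrary: e1)
  case (Rel R ts)
  have "map (val S (case_sum s (\<lambda>i. e2 ! i)) e1) (map (ub_tm (length e1)) ts) = map (val S s (e1 @ e2)) ts"
    by (simp add: val_ub)
  then show ?case by (simp only: ub_fm.simps sat.simps)
next
  case (Exist \<phi>)
  have "sat S (case_sum s (\<lambda>i. e2 ! i)) (x # e1) (ub_fm (Suc (length e1)) \<phi>) = sat S s (x # e1 @ e2) \<phi>" for x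
    using Exist[of "x # e1"] by simp
  then show ?case by simp
qed (simp_all add: val_ub)

lemma wf_ub_tm: "wf_tm L k t \<Longrightarrow> wf_tm L d (ub_tm d t)"
  by (induction t) auto

lemma wf_ub_fm: "wf_fm L k \<phi> \<Longrightarrow> wf_fm L d (ub_fm d \<phi>)"
  by (induction \<phi> arbitrary: k d) (auto simp: wf_ub_tm)

lemma set_ub_tm: "wf_tm L (d + k) t \<Longrightarrow> set_tm (ub_tm d t) \<subseteq> UNIV <+> {..<k}"
  by (induction t) auto

lemma set_ub_fm: "wf_fm L (d + k) \<phi> \<Longrightarrow> set_fm (ub_fm d \<phi>) \<subseteq> UNIV <+> {..<k}"
proof (induction \<phi> arbitrary: d)
  case (Eql s t)
  then show ?case using set_ub_tm[of L d k s] set_ub_tm[of L d k t] by auto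
next
  case (Rel R ts)
  then show ?case using set_ub_tm[of L d k] by fastforce
next
  case (Conj \<phi>1 \<phi>2)
  then show ?case by simp
qed auto

text \<open>Formulas whose dangling bound variables are arbitrary; the value of a Skolem function at a
  list of arguments is a witness for the outermost dangling variable.\<close>

definition all_fms :: "('f, 'r) lang \<Rightarrow> ('f, 'r, nat) fm set" where
  "all_fms L = {\<phi>. \<exists>k. wf_fm L k \<phi>}"

text \<open>One argument list encodes both kinds of variables: its first \<open>k\<close> entries
  are the bound environment, the rest the values of free variables, with the head as
  default.\<close>

definition env_of :: "'u list \<Rightarrow> nat \<Rightarrow> nat \<Rightarrow> 'u" where
  "env_of ds k i = (if k + i < length ds then ds ! (k + i) else hd ds)"

lemma env_of_mem: "ds \<noteq> [] \<Longrightarrow> env_of ds k i \<in> set ds"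
  by (simp add: env_of_def)

definition skolem_closed :: "('f, 'r) lang \<Rightarrow> ('f, 'r, 'u) struct \<Rightarrow> 'u set \<Rightarrow> bool" where
  "skolem_closed L S X \<longleftrightarrow> (\<forall>\<phi> k ds. wf_fm L (Suc k) \<phi> \<longrightarrow> k \<le> length ds \<longrightarrow> ds \<noteq> [] \<longrightarrow> set ds \<subseteq> X \<longrightarrow>
    (\<exists>u \<in> Dom S. sat S (env_of ds k) (u # take k ds) \<phi>) \<longrightarrow>
    (\<exists>u \<in> X. sat S (env_of ds k) (u # take k ds) \<phi>))"

lemma skolem_closedD:
  fixes s :: "nat \<Rightarrow> 'u"
  assumes c: "skolem_closed L S X" and \<phi>: "wf_fm L (Suc (length e)) \<phi>" and e: "set e \<subseteq> X" "range s \<subseteq> X"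
    and u: "u \<in> Dom S" "sat S s (u # e) \<phi>"
  shows "\<exists>u \<in> X. sat S s (u # e) \<phi>"
proof -
  obtain n where n: "\<And>i. i \<in> set_fm \<phi> \<Longrightarrow> i < n"
    using finite_set_fm[of \<phi>] by (metis finite_nat_set_iff_bounded)
  define ds where "ds = e @ map s [0..<Suc n]"
  have ds: "ds \<noteq> []" "set ds \<subseteq> X" "length e \<le> length ds" "take (length e) ds = e"
    using e by (auto simp: ds_def)
  have "env_of ds (length e) i = s i" if "i \<in> set_fm \<phi>" for i
    using n[OF that] unfolding env_of_def ds_def by (simp add: nth_append del: upt_Suc)
  then have *: "sat S (env_of ds (length e)) (u # e) \<phi> = sat S s (u # e) \<phi>" for u
    by (intro sat_cong)
  have "\<exists>u \<in> Dom S. sat S (env_of ds (length e)) (u # take (length e) ds) \<phi>"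
    unfolding ds(4) * using u by blast
  with c[unfolded skolem_closed_def, rule_format, OF \<phi> ds(3,1,2)]
  have "\<exists>u \<in> X. sat S (env_of ds (length e)) (u # take (length e) ds) \<phi>" by blast
  then show ?thesis unfolding ds(4) * .
qed

lemma val_Dom: "val (S\<lparr>Dom := X\<rparr>) s e t = val S s e t"
  by (induction t) (auto intro!: arg_cong[where f="FunI S _"])

lemma skolem_elem_sub:
  fixes S :: "('f, 'r, 'u) struct"
  assumes S: "structure_of L S" and X: "X \<subseteq> Dom S" "X \<noteq> {}" and c: "skolem_closed L S X"
  shows "elem_sub L (S\<lparr>Dom := X\<rparr>) S"
proof -
  have sat: "set e \<subseteq> X \<Longrightarrow> range s \<subseteq> X \<Longrightarrow> wf_fm L (length e) \<phi> \<Longrightarrow>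
      sat (S\<lparr>Dom := X\<rparr>) s e \<phi> = sat S s e \<phi>" for s :: "nat \<Rightarrow> 'u" and e \<phi>
  proof (induction \<phi> arbitrary: e)
    case (Exist \<phi>)
    have "(\<exists>u \<in> X. sat S s (u # e) \<phi>) = (\<exists>u \<in> Dom S. sat S s (u # e) \<phi>)"
      using skolem_closedD[OF c _ Exist.prems(1,2)] Exist.prems(3) X(1) by auto
    moreover have "sat (S\<lparr>Dom := X\<rparr>) s (u # e) \<phi> = sat S s (u # e) \<phi>" if "u \<in> X" for u
      using Exist that by simp
    ultimately show ?case by simp
  next
    case (Rel R ts)
    have "map (val (S\<lparr>Dom := X\<rparr>) s e) ts = map (val S s e) ts" by (simp add: val_Dom)
    then show ?case by (simp only: sat.simps) simp
  qed (auto simp: val_Dom)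
  have "structure_of L (S\<lparr>Dom := X\<rparr>)" unfolding structure_of_def
  proof (intro conjI ballI allI impI)
    fix f us assume f: "f \<in> Funs L" "length us = far L f" "set us \<subseteq> Dom (S\<lparr>Dom := X\<rparr>)"
    \<comment> \<open>The value of \<open>f\<close> at \<open>us\<close> is the only witness of
      \<open>x = f(us)\<close>, so Skolem closure also gives closure under functions.\<close>
    define \<phi> :: "('f, 'r, nat) fm" where
      "\<phi> = Eql (Bound 0) (App f (map (\<lambda>i. Bound (Suc i)) [0..<length us]))"
    have wf: "wf_fm L (Suc (length us)) \<phi>" using f by (auto simp: \<phi>_def)
    have "map ((!) us) [0..<length us] = us" by (rule map_nth)
    then have val: "sat S s (u # us) \<phi> \<longleftrightarrow> u = FunI S f us" for u s
      by (simp add: \<phi>_def comp_def)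
    obtain x where x: "x \<in> X" using X(2) by blast
    have "FunI S f us \<in> Dom S" using S f X(1) by (auto simp: structure_of_def)
    then have "\<exists>u \<in> X. sat S (\<lambda>_. x) (u # us) \<phi>"
      using f(3) x val by (intro skolem_closedD[OF c wf]) auto
    then show "FunI (S\<lparr>Dom := X\<rparr>) f us \<in> Dom (S\<lparr>Dom := X\<rparr>)" using val by simp
  qed (use X in simp)
  then show ?thesis unfolding elem_sub_def
    using S X(1) sat[of "[]"] by (auto simp: formulas_def)
qed

context simple_monster
begin

lemma elem_mod:
  assumes e: "elem_sub L M S"
  shows "is_mod (Dom M)"
proof -
  have D: "Dom M \<subseteq> U" "Dom M \<noteq> {}" using e by (auto simp: elem_sub_def structure_of_def)
  obtain m0 where m0: "m0 \<in> Dom M" using D(2) by blast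
  have "\<exists>a. range a \<subseteq> Dom M \<and> P a" if P: "Dfn (Dom M) P" and a: "tup a" "P a" for P and a :: "nat \<Rightarrow> 'u"
  proof -
    from P obtain \<phi> where \<phi>: "\<phi> \<in> formulas L (UNIV <+> Dom M)"
      "\<forall>a. tup a \<longrightarrow> (P a \<longleftrightarrow> sat S (case_sum a id) [] \<phi>)" unfolding Dfn_def by (elim bexE)
    define V where "V = set_fm \<phi> \<inter> range Inl"
    have "finite V" by (simp add: V_def)
    from ex_block[OF this formulas_set_fm[OF \<phi>(1)]]
    obtain \<psi> where \<psi>: "\<psi> \<in> formulas L (set_fm \<phi> - V)"
      and sat: "\<And>(S :: ('f, 'r, 'u) struct) s. sat S s [] \<psi> \<longleftrightarrow>
        (\<exists>t. (\<forall>v. v \<notin> V \<longrightarrow> t v = s v) \<and> (\<forall>v \<in> V. t v \<in> Dom S) \<and> sat S t [] \<phi>)"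
      by (elim bexE) blast
    have \<psi>M: "set_fm \<psi> \<subseteq> Inr ` Dom M"
    proof
      fix z assume "z \<in> set_fm \<psi>"
      then have z: "z \<in> set_fm \<phi>" "z \<notin> V" "z \<in> UNIV <+> Dom M" using \<psi> \<phi>(1) by (auto simp: formulas_def)
      then show "z \<in> Inr ` Dom M" by (cases z rule: sum.exhaust) (auto simp: V_def)
    qed
    have "sat S (case_sum a id) [] \<psi>" unfolding sat
      using \<phi>(2) a by (intro exI[of _ "case_sum a id"]) (auto simp: V_def tup_def)
    moreover have "\<psi> \<in> formulas L UNIV" using \<psi> by (simp add: formulas_def)
    ultimately have "sat M (case_sum a id) [] \<psi>"
      by (intro iffD2[OF elem_sub_sat[OF e]]) (use \<psi>M in auto)
    then obtain t where t: "\<forall>v. v \<notin> V \<longrightarrow> t v = case_sum a id v" "\<forall>v \<in> V. t v \<in> Dom M" "sat M t [] \<phi>"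
      unfolding sat by blast
    define a' where "a' i = (if Inl i \<in> V then t (Inl i) else m0)" for i
    have ta: "t v = case_sum a' id v" "t v \<in> Dom M" if "v \<in> set_fm \<phi>" for v
    proof -
      have v: "v \<in> UNIV <+> Dom M" using that \<phi>(1) by (auto simp: formulas_def)
      have "t v = case_sum a' id v \<and> t v \<in> Dom M"
      proof (cases "v \<in> V")
        case True
        then show ?thesis using t(2) by (auto simp: V_def a'_def)
      next
        case False
        with v that obtain b where "v = Inr b" "b \<in> Dom M" by (auto simp: V_def)
        then show ?thesis using t(1) False by simp
      qed
      then show "t v = case_sum a' id v" "t v \<in> Dom M" by blast+
    qed
    have "\<phi> \<in> formulas L UNIV" using \<phi>(1) by (simp add: formulas_def)
    then have "sat S t [] \<phi>" using t(3) elem_sub_sat[OF e, of \<phi> t] ta(2) by blast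
    then have "sat S (case_sum a' id) [] \<phi>" using sat_cong[of \<phi> t "case_sum a' id"] ta(1) by blast
    moreover have r: "range a' \<subseteq> Dom M" using t(2) m0 by (auto simp: a'_def)
    moreover have "tup a'" using r D(1) by (auto simp: tup_range)
    ultimately show ?thesis using \<phi>(2) by blast
  qed
  then show ?thesis using D unfolding is_mod_def by blast
qed

lemma mod_skolem:
  assumes M: "is_mod M"
  shows "skolem_closed L S M"
  unfolding skolem_closed_def
proof (intro allI impI)
  fix \<phi> :: "('f, 'r, nat) fm" and k ds
  assume \<phi>: "wf_fm L (Suc k) \<phi>" and ds: "k \<le> length ds" "ds \<noteq> []" "set ds \<subseteq> M"
    and ex: "\<exists>u \<in> U. sat S (env_of ds k) (u # take k ds) \<phi>"
  let ?e = "take k ds"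
  have len: "length ?e = k" using ds(1) by simp
  define g :: "nat + nat \<Rightarrow> nat + 'u" where
    "g = case_sum (\<lambda>v. Inr (env_of ds k v)) (case_nat (Inl 0) (\<lambda>i. Inr (?e ! i)))"
  define \<chi> where "\<chi> = map_fm g (ub_fm 0 \<phi>)"
  have s: "sat S (case_sum a id) [] \<chi> \<longleftrightarrow> sat S (env_of ds k) (a 0 # ?e) \<phi>" for a
  proof -
    have "case_sum a id \<circ> g = case_sum (env_of ds k) (\<lambda>i. (a 0 # ?e) ! i)"
      by (auto simp: g_def fun_eq_iff nth_Cons split: sum.split nat.split)
    then show ?thesis
      unfolding \<chi>_def sat_map using sat_ub[of S "env_of ds k" "a 0 # ?e" "[]" \<phi>] by simp
  qed
  have "\<chi> \<in> formulas L (UNIV <+> M)" unfolding \<chi>_def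
  proof (rule map_formulas)
    show "ub_fm 0 \<phi> \<in> formulas L (UNIV <+> {..<Suc k})"
      using set_ub_fm[of L 0 "Suc k" \<phi>] wf_ub_fm[OF \<phi>, of 0] \<phi> by (simp add: formulas_def)
    have "?e ! i \<in> M" if "i < k" for i
      using that ds(3) len by (metis in_mono in_set_takeD nth_mem)
    moreover have "env_of ds k v \<in> M" for v using env_of_mem[OF ds(2)] ds(3) by blast
    ultimately have "g z \<in> UNIV <+> M" if "z \<in> UNIV <+> {..<Suc k}" for z
      using that by (auto simp: g_def split: nat.split)
    moreover have "set_fm (ub_fm 0 \<phi>) \<subseteq> UNIV <+> {..<Suc k}"
      using set_ub_fm[of L 0 "Suc k" \<phi>] \<phi> by simp
    ultimately show "g ` set_fm (ub_fm 0 \<phi>) \<subseteq> UNIV <+> M" by blast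
  qed
  then have D: "Dfn M (\<lambda>a. sat S (case_sum a id) [] \<chi>)" by (rule Dfn_sat)
  from ex obtain u where u: "u \<in> U" "sat S (env_of ds k) (u # ?e) \<phi>" by blast
  have "\<exists>a. range a \<subseteq> M \<and> sat S (case_sum a id) [] \<chi>"
    by (rule mod_ex[OF M D, of "\<lambda>_. u"]) (use u s in \<open>simp_all add: tup_def\<close>)
  then obtain a where "range a \<subseteq> M" "sat S (case_sum a id) [] \<chi>" by blast
  then show "\<exists>u \<in> M. sat S (env_of ds k) (u # ?e) \<phi>" unfolding s by blast
qed

lemma skolem_mod:
  assumes "X \<subseteq> U" "X \<noteq> {}" "skolem_closed L S X"
  shows "is_mod X"
  using elem_mod[OF skolem_elem_sub[OF struc assms]] by simp

end


section \<open>Closures and cardinalities\<close>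

inductive_set cl :: "('a list \<Rightarrow> 'a set) \<Rightarrow> 'a set \<Rightarrow> 'a set" for F X where
  cl_base: "x \<in> X \<Longrightarrow> x \<in> cl F X"
| cl_step: "(\<And>d. d \<in> set ds \<Longrightarrow> d \<in> cl F X) \<Longrightarrow> u \<in> F ds \<Longrightarrow> u \<in> cl F X"

lemma cl_least: "X \<subseteq> Y \<Longrightarrow> (\<And>ds. set ds \<subseteq> Y \<Longrightarrow> F ds \<subseteq> Y) \<Longrightarrow> cl F X \<subseteq> Y"
proof
  fix u assume XY: "X \<subseteq> Y" "\<And>ds. set ds \<subseteq> Y \<Longrightarrow> F ds \<subseteq> Y" and u: "u \<in> cl F X"
  from u show "u \<in> Y"
  proof induction
    case (cl_step ds u)
    have "set ds \<subseteq> Y" using cl_step.IH by (rule subsetI)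
    from subsetD[OF XY(2)[OF this] cl_step.hyps(2)] show ?case .
  next
    case (cl_base x)
    with XY(1) show ?case by (rule subsetD)
  qed
qed

lemma cl_subset: "X \<subseteq> cl F X"
  by (auto intro: cl_base)

lemma cl_closed: "set ds \<subseteq> cl F X \<Longrightarrow> F ds \<subseteq> cl F X"
  by (auto intro: cl_step)

lemma cl_mono: "X \<subseteq> Y \<Longrightarrow> cl F X \<subseteq> cl F Y"
  by (rule cl_least) (blast intro: cl_base, rule cl_closed)

lemma cl_finite: "u \<in> cl F X \<Longrightarrow> \<exists>X0 \<subseteq> X. finite X0 \<and> u \<in> cl F X0"
proof (induction rule: cl.induct)
  case (cl_base x)
  then show ?case by (intro exI[of _ "{x}"]) (auto intro: cl.cl_base)
next
  case (cl_step ds u)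
  have "\<forall>d \<in> set ds. \<exists>X0. X0 \<subseteq> X \<and> finite X0 \<and> d \<in> cl F X0" by (rule ballI) (rule cl_step.IH)
  then obtain Y where Y: "\<forall>d \<in> set ds. Y d \<subseteq> X \<and> finite (Y d) \<and> d \<in> cl F (Y d)"
    by (rule bchoice[THEN exE])
  have "cl F (Y d) \<subseteq> cl F (\<Union>d \<in> set ds. Y d)" if "d \<in> set ds" for d
    using that by (intro cl_mono) blast
  then have "set ds \<subseteq> cl F (\<Union>d \<in> set ds. Y d)" using Y by blast
  from subsetD[OF cl_closed[OF this] cl_step.hyps(2)] have "u \<in> cl F (\<Union>d \<in> set ds. Y d)" .
  then show ?case using Y by (intro exI[of _ "\<Union>d \<in> set ds. Y d"]) auto
qed

lemma finite_ordLeq_infinite: "finite A \<Longrightarrow> infinite Z \<Longrightarrow> |A| \<le>o |Z|"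
  using ordLeq_total[OF card_of_Well_order card_of_Well_order] card_of_ordLeq_finite by blast

lemma Times_ordLeq_infinite: "infinite Z \<Longrightarrow> |A| \<le>o |Z| \<Longrightarrow> |B| \<le>o |Z| \<Longrightarrow> |A \<times> B| \<le>o |Z|"
  by (rule card_of_Sigma_ordLeq_infinite) auto

lemma Un_ordLeq_infinite:
  assumes "infinite Z" "|A| \<le>o |Z|" "|B| \<le>o |Z|"
  shows "|A \<union> B| \<le>o |Z|"
proof -
  have "|\<Union>b \<in> UNIV. if b then A else B| \<le>o |Z|"
    by (rule card_of_UNION_ordLeq_infinite) (use assms in \<open>simp_all add: finite_ordLeq_infinite\<close>)
  then show ?thesis by (simp add: UNIV_bool Un_commute)
qed

lemma nat_ordLeq: "infinite Z \<Longrightarrow> |UNIV :: nat set| \<le>o |Z|"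
  by (simp add: infinite_iff_card_of_nat)

lemma card_lists:
  assumes Z: "infinite Z" and A: "|A| \<le>o |Z|"
  shows "|lists A| \<le>o |Z|"
proof -
  have "|{xs \<in> lists A. length xs = n}| \<le>o |Z|" for n
  proof (induction n)
    case 0
    have "{xs \<in> lists A. length xs = 0} = {[]}" by auto
    then have "finite {xs \<in> lists A. length xs = 0}" by simp
    then show ?case using Z by (rule finite_ordLeq_infinite)
  next
    case (Suc n)
    have "{xs \<in> lists A. length xs = Suc n} \<subseteq> (\<lambda>(x, xs). x # xs) ` (A \<times> {xs \<in> lists A. length xs = n})"
      by (auto simp: length_Suc_conv image_iff)
    then have "|{xs \<in> lists A. length xs = Suc n}| \<le>o |(\<lambda>(x, xs). x # xs) ` (A \<times> {xs \<in> lists A. length xs = n})|"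
      by (rule card_of_mono1)
    also have "|(\<lambda>(x, xs). x # xs) ` (A \<times> {xs \<in> lists A. length xs = n})| \<le>o |A \<times> {xs \<in> lists A. length xs = n}|"
      by (rule card_of_image)
    also have "|A \<times> {xs \<in> lists A. length xs = n}| \<le>o |Z|" using Times_ordLeq_infinite[OF Z A Suc] .
    finally show ?case .
  qed
  moreover have "lists A = (\<Union>n. {xs \<in> lists A. length xs = n})" by auto
  ultimately show ?thesis
    using card_of_UNION_ordLeq_infinite[OF Z nat_ordLeq[OF Z], of "\<lambda>n. {xs \<in> lists A. length xs = n}"] by simp
qed

lemma card_cl:
  assumes Z: "infinite Z" and X: "|X| \<le>o |Z|" and F: "\<And>ds. |F ds| \<le>o |Z|"
  shows "|cl F X| \<le>o |Z|"
proof -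
  define st where "st = rec_nat X (\<lambda>_ Y. Y \<union> (\<Union>ds \<in> lists Y. F ds))"
  have st: "st 0 = X" "\<And>n. st (Suc n) = st n \<union> (\<Union>ds \<in> lists (st n). F ds)" by (simp_all add: st_def)
  have card: "|st n| \<le>o |Z|" for n
  proof (induction n)
    case (Suc n)
    have "|\<Union>ds \<in> lists (st n). F ds| \<le>o |Z|"
      using card_of_UNION_ordLeq_infinite[OF Z card_lists[OF Z Suc]] F by blast
    then show ?case unfolding st(2) using Suc Un_ordLeq_infinite[OF Z] by blast
  qed (simp add: st X)
  have mono: "n \<le> m \<Longrightarrow> st n \<subseteq> st m" for n m
    by (rule lift_Suc_mono_le[of st]) (auto simp: st)
  have "cl F X \<subseteq> (\<Union>n. st n)"
  proof (rule cl_least)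
    show "X \<subseteq> (\<Union>n. st n)" using st(1) by blast
    fix ds assume ds: "set ds \<subseteq> (\<Union>n. st n)"
    have "\<exists>n. set ds \<subseteq> st n" using ds
    proof (induction ds)
      case (Cons d ds)
      then obtain n m where "set ds \<subseteq> st n" "d \<in> st m" by auto
      then have "set (d # ds) \<subseteq> st (max n m)" using mono[of n "max n m"] mono[of m "max n m"] by auto
      then show ?case by blast
    qed simp
    then obtain n where "set ds \<subseteq> st n" by blast
    then have "F ds \<subseteq> st (Suc n)" unfolding st(2) by auto
    then show "F ds \<subseteq> (\<Union>n. st n)" by blast
  qed
  then have "|cl F X| \<le>o |\<Union>n. st n|" by (rule card_of_mono1)
  also have "|\<Union>n. st n| \<le>o |Z|" using card_of_UNION_ordLeq_infinite[OF Z nat_ordLeq[OF Z]] card by blast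
  finally show ?thesis .
qed

text \<open>A formula over \<open>V\<close> is determined by a formula in numbered variables and the
  list of elements put for them.\<close>

lemma card_formulas:
  fixes V :: "'v set" and L :: "('f, 'r) lang"
  assumes Z: "infinite Z" and V: "|V| \<le>o |Z|" and L: "|all_fms L| \<le>o |Z|"
  shows "|formulas L V| \<le>o |Z|"
proof -
  have "formulas L V \<subseteq> (\<lambda>(\<psi>, vs). map_fm ((!) vs) \<psi>) ` (all_fms L \<times> lists V)"
  proof
    fix \<phi> assume \<phi>: "\<phi> \<in> formulas L V"
    obtain vs where vs: "set vs = set_fm \<phi>" by (rule exE[OF finite_list[OF finite_set_fm[of \<phi>]]])
    define ix where "ix v = (SOME i. i < length vs \<and> vs ! i = v)" for v
    have ix: "vs ! ix v = v" if "v \<in> set_fm \<phi>" for v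
    proof -
      have "\<exists>i. i < length vs \<and> vs ! i = v" using that unfolding vs[symmetric] by (simp add: in_set_conv_nth)
      from someI_ex[OF this] show ?thesis by (simp add: ix_def)
    qed
    have "map_fm ((!) vs) (map_fm ix \<phi>) = map_fm (\<lambda>v. vs ! ix v) \<phi>" by (simp add: fm.map_comp comp_def)
    also have "\<dots> = map_fm id \<phi>" by (rule fm.map_cong0) (simp add: ix)
    finally have "\<phi> = map_fm ((!) vs) (map_fm ix \<phi>)" by (simp add: fm.map_id)
    moreover have "map_fm ix \<phi> \<in> all_fms L" using \<phi> by (auto simp: all_fms_def formulas_def wf_fm_map)
    moreover have "vs \<in> lists V" using vs \<phi> by (auto simp: formulas_def)
    ultimately show "\<phi> \<in> (\<lambda>(\<psi>, vs). map_fm ((!) vs) \<psi>) ` (all_fms L \<times> lists V)" by (intro image_eqI[of _ _ "(map_fm ix \<phi>, vs)"]) auto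
  qed
  then have "|formulas L V| \<le>o |(\<lambda>(\<psi>, vs). map_fm ((!) vs) \<psi>) ` (all_fms L \<times> lists V)|"
    by (rule card_of_mono1)
  also have "|(\<lambda>(\<psi>, vs). map_fm ((!) vs) \<psi>) ` (all_fms L \<times> lists V)| \<le>o |all_fms L \<times> lists V|" by (rule card_of_image)
  also have "|all_fms L \<times> lists V| \<le>o |Z|" by (rule Times_ordLeq_infinite[OF Z L card_lists[OF Z V]])
  finally show ?thesis .
qed

text \<open>Turns formulas injectively into sentences: free variables become dangling bound variables
  with even indices, the dangling ones get odd indices, and then all are quantified.\<close>

fun fr_tm :: "nat \<Rightarrow> ('f, nat) tm \<Rightarrow> ('f, nat) tm" where
  "fr_tm d (Free i) = Bound (d + 2 * i)"
| "fr_tm d (Bound j) = (if j < d then Bound j else Bound (d + 2 * (j - d) + 1))"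
| "fr_tm d (App f ts) = App f (map (fr_tm d) ts)"

fun fr_fm :: "nat \<Rightarrow> ('f, 'r, nat) fm \<Rightarrow> ('f, 'r, nat) fm" where
  "fr_fm d (Eql s t) = Eql (fr_tm d s) (fr_tm d t)"
| "fr_fm d (Rel R ts) = Rel R (map (fr_tm d) ts)"
| "fr_fm d (Neg \<phi>) = Neg (fr_fm d \<phi>)"
| "fr_fm d (Conj \<phi> \<psi>) = Conj (fr_fm d \<phi>) (fr_fm d \<psi>)"
| "fr_fm d (Exist \<phi>) = Exist (fr_fm (Suc d) \<phi>)"

lemma fr_tm_inj: "fr_tm d t = fr_tm d t' \<Longrightarrow> t = t'"
proof (induction t arbitrary: t')
  case (Free i)
  then show ?case by (cases t') (auto split: if_splits, presburger)
next
  case (Bound j)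
  then show ?case by (cases t') (auto split: if_splits, presburger+)
next
  case (App f ts)
  then obtain ts' where t': "t' = App f ts'" "map (fr_tm d) ts = map (fr_tm d) ts'"
    by (cases t') (auto split: if_splits)
  have "ts = ts'"
  proof (rule nth_equalityI)
    show len: "length ts = length ts'" using t'(2) by (metis length_map)
    show "ts ! i = ts' ! i" if "i < length ts" for i
      using App.IH[OF nth_mem[OF that], of "ts' ! i"] t'(2) that len by (metis nth_map)
  qed
  then show ?case using t' by simp
qed

lemma map_fr_tm_inj: "map (fr_tm d) ts = map (fr_tm d) ts' \<Longrightarrow> ts = ts'"
  using fr_tm_inj by (metis inj_onI map_inj_on)

lemma fr_fm_inj: "fr_fm d \<phi> = fr_fm d \<phi>' \<Longrightarrow> \<phi> = \<phi>'"
proof (induction \<phi> arbitrary: d \<phi>')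
  case (Eql s t)
  then show ?case by (cases \<phi>') (auto dest: fr_tm_inj)
next
  case (Rel R ts)
  then show ?case by (cases \<phi>') (auto dest: map_fr_tm_inj)
next
  case (Neg \<phi>)
  then show ?case by (cases \<phi>') auto
next
  case (Conj \<phi>1 \<phi>2)
  then show ?case by (cases \<phi>') auto
next
  case (Exist \<phi>)
  then show ?case by (cases \<phi>') auto
qed

lemma set_fr_tm [simp]: "set_tm (fr_tm d t) = {}"
  by (induction t) auto

lemma set_fr_fm [simp]: "set_fm (fr_fm d \<phi>) = {}"
  by (induction \<phi> arbitrary: d) auto

lemma wf_fr_tm: "wf_tm L k t \<Longrightarrow> \<exists>K. \<forall>K' \<ge> K. wf_tm L K' (fr_tm d t)"
proof (induction t)
  case (Free i)
  show ?case by (rule exI[of _ "Suc (d + 2 * i)"]) auto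
next
  case (Bound j)
  show ?case by (rule exI[of _ "Suc (j + d + 2 * (j - d) + 1)"]) auto
next
  case (App f ts)
  then have "\<forall>t \<in> set ts. \<exists>K. \<forall>K' \<ge> K. wf_tm L K' (fr_tm d t)" by auto
  then obtain K where K: "\<forall>t \<in> set ts. \<forall>K' \<ge> K t. wf_tm L K' (fr_tm d t)" by (rule bchoice[THEN exE])
  have "K t \<le> (\<Sum>t \<in> set ts. K t)" if "t \<in> set ts" for t using that by (intro member_le_sum) auto
  then have "\<forall>K' \<ge> \<Sum>t \<in> set ts. K t. \<forall>t \<in> set ts. wf_tm L K' (fr_tm d t)" using K le_trans by blast
  then show ?case using App.prems by (intro exI[of _ "\<Sum>t \<in> set ts. K t"]) simp
qed

lemma wf_fr_fm: "wf_fm L k \<phi> \<Longrightarrow> \<exists>K. \<forall>K' \<ge> K. wf_fm L K' (fr_fm d \<phi>)"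
proof (induction \<phi> arbitrary: k d)
  case (Eql s t)
  then obtain K1 K2 where "\<forall>K' \<ge> K1. wf_tm L K' (fr_tm d s)" "\<forall>K' \<ge> K2. wf_tm L K' (fr_tm d t)"
    using wf_fr_tm by (metis wf_fm.simps(1))
  then show ?case by (intro exI[of _ "max K1 K2"]) auto
next
  case (Rel R ts)
  then have "\<forall>t \<in> set ts. \<exists>K. \<forall>K' \<ge> K. wf_tm L K' (fr_tm d t)" using wf_fr_tm by (metis wf_fm.simps(2))
  then obtain K where K: "\<forall>t \<in> set ts. \<forall>K' \<ge> K t. wf_tm L K' (fr_tm d t)" by (rule bchoice[THEN exE])
  have "K t \<le> (\<Sum>t \<in> set ts. K t)" if "t \<in> set ts" for t using that by (intro member_le_sum) auto
  then have "\<forall>K' \<ge> \<Sum>t \<in> set ts. K t. \<forall>t \<in> set ts. wf_tm L K' (fr_tm d t)" using K le_trans by blast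
  then show ?case using Rel by (intro exI[of _ "\<Sum>t \<in> set ts. K t"]) simp
next
  case (Neg \<phi>)
  then show ?case by simp
next
  case (Conj \<phi>1 \<phi>2)
  then obtain K1 K2 where "\<forall>K' \<ge> K1. wf_fm L K' (fr_fm d \<phi>1)" "\<forall>K' \<ge> K2. wf_fm L K' (fr_fm d \<phi>2)"
    by (metis wf_fm.simps(4))
  then show ?case by (intro exI[of _ "max K1 K2"]) auto
next
  case (Exist \<phi>)
  then obtain K where "\<forall>K' \<ge> K. wf_fm L K' (fr_fm (Suc d) \<phi>)" by (metis wf_fm.simps(5))
  then show ?case by (intro exI[of _ K]) auto
qed

text \<open>The conjunction marks the end of the quantifier prefix, so \<open>a\<close> is recovered
  without knowing the length of the prefix.\<close>

lemma Exist_pow_inj: "(Exist ^^ m) (Conj a a) = (Exist ^^ n) (Conj b b) \<Longrightarrow> a = b"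
proof (induction m arbitrary: n)
  case 0
  then show ?case by (cases n) auto
next
  case (Suc m)
  then show ?case by (cases n) auto
qed

lemma wf_Exist_pow: "wf_fm L d ((Exist ^^ m) \<phi>) \<longleftrightarrow> wf_fm L (d + m) \<phi>"
  by (induction m arbitrary: d) auto

lemma set_Exist_pow: "set_fm ((Exist ^^ m) \<phi>) = set_fm \<phi>"
  by (induction m) auto

text \<open>Formulas are coded injectively by sentences \<open>g \<phi>\<close>, and a complete
  theory contains \<open>g \<phi>\<close> or its negation; as no \<open>g \<phi>\<close> is a
  negation, this choice stays injective. It turns \<open>|T| <o \<kappa>\<close> into a bound on the
  number of formulas.\<close>

lemma card_all_fms:
  fixes L :: "('f, 'r) lang"
  assumes T: "complete_theory L T"
  shows "|all_fms L| \<le>o |T|"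
proof -
  have "\<forall>\<phi> :: ('f, 'r, nat) fm. \<exists>K. \<phi> \<in> all_fms L \<longrightarrow> wf_fm L K (fr_fm 0 \<phi>)"
  proof
    fix \<phi> :: "('f, 'r, nat) fm"
    show "\<exists>K. \<phi> \<in> all_fms L \<longrightarrow> wf_fm L K (fr_fm 0 \<phi>)"
    proof (cases "\<phi> \<in> all_fms L")
      case True
      then obtain k where "wf_fm L k \<phi>" by (auto simp: all_fms_def)
      from wf_fr_fm[OF this, of 0] show ?thesis by blast
    qed simp
  qed
  then obtain K where K: "\<forall>\<phi>. \<phi> \<in> all_fms L \<longrightarrow> wf_fm L (K \<phi>) (fr_fm 0 \<phi>)" by (rule choice[THEN exE])
  define g where "g \<phi> = (Exist ^^ K \<phi>) (Conj (fr_fm 0 \<phi>) (fr_fm 0 \<phi>))" for \<phi>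
  have g_inj: "\<phi> = \<psi>" if "g \<phi> = g \<psi>" for \<phi> \<psi>
    using Exist_pow_inj that fr_fm_inj unfolding g_def by blast
  have g_Neg: "g \<phi> \<noteq> Neg \<psi>" for \<phi> \<psi> by (cases "K \<phi>") (auto simp: g_def)
  have g_sen: "g \<phi> \<in> formulas L {}" if "\<phi> \<in> all_fms L" for \<phi>
    using K that by (simp add: g_def formulas_def wf_Exist_pow set_Exist_pow)
  define t where "t \<phi> = (if g \<phi> \<in> T then g \<phi> else Neg (g \<phi>))" for \<phi>
  have "inj_on t (all_fms L)"
  proof (rule inj_onI)
    fix \<phi> \<psi> assume "t \<phi> = t \<psi>"
    then have "g \<phi> = g \<psi>" using g_Neg by (auto simp: t_def split: if_splits) (metis g_Neg)+
    then show "\<phi> = \<psi>" by (rule g_inj)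
  qed
  moreover have "t ` all_fms L \<subseteq> T"
  proof (rule image_subsetI)
    fix \<phi> :: "('f, 'r, nat) fm" assume "\<phi> \<in> all_fms L"
    then have g: "g \<phi> \<in> formulas L {}" by (rule g_sen)
    have "Neg (g \<phi>) \<in> T" if "g \<phi> \<notin> T"
      using bspec[OF conjunct2[OF T[unfolded complete_theory_def]] g] that by simp
    then show "t \<phi> \<in> T" by (simp add: t_def)
  qed
  ultimately show ?thesis by (intro card_of_ordLeqI) auto
qed

lemma infinite_all_fms: "infinite (all_fms L)"
proof -
  have "range (\<lambda>i. Eql (Free i) (Free i)) \<subseteq> all_fms L" by (auto simp: all_fms_def)
  moreover have "infinite (range (\<lambda>i :: nat. Eql (Free i) (Free i)))"
    by (intro range_inj_infinite) (simp add: inj_on_def)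
  ultimately show ?thesis using finite_subset by blast
qed

text \<open>A nonempty subset of size below \<open>\<kappa>\<close> is the image of an initial
  segment of \<open>\<kappa>\<close>; after an embedding of \<open>Z\<close> into
  \<open>\<mu>\<close> it is decoded from a pair counted by \<open>cexp_less\<close>.\<close>

lemma card_small_subsets:
  fixes \<kappa> :: "'k rel" and \<mu> :: "'m rel" and Z :: "'z set"
  assumes \<kappa>: "Card_order \<kappa>" and \<mu>: "Card_order \<mu>" and exp: "\<mu> =o cexp_less \<mu> \<kappa>"
    and Z: "|Z| \<le>o \<mu>" and inf: "infinite (Field \<mu>)"
  shows "|{X. X \<subseteq> Z \<and> |X| <o \<kappa>}| \<le>o \<mu>"
proof -
  define B where "B \<alpha> = Func (underS \<kappa> \<alpha>) (Field \<mu>)" for \<alpha>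
  obtain j where j: "inj_on j Z" "j ` Z \<subseteq> Field \<mu>"
    using Z card_of_ordLeq[of Z "Field \<mu>"] ordLeq_ordIso_trans[OF Z ordIso_symmetric[OF card_of_Field_ordIso[OF \<mu>]]]
    by blast
  define dec where "dec = (\<lambda>(\<alpha>, f). {z \<in> Z. j z \<in> f ` underS \<kappa> \<alpha>})"
  have "{X. X \<subseteq> Z \<and> |X| <o \<kappa>} \<subseteq> insert {} (dec ` (SIGMA \<alpha> : Field \<kappa>. B \<alpha>))"
  proof
    fix X assume "X \<in> {X. X \<subseteq> Z \<and> |X| <o \<kappa>}"
    then have X: "X \<subseteq> Z" "|X| <o \<kappa>" by auto
    show "X \<in> insert {} (dec ` (SIGMA \<alpha> : Field \<kappa>. B \<alpha>))"
    proof (cases "X = {}")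
      case False
      obtain \<alpha> where \<alpha>: "\<alpha> \<in> Field \<kappa>" "|X| =o Restr \<kappa> (underS \<kappa> \<alpha>)"
        using ordLess_iff_ordIso_Restr[OF card_order_on_well_order_on[OF \<kappa>] card_of_Well_order[of X]] X(2)
        by blast
      have "Well_order \<kappa>" using \<kappa> by (simp add: card_order_on_well_order_on)
      then have "Field (Restr \<kappa> (underS \<kappa> \<alpha>)) = underS \<kappa> \<alpha>"
        by (intro Refl_Field_Restr2 Order_Relation.underS_Field) (simp add: order_on_defs)
      with ordIso_symmetric[OF \<alpha>(2)] obtain f where f: "bij_betw f (underS \<kappa> \<alpha>) X"
        unfolding ordIso_def iso_def by (auto simp: Field_card_of)
      define f' where "f' x = (if x \<in> underS \<kappa> \<alpha> then j (f x) else undefined)" for x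
      have "f' \<in> B \<alpha>" using f X(1) j(2) by (auto simp: B_def Func_def f'_def bij_betw_def)
      moreover have "dec (\<alpha>, f') = X"
      proof -
        have "f' ` underS \<kappa> \<alpha> = j ` X" using f by (auto simp: f'_def bij_betw_def image_iff)
        then show ?thesis using inj_on_image_mem_iff[OF j(1) _ X(1)] X(1) unfolding dec_def by auto
      qed
      ultimately show ?thesis using \<alpha>(1) by (intro insertI2 image_eqI[of _ _ "(\<alpha>, f')"]) auto
    qed simp
  qed
  then have "|{X. X \<subseteq> Z \<and> |X| <o \<kappa>}| \<le>o |insert {} (dec ` (SIGMA \<alpha> : Field \<kappa>. B \<alpha>))|"
    by (rule card_of_mono1)
  also have "|insert {} (dec ` (SIGMA \<alpha> : Field \<kappa>. B \<alpha>))| \<le>o \<mu>"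
  proof -
    have "|dec ` (SIGMA \<alpha> : Field \<kappa>. B \<alpha>)| \<le>o |SIGMA \<alpha> : Field \<kappa>. B \<alpha>|" by (rule card_of_image)
    also have "|SIGMA \<alpha> : Field \<kappa>. B \<alpha>| =o cexp_less \<mu> \<kappa>"
      unfolding cexp_less_def Csum_def cexp_def B_def by (simp add: Field_card_of card_of_refl)
    also have "cexp_less \<mu> \<kappa> =o \<mu>" using exp by (rule ordIso_symmetric)
    finally have "|dec ` (SIGMA \<alpha> : Field \<kappa>. B \<alpha>)| \<le>o |Field \<mu>|"
      using ordLeq_ordIso_trans[OF _ ordIso_symmetric[OF card_of_Field_ordIso[OF \<mu>]]] by blast
    then have "|{{}} \<union> dec ` (SIGMA \<alpha> : Field \<kappa>. B \<alpha>)| \<le>o |Field \<mu>|"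
      using inf by (intro Un_ordLeq_infinite) (auto simp: finite_ordLeq_infinite)
    then show ?thesis using ordLeq_ordIso_trans[OF _ card_of_Field_ordIso[OF \<mu>]] by simp
  qed
  finally show ?thesis .
qed

section \<open>Amalgamation along a filtration\<close>

context simple_monster
begin

lemma independence_Ind:
  fixes c1 c2 :: "'x::countable \<Rightarrow> 'u"
  assumes D: "is_mod D" "base D" and W: "base W" "D \<subseteq> W1" "D \<subseteq> E" "W1 \<subseteq> W" "E \<subseteq> W"
    and t: "tup c1" "tup c2" and c: "eqt D c1 c2" and i: "Ind D c1 E" "Ind D c2 W1"
    and e: "\<And>e :: nat \<Rightarrow> 'u. range e \<subseteq> E \<Longrightarrow> Ind D e W1"
  shows "\<exists>c. tup c \<and> eqt E c1 c \<and> eqt W1 c2 c \<and> Ind D c W"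
proof -
  have DU: "D \<subseteq> U" using D(2) by (rule base_D)
  have EU: "E \<subseteq> U" "W1 \<subseteq> U" using base_D[OF W(1)] W(4,5) by auto
  have ne: "E \<noteq> {}" "W1 \<noteq> {}" using mod_ne[OF D(1)] W(2,3) by auto
  define G where "G = {P. (Dfn E P \<and> P c1) \<or> (Dfn W1 P \<and> P c2)}"
  have "\<exists>c. tup c \<and> (\<forall>P \<in> G. P c) \<and> Ind D c W"
  proof (rule ext_nd[OF D W(1) subset_trans[OF W(2,4)], where 'y="nat + nat"])
    fix P assume "P \<in> G"
    then show "Dfn W P" using Dfn_mono[of E P W] Dfn_mono[of W1 P W] W(4,5) by (auto simp: G_def)
  next
    fix F assume F: "F \<subseteq> G" "finite F"
    define F1 where "F1 = {P \<in> F. Dfn E P \<and> P c1}"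
    define F2 where "F2 = {P \<in> F. Dfn W1 P \<and> P c2}"
    have "Dfn E (\<lambda>a. \<forall>P \<in> F1. P a)" by (rule Dfn_ball) (use F in \<open>auto simp: F1_def\<close>)
    from Dfn_abs_nat[OF this ne(1) EU(1)] obtain e :: "nat \<Rightarrow> 'u" and Q1 :: "('x + nat \<Rightarrow> 'u) \<Rightarrow> bool"
      where e1: "range e \<subseteq> E" "Dfn {} Q1" "\<forall>a. (\<forall>P \<in> F1. P a) \<longleftrightarrow> Q1 (a \<oplus> e)" by (elim exE conjE)
    have "Dfn W1 (\<lambda>a. \<forall>P \<in> F2. P a)" by (rule Dfn_ball) (use F in \<open>auto simp: F2_def\<close>)
    from Dfn_abs_nat[OF this ne(2) EU(2)] obtain w :: "nat \<Rightarrow> 'u" and Q2 :: "('x + nat \<Rightarrow> 'u) \<Rightarrow> bool"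
      where w: "range w \<subseteq> W1" "Dfn {} Q2" "\<forall>a. (\<forall>P \<in> F2. P a) \<longleftrightarrow> Q2 (a \<oplus> w)" by (elim exE conjE)
    define \<chi> where "\<chi> = (\<lambda>z :: 'x + (nat + nat) \<Rightarrow> 'u. Q1 ((\<lambda>x. z (Inl x)) \<oplus> (\<lambda>v. z (Inr (Inl v)))) \<and>
      Q2 ((\<lambda>x. z (Inl x)) \<oplus> (\<lambda>v. z (Inr (Inr v)))))"
    have Q: "Dfn D Q1" "Dfn D Q2" using Dfn_mono[OF e1(2)] Dfn_mono[OF w(2)] by auto
    have \<chi>: "Dfn D \<chi>" unfolding \<chi>_def
      by (rule Dfn_conj) (rule Dfn_rn'[OF Q(1) DU], rule rn_jn[OF rn_ren rn_ren],
        rule Dfn_rn'[OF Q(2) DU], rule rn_jn[OF rn_ren rn_ren])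
    have te: "tup e" "tup w" using e1(1) w(1) EU by (auto simp: tup_range)
    have "Q1 (c1 \<oplus> e)" using e1(3) by (auto simp: F1_def)
    moreover have "Q2 (c2 \<oplus> w)" using w(3) by (auto simp: F2_def)
    moreover have "ind D c1 e" using i(1) e1(1) by (simp add: Ind_def)
    moreover have "ind D c2 w" using i(2) w(1) by (simp add: Ind_def)
    moreover have "ind D e w" using e[OF e1(1)] w(1) by (simp add: Ind_def)
    ultimately have nk: "\<not> kdiv k D \<chi> (e \<oplus> w)" for k
      by (intro independence_theorem[OF D t te c _ _ _ Q _ _ \<chi>_def])
    have "range (e \<oplus> w) \<subseteq> W" unfolding range_jn using e1(1) w(1) W(4,5) by blast
    moreover have "\<forall>P \<in> F. P a" if "\<chi> (a \<oplus> (e \<oplus> w))" for a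
    proof
      fix P assume P: "P \<in> F"
      have "Q1 (a \<oplus> e)" "Q2 (a \<oplus> w)" using that by (simp_all add: \<chi>_def)
      then have "\<forall>P \<in> F1. P a" "\<forall>P \<in> F2. P a" using e1(3) w(3) by blast+
      moreover have "P \<in> F1 \<or> P \<in> F2" using P F(1) by (auto simp: F1_def F2_def G_def)
      ultimately show "P a" by blast
    qed
    ultimately show "\<exists>\<phi> (b :: nat + nat \<Rightarrow> 'u). range b \<subseteq> W \<and> Dfn D \<phi> \<and>
      (\<forall>k. \<not> kdiv k D \<phi> b) \<and> (\<forall>a. tup a \<longrightarrow> \<phi> (a \<oplus> b) \<longrightarrow> (\<forall>P \<in> F. P a))"
      using \<chi> nk by blast
  qed
  then obtain c where "tup c" "\<forall>P \<in> G. P c" "Ind D c W" by (elim exE conjE)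
  moreover have "eqt E c1 c" "eqt W1 c2 c" using calculation(2) unfolding eqt_def G_def by blast+
  ultimately show ?thesis by blast
qed

end

text \<open>\<open>Nlt a\<close> and \<open>Nle a\<close> are the models before and after stage
  \<open>a\<close>, which makes successor and limit stages uniform; \<open>fin_Nlt\<close> says that
  \<open>Nlt a\<close> is exhausted by \<open>M\<close> and the earlier stages.\<close>

locale filtration = simple_monster L S kb
  for L :: "('f, 'r) lang" and S :: "('f, 'r, 'u) struct" and kb :: "'k rel" +
  fixes M N :: "'u set" and I :: "'a set" and R :: "'a rel" and Nlt Nle :: "'a \<Rightarrow> 'u set"
  assumes wfR: "wf R" and base_N: "base N" and mod_M: "is_mod M"
    and Nlt_mod: "a \<in> I \<Longrightarrow> is_mod (Nlt a)" and Nle_mod: "a \<in> I \<Longrightarrow> is_mod (Nle a)"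
    and M_Nlt: "a \<in> I \<Longrightarrow> M \<subseteq> Nlt a" and Nlt_Nle: "a \<in> I \<Longrightarrow> Nlt a \<subseteq> Nle a" and Nle_N: "a \<in> I \<Longrightarrow> Nle a \<subseteq> N"
    and Nle_Nlt: "a \<in> I \<Longrightarrow> b \<in> I \<Longrightarrow> (b, a) \<in> R \<Longrightarrow> Nle b \<subseteq> Nlt a"
    and fin_Nlt: "a \<in> I \<Longrightarrow> finite X \<Longrightarrow> X \<subseteq> Nlt a \<Longrightarrow> X \<subseteq> M \<or> (\<exists>b \<in> I. (b, a) \<in> R \<and> X \<subseteq> Nle b)"
    and fin_N: "finite X \<Longrightarrow> X \<subseteq> N \<Longrightarrow> \<exists>a \<in> I. X \<subseteq> Nle a"
begin

definition good :: "'u set \<Rightarrow> ('x::countable \<Rightarrow> 'u) \<Rightarrow> bool" where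
  "good A c \<longleftrightarrow> A \<subseteq> N \<and> tup c \<and> is_mod (A \<inter> M) \<and> Ind (A \<inter> M) c A \<and> (\<forall>a \<in> I. is_mod (A \<inter> Nlt a) \<and>
    (\<forall>e :: nat \<Rightarrow> 'u. range e \<subseteq> A \<inter> Nle a \<longrightarrow> Ind (A \<inter> Nlt a) e (Nlt a)))"

definition active :: "'u set \<Rightarrow> 'a \<Rightarrow> bool" where
  "active A a \<longleftrightarrow> \<not> A \<inter> Nle a \<subseteq> Nlt a"

text \<open>Agreement is required only at levels active for both sides: at an inactive level a set
  gains no elements, so nothing new has to be amalgamated for it.\<close>

definition similar :: "'u set \<times> ('x::countable \<Rightarrow> 'u) \<Rightarrow> 'u set \<times> ('x \<Rightarrow> 'u) \<Rightarrow> bool" where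
  "similar s t \<longleftrightarrow> fst s \<inter> M = fst t \<inter> M \<and> eqt (fst s \<inter> M) (snd s) (snd t) \<and>
    (\<forall>a \<in> I. active (fst s) a \<longrightarrow> active (fst t) a \<longrightarrow>
      fst s \<inter> Nle a = fst t \<inter> Nle a \<and> eqt (fst s \<inter> Nle a) (snd s) (snd t))"

text \<open>Compactness over earlier levels gives \<open>c1\<close> on \<open>Nlt a\<close>. At
  \<open>a\<close> all active members of \<open>Q\<close> have the same trace on
  \<open>Nle a\<close> and the same type over it, so a single amalgamation with the type of
  \<open>c1\<close> over \<open>Nlt a\<close> is left. Independence over \<open>M0\<close> is
  restored by transitivity and keeps the induction going.\<close>

lemma similar_realize_aux:
  fixes Q :: "('u set \<times> ('x::countable \<Rightarrow> 'u)) set"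
  assumes fin: "finite Q" and s0: "s0 \<in> Q" and good: "\<And>s. s \<in> Q \<Longrightarrow> good (fst s) (snd s)"
    and sim: "\<And>s t. s \<in> Q \<Longrightarrow> t \<in> Q \<Longrightarrow> similar s t"
    and M0_def: "M0 = fst s0 \<inter> M"
  shows "a \<in> I \<Longrightarrow> \<exists>c. tup c \<and> Ind M0 c (Nle a) \<and> (\<forall>s \<in> Q. eqt (fst s \<inter> Nle a) (snd s) c)"
  using wfR
proof (induction a rule: wf_induct_rule)
  case (less a)
  note a = \<open>a \<in> I\<close>
  have M0: "is_mod M0" using good[OF s0] by (simp add: good_def M0_def)
  have AM: "fst s \<inter> M = M0" if "s \<in> Q" for s using sim[OF s0 that] by (simp add: similar_def M0_def)
  have eqM: "eqt M0 (snd s0) (snd s)" if "s \<in> Q" for s using sim[OF s0 that] unfolding similar_def M0_def by blast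
  have iA: "Ind M0 (snd s) (fst s)" if "s \<in> Q" for s using good[OF that] AM[OF that] by (simp add: good_def)
  have bN: "X \<subseteq> N \<Longrightarrow> base X" for X using base_N by (rule base_subset)
  have bM0: "base M0" using good[OF s0] by (intro bN) (auto simp: good_def M0_def)
  have M0_Nlt: "M0 \<subseteq> Nlt a" using M_Nlt[OF a] by (auto simp: M0_def)
  have bNlt: "base (Nlt a)" "base (Nle a)" using Nlt_Nle[OF a] Nle_N[OF a] by (auto intro: bN)
  define G where "G = {P. \<exists>s \<in> Q. Dfn (fst s \<inter> Nlt a) P \<and> P (snd s)}"
  have "\<exists>c. tup c \<and> (\<forall>P \<in> G. P c) \<and> Ind M0 c (Nlt a)"
  proof (rule ext_nd[OF M0 bM0 bNlt(1) M0_Nlt, where 'y=nat])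
    fix P assume "P \<in> G"
    then show "Dfn (Nlt a) P" using Dfn_mono[OF _ Int_lower2] by (auto simp: G_def)
  next
    fix F assume F: "F \<subseteq> G" "finite F"
    have "\<forall>P \<in> F. \<exists>s X. s \<in> Q \<and> X \<subseteq> fst s \<inter> Nlt a \<and> finite X \<and> Dfn X P \<and> P (snd s)"
    proof
      fix P assume "P \<in> F"
      then obtain s where s: "s \<in> Q" "Dfn (fst s \<inter> Nlt a) P" "P (snd s)" using F by (auto simp: G_def)
      from Dfn_params[OF s(2)] obtain X where "X \<subseteq> fst s \<inter> Nlt a" "finite X" "Dfn X P" by blast
      then show "\<exists>s X. s \<in> Q \<and> X \<subseteq> fst s \<inter> Nlt a \<and> finite X \<and> Dfn X P \<and> P (snd s)" using s by blast
    qed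
    then obtain s where "\<forall>P \<in> F. \<exists>X. s P \<in> Q \<and> X \<subseteq> fst (s P) \<inter> Nlt a \<and> finite X \<and> Dfn X P \<and> P (snd (s P))"
      by (rule bchoice[THEN exE])
    then obtain X where X: "\<forall>P \<in> F. s P \<in> Q \<and> X P \<subseteq> fst (s P) \<inter> Nlt a \<and> finite (X P) \<and> Dfn (X P) P \<and> P (snd (s P))"
      by (rule bchoice[THEN exE])
    let ?X = "\<Union>P \<in> F. X P"
    have "finite ?X" "?X \<subseteq> Nlt a" using X F(2) by auto
    \<comment> \<open>The finitely many parameters lie either in \<open>M\<close>, where all members
      of \<open>Q\<close> share one type and \<open>snd s0\<close> serves, or in an earlier
      \<open>Nle b\<close>, where the induction hypothesis serves.\<close>
    from fin_Nlt[OF a this] have "\<exists>W c. W \<noteq> {} \<and> W \<subseteq> Nlt a \<and> Ind M0 c W \<and> (\<forall>P \<in> F. Dfn W P \<and> P c)"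
    proof (elim disjE bexE conjE)
      assume XM: "?X \<subseteq> M"
      have "Dfn M0 P \<and> P (snd s0)" if P: "P \<in> F" for P
      proof -
        have "X P \<subseteq> M0" using X XM P AM[of "s P"] by blast
        then have "Dfn M0 P" using X P Dfn_mono by blast
        moreover have "P (snd s0)" using eqtD[OF eqM[of "s P"] \<open>Dfn M0 P\<close>] X P by blast
        ultimately show ?thesis by blast
      qed
      moreover have "Ind M0 (snd s0) M0" by (rule Ind_mono[OF iA[OF s0]]) (simp add: M0_def)
      ultimately show ?thesis using M0_Nlt mod_ne[OF M0] by (intro exI[of _ M0] exI[of _ "snd s0"]) blast
    next
      fix b assume b: "b \<in> I" "(b, a) \<in> R" "?X \<subseteq> Nle b"
      from less.IH[OF b(2,1)] obtain c where c: "Ind M0 c (Nle b)" "\<forall>s \<in> Q. eqt (fst s \<inter> Nle b) (snd s) c"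
        by (elim exE conjE)
      have "Dfn (Nle b) P \<and> P c" if P: "P \<in> F" for P
      proof -
        have "Dfn (fst (s P) \<inter> Nle b) P" using Dfn_mono[of "X P" P "fst (s P) \<inter> Nle b"] X P b(3) by blast
        moreover have "eqt (fst (s P) \<inter> Nle b) (snd (s P)) c" "P (snd (s P))" using c(2) X P by blast+
        ultimately have "P c" using eqtD by blast
        then show ?thesis using Dfn_mono[OF \<open>Dfn (fst (s P) \<inter> Nle b) P\<close>, of "Nle b"] by blast
      qed
      then show ?thesis using Nle_Nlt[OF a b(1,2)] mod_ne[OF Nle_mod[OF b(1)]] c(1)
        by (intro exI[of _ "Nle b"] exI[of _ c]) blast
    qed
    then obtain W c where W: "W \<noteq> {}" "W \<subseteq> Nlt a" "Ind M0 c W" "\<forall>P \<in> F. Dfn W P \<and> P c"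
      by (elim exE conjE)
    have WU: "W \<subseteq> U" using W(2) base_D[OF bNlt(1)] by blast
    have "Dfn W (\<lambda>x. \<forall>P \<in> F. P x)" by (rule Dfn_ball) (use F(2) W(4) in auto)
    from Dfn_abs_nat[OF this W(1) WU] obtain d :: "nat \<Rightarrow> 'u" and \<phi> :: "('x + nat \<Rightarrow> 'u) \<Rightarrow> bool"
      where d: "range d \<subseteq> W" "Dfn {} \<phi>" "\<forall>a. (\<forall>P \<in> F. P a) \<longleftrightarrow> \<phi> (a \<oplus> d)" by (elim exE conjE)
    have \<phi>: "Dfn M0 \<phi>" using d(2) Dfn_mono by blast
    have "ind M0 c d" using W(3) d(1) by (simp add: Ind_def)
    moreover have "\<phi> (c \<oplus> d)" using d(3) W(4) by blast
    ultimately have "\<forall>k. \<not> kdiv k M0 \<phi> d" using indD[OF _ \<phi>] by blast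
    then show "\<exists>\<phi> (b :: nat \<Rightarrow> 'u). range b \<subseteq> Nlt a \<and> Dfn M0 \<phi> \<and>
      (\<forall>k. \<not> kdiv k M0 \<phi> b) \<and> (\<forall>a. tup a \<longrightarrow> \<phi> (a \<oplus> b) \<longrightarrow> (\<forall>P \<in> F. P a))"
      using d(1,3) W(2) \<phi> by (intro exI[of _ \<phi>] exI[of _ d]) blast
  qed
  then obtain c1 where c1: "tup c1" "\<forall>P \<in> G. P c1" "Ind M0 c1 (Nlt a)" by (elim exE conjE)
  have e1: "eqt (fst s \<inter> Nlt a) (snd s) c1" if "s \<in> Q" for s
    using c1(2) that unfolding eqt_def G_def by blast
  show ?case
  proof (cases "\<exists>s \<in> Q. active (fst s) a")
    case False
    from ext_Ind[OF M0 bM0 bNlt(2) M0_Nlt Nlt_Nle[OF a] c1(3)]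
    obtain c where c: "tup c" "eqt (Nlt a) c1 c" "Ind M0 c (Nle a)" by (elim exE conjE)
    have "eqt (fst s \<inter> Nle a) (snd s) c" if s: "s \<in> Q" for s
    proof -
      have sub: "fst s \<inter> Nle a \<subseteq> fst s \<inter> Nlt a" using False s by (auto simp: active_def)
      have "eqt (fst s \<inter> Nlt a) (snd s) c" by (rule eqt_trans[OF e1[OF s] eqt_mono[OF c(2)]]) blast
      then show ?thesis using sub by (rule eqt_mono)
    qed
    then show ?thesis using c by blast
  next
    case True
    then obtain s where s: "s \<in> Q" "active (fst s) a" by blast
    let ?D = "fst s \<inter> Nlt a" and ?E = "fst s \<inter> Nle a"
    have g: "is_mod ?D" "\<And>e :: nat \<Rightarrow> 'u. range e \<subseteq> ?E \<Longrightarrow> Ind ?D e (Nlt a)" "tup (snd s)" "fst s \<subseteq> N"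
      using good[OF s(1)] a by (auto simp: good_def)
    have bD: "base ?D" using g(4) by (intro bN) blast
    have M0D: "M0 \<subseteq> ?D" using AM[OF s(1)] M0_Nlt by blast
    have DE: "?D \<subseteq> ?E" using Nlt_Nle[OF a] by blast
    have U: "Nlt a \<subseteq> U" "Nle a \<subseteq> U" using bNlt by (auto dest: base_D)
    have "Ind M0 (snd s) ?E" by (rule Ind_mono[OF iA[OF s(1)]]) blast
    then have i1: "Ind ?D (snd s) ?E"
      by (rule Ind_base_mono) (use M0D DE bD mod_ne[OF g(1)] U in blast)+
    have i2: "Ind ?D c1 (Nlt a)" by (rule Ind_base_mono[OF c1(3)]) (use M0D bD mod_ne[OF g(1)] U in blast)+
    have "\<exists>c. tup c \<and> eqt ?E (snd s) c \<and> eqt (Nlt a) c1 c \<and> Ind ?D c (Nle a)"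
      by (rule independence_Ind[OF g(1) bD bNlt(2) Int_lower2 DE Nlt_Nle[OF a] Int_lower2 g(3) c1(1) e1[OF s(1)] i1 i2])
        (rule g(2))
    then obtain c where c: "tup c" "eqt ?E (snd s) c" "eqt (Nlt a) c1 c" "Ind ?D c (Nle a)" by (elim exE conjE)
    have "Ind M0 c (Nlt a)" by (rule Ind_eqt[OF c1(3) c(3) M0_Nlt U(1)])
    then have "Ind M0 c ?D" by (rule Ind_mono) blast
    from Ind_trans[OF M0 g(1) M0D _ bNlt(2) c(1) this c(4)] have "Ind M0 c (Nle a)" using DE by blast
    moreover have "eqt (fst t \<inter> Nle a) (snd t) c" if t: "t \<in> Q" for t
    proof (cases "active (fst t) a")
      case True
      then have "fst t \<inter> Nle a = ?E" "eqt (fst t \<inter> Nle a) (snd t) (snd s)"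
        using sim[OF t s(1)] s(2) a by (auto simp: similar_def)
      then show ?thesis using eqt_trans c(2) by metis
    next
      case False
      then have sub: "fst t \<inter> Nle a \<subseteq> fst t \<inter> Nlt a" by (auto simp: active_def)
      have "eqt (fst t \<inter> Nlt a) (snd t) c" by (rule eqt_trans[OF e1[OF t] eqt_mono[OF c(3)]]) blast
      then show ?thesis using sub by (rule eqt_mono)
    qed
    ultimately show ?thesis using c(1) by blast
  qed
qed

lemma similar_realize:
  fixes Q :: "('u set \<times> ('x::countable \<Rightarrow> 'u)) set"
  assumes good: "\<And>s. s \<in> Q \<Longrightarrow> good (fst s) (snd s)"
    and sim: "\<And>s t. s \<in> Q \<Longrightarrow> t \<in> Q \<Longrightarrow> similar s t"
  shows "\<exists>c. tup c \<and> (\<forall>s \<in> Q. eqt (fst s) (snd s) c)"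
proof -
  have AN: "s \<in> Q \<Longrightarrow> fst s \<subseteq> N" for s using good by (auto simp: good_def)
  define I' where "I' = {(s, P). s \<in> Q \<and> Dfn (fst s) P \<and> P (snd s)}"
  have "\<exists>c. tup c \<and> (\<forall>i \<in> I'. snd i c)"
  proof (rule compact[OF base_N])
    fix i assume "i \<in> I'"
    then have "Dfn (fst (fst i)) (snd i)" "fst i \<in> Q" by (auto simp: I'_def)
    from this(1) AN[OF this(2)] show "Dfn N (snd i)" by (rule Dfn_mono)
  next
    fix J assume J: "J \<subseteq> I'" "finite J"
    show "\<exists>c. tup c \<and> (\<forall>i \<in> J. snd i c)"
    proof (cases "J = {}")
      case True
      then show ?thesis using ex_tup by simp
    next
      case False
      then obtain i0 where i0: "i0 \<in> J" by blast
      have "\<forall>i \<in> J. \<exists>X. X \<subseteq> fst (fst i) \<and> finite X \<and> Dfn X (snd i)"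
      proof
        fix i assume "i \<in> J"
        then have "Dfn (fst (fst i)) (snd i)" using J by (auto simp: I'_def)
        from Dfn_params[OF this] show "\<exists>X. X \<subseteq> fst (fst i) \<and> finite X \<and> Dfn X (snd i)" by blast
      qed
      then obtain X where X: "\<forall>i \<in> J. X i \<subseteq> fst (fst i) \<and> finite (X i) \<and> Dfn (X i) (snd i)"
        by (rule bchoice[THEN exE])
      have JQ: "fst i \<in> Q" "snd i (snd (fst i))" if "i \<in> J" for i using J(1) that by (auto simp: I'_def)
      have "finite (\<Union>i \<in> J. X i)" "(\<Union>i \<in> J. X i) \<subseteq> N" using J(2) X AN JQ(1) by (simp, blast)
      from fin_N[OF this] obtain a where a: "a \<in> I" "(\<Union>i \<in> J. X i) \<subseteq> Nle a" by blast
      have fJ: "finite (fst ` J)" using J(2) by simp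
      have "\<exists>c. tup c \<and> Ind (fst (fst i0) \<inter> M) c (Nle a) \<and> (\<forall>s \<in> fst ` J. eqt (fst s \<inter> Nle a) (snd s) c)"
        by (rule similar_realize_aux[OF fJ _ _ _ refl a(1)]) (use i0 JQ(1) good sim in blast)+
      then obtain c where c: "tup c" "\<forall>s \<in> fst ` J. eqt (fst s \<inter> Nle a) (snd s) c" by (elim exE conjE)
      have "snd i c" if i: "i \<in> J" for i
      proof -
        have "Dfn (fst (fst i) \<inter> Nle a) (snd i)" by (rule Dfn_mono[of "X i"]) (use X i a(2) in blast)+
        moreover have "eqt (fst (fst i) \<inter> Nle a) (snd (fst i)) c" using c(2) i by blast
        ultimately show ?thesis using JQ(2)[OF i] eqtD by blast
      qed
      then show ?thesis using c(1) by blast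
    qed
  qed
  then obtain c where "tup c" "\<forall>i \<in> I'. snd i c" by (elim exE conjE)
  moreover have "eqt (fst s) (snd s) c" if "s \<in> Q" for s
    unfolding eqt_def
  proof (intro allI impI)
    fix P assume "Dfn (fst s) P" "P (snd s)"
    with that have "(s, P) \<in> I'" by (simp add: I'_def)
    from bspec[OF calculation(2) this] show "P c" by simp
  qed
  ultimately show ?thesis by blast
qed

end

lemma Plus_ordLeq_infinite: "infinite Z \<Longrightarrow> |A| \<le>o |Z| \<Longrightarrow> |B| \<le>o |Z| \<Longrightarrow> |A <+> B| \<le>o |Z|"
  unfolding Plus_def
  by (rule Un_ordLeq_infinite) (auto intro: ordLeq_transitive[OF card_of_image])

section \<open>Cardinal arithmetic of the pair of models\<close>

text \<open>\<open>\<kappa>\<close> exceeds the infinite number of formulas, and the sum defining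
  \<open>cexp_less\<close> has a nonempty summand for each element of \<open>\<kappa>\<close>; this
  forces \<open>\<mu>\<close> to be infinite.\<close>

lemma infinite_exponent:
  fixes M :: "'u set" and \<kappa> :: "'l rel" and \<mu> :: "'m rel"
  assumes \<kappa>: "Card_order \<kappa>" and \<mu>: "Card_order \<mu>" and all_less: "|all_fms L| <o \<kappa>"
    and exp: "\<mu> =o cexp_less \<mu> \<kappa>" and M: "|M| =o \<mu>" "M \<noteq> {}"
  shows "infinite (Field \<kappa>)" "infinite (Field \<mu>)" "infinite M"
proof -
  have "|all_fms L| \<le>o |Field \<kappa>|"
    by (rule ordLeq_ordIso_trans[OF ordLess_imp_ordLeq[OF all_less] ordIso_symmetric[OF card_of_Field_ordIso[OF \<kappa>]]])
  then show inf: "infinite (Field \<kappa>)" using card_of_ordLeq_finite infinite_all_fms by blast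
  have iso: "|Field \<mu>| =o |M|"
    by (rule ordIso_transitive[OF card_of_Field_ordIso[OF \<mu>] ordIso_symmetric[OF M(1)]])
  then obtain j where "bij_betw j (Field \<mu>) M" unfolding card_of_ordIso[symmetric] by (elim exE)
  then have "j ` Field \<mu> = M" by (rule bij_betw_imp_surj_on)
  then have "Field \<mu> \<noteq> {}" using M(2) by (metis image_empty)
  then obtain z where z: "z \<in> Field \<mu>" by blast
  let ?S = "SIGMA \<alpha> : Field \<kappa>. Func (underS \<kappa> \<alpha>) (Field \<mu>)"
  have "(\<lambda>\<alpha>. (\<alpha>, \<lambda>x. if x \<in> underS \<kappa> \<alpha> then z else undefined)) ` Field \<kappa> \<subseteq> ?S"
    using z by (auto simp: Func_def)
  moreover have "inj_on (\<lambda>\<alpha>. (\<alpha>, \<lambda>x. if x \<in> underS \<kappa> \<alpha> then z else undefined)) (Field \<kappa>)"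
    by (rule inj_onI) simp
  ultimately have "|Field \<kappa>| \<le>o |?S|" unfolding card_of_ordLeq[symmetric] by (intro exI conjI)
  then have S_inf: "infinite ?S" using card_of_ordLeq_finite[of "Field \<kappa>" ?S] inf by blast
  have S: "cexp_less \<mu> \<kappa> = |?S|"
    unfolding cexp_less_def Csum_def cexp_def by (simp add: Field_card_of)
  have "|Field \<mu>| =o |?S|"
    by (rule ordIso_transitive[OF card_of_Field_ordIso[OF \<mu>] exp[unfolded S]])
  from card_of_ordIso_finite[OF this] S_inf show "infinite (Field \<mu>)" by simp
  then show "infinite M" using card_of_ordIso_finite[OF iso] by simp
qed

locale elementary_pair = simple_monster L S kb
  for L :: "('f, 'r) lang" and S :: "('f, 'r, 'u) struct" and kb :: "'k rel" +
  fixes M N :: "'u set" and \<kappa> :: "'l rel" and \<mu> :: "'m rel"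
  assumes mods: "is_mod M" "is_mod N" and M_N: "M \<subseteq> N" and base_N: "base N"
    and card_\<kappa>: "Card_order \<kappa>" and card_\<mu>: "Card_order \<mu>" and all_less: "|all_fms L| <o \<kappa>"
    and exp: "\<mu> =o cexp_less \<mu> \<kappa>" and card_M: "|M| =o \<mu>" and card_N: "|N| =o cardSuc \<mu>"
begin

lemma inf_\<kappa>: "infinite (Field \<kappa>)" and inf_\<mu>: "infinite (Field \<mu>)" and inf_M: "infinite M"
  using infinite_exponent[OF card_\<kappa> card_\<mu> all_less exp card_M mod_ne[OF mods(1)]] by blast+

lemma small_subsets:
  assumes "|Z| \<le>o |M|"
  shows "|{X. X \<subseteq> Z \<and> |X| <o \<kappa>}| \<le>o |M|"
  by (rule ordLeq_ordIso_trans[OF card_small_subsets[OF card_\<kappa> card_\<mu> exp _ inf_\<mu>] ordIso_symmetric[OF card_M]])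
    (rule ordLeq_ordIso_trans[OF assms card_M])

text \<open>Otherwise all subsets of \<open>M\<close> would be among its subsets of size below
  \<open>\<kappa>\<close>, of which there are at most \<open>|M|\<close>, against Cantor.\<close>

lemma \<kappa>_M: "\<kappa> \<le>o |M|"
proof (rule ccontr)
  assume "\<not> \<kappa> \<le>o |M|"
  then have less: "|M| <o \<kappa>"
    using ordLess_or_ordLeq[OF card_of_Well_order card_order_on_well_order_on[OF card_\<kappa>]] by blast
  have "Pow M \<subseteq> {X. X \<subseteq> M \<and> |X| <o \<kappa>}"
    by (auto intro: ordLeq_ordLess_trans[OF card_of_mono1 less])
  from ordLeq_transitive[OF card_of_mono1[OF this] small_subsets[OF ordIso_imp_ordLeq[OF card_of_refl]]]
  show False using not_ordLeq_ordLess card_of_Pow[of M] by blast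
qed

lemma less_M: "|X| <o \<kappa> \<Longrightarrow> |X| \<le>o |M|"
  using ordLess_ordLeq_trans[OF _ \<kappa>_M] ordLess_imp_ordLeq by blast

lemma all_M: "|all_fms L| \<le>o |M|"
  by (rule less_M[OF all_less])

lemma formulas_M: "|V| \<le>o |M| \<Longrightarrow> |formulas L V| \<le>o |M|"
  by (rule card_formulas[OF inf_M _ all_M])

text \<open>Closures and unions are estimated through one infinite set \<open>Z\<close> of size
  below \<open>\<kappa>\<close>, an argument that works for singular \<open>\<kappa>\<close>
  too.\<close>

lemma less_bound:
  fixes A :: "'a set"
  assumes "|A| <o \<kappa>"
  obtains Z :: "('a + ('f, 'r, nat) fm) set"
  where "infinite Z" "|A| \<le>o |Z|" "|all_fms L| \<le>o |Z|" "|Z| <o \<kappa>"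
proof (rule that[of "A <+> all_fms L"])
  show "infinite (A <+> all_fms L)" using infinite_all_fms[of L] by (simp add: finite_Plus_iff)
  show "|A| \<le>o |A <+> all_fms L|" by (rule card_of_Plus1)
  show "|all_fms L| \<le>o |A <+> all_fms L|" by (rule card_of_Plus2)
  show "|A <+> all_fms L| <o \<kappa>"
    by (rule card_of_Plus_ordLess_infinite_Field[OF inf_\<kappa> card_\<kappa> assms all_less])
qed

lemma less_formulas:
  fixes V :: "'a set"
  assumes "|V| <o \<kappa>" "\<Theta> \<subseteq> formulas L V"
  shows "|\<Theta>| <o \<kappa>"
proof -
  obtain Z :: "('a + ('f, 'r, nat) fm) set" where Z: "infinite Z" "|V| \<le>o |Z|" "|all_fms L| \<le>o |Z|" "|Z| <o \<kappa>"
    by (rule less_bound[OF assms(1)])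
  have "|\<Theta>| \<le>o |Z|"
    by (rule ordLeq_transitive[OF card_of_mono1[OF assms(2)] card_formulas[OF Z(1-3)]])
  then show ?thesis using Z(4) by (rule ordLeq_ordLess_trans)
qed

lemma less_Plus: "|A| <o \<kappa> \<Longrightarrow> |B| <o \<kappa> \<Longrightarrow> |A <+> B| <o \<kappa>"
  by (rule card_of_Plus_ordLess_infinite_Field[OF inf_\<kappa> card_\<kappa>])

lemma less_image: "|A| <o \<kappa> \<Longrightarrow> |f ` A| <o \<kappa>"
  by (rule ordLeq_ordLess_trans[OF card_of_image])

lemma less_subset: "|A| <o \<kappa> \<Longrightarrow> B \<subseteq> A \<Longrightarrow> |B| <o \<kappa>"
  by (rule ordLeq_ordLess_trans[OF card_of_mono1])


section \<open>Realizing types of sets that do not weakly divide\<close>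

text \<open>An enumeration of \<open>A\<close> and \<open>C\<close> is a labelling of their elements by \<open>P\<close> and \<open>Q\<close>, and \<open>\<Theta>\<close> is
  the type of \<open>A C\<close> over \<open>B\<close> in terms of the labels.\<close>

lemma nwd_uniform:
  fixes f :: "'u set \<Rightarrow> 'u \<Rightarrow> 'u" and R :: "('u set \<times> 'u set) set"
  assumes Q: "Q \<subseteq> M" and A: "\<And>A C. (A, C) \<in> R \<Longrightarrow> A \<subseteq> N \<and> inj_on (f A) A \<and> f A ` A = P \<and> B \<subseteq> A"
    and C: "\<And>A C. (A, C) \<in> R \<Longrightarrow> C \<subseteq> U \<and> inj_on (f C) C \<and> f C ` C = Q"
    and nwd: "\<And>A C. (A, C) \<in> R \<Longrightarrow> set_not_weakly_divides L S A (B \<union> C) B"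
    and \<Theta>: "\<And>A C. (A, C) \<in> R \<Longrightarrow> \<Theta> = {\<theta> \<in> formulas L ((P <+> Q) <+> B).
      sat S (case_sum (case_sum (inv_into A (f A)) (inv_into C (f C))) id) [] \<theta>}"
  shows "\<exists>d :: 'u \<Rightarrow> 'u. range d \<subseteq> U \<and> (\<forall>(A, C) \<in> R. \<forall>\<theta> \<in> \<Theta>.
    sat S (case_sum (case_sum (inv_into A (f A)) d) id) [] \<theta>)"
proof (cases "R = {}")
  case True
  then show ?thesis using U_ne by (intro exI[of _ "\<lambda>_. SOME u. u \<in> U"]) (auto intro: someI_ex)
next
  case False
  then obtain A0 C0 where s0: "(A0, C0) \<in> R" by auto
  obtain u0 where u0: "u0 \<in> U" using U_ne by blast
  have NU: "N \<subseteq> U" using base_D[OF base_N] .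
  \<comment> \<open>Replaces the labels in \<open>P\<close> by the elements of \<open>A\<close> they
    stand for; the labels in \<open>Q\<close> remain as the variables to be realized.\<close>
  define \<rho> :: "'u set \<Rightarrow> ('u + 'u) + 'u \<Rightarrow> 'u + 'u" where
    "\<rho> A = case_sum (case_sum (\<lambda>x. Inr (inv_into A (f A) x)) Inl) Inr" for A
  have sat\<rho>: "sat S (case_sum d id) [] (map_fm (\<rho> A) \<theta>) \<longleftrightarrow>
      sat S (case_sum (case_sum (inv_into A (f A)) d) id) [] \<theta>" for d A \<theta>
    unfolding sat_map by (rule sat_cong) (auto simp: \<rho>_def split: sum.split)
  have B: "B \<subseteq> A0" using A[OF s0] by blast
  have inv: "inv_into A (f A) x \<in> A" if "(A, C) \<in> R" "x \<in> P" for A C x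
    using A[OF that(1)] that(2) inv_into_into by metis
  define q where "q = (\<Union>(A, C) \<in> R. map_fm (\<rho> A) ` \<Theta>)"
  have q: "q \<subseteq> formulas L (Q <+> N)"
  proof
    fix \<phi> assume "\<phi> \<in> q"
    then obtain A' C' \<theta> where *: "(A', C') \<in> R" "\<theta> \<in> \<Theta>" "\<phi> = map_fm (\<rho> A') \<theta>" by (auto simp: q_def)
    have \<theta>: "\<theta> \<in> formulas L ((P <+> Q) <+> B)" using * \<Theta>[OF *(1)] by blast
    have "\<rho> A' z \<in> Q <+> N" if "z \<in> (P <+> Q) <+> B" for z
      using that inv[OF *(1)] A[OF *(1)] by (auto simp: \<rho>_def)
    moreover have "set_fm \<theta> \<subseteq> (P <+> Q) <+> B" using \<theta> by (simp add: formulas_def)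
    ultimately show "\<phi> \<in> formulas L (Q <+> N)" unfolding *(3) by (intro map_formulas[OF \<theta>]) blast
  qed
  have "consistent S q" unfolding consistent_def
  proof (intro allI impI)
    fix F assume F: "finite F" "F \<subseteq> q"
    obtain \<phi>s where \<phi>s: "set \<phi>s = F" by (rule exE[OF finite_list[OF F(1)]])
    let ?n = "length \<phi>s"
    have "\<forall>i. \<exists>A C \<theta>. i < ?n \<longrightarrow> (A, C) \<in> R \<and> \<theta> \<in> \<Theta> \<and> \<phi>s ! i = map_fm (\<rho> A) \<theta>"
    proof
      fix i
      show "\<exists>A C \<theta>. i < ?n \<longrightarrow> (A, C) \<in> R \<and> \<theta> \<in> \<Theta> \<and> \<phi>s ! i = map_fm (\<rho> A) \<theta>"
      proof (cases "i < ?n")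
        case True
        then have "\<phi>s ! i \<in> q" using F(2) \<phi>s nth_mem by blast
        then show ?thesis by (auto simp: q_def)
      qed simp
    qed
    then obtain A' where "\<forall>i. \<exists>C \<theta>. i < ?n \<longrightarrow> (A' i, C) \<in> R \<and> \<theta> \<in> \<Theta> \<and> \<phi>s ! i = map_fm (\<rho> (A' i)) \<theta>"
      by (rule choice[THEN exE])
    then obtain C' where "\<forall>i. \<exists>\<theta>. i < ?n \<longrightarrow> (A' i, C' i) \<in> R \<and> \<theta> \<in> \<Theta> \<and> \<phi>s ! i = map_fm (\<rho> (A' i)) \<theta>"
      by (rule choice[THEN exE])
    then obtain \<theta> where "\<forall>i. i < ?n \<longrightarrow> (A' i, C' i) \<in> R \<and> \<theta> i \<in> \<Theta> \<and> \<phi>s ! i = map_fm (\<rho> (A' i)) (\<theta> i)"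
      by (rule choice[THEN exE])
    then have R: "\<And>i. i < ?n \<Longrightarrow> (A' i, C' i) \<in> R" "\<And>i. i < ?n \<Longrightarrow> \<theta> i \<in> \<Theta>"
      "\<And>i. i < ?n \<Longrightarrow> \<phi>s ! i = map_fm (\<rho> (A' i)) (\<theta> i)" by blast+
    have "finite (\<theta> ` {..<?n})" "\<theta> ` {..<?n} \<subseteq> formulas L ((P <+> Q) <+> B)" using R(2) \<Theta>[OF s0] by auto
    from finite_conj[OF this] obtain \<sigma> where \<sigma>: "\<sigma> \<in> formulas L ((P <+> Q) <+> B)"
      "\<forall>(S :: ('f, 'r, 'u) struct) s. Dom S \<noteq> {} \<longrightarrow> (sat S s [] \<sigma> \<longleftrightarrow> (\<forall>\<phi> \<in> \<theta> ` {..<?n}. sat S s [] \<phi>))"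
      by (elim bexE)
    have sat\<sigma>: "sat S s [] \<sigma> \<longleftrightarrow> (\<forall>i<?n. sat S s [] (\<theta> i))" for s using \<sigma>(2) U_ne by auto
    have true\<Theta>: "sat S (case_sum (case_sum (inv_into A0 (f A0)) (inv_into C0 (f C0))) id) [] \<theta>'" if "\<theta>' \<in> \<Theta>" for \<theta>'
      using that unfolding \<Theta>[OF s0] by simp
    have "sat S (case_sum (case_sum (inv_into A0 (f A0)) (inv_into C0 (f C0))) id) [] \<sigma>"
      unfolding sat\<sigma> using true\<Theta>[OF R(2)] by simp
    with \<sigma>(1) have \<sigma>\<Theta>: "\<sigma> \<in> \<Theta>" unfolding \<Theta>[OF s0] by simp
    have \<sigma>_cong: "sat S (case_sum (case_sum p d) id) [] \<sigma> \<longleftrightarrow> sat S (case_sum (case_sum p' d') id) [] \<sigma>"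
      if "\<And>x. x \<in> P \<Longrightarrow> p x = p' x" "\<And>x. x \<in> Q \<Longrightarrow> d x = d' x" for p p' d d'
      by (rule sat_cong) (use \<sigma>(1) that in \<open>fastforce simp: formulas_def split: sum.split\<close>)
    \<comment> \<open>\<open>\<Psi>\<close> below says that no \<open>d\<close> satisfies
      \<open>\<sigma>\<close> with all \<open>n\<close> copies. If the claim failed, the sets
      \<open>A' l\<close> would satisfy \<open>\<Psi>\<close> and the copies of the type over
      \<open>B\<close>. Weak nondividing would give copies that satisfy \<open>\<Psi>\<close> and
      also the formula \<open>map_fm k \<sigma>\<close> over \<open>B \<union> C0\<close>, but then
      \<open>d0\<close> refutes \<open>\<Psi>\<close>.\<close>
    have "\<exists>d. tup d \<and> (\<forall>l<?n. sat S (case_sum (case_sum (inv_into (A' l) (f (A' l))) d) id) [] \<sigma>)"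
    proof (rule ccontr)
      assume neg: "\<not> ?thesis"
      define d0 where "d0 y = (if y \<in> Q then inv_into C0 (f C0) y else u0)" for y
      have d0: "tup d0" unfolding tup_def d0_def
        using C[OF s0] u0 inv_into_into[of _ "f C0" C0] by auto
      define g where "g = inv_into A0 (f A0)"
      define \<Psi> where "\<Psi> t \<longleftrightarrow> \<not> (\<exists>d. tup d \<and> (\<forall>l \<in> {..<?n}.
        sat S (case_sum ((\<lambda>p. t (l, g p)) \<oplus> d) id) [] \<sigma>))" for t :: "nat \<times> 'u \<Rightarrow> 'u"
      have DB: "B \<subseteq> U" using B A[OF s0] NU by blast
      have "Dfn B (\<lambda>z. sat S (case_sum z id) [] \<sigma>)" by (rule Dfn_sat[OF \<sigma>(1)])
      then have \<Psi>: "Dfn B \<Psi>" unfolding \<Psi>_def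
        by (intro Dfn_not Dfn_exI Dfn_ball[OF finite_lessThan]) (rule Dfn_rn'[OF _ DB], assumption, rule rn_jn[OF rn_ren rn_ren])
      show False
      \<comment> \<open>\<open>\<tau>\<close> below takes a default element from \<open>A0\<close>.
        If there is none, \<open>P\<close> is empty and \<open>\<sigma>\<close> speaks only of
        \<open>C0\<close> and \<open>B\<close>, so \<open>d0\<close> satisfies it.\<close>
      proof (cases "A0 = {}")
        case True
        then have "P = {}" using A[OF s0] by blast
        have "sat S (case_sum (case_sum (inv_into (A' l) (f (A' l))) d0) id) [] \<sigma>" for l
        proof -
          have "sat S (case_sum (case_sum g (inv_into C0 (f C0))) id) [] \<sigma>"
            using true\<Theta>[OF \<sigma>\<Theta>] unfolding g_def .
          then show ?thesis using \<open>P = {}\<close> by (subst \<sigma>_cong[of _ g _ "inv_into C0 (f C0)"]) (auto simp: d0_def)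
        qed
        then show False using neg d0 by blast
      next
        case False
        then obtain x0 where x0: "x0 \<in> A0" by blast
        define \<tau> where "\<tau> = (\<lambda>(l, x). (if l < ?n then l else 0, if x \<in> A0 then x else x0))"
        define s where "s = (\<lambda>(l, x). if l < ?n \<and> x \<in> A0 then inv_into (A' l) (f (A' l)) (f A0 x) else u0)"
        have fA: "f A0 x \<in> P" if "x \<in> A0" for x using A[OF s0] that by blast
        have gP: "g p \<in> A0" "f A0 (g p) = p" if "p \<in> P" for p
          using A[OF s0] that inv_into_into[of p "f A0" A0] f_inv_into_f[of p "f A0" A0] by (auto simp: g_def)
        have n0: "0 < ?n"
        proof (rule ccontr)
          assume "\<not> 0 < ?n"
          then show False using neg d0 by auto
        qed
        have ts: "tup s"
        proof -
          have "inv_into (A' l) (f (A' l)) (f A0 x) \<in> U" if "l < ?n" "x \<in> A0" for l x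
            using inv[OF R(1)[OF that(1)] fA[OF that(2)]] A[OF R(1)[OF that(1)]] NU by blast
          then show ?thesis using u0 by (auto simp: tup_def s_def)
        qed
        have \<Psi>eq: "\<Psi> (\<lambda>v. t (\<tau> v)) \<longleftrightarrow> \<Psi> t" for t
        proof -
          have "sat S (case_sum ((\<lambda>p. t (\<tau> (l, g p))) \<oplus> d) id) [] \<sigma> \<longleftrightarrow>
              sat S (case_sum ((\<lambda>p. t (l, g p)) \<oplus> d) id) [] \<sigma>" if "l \<in> {..<?n}" for l d
            by (rule \<sigma>_cong) (use that gP in \<open>simp_all add: \<tau>_def\<close>)
          then show ?thesis unfolding \<Psi>_def by (simp cong: ball_cong)
        qed
        have "\<Psi> s"
        proof -
          have "sat S (case_sum ((\<lambda>p. s (l, g p)) \<oplus> d) id) [] \<sigma> \<longleftrightarrow>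
              sat S (case_sum (case_sum (inv_into (A' l) (f (A' l))) d) id) [] \<sigma>" if "l < ?n" for l d
            by (rule \<sigma>_cong) (use that gP in \<open>simp_all add: s_def\<close>)
          then show ?thesis unfolding \<Psi>_def using neg by blast
        qed
        have r: "realizes S (\<lambda>i. s (l, i)) (tp L S A0 id B)" if l: "l < ?n" for l
          unfolding realizes_def
        proof
          fix \<phi> :: "('f, 'r, 'u + 'u) fm" assume "\<phi> \<in> tp L S A0 id B"
          then have \<phi>: "\<phi> \<in> formulas L (A0 <+> B)" "sat S (case_sum id id) [] \<phi>" by (auto simp: tp_def)
          define h :: "'u + 'u \<Rightarrow> ('u + 'u) + 'u" where "h = case_sum (\<lambda>x. Inl (Inl (f A0 x))) Inr"
          have set\<phi>: "set_fm \<phi> \<subseteq> A0 <+> B" using \<phi>(1) by (simp add: formulas_def)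
          have "map_fm h \<phi> \<in> formulas L ((P <+> Q) <+> B)"
            by (rule map_formulas[OF \<phi>(1)]) (use set\<phi> fA in \<open>fastforce simp: h_def\<close>)
          moreover have "sat S (case_sum (case_sum (inv_into A0 (f A0)) (inv_into C0 (f C0))) id) [] (map_fm h \<phi>)"
          proof -
            have "sat S (case_sum (case_sum (inv_into A0 (f A0)) (inv_into C0 (f C0))) id \<circ> h) [] \<phi> \<longleftrightarrow>
                sat S (case_sum id id) [] \<phi>"
              by (rule sat_cong) (use set\<phi> A[OF s0] in \<open>auto simp: h_def\<close>)
            then show ?thesis unfolding sat_map using \<phi>(2) by blast
          qed
          ultimately have "map_fm h \<phi> \<in> \<Theta>" unfolding \<Theta>[OF s0] by simp
          then have "sat S (case_sum (case_sum (inv_into (A' l) (f (A' l))) (inv_into (C' l) (f (C' l)))) id) [] (map_fm h \<phi>)"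
            unfolding \<Theta>[OF R(1)[OF l]] by simp
          moreover have "sat S (case_sum (case_sum (inv_into (A' l) (f (A' l))) (inv_into (C' l) (f (C' l)))) id \<circ> h) [] \<phi> \<longleftrightarrow>
              sat S (case_sum (\<lambda>i. s (l, i)) id) [] \<phi>"
            by (rule sat_cong) (use set\<phi> l in \<open>auto simp: h_def s_def\<close>)
          ultimately show "sat S (case_sum (\<lambda>i. s (l, i)) id) [] \<phi>" unfolding sat_map by blast
        qed
        define k :: "('u + 'u) + 'u \<Rightarrow> 'u + 'u" where "k = case_sum (case_sum (\<lambda>p. Inl (g p)) (\<lambda>y. Inr (d0 y))) Inr"
        have \<sigma>set: "set_fm \<sigma> \<subseteq> (P <+> Q) <+> B" using \<sigma>(1) by (simp add: formulas_def)
        have d0Q: "d0 y \<in> C0" if "y \<in> Q" for y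
          using that C[OF s0] inv_into_into[of y "f C0" C0] by (auto simp: d0_def)
        have satk: "sat S (case_sum t id) [] (map_fm k \<sigma>) \<longleftrightarrow> sat S (case_sum ((\<lambda>p. t (g p)) \<oplus> d0) id) [] \<sigma>" for t
          unfolding sat_map by (rule sat_cong) (auto simp: k_def split: sum.split)
        have "map_fm k \<sigma> \<in> formulas L (A0 <+> (B \<union> C0))"
          by (rule map_formulas[OF \<sigma>(1)]) (use \<sigma>set gP d0Q in \<open>fastforce simp: k_def\<close>)
        moreover have "sat S (case_sum id id) [] (map_fm k \<sigma>)"
        proof -
          have "sat S (case_sum ((\<lambda>p. id (g p)) \<oplus> d0) id) [] \<sigma> \<longleftrightarrow>
              sat S (case_sum (case_sum (inv_into A0 (f A0)) (inv_into C0 (f C0))) id) [] \<sigma>"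
            by (rule \<sigma>_cong) (simp_all add: g_def d0_def)
          then show ?thesis unfolding satk using true\<Theta>[OF \<sigma>\<Theta>] by simp
        qed
        ultimately have k: "{map_fm k \<sigma>} \<subseteq> tp L S A0 id (B \<union> C0)" by (simp add: tp_def)
        have nwd0: "not_weakly_divides L S A0 (tp L S A0 id (B \<union> C0)) (tp L S A0 id B) B"
          using nwd[OF s0] by (simp add: set_not_weakly_divides_def)
        have "\<exists>s'. tup s' \<and> \<Psi> (\<lambda>v. s' (\<tau> v)) \<and> (\<forall>l<?n. realizes S (\<lambda>i. s' (l, i)) {map_fm k \<sigma>})"
        proof (rule nwd_realize[OF nwd0 \<Psi> _ ts _ r k])
          show "\<tau> v \<in> {..<?n} \<times> A0" for v using n0 x0 by (cases v) (simp add: \<tau>_def)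
          show "\<Psi> (\<lambda>v. s (\<tau> v))" using \<Psi>eq \<open>\<Psi> s\<close> by simp
        qed simp_all
        then obtain s' where s': "\<Psi> s'" "\<forall>l<?n. realizes S (\<lambda>i. s' (l, i)) {map_fm k \<sigma>}" unfolding \<Psi>eq by blast
        have "sat S (case_sum ((\<lambda>p. s' (l, g p)) \<oplus> d0) id) [] \<sigma>" if "l \<in> {..<?n}" for l
          using s'(2) that satk[of "\<lambda>i. s' (l, i)"] by (simp add: realizes_def)
        then show False using s'(1) d0 unfolding \<Psi>_def by blast
      qed
    qed
    then obtain d where d: "tup d" "\<forall>l<?n. sat S (case_sum (case_sum (inv_into (A' l) (f (A' l))) d) id) [] \<sigma>"
      by (elim exE conjE)
    have "sat S (case_sum d id) [] \<phi>" if "\<phi> \<in> F" for \<phi>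
    proof -
      from that obtain l where l: "l < ?n" "\<phi> = \<phi>s ! l" unfolding \<phi>s[symmetric] by (auto simp: in_set_conv_nth)
      show ?thesis unfolding l(2) R(3)[OF l(1)] sat\<rho> using d(2) l(1) unfolding sat\<sigma> by blast
    qed
    then show "\<exists>a. range a \<subseteq> U \<and> realizes S a F"
      using d(1) by (intro exI[of _ d]) (auto simp: realizes_def tup_range)
  qed
  moreover have "small Q" by (rule small_subset[of _ N]) (use Q M_N base_N in \<open>auto simp: base_def\<close>)
  moreover have "small N" using base_N by (simp add: base_def)
  ultimately have "\<exists>d. range d \<subseteq> U \<and> realizes S d q" using NU q by (intro realize)
  then obtain d where d: "range d \<subseteq> U" "realizes S d q" by (elim exE conjE)
  have "sat S (case_sum (case_sum (inv_into A' (f A')) d) id) [] \<theta>" if "(A', C') \<in> R" "\<theta> \<in> \<Theta>" for A' C' \<theta>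
  proof -
    have "map_fm (\<rho> A') \<theta> \<in> q" using that by (auto simp: q_def)
    then show ?thesis using d(2) unfolding realizes_def sat\<rho>[symmetric] by blast
  qed
  then show ?thesis using d(1) by blast
qed

text \<open>Labelling \<open>A\<close> and \<open>C\<close> by elements of \<open>M\<close> makes
  the types of different pairs comparable. A labelled type is a set of fewer than
  \<open>\<kappa>\<close> formulas over \<open>M\<close>, so there are at most \<open>|M|\<close> of
  them, and \<open>nwd_uniform\<close> gives one tuple for each.\<close>

lemma realize_sets:
  "\<exists>R \<subseteq> U. |R| \<le>o |M| \<and> (\<forall>A B C. B \<subseteq> A \<longrightarrow> A \<subseteq> N \<longrightarrow> B \<subseteq> M \<longrightarrow> |A| <o \<kappa> \<longrightarrow> C \<subseteq> U \<longrightarrow> |C| <o \<kappa> \<longrightarrow>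
    set_not_weakly_divides L S A (B \<union> C) B \<longrightarrow> (\<exists>c. c ` C \<subseteq> R \<and> realizes S c (tp L S C id (B \<union> A))))"
proof -
  have "\<forall>X :: 'u set. \<exists>f. |X| <o \<kappa> \<longrightarrow> inj_on f X \<and> f ` X \<subseteq> M"
    using less_M card_of_ordLeq[of _ M] by metis
  then obtain f where f: "\<forall>X :: 'u set. |X| <o \<kappa> \<longrightarrow> inj_on (f X) X \<and> f X ` X \<subseteq> M" by (rule choice[THEN exE])
  define ok where "ok A B C \<longleftrightarrow> B \<subseteq> A \<and> A \<subseteq> N \<and> B \<subseteq> M \<and> |A| <o \<kappa> \<and> C \<subseteq> U \<and> |C| <o \<kappa> \<and>
    set_not_weakly_divides L S A (B \<union> C) B" for A B C
  define th :: "'u set \<Rightarrow> 'u set \<Rightarrow> 'u set \<Rightarrow> ('f, 'r, ('u + 'u) + 'u) fm set" where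
    "th A B C = {\<theta> \<in> formulas L ((f A ` A <+> f C ` C) <+> B).
      sat S (case_sum (case_sum (inv_into A (f A)) (inv_into C (f C))) id) [] \<theta>}" for A B C
  define Col where "Col = {X. X \<subseteq> formulas L ((M <+> M) <+> M) \<and> |X| <o \<kappa>}"
  have "|(M <+> M) <+> M| \<le>o |M|"
    by (intro Plus_ordLeq_infinite[OF inf_M] ordIso_imp_ordLeq[OF card_of_refl])
  then have Col: "|Col| \<le>o |M|" unfolding Col_def by (intro small_subsets formulas_M)
  have fml: "th A B C \<subseteq> formulas L ((f A ` A <+> f C ` C) <+> B)" for A B C by (auto simp: th_def)
  have th: "th A B C \<in> Col" if "ok A B C" for A B C
  proof -
    have "|(f A ` A <+> f C ` C) <+> B| <o \<kappa>"
      using that by (intro less_Plus less_image) (auto simp: ok_def dest: less_subset)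
    then have "|th A B C| <o \<kappa>" using fml by (rule less_formulas)
    moreover have "f A ` A \<subseteq> M" "f C ` C \<subseteq> M" "B \<subseteq> M" using that f by (simp_all add: ok_def)
    then have "(f A ` A <+> f C ` C) <+> B \<subseteq> (M <+> M) <+> M" by blast
    ultimately show ?thesis using fml[of A B C] formulas_mono[of "(f A ` A <+> f C ` C) <+> B" "(M <+> M) <+> M" L] by (simp add: Col_def)
  qed
  \<comment> \<open>The trivial equations in a labelled type recover \<open>B\<close> and the two
    label sets from it.\<close>
  have mem: "(Eql (Free v) (Free v)) \<in> th A B C \<longleftrightarrow> v \<in> (f A ` A <+> f C ` C) <+> B" for v A B C
    by (auto simp: th_def formulas_def)
  have "\<exists>d :: 'u \<Rightarrow> 'u. range d \<subseteq> U \<and> (\<forall>A B C. ok A B C \<longrightarrow> th A B C = \<Theta> \<longrightarrow> (\<forall>\<theta> \<in> \<Theta>.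
    sat S (case_sum (case_sum (inv_into A (f A)) d) id) [] \<theta>))" for \<Theta>
  proof -
    define B' where "B' = {b. Eql (Free (Inr b)) (Free (Inr b)) \<in> \<Theta>}"
    define P where "P = {b. Eql (Free (Inl (Inl b))) (Free (Inl (Inl b))) \<in> \<Theta>}"
    define Q where "Q = {b. b \<in> M \<and> Eql (Free (Inl (Inr b))) (Free (Inl (Inr b))) \<in> \<Theta>}"
    define R where "R = {(A, C). \<exists>B. ok A B C \<and> th A B C = \<Theta>}"
    have B: "B = B'" "f A ` A = P" "f C ` C = Q" if "ok A B C" "th A B C = \<Theta>" for A B C
    proof -
      show "B = B'" "f A ` A = P" unfolding B'_def P_def that(2)[symmetric] mem by auto
      have "f C ` C \<subseteq> M" using that(1) f by (auto simp: ok_def)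
      then show "f C ` C = Q" unfolding Q_def that(2)[symmetric] mem by auto
    qed
    have R: "ok A B' C \<and> th A B' C = \<Theta> \<and> f A ` A = P \<and> f C ` C = Q" if "(A, C) \<in> R" for A C
    proof -
      from that obtain B0 where B0: "ok A B0 C" "th A B0 C = \<Theta>" by (auto simp: R_def)
      show ?thesis using B0 B[OF B0] by simp
    qed
    have "\<exists>d :: 'u \<Rightarrow> 'u. range d \<subseteq> U \<and> (\<forall>(A, C) \<in> R. \<forall>\<theta> \<in> \<Theta>.
      sat S (case_sum (case_sum (inv_into A (f A)) d) id) [] \<theta>)"
    proof (rule nwd_uniform)
      show "Q \<subseteq> M" by (auto simp: Q_def)
      show "A \<subseteq> N \<and> inj_on (f A) A \<and> f A ` A = P \<and> B' \<subseteq> A" if "(A, C) \<in> R" for A C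
        using R[OF that] f by (auto simp: ok_def)
      show "C \<subseteq> U \<and> inj_on (f C) C \<and> f C ` C = Q" if "(A, C) \<in> R" for A C
        using R[OF that] f by (auto simp: ok_def)
      show "set_not_weakly_divides L S A (B' \<union> C) B'" if "(A, C) \<in> R" for A C
        using R[OF that] by (simp add: ok_def)
      show "\<Theta> = {\<theta> \<in> formulas L ((P <+> Q) <+> B').
        sat S (case_sum (case_sum (inv_into A (f A)) (inv_into C (f C))) id) [] \<theta>}" if "(A, C) \<in> R" for A C
      proof -
        have "th A B' C = \<Theta>" "f A ` A = P" "f C ` C = Q" using R[OF that] by blast+
        then show ?thesis unfolding th_def by simp
      qed
    qed
    then obtain d :: "'u \<Rightarrow> 'u" where d: "range d \<subseteq> U" "\<forall>(A, C) \<in> R. \<forall>\<theta> \<in> \<Theta>.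
      sat S (case_sum (case_sum (inv_into A (f A)) d) id) [] \<theta>" by (elim exE conjE)
    have "\<forall>\<theta> \<in> \<Theta>. sat S (case_sum (case_sum (inv_into A (f A)) d) id) [] \<theta>"
      if "ok A B C" "th A B C = \<Theta>" for A B C
    proof -
      have "(A, C) \<in> R" using that by (auto simp: R_def)
      from bspec[OF d(2) this] show ?thesis by simp
    qed
    then show ?thesis using d(1) by blast
  qed
  then have "\<forall>\<Theta>. \<exists>d :: 'u \<Rightarrow> 'u. range d \<subseteq> U \<and> (\<forall>A B C. ok A B C \<longrightarrow> th A B C = \<Theta> \<longrightarrow> (\<forall>\<theta> \<in> \<Theta>.
    sat S (case_sum (case_sum (inv_into A (f A)) d) id) [] \<theta>))" by (rule allI)
  then obtain d :: "('f, 'r, ('u + 'u) + 'u) fm set \<Rightarrow> 'u \<Rightarrow> 'u" where d: "\<forall>\<Theta>. range (d \<Theta>) \<subseteq> U \<and>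
    (\<forall>A B C. ok A B C \<longrightarrow> th A B C = \<Theta> \<longrightarrow> (\<forall>\<theta> \<in> \<Theta>. sat S (case_sum (case_sum (inv_into A (f A)) (d \<Theta>)) id) [] \<theta>))"
    by (rule choice[THEN exE])
  define R where "R = (\<Union>\<Theta> \<in> Col. d \<Theta> ` M)"
  have "R \<subseteq> U" using d by (auto simp: R_def)
  moreover have "|R| \<le>o |M|" unfolding R_def
    by (rule card_of_UNION_ordLeq_infinite[OF inf_M Col]) (rule ballI, rule card_of_image)
  moreover have "\<exists>c. c ` C \<subseteq> R \<and> realizes S c (tp L S C id (B \<union> A))" if ok: "ok A B C" for A B C
  proof (intro exI conjI)
    let ?c = "d (th A B C) \<circ> f C"
    have fC: "f C ` C \<subseteq> M" "inj_on (f C) C" "inj_on (f A) A" "B \<subseteq> A" using ok f by (auto simp: ok_def)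
    show "?c ` C \<subseteq> R" using th[OF ok] fC(1) by (auto simp: R_def)
    show "realizes S ?c (tp L S C id (B \<union> A))" unfolding realizes_def
    proof
      fix \<phi> :: "('f, 'r, 'u + 'u) fm" assume "\<phi> \<in> tp L S C id (B \<union> A)"
      then have \<phi>: "\<phi> \<in> formulas L (C <+> A)" "sat S (case_sum id id) [] \<phi>" using fC(4) by (auto simp: tp_def Un_absorb1)
      define h :: "'u + 'u \<Rightarrow> ('u + 'u) + 'u" where
        "h = case_sum (\<lambda>y. Inl (Inr (f C y))) (\<lambda>x. Inl (Inl (f A x)))"
      have set\<phi>: "set_fm \<phi> \<subseteq> C <+> A" using \<phi>(1) by (simp add: formulas_def)
      have "map_fm h \<phi> \<in> formulas L ((f A ` A <+> f C ` C) <+> B)"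
        by (rule map_formulas[OF \<phi>(1)]) (use set\<phi> in \<open>fastforce simp: h_def\<close>)
      moreover have "sat S (case_sum (case_sum (inv_into A (f A)) (inv_into C (f C))) id \<circ> h) [] \<phi> \<longleftrightarrow>
          sat S (case_sum id id) [] \<phi>"
        by (rule sat_cong) (use set\<phi> fC in \<open>auto simp: h_def\<close>)
      ultimately have "map_fm h \<phi> \<in> th A B C" using \<phi>(2) unfolding th_def mem_Collect_eq sat_map by blast
      then have "sat S (case_sum (case_sum (inv_into A (f A)) (d (th A B C))) id) [] (map_fm h \<phi>)"
        using d ok by blast
      moreover have "sat S (case_sum (case_sum (inv_into A (f A)) (d (th A B C))) id \<circ> h) [] \<phi> \<longleftrightarrow>
          sat S (case_sum ?c id) [] \<phi>"
        by (rule sat_cong) (use set\<phi> fC in \<open>auto simp: h_def\<close>)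
      ultimately show "sat S (case_sum ?c id) [] \<phi>" unfolding sat_map by blast
    qed
  qed
  ultimately show ?thesis unfolding ok_def by (intro exI[of _ R]) blast
qed

end

section \<open>Skolem functions and local character as closure conditions\<close>

context simple_monster
begin

text \<open>One choice of witnesses serves both models: a witness is taken in \<open>M\<close>
  whenever the arguments lie in \<open>M\<close>.\<close>

lemma skolem_ex:
  assumes mods: "is_mod M" "is_mod N" and M_N: "M \<subseteq> N"
  shows "\<exists>F. (\<forall>ds. |F ds| \<le>o |all_fms L| ) \<and> (\<forall>ds. set ds \<subseteq> M \<longrightarrow> F ds \<subseteq> M) \<and>
    (\<forall>ds. set ds \<subseteq> N \<longrightarrow> F ds \<subseteq> N) \<and>
    (\<forall>X. X \<subseteq> N \<longrightarrow> (\<forall>ds. set ds \<subseteq> X \<longrightarrow> F ds \<subseteq> X) \<longrightarrow> skolem_closed L S X)"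
proof -
  define cond where "cond = (\<lambda>(\<phi> :: ('f, 'r, nat) fm, k, ds). wf_fm L (Suc k) \<phi> \<and> k \<le> length ds \<and> ds \<noteq> [] \<and>
    (\<exists>u \<in> U. sat S (env_of ds k) (u # take k ds) \<phi>) \<and> set ds \<subseteq> N)"
  have "\<forall>q. \<exists>u. cond q \<longrightarrow> u \<in> N \<and> (set (snd (snd q)) \<subseteq> M \<longrightarrow> u \<in> M) \<and>
    sat S (env_of (snd (snd q)) (fst (snd q))) (u # take (fst (snd q)) (snd (snd q))) (fst q)"
  proof
    fix q :: "('f, 'r, nat) fm \<times> nat \<times> 'u list"
    obtain \<phi> k ds where q: "q = (\<phi>, k, ds)" by (cases q)
    have "\<exists>u. u \<in> N \<and> (set ds \<subseteq> M \<longrightarrow> u \<in> M) \<and> sat S (env_of ds k) (u # take k ds) \<phi>" if c: "cond q"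
    proof -
      from c have c: "wf_fm L (Suc k) \<phi>" "k \<le> length ds" "ds \<noteq> []" "set ds \<subseteq> N"
        "\<exists>u \<in> U. sat S (env_of ds k) (u # take k ds) \<phi>" by (simp_all add: cond_def q)
      note sk = mod_skolem[unfolded skolem_closed_def, rule_format]
      show ?thesis
      proof (cases "set ds \<subseteq> M")
        case True
        from sk[OF mods(1) c(1,2,3) True c(5)] show ?thesis using M_N by blast
      next
        case False
        from sk[OF mods(2) c(1,2,3,4,5)] show ?thesis using False by blast
      qed
    qed
    then show "\<exists>u. cond q \<longrightarrow> u \<in> N \<and> (set (snd (snd q)) \<subseteq> M \<longrightarrow> u \<in> M) \<and>
      sat S (env_of (snd (snd q)) (fst (snd q))) (u # take (fst (snd q)) (snd (snd q))) (fst q)"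
      by (auto simp: q)
  qed
  then obtain sk where sk: "\<forall>q. cond q \<longrightarrow> sk q \<in> N \<and> (set (snd (snd q)) \<subseteq> M \<longrightarrow> sk q \<in> M) \<and>
    sat S (env_of (snd (snd q)) (fst (snd q))) (sk q # take (fst (snd q)) (snd (snd q))) (fst q)"
    by (rule choice[THEN exE])
  define F where "F ds = (\<lambda>(\<phi>, k). sk (\<phi>, k, ds)) ` {(\<phi>, k). cond (\<phi>, k, ds)}" for ds
  have "|F ds| \<le>o |all_fms L|" for ds
  proof -
    have "{(\<phi>, k). cond (\<phi>, k, ds)} \<subseteq> all_fms L \<times> (UNIV :: nat set)" by (auto simp: cond_def all_fms_def)
    from ordLeq_transitive[OF card_of_mono1[OF this] Times_ordLeq_infinite[OF infinite_all_fms
        ordIso_imp_ordLeq[OF card_of_refl] nat_ordLeq[OF infinite_all_fms]]]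
    show ?thesis unfolding F_def by (rule ordLeq_transitive[OF card_of_image])
  qed
  moreover have "F ds \<subseteq> M" if "set ds \<subseteq> M" for ds using sk that by (auto simp: F_def)
  moreover have "F ds \<subseteq> N" for ds using sk by (auto simp: F_def)
  moreover have "skolem_closed L S X" if X: "X \<subseteq> N" "\<forall>ds. set ds \<subseteq> X \<longrightarrow> F ds \<subseteq> X" for X
    unfolding skolem_closed_def
  proof (intro allI impI)
    fix \<phi> :: "('f, 'r, nat) fm" and k ds
    assume "wf_fm L (Suc k) \<phi>" "k \<le> length ds" "ds \<noteq> []" and ds: "set ds \<subseteq> X"
      and "\<exists>u \<in> U. sat S (env_of ds k) (u # take k ds) \<phi>"
    then have c: "cond (\<phi>, k, ds)" using X(1) by (auto simp: cond_def)
    then have "sk (\<phi>, k, ds) \<in> F ds" by (auto simp: F_def)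
    then have "sk (\<phi>, k, ds) \<in> X" using X(2) ds by blast
    moreover have "sat S (env_of ds k) (sk (\<phi>, k, ds) # take k ds) \<phi>" using sk[rule_format, OF c] by simp
    ultimately show "\<exists>u \<in> X. sat S (env_of ds k) (u # take k ds) \<phi>" by blast
  qed
  ultimately show ?thesis by (intro exI[of _ F]) blast
qed

lemma local_character_set:
  fixes e :: "nat \<Rightarrow> 'u"
  assumes W: "base W" "W \<noteq> {}" and e: "tup e"
  shows "\<exists>D0 \<subseteq> W. |D0| \<le>o |all_fms L| \<and> (\<forall>D. D0 \<subseteq> D \<longrightarrow> D \<subseteq> W \<longrightarrow> D \<noteq> {} \<longrightarrow> Ind D e W)"
proof -
  from local_character[OF W e] obtain X :: "('f, 'r, (nat + nat) + 'u) fm \<times> nat \<Rightarrow> 'u set"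
    where X: "\<forall>q. countable (X q) \<and> X q \<subseteq> W"
      "\<forall>D. (\<Union>q \<in> formulas L (UNIV <+> {}) \<times> UNIV. X q) \<subseteq> D \<longrightarrow> D \<subseteq> W \<longrightarrow> D \<noteq> {} \<longrightarrow> Ind D e W"
    by (elim exE conjE)
  let ?A = "all_fms L"
  let ?I = "formulas L (UNIV <+> {} :: ((nat + nat) + 'u) set) \<times> (UNIV :: nat set)"
  note inf = infinite_all_fms[of L]
  have "|(UNIV :: (nat + nat) set)| \<le>o |?A|"
    using Plus_ordLeq_infinite[OF inf nat_ordLeq[OF inf] nat_ordLeq[OF inf]] by simp
  then have "|UNIV <+> {} :: ((nat + nat) + 'u) set| \<le>o |?A|"
    by (rule Plus_ordLeq_infinite[OF inf _ finite_ordLeq_infinite[OF _ inf]]) simp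
  then have "|formulas L (UNIV <+> {} :: ((nat + nat) + 'u) set)| \<le>o |?A|"
    by (rule card_formulas[OF inf]) (rule ordIso_imp_ordLeq[OF card_of_refl])
  then have I: "|?I| \<le>o |?A|" by (rule Times_ordLeq_infinite[OF inf _ nat_ordLeq[OF inf]])
  have "|X q| \<le>o |?A|" for q
  proof -
    have "|X q| \<le>o |UNIV :: nat set|" using X(1) unfolding countable_def card_of_ordLeq[symmetric] by blast
    then show ?thesis by (rule ordLeq_transitive[OF _ nat_ordLeq[OF inf]])
  qed
  then have "|\<Union>q \<in> ?I. X q| \<le>o |?A|" by (intro card_of_UNION_ordLeq_infinite[OF inf I] ballI)
  moreover have "(\<Union>q \<in> ?I. X q) \<subseteq> W" using X(1) by blast
  ultimately show ?thesis using X(2) by (intro exI[of _ "\<Union>q \<in> ?I. X q"] conjI)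
qed

lemma tp_eqD:
  assumes tp: "tp L S UNIV c A = tp L S UNIV c' A'" and t: "tup c" "tup c'"
  shows "A = A'" "eqt A c c'"
proof -
  have "b \<in> A \<longleftrightarrow> Eql (Free (Inr b)) (Free (Inr b)) \<in> tp L S UNIV c A" for b and c :: "'a \<Rightarrow> 'u" and A
    by (auto simp: tp_def formulas_def)
  then show A: "A = A'" using tp by blast
  show "eqt A c c'" unfolding eqt_def
  proof (intro allI impI)
    fix P assume P: "Dfn A P" "P c"
    from P(1) obtain \<phi> where \<phi>: "\<phi> \<in> formulas L (UNIV <+> A)"
      "\<And>a. tup a \<Longrightarrow> P a \<longleftrightarrow> sat S (case_sum a id) [] \<phi>" by (rule DfnE) blast
    then have "\<phi> \<in> tp L S UNIV c A" using P(2) t by (simp add: tp_def)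
    then show "P c'" unfolding tp using \<phi>(2)[OF t(2)] by (simp add: tp_def)
  qed
qed

end


section \<open>Realizing types that do not weakly divide\<close>

context elementary_pair
begin

definition skF :: "'u list \<Rightarrow> 'u set" where
  "skF = (SOME F. (\<forall>ds. |F ds| \<le>o |all_fms L| ) \<and> (\<forall>ds. set ds \<subseteq> M \<longrightarrow> F ds \<subseteq> M) \<and>
    (\<forall>ds. set ds \<subseteq> N \<longrightarrow> F ds \<subseteq> N) \<and>
    (\<forall>X. X \<subseteq> N \<longrightarrow> (\<forall>ds. set ds \<subseteq> X \<longrightarrow> F ds \<subseteq> X) \<longrightarrow> skolem_closed L S X))"

lemma skF:
  shows skF_card: "|skF ds| \<le>o |all_fms L|"
    and skF_M: "set ds \<subseteq> M \<Longrightarrow> skF ds \<subseteq> M"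
    and skF_N: "set ds \<subseteq> N \<Longrightarrow> skF ds \<subseteq> N"
    and skF_mod: "X \<noteq> {} \<Longrightarrow> X \<subseteq> N \<Longrightarrow> (\<And>ds. set ds \<subseteq> X \<Longrightarrow> skF ds \<subseteq> X) \<Longrightarrow> is_mod X"
proof -
  note * = someI_ex[OF skolem_ex[OF mods M_N], folded skF_def]
  show "|skF ds| \<le>o |all_fms L|" using * by blast
  show "set ds \<subseteq> M \<Longrightarrow> skF ds \<subseteq> M" using * by blast
  show "set ds \<subseteq> N \<Longrightarrow> skF ds \<subseteq> N" using * by blast
  show "X \<noteq> {} \<Longrightarrow> X \<subseteq> N \<Longrightarrow> (\<And>ds. set ds \<subseteq> X \<Longrightarrow> skF ds \<subseteq> X) \<Longrightarrow> is_mod X"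
  proof -
    assume X: "X \<noteq> {}" "X \<subseteq> N" and cl: "\<And>ds. set ds \<subseteq> X \<Longrightarrow> skF ds \<subseteq> X"
    have "skolem_closed L S X"
      using *[THEN conjunct2, THEN conjunct2, THEN conjunct2, rule_format, OF X(2) cl] .
    then show "is_mod X" using X base_D[OF base_N] by (intro skolem_mod) simp_all
  qed
qed

text \<open>\<open>|N|\<close> is a well-order of minimal length on \<open>N\<close>, so its proper
  initial segments have at most \<open>\<mu>\<close> elements, and so do the hulls.\<close>

definition Nle :: "'u \<Rightarrow> 'u set" where "Nle a = cl skF (M \<union> under |N| a)"

definition Nlt :: "'u \<Rightarrow> 'u set" where "Nlt a = cl skF (M \<union> underS |N| a)"

lemma hull_N: "X \<subseteq> N \<Longrightarrow> cl skF X \<subseteq> N"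
  by (rule cl_least) (auto dest: skF_N)

lemma hull_mod: "X \<noteq> {} \<Longrightarrow> X \<subseteq> N \<Longrightarrow> is_mod (cl skF X)"
  by (rule skF_mod) (use cl_subset[of X skF] hull_N cl_closed[of _ skF X] in blast)+

lemma wellN: "Well_order |N|" "Field |N| = N"
  by (rule card_of_Well_order, rule Field_card_of)

lemma under_N: "under |N| a \<subseteq> N" "underS |N| a \<subseteq> N"
  using under_Field[of "|N|" a] Order_Relation.underS_Field[of "|N|" a] wellN(2) by auto

lemma finite_under: "finite Y \<Longrightarrow> Y \<noteq> {} \<Longrightarrow> Y \<subseteq> N \<Longrightarrow> \<exists>b \<in> Y. Y \<subseteq> under |N| b"
proof (induction rule: finite_ne_induct)
  case (singleton x)
  then show ?case using wellN by (auto simp: under_def order_on_defs refl_on_def)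
next
  case (insert x Y)
  then obtain b where b: "b \<in> Y" "Y \<subseteq> under |N| b" by auto
  have "x \<in> N" "b \<in> N" using insert.prems b by auto
  have o: "refl_on N |N|" "trans |N|" "total_on N |N|" using wellN by (auto simp: order_on_defs)
  have "(x, b) \<in> |N| \<or> (b, x) \<in> |N|"
    using o \<open>x \<in> N\<close> \<open>b \<in> N\<close> by (cases "x = b") (auto simp: total_on_def refl_on_def)
  then show ?case
  proof
    assume "(x, b) \<in> |N|"
    then show ?thesis using b by (auto simp: under_def)
  next
    assume bx: "(b, x) \<in> |N|"
    have "(y, x) \<in> |N|" if "y \<in> Y" for y
      using b(2) that bx transD[OF o(2)] by (auto simp: under_def)
    moreover have "(x, x) \<in> |N|" using o(1) \<open>x \<in> N\<close> by (auto simp: refl_on_def)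
    ultimately show ?thesis by (auto simp: under_def)
  qed
qed

lemma hull_finite: "finite X \<Longrightarrow> X \<subseteq> cl skF Y \<Longrightarrow> \<exists>Y0 \<subseteq> Y. finite Y0 \<and> X \<subseteq> cl skF Y0"
proof -
  assume X: "finite X" "X \<subseteq> cl skF Y"
  have "\<forall>x \<in> X. \<exists>Y0. Y0 \<subseteq> Y \<and> finite Y0 \<and> x \<in> cl skF Y0"
    by (rule ballI) (rule cl_finite[OF subsetD[OF X(2)]])
  then obtain Z where Z: "\<forall>x \<in> X. Z x \<subseteq> Y \<and> finite (Z x) \<and> x \<in> cl skF (Z x)" by (rule bchoice[THEN exE])
  have "cl skF (Z x) \<subseteq> cl skF (\<Union>x \<in> X. Z x)" if "x \<in> X" for x using that by (intro cl_mono) blast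
  then have "x \<in> cl skF (\<Union>x \<in> X. Z x)" if "x \<in> X" for x using Z that by blast
  then have "X \<subseteq> cl skF (\<Union>x \<in> X. Z x)" by (rule subsetI)
  then show ?thesis using Z X(1) by (intro exI[of _ "\<Union>x \<in> X. Z x"]) auto
qed

lemma Nle_sub: "a \<in> N \<Longrightarrow> X \<subseteq> under |N| a \<Longrightarrow> cl skF (M \<union> X) \<subseteq> Nle a"
  unfolding Nle_def by (rule cl_mono) blast

sublocale filtration L S kb M N N "|N| - Id" Nlt Nle
proof
  have Mne: "M \<noteq> {}" by (rule mod_ne[OF mods(1)])
  show "wf ( |N| - Id)" using wellN by (auto simp: well_order_on_def)
  show "base N" "is_mod M" by (rule base_N mods(1))+
  show "is_mod (Nlt a)" for a unfolding Nlt_def using Mne M_N under_N by (intro hull_mod) auto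
  show "is_mod (Nle a)" for a unfolding Nle_def using Mne M_N under_N by (intro hull_mod) auto
  show "M \<subseteq> Nlt a" for a unfolding Nlt_def using cl_subset[of "M \<union> underS |N| a" skF] by blast
  show "Nlt a \<subseteq> Nle a" for a unfolding Nlt_def Nle_def by (rule cl_mono) (auto simp: under_def underS_def)
  show "Nle a \<subseteq> N" for a unfolding Nle_def using M_N under_N by (intro hull_N) auto
  show "Nle b \<subseteq> Nlt a" if "(b, a) \<in> |N| - Id" for a b
  proof -
    have o: "trans |N|" "antisym |N|" using wellN by (auto simp: order_on_defs)
    have "under |N| b \<subseteq> underS |N| a"
      using that transD[OF o(1)] antisymD[OF o(2)] by (auto simp: under_def underS_def)
    then show ?thesis unfolding Nlt_def Nle_def by (intro cl_mono) blast
  qed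
  show "X \<subseteq> M \<or> (\<exists>b \<in> N. (b, a) \<in> |N| - Id \<and> X \<subseteq> Nle b)" if X: "finite X" "X \<subseteq> Nlt a" for a X
  proof -
    from hull_finite[OF X(1) X(2)[unfolded Nlt_def]] obtain Y0
      where Y0: "Y0 \<subseteq> M \<union> underS |N| a" "finite Y0" "X \<subseteq> cl skF Y0" by blast
    show ?thesis
    proof (cases "Y0 \<subseteq> M")
      case True
      have "cl skF Y0 \<subseteq> M" by (rule cl_least[OF True skF_M])
      then show ?thesis using Y0(3) by blast
    next
      case False
      \<comment> \<open>The last of the finitely many generators below \<open>a\<close> is the
        \<open>b\<close> whose stage contains \<open>X\<close>.\<close>
      let ?Y = "Y0 \<inter> underS |N| a"
      have "finite ?Y" "?Y \<noteq> {}" "?Y \<subseteq> N" using Y0(1,2) False under_N(2)[of a] by blast+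
      from finite_under[OF this] obtain b where b: "b \<in> ?Y" "?Y \<subseteq> under |N| b" by blast
      have bN: "b \<in> N" "(b, a) \<in> |N| - Id" using b(1) under_N by (auto simp: underS_def)
      have "cl skF Y0 \<subseteq> cl skF (M \<union> ?Y)" using Y0(1) by (intro cl_mono) blast
      then have "X \<subseteq> Nle b" using Y0(3) Nle_sub[OF bN(1) b(2)] by blast
      then show ?thesis using bN by blast
    qed
  qed
  show "\<exists>a \<in> N. X \<subseteq> Nle a" if X: "finite X" "X \<subseteq> N" for X
  proof (cases "X = {}")
    case True
    then show ?thesis using mod_ne[OF mods(2)] by blast
  next
    case False
    from finite_under[OF X(1) False X(2)] obtain b where b: "b \<in> X" "X \<subseteq> under |N| b" by blast
    then have "X \<subseteq> Nle b" unfolding Nle_def using cl_subset[of "M \<union> under |N| b" skF] by blast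
    then show ?thesis using b(1) X(2) by blast
  qed
qed

lemma level_unique:
  assumes "a \<in> N" "b \<in> N" "X \<subseteq> Nle a" "\<not> X \<subseteq> Nlt a" "X \<subseteq> Nle b" "\<not> X \<subseteq> Nlt b"
  shows "a = b"
proof (rule ccontr)
  assume "a \<noteq> b"
  moreover have "total_on N |N|" using wellN by (auto simp: order_on_defs)
  ultimately have "(a, b) \<in> |N| - Id \<or> (b, a) \<in> |N| - Id" using assms by (auto simp: total_on_def)
  then show False using Nle_Nlt[of a b] Nle_Nlt[of b a] assms by blast
qed

lemma card_Nle: "a \<in> N \<Longrightarrow> |Nle a| \<le>o |M|"
proof -
  assume a: "a \<in> N"
  have "|underS |N| a| <o |N|" by (rule card_of_underS) (use a card_of_Card_order[of N] wellN(2) in simp_all)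
  then have "|underS |N| a| <o cardSuc \<mu>" by (rule ordLess_ordIso_trans[OF _ card_N])
  then have "|underS |N| a| \<le>o \<mu>" using cardSuc_ordLeq_ordLess[OF card_\<mu> card_of_Card_order] by blast
  then have 1: "|underS |N| a| \<le>o |M|" by (rule ordLeq_ordIso_trans[OF _ ordIso_symmetric[OF card_M]])
  have refl: "|M| \<le>o |M|" by (rule ordIso_imp_ordLeq[OF card_of_refl])
  have fin: "|{a}| \<le>o |M|" by (rule finite_ordLeq_infinite[OF _ inf_M]) simp
  have "|M \<union> (underS |N| a \<union> {a})| \<le>o |M|" by (intro Un_ordLeq_infinite[OF inf_M] refl 1 fin)
  moreover have "M \<union> under |N| a \<subseteq> M \<union> (underS |N| a \<union> {a})" by (auto simp: under_def underS_def)
  ultimately have "|M \<union> under |N| a| \<le>o |M|" using card_of_mono1 ordLeq_transitive by blast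
  then show ?thesis unfolding Nle_def
    by (rule card_cl[OF inf_M]) (rule ordLeq_transitive[OF skF_card all_M])
qed

definition pad :: "'u list \<Rightarrow> nat \<Rightarrow> 'u" where "pad es i = (if i < length es then es ! i else hd es)"

lemma range_pad: "es \<noteq> [] \<Longrightarrow> range (pad es) \<subseteq> set es"
  by (auto simp: pad_def)

text \<open>Besides Skolem functions, \<open>F\<close> adds for a tuple of level \<open>a\<close> a set over which the tuple is
  independent from \<open>Nlt a\<close>.\<close>

lemma closure_ex:
  "\<exists>F. (\<forall>ds. |F ds| \<le>o |all_fms L| ) \<and> (\<forall>ds. set ds \<subseteq> N \<longrightarrow> F ds \<subseteq> N) \<and>
    (\<forall>A (c :: nat \<Rightarrow> 'u). A \<subseteq> N \<longrightarrow> A \<inter> M \<noteq> {} \<longrightarrow> (\<forall>ds. set ds \<subseteq> A \<longrightarrow> F ds \<subseteq> A) \<longrightarrow> tup c \<longrightarrow>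
      Ind (A \<inter> M) c A \<longrightarrow> good A c)"
proof -
  have NU: "N \<subseteq> U" using base_D[OF base_N] .
  have bNlt: "base (Nlt a)" if "a \<in> N" for a using base_subset[OF base_N] Nlt_Nle[OF that] Nle_N[OF that] by blast
  have "\<forall>q. \<exists>D0. fst q \<in> N \<longrightarrow> snd q \<noteq> [] \<longrightarrow> set (snd q) \<subseteq> N \<longrightarrow> D0 \<subseteq> Nlt (fst q) \<and> |D0| \<le>o |all_fms L| \<and>
    (\<forall>D. D0 \<subseteq> D \<longrightarrow> D \<subseteq> Nlt (fst q) \<longrightarrow> D \<noteq> {} \<longrightarrow> Ind D (pad (snd q)) (Nlt (fst q)))"
  proof
    fix q :: "'u \<times> 'u list"
    show "\<exists>D0. fst q \<in> N \<longrightarrow> snd q \<noteq> [] \<longrightarrow> set (snd q) \<subseteq> N \<longrightarrow> D0 \<subseteq> Nlt (fst q) \<and> |D0| \<le>o |all_fms L| \<and>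
      (\<forall>D. D0 \<subseteq> D \<longrightarrow> D \<subseteq> Nlt (fst q) \<longrightarrow> D \<noteq> {} \<longrightarrow> Ind D (pad (snd q)) (Nlt (fst q)))"
    proof (cases "fst q \<in> N \<and> snd q \<noteq> [] \<and> set (snd q) \<subseteq> N")
      case True
      then have t: "tup (pad (snd q))" using range_pad[of "snd q"] NU by (auto simp: tup_range)
      from True have N: "fst q \<in> N" by blast
      from local_character_set[OF bNlt[OF N] mod_ne[OF Nlt_mod[OF N]] t] show ?thesis by blast
    qed auto
  qed
  then obtain Dw where Dw: "\<forall>q. fst q \<in> N \<longrightarrow> snd q \<noteq> [] \<longrightarrow> set (snd q) \<subseteq> N \<longrightarrow> Dw q \<subseteq> Nlt (fst q) \<and> |Dw q| \<le>o |all_fms L| \<and>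
    (\<forall>D. Dw q \<subseteq> D \<longrightarrow> D \<subseteq> Nlt (fst q) \<longrightarrow> D \<noteq> {} \<longrightarrow> Ind D (pad (snd q)) (Nlt (fst q)))"
    by (rule choice[THEN exE])
  \<comment> \<open>By \<open>level_unique\<close> a list has at most one level; the set-valued form
    also covers lists without one.\<close>
  define lv where "lv es = {a \<in> N. es \<noteq> [] \<and> set es \<subseteq> Nle a \<and> \<not> set es \<subseteq> Nlt a}" for es
  define F where "F es = skF es \<union> (\<Union>a \<in> lv es. Dw (a, es))" for es
  have esN: "set es \<subseteq> N" "es \<noteq> []" "a \<in> N" if "a \<in> lv es" for a es using that Nle_N by (auto simp: lv_def)
  have F1: "|F es| \<le>o |all_fms L|" for es unfolding F_def
  proof (rule Un_ordLeq_infinite[OF infinite_all_fms skF_card])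
    have "lv es \<subseteq> {a}" if "a \<in> lv es" for a using that level_unique by (auto simp: lv_def)
    then have "finite (lv es)" using finite_subset[of "lv es" "{_}"] by (cases "lv es = {}") blast+
    then have "|lv es| \<le>o |all_fms L|" using infinite_all_fms by (rule finite_ordLeq_infinite)
    moreover have "|Dw (a, es)| \<le>o |all_fms L|" if "a \<in> lv es" for a using Dw esN[OF that] by simp
    ultimately show "|\<Union>a \<in> lv es. Dw (a, es)| \<le>o |all_fms L|"
      by (intro card_of_UNION_ordLeq_infinite[OF infinite_all_fms] ballI)
  qed
  have F2: "F es \<subseteq> N" if "set es \<subseteq> N" for es
  proof -
    have "Dw (a, es) \<subseteq> N" if "a \<in> lv es" for a
      using Dw[rule_format, of "(a, es)"] esN[OF that] Nlt_Nle[of a] Nle_N[of a] by auto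
    then show ?thesis using skF_N[OF that] by (auto simp: F_def)
  qed
  have F3: "good A c" if A: "A \<subseteq> N" "A \<inter> M \<noteq> {}" "\<forall>ds. set ds \<subseteq> A \<longrightarrow> F ds \<subseteq> A" and c: "tup c" "Ind (A \<inter> M) c A"
    for A and c :: "nat \<Rightarrow> 'u"
    unfolding good_def
  proof (intro conjI ballI allI impI A(1) c)
    have skA: "skF ds \<subseteq> A" if "set ds \<subseteq> A" for ds using A(3) that by (auto simp: F_def)
    have AM: "skF ds \<subseteq> A \<inter> M" if "set ds \<subseteq> A \<inter> M" for ds using skA[of ds] skF_M[of ds] that by blast
    show "is_mod (A \<inter> M)" by (rule skF_mod[OF A(2) _ AM]) (use A(1) in blast)+
    fix a assume a: "a \<in> N"
    have cl: "skF ds \<subseteq> A \<inter> Nlt a" if "set ds \<subseteq> A \<inter> Nlt a" for ds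
      using skA[of ds] cl_closed[of ds skF] that by (auto simp: Nlt_def)
    have ne: "A \<inter> Nlt a \<noteq> {}" using A(2) M_Nlt[OF a] by blast
    show "is_mod (A \<inter> Nlt a)" by (rule skF_mod[OF ne _ cl]) (use A(1) in blast)+
    fix e :: "nat \<Rightarrow> 'u" assume e: "range e \<subseteq> A \<inter> Nle a"
    have DU: "A \<inter> Nlt a \<subseteq> U" using A(1) NU by blast
    show "Ind (A \<inter> Nlt a) e (Nlt a)" unfolding Ind_def
    proof (intro allI impI)
      fix w :: "nat \<Rightarrow> 'u" assume w: "range w \<subseteq> Nlt a"
      have tw: "tup w" using w base_D[OF bNlt[OF a]] by (auto simp: tup_range)
      have te: "tup e" using e A(1) NU by (auto simp: tup_range)
      show "ind (A \<inter> Nlt a) e w" unfolding ind_def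
      proof (intro allI impI)
        fix \<phi> :: "(nat + nat \<Rightarrow> 'u) \<Rightarrow> bool" and k
        assume \<phi>: "Dfn (A \<inter> Nlt a) \<phi>" "\<phi> (e \<oplus> w)"
        from Dfn_support[OF \<phi>(1)] obtain V where V: "finite V"
          "\<forall>x x'. tup x \<longrightarrow> tup x' \<longrightarrow> (\<forall>v \<in> V. x v = x' v) \<longrightarrow> \<phi> x = \<phi> x'" by (elim exE conjE)
        have "finite (Inl -` V)" using V(1) by (rule finite_vimageI) simp
        then obtain n where n: "\<forall>i \<in> Inl -` V. i < n" using finite_nat_set_iff_bounded by blast
        \<comment> \<open>Only finitely many coordinates of \<open>e\<close> occur in
          \<open>\<phi>\<close>, so \<open>e\<close> is replaced by a finite list;
          \<open>Suc n\<close> keeps the list nonempty.\<close>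
        define es where "es = map e [0..<Suc n]"
        have es: "es \<noteq> []" "set es \<subseteq> A \<inter> Nle a" using e by (auto simp: es_def)
        have tp: "tup (pad es)" using range_pad[OF es(1)] es(2) A(1) NU by (auto simp: tup_range)
        have eq: "pad es i = e i" if "i < Suc n" for i
          using that by (simp add: pad_def es_def del: upt_Suc)
        have "(e \<oplus> w) v = (pad es \<oplus> w) v" if "v \<in> V" for v
        proof (cases v)
          case (Inl i)
          then have "i < n" using n that by simp
          then show ?thesis using eq[of i] Inl by simp
        qed simp
        then have "\<phi> (e \<oplus> w) = \<phi> (pad es \<oplus> w)"
          using V(2)[rule_format, of "e \<oplus> w" "pad es \<oplus> w"] te tw tp by simp
        then have \<phi>': "\<phi> (pad es \<oplus> w)" using \<phi>(2) by blast
        have "ind (A \<inter> Nlt a) (pad es) w"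
        \<comment> \<open>Either the list already lies in the base, or \<open>a\<close> is its level
          and \<open>F\<close> has put \<open>Dw (a, es)\<close> into \<open>A\<close>.\<close>
        proof (cases "set es \<subseteq> Nlt a")
          case True
          then show ?thesis using range_pad[OF es(1)] es(2) by (intro ind_refl DU) blast
        next
          case False
          then have lv: "a \<in> lv es" using es a by (auto simp: lv_def)
          have "F es \<subseteq> A" using es(2) by (intro A(3)[rule_format]) blast
          then have DA: "Dw (a, es) \<subseteq> A" using lv unfolding F_def by blast
          then have "Ind (A \<inter> Nlt a) (pad es) (Nlt a)"
            using Dw[rule_format, of "(a, es)"] esN[OF lv] ne DA by auto
          then show ?thesis using w by (simp add: Ind_def)
        qed
        from indD[OF this \<phi>(1) \<phi>'] show "\<not> kdiv k (A \<inter> Nlt a) \<phi> w" .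
      qed
    qed
  qed
  show ?thesis
  proof (intro exI[of _ F] conjI allI impI)
    show "|F ds| \<le>o |all_fms L|" for ds by (rule F1)
    show "F ds \<subseteq> N" if "set ds \<subseteq> N" for ds using that by (rule F2)
    show "good A c" if "A \<subseteq> N" "A \<inter> M \<noteq> {}" "\<forall>ds. set ds \<subseteq> A \<longrightarrow> F ds \<subseteq> A" "tup c" "Ind (A \<inter> M) c A"
      for A and c :: "nat \<Rightarrow> 'u" using that by (rule F3)
  qed
qed

text \<open>Local character in \<open>M\<close> supplies \<open>M1\<close> such that
  \<open>c\<close> is independent from \<open>M\<close> over every nonempty set between
  \<open>M1\<close> and \<open>M\<close>. With \<open>M1\<close> in \<open>A\<close>, transitivity
  through \<open>M\<close> gives independence of \<open>c\<close> from \<open>A\<close> over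
  \<open>A \<inter> M\<close>.\<close>

lemma good_ex:
  fixes c :: "nat \<Rightarrow> 'u"
  assumes c: "tup c" "Ind M c N" and A0: "A0 \<subseteq> N" "|A0| <o \<kappa>"
  shows "\<exists>A. good A c \<and> A0 \<subseteq> A \<and> |A| <o \<kappa>"
proof -
  from closure_ex obtain F where F: "\<forall>ds. |F ds| \<le>o |all_fms L|" "\<forall>ds. set ds \<subseteq> N \<longrightarrow> F ds \<subseteq> N"
    "\<forall>A (c :: nat \<Rightarrow> 'u). A \<subseteq> N \<longrightarrow> A \<inter> M \<noteq> {} \<longrightarrow> (\<forall>ds. set ds \<subseteq> A \<longrightarrow> F ds \<subseteq> A) \<longrightarrow> tup c \<longrightarrow>
      Ind (A \<inter> M) c A \<longrightarrow> good A c" by (elim exE conjE)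
  have bM: "base M" by (rule base_subset[OF base_N M_N])
  have Mne: "M \<noteq> {}" by (rule mod_ne[OF mods(1)])
  then obtain m0 where m0: "m0 \<in> M" by blast
  from local_character_set[OF bM Mne c(1)] obtain M1 where M1: "M1 \<subseteq> M" "|M1| \<le>o |all_fms L|"
    "\<forall>D. M1 \<subseteq> D \<longrightarrow> D \<subseteq> M \<longrightarrow> D \<noteq> {} \<longrightarrow> Ind D c M" by (elim exE conjE)
  define X where "X = A0 \<union> (M1 \<union> {m0})"
  define A where "A = cl F X"
  have XA: "X \<subseteq> A" unfolding A_def by (rule cl_subset)
  have XN: "X \<subseteq> N" using A0(1) M1(1) m0 M_N by (auto simp: X_def)
  have AN: "A \<subseteq> N" unfolding A_def by (rule cl_least[OF XN]) (use F(2) in blast)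
  have ne: "A \<inter> M \<noteq> {}" using XA m0 by (auto simp: X_def)
  have clA: "\<forall>ds. set ds \<subseteq> A \<longrightarrow> F ds \<subseteq> A" unfolding A_def by (intro allI impI cl_closed)
  have i1: "Ind (A \<inter> M) c M" using M1(1,3) XA ne by (auto simp: X_def)
  have "Ind (A \<inter> M) c A" unfolding Ind_def
  proof (intro allI impI)
    fix w :: "nat \<Rightarrow> 'u" assume w: "range w \<subseteq> A"
    \<comment> \<open>A constant tuple from \<open>A \<inter> M\<close> is trivially independent; it
      serves to obtain that \<open>A \<inter> M\<close> is a model, which transitivity
      requires.\<close>
    have "good A (\<lambda>_ :: nat. m0)"
    proof (rule F(3)[rule_format, OF AN ne])
      show "F ds \<subseteq> A" if "set ds \<subseteq> A" for ds using clA that by blast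
      show "tup (\<lambda>_ :: nat. m0)" using m0 mod_U[OF mods(1)] by (auto simp: tup_def)
      show "Ind (A \<inter> M) (\<lambda>_ :: nat. m0) A" unfolding Ind_def
        using ind_refl[of "\<lambda>_ :: nat. m0" "A \<inter> M"] XA m0 mod_U[OF mods(1)] by (auto simp: X_def)
    qed
    then have "is_mod (A \<inter> M)" by (simp add: good_def)
    from Ind_trans[OF this mods(1) Int_lower2 M_N base_N c(1) i1 c(2)]
    show "ind (A \<inter> M) c w" using w AN by (auto simp: Ind_def)
  qed
  then have "good A c" using F(3)[rule_format, OF AN ne _ c(1)] clA by blast
  moreover have "|A| <o \<kappa>"
  proof -
    obtain Z :: "('u + ('f, 'r, nat) fm) set" where Z: "infinite Z" "|A0| \<le>o |Z|" "|all_fms L| \<le>o |Z|" "|Z| <o \<kappa>"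
      by (rule less_bound[OF A0(2)])
    have fin: "|{m0}| \<le>o |Z|" by (rule finite_ordLeq_infinite[OF _ Z(1)]) simp
    have "|X| \<le>o |Z|" unfolding X_def
      by (intro Un_ordLeq_infinite[OF Z(1)] Z(2) ordLeq_transitive[OF M1(2) Z(3)] fin)
    then have "|A| \<le>o |Z|" unfolding A_def
      by (rule card_cl[OF Z(1)]) (rule ordLeq_transitive[OF _ Z(3)], use F(1) in blast)
    then show ?thesis using Z(4) by (rule ordLeq_ordLess_trans)
  qed
  ultimately show ?thesis using XA by (intro exI[of _ A]) (auto simp: X_def)
qed

end

context elementary_pair
begin

text \<open>A level \<open>a\<close> is coded by a subset \<open>\<iota> a\<close> of \<open>M\<close>. A small set \<open>Is s \<subseteq> M\<close> separates the codes of
  the active levels of \<open>s\<close>, so pairs of the same colour can be compared level by level, although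
  there are more than \<open>\<mu>\<close> levels.\<close>

lemma colour_ex:
  "\<exists>col :: 'u set \<times> (nat \<Rightarrow> 'u) \<Rightarrow>
      'u set \<times> ('f, 'r, nat + 'u) fm set \<times> ('u set \<times> ('f, 'r, nat + 'u) fm) set.
    |col ` {s. good (fst s) (snd s) \<and> |fst s| <o \<kappa>}| \<le>o |M| \<and>
    (\<forall>s t. good (fst s) (snd s) \<longrightarrow> good (fst t) (snd t) \<longrightarrow> col s = col t \<longrightarrow> similar s t)"
proof -
  have "\<mu> <o |Pow M|" by (rule ordIso_ordLess_trans[OF ordIso_symmetric[OF card_M] card_of_Pow])
  then have "|N| \<le>o |Pow M|"
    by (rule ordIso_ordLeq_trans[OF card_N cardSuc_least[OF card_\<mu> card_of_Card_order]])
  then obtain \<iota> where \<iota>: "inj_on \<iota> N" "\<iota> ` N \<subseteq> Pow M" unfolding card_of_ordLeq[symmetric] by (elim exE conjE)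
  have "\<forall>a \<in> N. \<exists>g. inj_on g (Nle a) \<and> g ` Nle a \<subseteq> M"
    using card_Nle unfolding card_of_ordLeq[symmetric] by blast
  then obtain g where g: "\<forall>a \<in> N. inj_on (g a) (Nle a) \<and> g a ` Nle a \<subseteq> M" by (rule bchoice[THEN exE])
  define lv where "lv s = {a \<in> N. active (fst s) a}" for s :: "'u set \<times> (nat \<Rightarrow> 'u)"
  define sepr where "sepr a b = (SOME x. x \<in> \<iota> a \<longleftrightarrow> x \<notin> \<iota> b)" for a b
  have sepr: "sepr a b \<in> \<iota> a \<longleftrightarrow> sepr a b \<notin> \<iota> b" if "a \<in> N" "b \<in> N" "a \<noteq> b" for a b
  proof -
    have "\<iota> a \<noteq> \<iota> b" using inj_onD[OF \<iota>(1) _ that(1,2)] that(3) by blast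
    then have "\<exists>x. x \<in> \<iota> a \<longleftrightarrow> x \<notin> \<iota> b" by blast
    then show ?thesis unfolding sepr_def by (rule someI_ex)
  qed
  have sepr_M: "sepr a b \<in> M" if "a \<in> N" "b \<in> N" "a \<noteq> b" for a b
    using sepr[OF that] \<iota>(2) that by blast
  \<comment> \<open>One separating element for each pair of distinct active levels; the trace of
    \<open>\<iota> a\<close> on \<open>Is s\<close> then identifies \<open>a\<close> among the
    active levels of \<open>s\<close>.\<close>
  define Is where "Is s = (\<lambda>(a, b). sepr a b) ` {(a, b). a \<in> lv s \<and> b \<in> lv s \<and> a \<noteq> b}" for s
  \<comment> \<open>For each active level, the trace of its code is paired with the formulas of the
    type over the part up to that level; \<open>g a\<close> codes their parameters in
    \<open>M\<close>.\<close>
  define K where "K s = (\<Union>a \<in> lv s. (\<lambda>\<phi>. (\<iota> a \<inter> Is s, map_fm (map_sum id (g a)) \<phi>)) `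
    tp L S UNIV (snd s) (fst s \<inter> Nle a))" for s
  define col where "col s = (Is s, tp L S UNIV (snd s) (fst s \<inter> M), K s)" for s
  define SM where "SM = {X. X \<subseteq> M \<and> |X| <o \<kappa>}"
  define Fm :: "('f, 'r, nat + 'u) fm set" where "Fm = formulas L (UNIV <+> M)"
  have refl: "|M| \<le>o |M|" by (rule ordIso_imp_ordLeq[OF card_of_refl])
  have SM: "|SM| \<le>o |M|" unfolding SM_def by (rule small_subsets[OF refl])
  have Fm: "|Fm| \<le>o |M|" unfolding Fm_def
    by (intro formulas_M Plus_ordLeq_infinite[OF inf_M nat_ordLeq[OF inf_M] refl])
  let ?C = "SM \<times> {X. X \<subseteq> Fm \<and> |X| <o \<kappa>} \<times> {X. X \<subseteq> SM \<times> Fm \<and> |X| <o \<kappa>}"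
  have C: "|?C| \<le>o |M|"
    by (intro Times_ordLeq_infinite[OF inf_M] SM small_subsets Fm)
  have lvN: "lv s \<subseteq> N" for s by (auto simp: lv_def)
  have IsM: "Is s \<subseteq> M" for s using sepr_M by (auto simp: Is_def lv_def)
  have "col s \<in> ?C" if s: "good (fst s) (snd s)" "|fst s| <o \<kappa>" for s
  proof -
    obtain Z :: "('u + ('f, 'r, nat) fm) set"
      where Z: "infinite Z" "|fst s| \<le>o |Z|" "|all_fms L| \<le>o |Z|" "|Z| <o \<kappa>" by (rule less_bound[OF s(2)])
    \<comment> \<open>An active level is charged to an element it adds, so there are at most
      \<open>|fst s|\<close> active levels.\<close>
    have "\<forall>a \<in> lv s. \<exists>x. x \<in> fst s \<and> x \<in> Nle a \<and> x \<notin> Nlt a" by (auto simp: lv_def active_def)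
    then obtain x where x: "\<forall>a \<in> lv s. x a \<in> fst s \<and> x a \<in> Nle a \<and> x a \<notin> Nlt a" by (rule bchoice[THEN exE])
    have "inj_on x (lv s)"
    proof (rule inj_onI)
      fix a b assume ab: "a \<in> lv s" "b \<in> lv s" "x a = x b"
      show "a = b" by (rule level_unique[of a b "{x a}"]) (use ab x in \<open>auto simp: lv_def\<close>)
    qed
    then have "|lv s| \<le>o |fst s|" using x by (intro card_of_ordLeqI) auto
    then have lv: "|lv s| \<le>o |Z|" using Z(2) by (rule ordLeq_transitive)
    have "{(a, b). a \<in> lv s \<and> b \<in> lv s \<and> a \<noteq> b} \<subseteq> lv s \<times> lv s" by auto
    from ordLeq_transitive[OF card_of_mono1[OF this] Times_ordLeq_infinite[OF Z(1) lv lv]]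
    have "|Is s| \<le>o |Z|" unfolding Is_def by (rule ordLeq_transitive[OF card_of_image])
    then have Is: "|Is s| <o \<kappa>" using Z(4) by (rule ordLeq_ordLess_trans)
    have tpZ: "|tp L S UNIV (snd s) X| \<le>o |Z|" if "X \<subseteq> fst s" for X
    proof -
      have "|X| \<le>o |Z|" by (rule ordLeq_transitive[OF card_of_mono1[OF that] Z(2)])
      then have "|UNIV <+> X :: (nat + 'u) set| \<le>o |Z|"
        by (rule Plus_ordLeq_infinite[OF Z(1) nat_ordLeq[OF Z(1)]])
      from card_formulas[OF Z(1) this Z(3)]
      have F: "|formulas L (UNIV <+> X) :: ('f, 'r, nat + 'u) fm set| \<le>o |Z|" .
      have "tp L S UNIV (snd s) X \<subseteq> formulas L (UNIV <+> X)" by (auto simp: tp_def)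
      from ordLeq_transitive[OF card_of_mono1[OF this] F] show ?thesis .
    qed
    have "|K s| \<le>o |Z|" unfolding K_def
      by (intro card_of_UNION_ordLeq_infinite[OF Z(1) lv] ballI ordLeq_transitive[OF card_of_image] tpZ) blast
    then have K: "|K s| <o \<kappa>" using Z(4) by (rule ordLeq_ordLess_trans)
    have "|tp L S UNIV (snd s) (fst s \<inter> M)| <o \<kappa>"
      by (rule ordLeq_ordLess_trans[OF tpZ Z(4)]) blast
    moreover have "tp L S UNIV (snd s) (fst s \<inter> M) \<subseteq> Fm"
      by (auto simp: tp_def Fm_def formulas_def)
    moreover have "Is s \<in> SM" using Is IsM by (simp add: SM_def)
    moreover have "K s \<subseteq> SM \<times> Fm"
    proof
      fix z assume "z \<in> K s"
      then obtain a \<phi> where z: "a \<in> lv s" "\<phi> \<in> tp L S UNIV (snd s) (fst s \<inter> Nle a)"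
        "z = (\<iota> a \<inter> Is s, map_fm (map_sum id (g a)) \<phi>)" unfolding K_def by blast
      have "\<iota> a \<inter> Is s \<in> SM" using IsM[of s] less_subset[OF Is] by (auto simp: SM_def)
      moreover have "map_fm (map_sum id (g a)) \<phi> \<in> Fm" unfolding Fm_def
      proof (rule map_formulas)
        show \<phi>: "\<phi> \<in> formulas L (UNIV <+> fst s \<inter> Nle a)" using z(2) by (simp add: tp_def)
        have "g a ` Nle a \<subseteq> M" using g z(1) lvN by blast
        then have "map_sum id (g a) v \<in> UNIV <+> M" if "v \<in> UNIV <+> fst s \<inter> Nle a" for v
          using that by auto
        then show "map_sum id (g a) ` set_fm \<phi> \<subseteq> UNIV <+> M" using \<phi> by (auto simp: formulas_def)
      qed
      ultimately show "z \<in> SM \<times> Fm" by (simp add: z(3))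
    qed
    ultimately show ?thesis using K by (simp add: col_def)
  qed
  then have "col ` {s. good (fst s) (snd s) \<and> |fst s| <o \<kappa>} \<subseteq> ?C" by blast
  from ordLeq_transitive[OF card_of_mono1[OF this] C]
  have card: "|col ` {s. good (fst s) (snd s) \<and> |fst s| <o \<kappa>}| \<le>o |M|" .
  have K_at: "{\<psi>. (\<iota> a \<inter> Is s, \<psi>) \<in> K s} = map_fm (map_sum id (g a)) ` tp L S UNIV (snd s) (fst s \<inter> Nle a)"
    if a: "a \<in> lv s" for a s
  proof -
    have "b = a" if b: "b \<in> lv s" "\<iota> a \<inter> Is s = \<iota> b \<inter> Is s" for b
    proof (rule ccontr)
      assume "b \<noteq> a"
      then have "sepr a b \<in> Is s" using a b by (auto simp: Is_def)
      moreover have "sepr a b \<in> \<iota> a \<longleftrightarrow> sepr a b \<notin> \<iota> b" using a b \<open>b \<noteq> a\<close> by (intro sepr) (auto simp: lv_def)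
      ultimately show False using b(2) by blast
    qed
    then show ?thesis using a unfolding K_def by auto
  qed
  have sim: "similar s t" if s: "good (fst s) (snd s)" and t: "good (fst t) (snd t)" and eq: "col s = col t" for s t
  proof -
    have tup: "tup (snd s)" "tup (snd t)" using s t by (auto simp: good_def)
    have eqs: "Is s = Is t" "tp L S UNIV (snd s) (fst s \<inter> M) = tp L S UNIV (snd t) (fst t \<inter> M)" "K s = K t"
      using eq by (simp_all add: col_def)
    have "fst s \<inter> Nle a = fst t \<inter> Nle a \<and> eqt (fst s \<inter> Nle a) (snd s) (snd t)"
      if a: "a \<in> N" "active (fst s) a" "active (fst t) a" for a
    proof -
      let ?m = "map_fm (map_sum id (g a)) :: ('f, 'r, nat + 'u) fm \<Rightarrow> ('f, 'r, nat + 'u) fm"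
      let ?F = "formulas L (UNIV <+> Nle a) :: ('f, 'r, nat + 'u) fm set"
      have m: "?m ` tp L S UNIV (snd s) (fst s \<inter> Nle a) = ?m ` tp L S UNIV (snd t) (fst t \<inter> Nle a)"
        using K_at[of a s] K_at[of a t] a eqs(1,3) by (simp add: lv_def)
      have inj: "inj_on ?m ?F"
      proof (rule inj_onI)
        fix \<phi> \<psi> :: "('f, 'r, nat + 'u) fm"
        assume \<phi>: "\<phi> \<in> ?F" "\<psi> \<in> ?F" and m: "?m \<phi> = ?m \<psi>"
        show "\<phi> = \<psi>"
        proof (rule fm.inj_map_strong[OF _ m])
          fix z z' assume "z \<in> set_fm \<phi>" "z' \<in> set_fm \<psi>" and eq: "map_sum id (g a) z = map_sum id (g a) z'"
          then have "z \<in> UNIV <+> Nle a" "z' \<in> UNIV <+> Nle a" using \<phi> by (auto simp: formulas_def)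
          moreover have "inj_on (g a) (Nle a)" using g a(1) by blast
          ultimately show "z = z'" using eq by (auto dest: inj_onD)
        qed
      qed
      have F: "tp L S UNIV c (X \<inter> Nle a) \<subseteq> ?F" for c and X
        by (auto simp: tp_def formulas_def)
      from m have "tp L S UNIV (snd s) (fst s \<inter> Nle a) = tp L S UNIV (snd t) (fst t \<inter> Nle a)"
        unfolding inj_on_image_eq_iff[OF inj F F] .
      from tp_eqD[OF this tup] show ?thesis by blast
    qed
    then show ?thesis using tp_eqD[OF eqs(2) tup] unfolding similar_def by blast
  qed
  show ?thesis by (intro exI[of _ col] conjI card allI impI) (rule sim)
qed

text \<open>\<open>B\<close> is merely a set, while \<open>ext_nd\<close> works over models: a
  formula that does not divide over \<open>B\<close> does not divide over the larger
  \<open>M\<close>, and extending over \<open>M\<close> gives \<open>c\<close> independent from all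
  of \<open>N\<close>.\<close>

lemma realize_over:
  fixes m :: nat
  assumes A: "A \<subseteq> N" and B: "B \<subseteq> A" "B \<subseteq> M" and m: "0 < m" and p: "p \<in> complete_types L S {..<m} A"
    and nwd: "not_weakly_divides L S {..<m} p (restrict_type p B) {}"
  shows "\<exists>c :: nat \<Rightarrow> 'u. tup c \<and> Ind M c N \<and> (\<forall>a. tup a \<longrightarrow> eqt A c a \<longrightarrow> realizes S a p)"
proof -
  have NU: "N \<subseteq> U" using base_D[OF base_N] .
  have bA: "base A" by (rule base_subset[OF base_N A])
  have bM: "base M" by (rule base_subset[OF base_N M_N])
  have pf: "p \<subseteq> formulas L ({..<m} <+> A)" "consistent S p" using p by (auto simp: complete_types_def)
  have "|{..<m}| \<le>o |M|" by (rule finite_ordLeq_infinite[OF _ inf_M]) simp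
  moreover have "small M" using bM by (simp add: base_def)
  ultimately have "small {..<m}" by (rule small_ordLeq)
  moreover have "small A" "A \<subseteq> U" using bA by (simp_all add: base_def)
  ultimately obtain a where a: "range a \<subseteq> U" "realizes S a p" using realize[OF _ _ _ pf] by blast
  define c0 where "c0 i = a (trunc m i)" for i
  have c0t: "tup c0" using a(1) by (auto simp: tup_range c0_def)
  have "sat S (case_sum c0 id) [] \<phi> \<longleftrightarrow> sat S (case_sum a id) [] \<phi>" if "\<phi> \<in> p" for \<phi>
    by (rule sat_cong) (use pf(1) that in \<open>fastforce simp: formulas_def c0_def trunc_def split: sum.split\<close>)
  then have c0p: "realizes S c0 p" using a(2) by (simp add: realizes_def)
  have tr: "c0 (trunc m i) = c0 i" for i using m by (simp add: c0_def trunc_def)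
  have iB: "Ind B c0 A" by (rule nwd_Ind[OF m bA p B(1) nwd c0t c0p tr])
  define G where "G = {P. Dfn A P \<and> P c0}"
  have "\<exists>c. tup c \<and> (\<forall>P \<in> G. P c) \<and> Ind M c N"
  proof (rule ext_nd[OF mods(1) bM base_N M_N, where 'y=nat])
    show "Dfn N P" if "P \<in> G" for P using that Dfn_mono[OF _ A] by (auto simp: G_def)
    fix F assume F: "F \<subseteq> G" "finite F"
    have P: "Dfn A (\<lambda>x. \<forall>P \<in> F. P x)" by (rule Dfn_ball) (use F in \<open>auto simp: G_def\<close>)
    have P0: "\<forall>P \<in> F. P c0" using F by (auto simp: G_def)
    show "\<exists>\<phi> (b :: nat \<Rightarrow> 'u). range b \<subseteq> N \<and> Dfn M \<phi> \<and>
      (\<forall>k. \<not> kdiv k M \<phi> b) \<and> (\<forall>a. tup a \<longrightarrow> \<phi> (a \<oplus> b) \<longrightarrow> (\<forall>P \<in> F. P a))"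
    \<comment> \<open>With no parameters available, the finite part is satisfied in \<open>M\<close>
      itself, and a constant tuple stands in for the parameters.\<close>
    proof (cases "A = {}")
      case True
      then have PM: "Dfn M (\<lambda>x. \<forall>P \<in> F. P x)" using P Dfn_mono by blast
      obtain m0 where m0: "m0 \<in> M" using mod_ne[OF mods(1)] by blast
      have "\<exists>c. range c \<subseteq> M \<and> (\<forall>P \<in> F. P c)" by (rule mod_ex[OF mods(1) PM c0t P0])
      then obtain c1 where c1: "range c1 \<subseteq> M" "\<forall>P \<in> F. P c1" by (elim exE conjE)
      define \<phi> where "\<phi> z \<longleftrightarrow> (\<forall>P \<in> F. P (\<lambda>x. z (Inl x)))" for z :: "nat + nat \<Rightarrow> 'u"
      have \<phi>: "Dfn M \<phi>" unfolding \<phi>_def by (rule Dfn_rn'[OF PM mod_U[OF mods(1)]]) (rule rn_ren)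
      have "ind M c1 (\<lambda>_ :: nat. m0)" by (rule ind_refl[OF c1(1) mod_U[OF mods(1)]])
      then have "\<forall>k. \<not> kdiv k M \<phi> (\<lambda>_. m0)" using indD[OF _ \<phi>] c1(2) by (simp add: \<phi>_def)
      then show ?thesis using \<phi> m0 M_N
        by (intro exI[of _ \<phi>] exI[of _ "\<lambda>_. m0"]) (auto simp: \<phi>_def)
    next
      case False
      from Dfn_abs_nat[OF P False subset_trans[OF A NU]] obtain d :: "nat \<Rightarrow> 'u" and \<phi> :: "(nat + nat \<Rightarrow> 'u) \<Rightarrow> bool"
        where d: "range d \<subseteq> A" "Dfn {} \<phi>" "\<forall>a. (\<forall>P \<in> F. P a) \<longleftrightarrow> \<phi> (a \<oplus> d)" by (elim exE conjE)
      have "\<phi> (c0 \<oplus> d)" using d(3) P0 by blast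
      moreover have "ind B c0 d" using iB d(1) by (simp add: Ind_def)
      ultimately have "\<not> kdiv k B \<phi> d" for k using indD Dfn_mono[OF d(2)] by blast
      then have "\<not> kdiv k M \<phi> d" for k using kdiv_mono B(2) by blast
      moreover have "Dfn M \<phi>" using Dfn_mono[OF d(2)] by blast
      ultimately show ?thesis using d(1,3) A by (intro exI[of _ \<phi>] exI[of _ d]) blast
    qed
  qed
  then obtain c where c: "tup c" "\<forall>P \<in> G. P c" "Ind M c N" by (elim exE conjE)
  have "realizes S a p" if a: "tup a" "eqt A c a" for a
    unfolding realizes_def
  proof
    fix \<phi> assume \<phi>: "\<phi> \<in> p"
    then have D: "Dfn A (\<lambda>a. sat S (case_sum a id) [] \<phi>)" using pf(1) Dfn_sat by blast
    moreover have "sat S (case_sum c0 id) [] \<phi>" using c0p \<phi> by (simp add: realizes_def)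
    ultimately have "sat S (case_sum c id) [] \<phi>" using c(2) by (auto simp: G_def)
    then show "sat S (case_sum a id) [] \<phi>" using eqtD[OF a(2) D] by blast
  qed
  then show ?thesis using c by blast
qed

text \<open>One tuple \<open>d x\<close> is kept for each colour \<open>x\<close>; the colour of the
  enlarged pair \<open>(A', c)\<close> decides which of them realizes \<open>p\<close>.\<close>

lemma realize_types:
  "\<exists>R \<subseteq> U. |R| \<le>o |M| \<and> (\<forall>A B. \<forall>m :: nat. \<forall>p \<in> complete_types L S {..<m} A.
    B \<subseteq> A \<longrightarrow> A \<subseteq> N \<longrightarrow> B \<subseteq> M \<longrightarrow> |A| <o \<kappa> \<longrightarrow>
    not_weakly_divides L S {..<m} p (restrict_type p B) {} \<longrightarrow> (\<exists>a. a ` {..<m} \<subseteq> R \<and> realizes S a p))"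
proof -
  define X where "X = {s :: 'u set \<times> (nat \<Rightarrow> 'u). good (fst s) (snd s) \<and> |fst s| <o \<kappa>}"
  from colour_ex obtain col :: "'u set \<times> (nat \<Rightarrow> 'u) \<Rightarrow>
      'u set \<times> ('f, 'r, nat + 'u) fm set \<times> ('u set \<times> ('f, 'r, nat + 'u) fm) set"
    where col: "|col ` X| \<le>o |M|"
      "\<forall>s t. good (fst s) (snd s) \<longrightarrow> good (fst t) (snd t) \<longrightarrow> col s = col t \<longrightarrow> similar s t"
    unfolding X_def by (elim exE conjE)
  have "\<exists>c. tup c \<and> (\<forall>s \<in> {s \<in> X. col s = x}. eqt (fst s) (snd s) c)" for x
    by (rule similar_realize) (use col(2) in \<open>auto simp: X_def\<close>)
  then have "\<forall>x. \<exists>c. tup c \<and> (\<forall>s \<in> {s \<in> X. col s = x}. eqt (fst s) (snd s) c)" by (rule allI)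
  then obtain d where d: "\<forall>x. tup (d x) \<and> (\<forall>s \<in> {s \<in> X. col s = x}. eqt (fst s) (snd s) (d x))"
    by (rule choice[THEN exE])
  define R where "R = (\<Union>x \<in> col ` X. range (d x))"
  have "range (d x) \<subseteq> U" for x using d unfolding tup_range by blast
  then have "R \<subseteq> U" unfolding R_def by blast
  moreover have "|R| \<le>o |M|" unfolding R_def
    by (intro card_of_UNION_ordLeq_infinite[OF inf_M col(1)] ballI ordLeq_transitive[OF card_of_image nat_ordLeq[OF inf_M]])
  moreover have "\<exists>a. a ` {..<m} \<subseteq> R \<and> realizes S a p"
    if p: "p \<in> complete_types L S {..<m} A" and h: "B \<subseteq> A" "A \<subseteq> N" "B \<subseteq> M" "|A| <o \<kappa>"
      and nwd: "not_weakly_divides L S {..<m} p (restrict_type p B) {}" for A B p and m :: nat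
  proof (cases "m = 0")
    \<comment> \<open>In a type in no variables all formulas are sentences over \<open>A\<close>, so
      a constant tuple realizes it.\<close>
    case True
    obtain u0 where u0: "u0 \<in> U" using U_ne by blast
    have "realizes S (\<lambda>_. u0) p" unfolding realizes_def
    proof
      fix \<phi> assume \<phi>: "\<phi> \<in> p"
      have pf: "consistent S p" "\<phi> \<in> formulas L ({..<m} <+> A)" using p \<phi> by (auto simp: complete_types_def)
      have "finite {\<phi>}" "{\<phi>} \<subseteq> p" using \<phi> by auto
      then obtain a where "realizes S a {\<phi>}" by (rule consistentD[OF pf(1)])
      then have "sat S (case_sum a id) [] \<phi>" by (simp add: realizes_def)
      moreover have "sat S (case_sum a id) [] \<phi> \<longleftrightarrow> sat S (case_sum (\<lambda>_. u0) id) [] \<phi>"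
        by (rule sat_cong) (use pf(2) True in \<open>fastforce simp: formulas_def\<close>)
      ultimately show "sat S (case_sum (\<lambda>_. u0) id) [] \<phi>" by blast
    qed
    then show ?thesis using True by (intro exI[of _ "\<lambda>_. u0"]) simp
  next
    case False
    then have "0 < m" by simp
    from realize_over[OF h(2,1,3) this p nwd] obtain c :: "nat \<Rightarrow> 'u" where c: "tup c" "Ind M c N"
      "\<forall>a. tup a \<longrightarrow> eqt A c a \<longrightarrow> realizes S a p" by (elim exE conjE)
    from good_ex[OF c(1,2) h(2,4)] obtain A' where A': "good A' c" "A \<subseteq> A'" "|A'| <o \<kappa>" by (elim exE conjE)
    have X: "(A', c) \<in> X" using A' by (simp add: X_def)
    then have "eqt A' c (d (col (A', c)))" using d[rule_format, of "col (A', c)"] by auto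
    then have "eqt A c (d (col (A', c)))" using A'(2) by (rule eqt_mono)
    then have "realizes S (d (col (A', c))) p" using c(3) d by blast
    moreover have "range (d (col (A', c))) \<subseteq> R" using X unfolding R_def by blast
    ultimately show ?thesis by blast
  qed
  ultimately show ?thesis by (intro exI[of _ R]) blast
qed

end

section \<open>Construction of the two models\<close>

lemma elem_sub_trans:
  assumes "elem_sub L M N" "elem_sub L N P"
  shows "elem_sub L M P"
  using assms unfolding elem_sub_def by (metis subset_trans)

lemma elem_sub_common:
  assumes "elem_sub L M P" "elem_sub L N P" "Dom M \<subseteq> Dom N"
  shows "elem_sub L M N"
  using assms unfolding elem_sub_def by (metis subset_trans)

lemma (in simple_monster) hull_ex:
  fixes X :: "'u set" and Z :: "'z set"
  assumes X: "X \<subseteq> U" "X \<noteq> {}" and Z: "infinite Z" "|X| \<le>o |Z|" "|all_fms L| \<le>o |Z|"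
  shows "\<exists>H. X \<subseteq> Dom H \<and> elem_sub L H S \<and> |Dom H| \<le>o |Z|"
proof -
  have modU: "is_mod U" by (rule skolem_mod) (use U_ne in \<open>auto simp: skolem_closed_def\<close>)
  from skolem_ex[OF modU modU subset_refl] obtain F where F: "\<forall>ds. |F ds| \<le>o |all_fms L|"
    "\<forall>ds. set ds \<subseteq> U \<longrightarrow> F ds \<subseteq> U"
    "\<forall>X. X \<subseteq> U \<longrightarrow> (\<forall>ds. set ds \<subseteq> X \<longrightarrow> F ds \<subseteq> X) \<longrightarrow> skolem_closed L S X" by (elim exE conjE)
  have U: "cl F X \<subseteq> U" by (rule cl_least[OF X(1)]) (use F(2) in blast)
  have ne: "X \<subseteq> cl F X" "cl F X \<noteq> {}" using cl_subset[of X F] X(2) by auto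
  have "skolem_closed L S (cl F X)" using F(3)[rule_format, OF U cl_closed] .
  from skolem_elem_sub[OF struc U ne(2) this] have "elem_sub L (S\<lparr>Dom := cl F X\<rparr>) S" .
  moreover have "|cl F X| \<le>o |Z|"
    by (rule card_cl[OF Z(1,2)]) (rule ordLeq_transitive[OF _ Z(3)], use F(1) in blast)
  ultimately show ?thesis using ne(1) by (intro exI[of _ "S\<lparr>Dom := cl F X\<rparr>"]) simp
qed

theorem theorem1p7:
  fixes L :: "('f, 'r) lang"
    and T :: "('f, 'r, nat) fm set"
    and \<CC> M N :: "('f, 'r, 'u) struct"
    and \<kappa>bar :: "'kb rel" and \<kappa> :: "'k rel" and \<mu> :: "'m rel"
  assumes "complete_theory L T"
    and "is_model L T \<CC>"
    and "Card_order \<kappa>bar"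
    and "saturated L \<kappa>bar \<CC>"
    and "simple_theory L \<CC>"
    and "Card_order \<kappa>"
    and "Card_order \<mu>"
    and "|T| <o \<kappa>"
    and "\<mu> =o cexp_less \<mu> \<kappa>"
    and "elem_sub L M N"
    and "elem_sub L N \<CC>"
    and "|Dom M| =o \<mu>"
    and "|Dom N| =o cardSuc \<mu>"
    and "|Dom N| <o \<kappa>bar"
  shows "\<exists>Mp Np :: ('f, 'r, 'u) struct.
    elem_sub L Mp Np \<and> elem_sub L Np \<CC> \<and> elem_sub L N Np \<and> elem_sub L M Mp \<and>
    |Dom Mp| =o \<mu> \<and> |Dom Np| =o cardSuc \<mu> \<and>
    (\<forall>A B. \<forall>m :: nat. \<forall>p \<in> complete_types L \<CC> {..<m} A.
       B \<subseteq> A \<longrightarrow> A \<subseteq> Dom N \<longrightarrow> B \<subseteq> Dom M \<longrightarrow> |A| <o \<kappa> \<longrightarrow>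
       not_weakly_divides L \<CC> {..<m} p (restrict_type p B) {} \<longrightarrow>
       (\<exists>a. a ` {..<m} \<subseteq> Dom Mp \<and> realizes \<CC> a p)) \<and>
    (\<forall>A B C.
       B \<subseteq> A \<longrightarrow> A \<subseteq> Dom N \<longrightarrow> B \<subseteq> Dom M \<longrightarrow> |A| <o \<kappa> \<longrightarrow>
       C \<subseteq> Dom \<CC> \<longrightarrow> |C| <o \<kappa> \<longrightarrow>
       set_not_weakly_divides L \<CC> A (B \<union> C) B \<longrightarrow>
       (\<exists>C' c. C' \<subseteq> Dom Mp \<and> C' = c ` C \<and> realizes \<CC> c (tp L \<CC> C id (B \<union> A))))"
proof -
  have MC: "elem_sub L M \<CC>" using assms(10,11) by (rule elem_sub_trans)
  have dom: "Dom M \<subseteq> Dom N" "Dom N \<subseteq> Dom \<CC>" using assms(10,11) by (auto simp: elem_sub_def)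
  have all: "|all_fms L| <o \<kappa>" using card_all_fms[OF assms(1)] assms(8) by (rule ordLeq_ordLess_trans)
  \<comment> \<open>\<open>N\<close> is infinite and smaller than \<open>\<kappa>bar\<close>, which
    makes \<open>\<kappa>bar\<close> uncountable as the locale \<open>monster\<close>
    demands.\<close>
  have all_N: "natLeq <o \<kappa>bar"
  proof -
    have fin: "infinite (Dom N)"
    proof
      assume "finite (Dom N)"
      then have "finite (Dom M)" using dom(1) finite_subset by blast
      have ne: "Dom M \<noteq> {}" using assms(10) by (auto simp: elem_sub_def structure_of_def)
      show False
        using infinite_exponent(3)[OF assms(6,7) all assms(9,12) ne] \<open>finite (Dom M)\<close> by blast
    qed
    then have "natLeq \<le>o |Dom N|" using infinite_iff_natLeq_ordLeq[of "Dom N"] by blast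
    then show ?thesis using assms(14) by (rule ordLeq_ordLess_trans)
  qed
  interpret simple_monster L \<CC> \<kappa>bar
    by unfold_locales (use assms all_N in \<open>auto simp: is_model_def\<close>)
  have bN: "base (Dom N)" using dom(2) assms(14) by (simp add: base_def small_def)
  interpret elementary_pair L \<CC> \<kappa>bar "Dom M" "Dom N" \<kappa> \<mu>
    by unfold_locales (use elem_mod MC assms dom bN all in auto)
  from realize_types obtain R1 where R1: "R1 \<subseteq> U" "|R1| \<le>o |Dom M|"
    "\<forall>A B. \<forall>m :: nat. \<forall>p \<in> complete_types L \<CC> {..<m} A.
      B \<subseteq> A \<longrightarrow> A \<subseteq> Dom N \<longrightarrow> B \<subseteq> Dom M \<longrightarrow> |A| <o \<kappa> \<longrightarrow>
      not_weakly_divides L \<CC> {..<m} p (restrict_type p B) {} \<longrightarrow> (\<exists>a. a ` {..<m} \<subseteq> R1 \<and> realizes \<CC> a p)"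
    by (elim exE conjE)
  from realize_sets obtain R2 where R2: "R2 \<subseteq> U" "|R2| \<le>o |Dom M|"
    "\<forall>A B C. B \<subseteq> A \<longrightarrow> A \<subseteq> Dom N \<longrightarrow> B \<subseteq> Dom M \<longrightarrow> |A| <o \<kappa> \<longrightarrow> C \<subseteq> U \<longrightarrow> |C| <o \<kappa> \<longrightarrow>
      set_not_weakly_divides L \<CC> A (B \<union> C) B \<longrightarrow> (\<exists>c. c ` C \<subseteq> R2 \<and> realizes \<CC> c (tp L \<CC> C id (B \<union> A)))"
    by (elim exE conjE)
  have refl: "|X| \<le>o |X|" for X :: "'u set" by (rule ordIso_imp_ordLeq[OF card_of_refl])
  \<comment> \<open>\<open>Mp\<close> is a hull of \<open>M\<close> with both sets of realizations
    and \<open>Np\<close> a hull of \<open>N\<close> with \<open>Mp\<close>; all being elementary in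
    the same monster, inclusions between them are elementary.\<close>
  let ?X = "Dom M \<union> (R1 \<union> R2)"
  have X: "?X \<subseteq> U" "?X \<noteq> {}" using dom R1(1) R2(1) mod_ne[OF mods(1)] by auto
  have "|?X| \<le>o |Dom M|" by (intro Un_ordLeq_infinite[OF inf_M] refl R1(2) R2(2))
  from hull_ex[OF X inf_M this all_M] obtain Mp where
    Mp: "?X \<subseteq> Dom Mp" "elem_sub L Mp \<CC>" "|Dom Mp| \<le>o |Dom M|" by (elim exE conjE)
  have inf_N: "infinite (Dom N)" using inf_M dom(1) finite_subset by blast
  have MN: "|Dom M| \<le>o |Dom N|" by (rule card_of_mono1[OF dom(1)])
  let ?Y = "Dom N \<union> Dom Mp"
  have MpU: "Dom Mp \<subseteq> U" using Mp(2) by (simp add: elem_sub_def)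
  have Y: "?Y \<subseteq> U" "?Y \<noteq> {}" using dom MpU mod_ne[OF mods(2)] by auto
  have "|?Y| \<le>o |Dom N|" by (intro Un_ordLeq_infinite[OF inf_N] refl ordLeq_transitive[OF Mp(3) MN])
  from hull_ex[OF Y inf_N this ordLeq_transitive[OF all_M MN]] obtain Np where
    Np: "?Y \<subseteq> Dom Np" "elem_sub L Np \<CC>" "|Dom Np| \<le>o |Dom N|" by (elim exE conjE)
  have "|Dom M| \<le>o |Dom Mp|" "|Dom N| \<le>o |Dom Np|" using Mp(1) Np(1) by (auto intro: card_of_mono1)
  then have iso: "|Dom Mp| =o |Dom M|" "|Dom Np| =o |Dom N|" using Mp(3) Np(3) by (simp_all add: ordIso_iff_ordLeq)
  show ?thesis
  proof (rule exI[of _ Mp], rule exI[of _ Np], intro conjI)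
    show "elem_sub L Mp Np" by (rule elem_sub_common[OF Mp(2) Np(2)]) (use Np(1) in blast)
    show "elem_sub L Np \<CC>" by (rule Np(2))
    show "elem_sub L N Np" by (rule elem_sub_common[OF assms(11) Np(2)]) (use Np(1) in blast)
    show "elem_sub L M Mp" by (rule elem_sub_common[OF MC Mp(2)]) (use Mp(1) in blast)
    show "|Dom Mp| =o \<mu>" by (rule ordIso_transitive[OF iso(1) card_M])
    show "|Dom Np| =o cardSuc \<mu>" by (rule ordIso_transitive[OF iso(2) card_N])
  next
    have "R1 \<subseteq> Dom Mp" using Mp(1) by blast
    show "\<forall>A B. \<forall>m :: nat. \<forall>p \<in> complete_types L \<CC> {..<m} A.
       B \<subseteq> A \<longrightarrow> A \<subseteq> Dom N \<longrightarrow> B \<subseteq> Dom M \<longrightarrow> |A| <o \<kappa> \<longrightarrow>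
       not_weakly_divides L \<CC> {..<m} p (restrict_type p B) {} \<longrightarrow>
       (\<exists>a. a ` {..<m} \<subseteq> Dom Mp \<and> realizes \<CC> a p)"
    proof (intro allI ballI impI)
      fix A B and m :: nat and p
      assume "p \<in> complete_types L \<CC> {..<m} A" "B \<subseteq> A" "A \<subseteq> Dom N" "B \<subseteq> Dom M" "|A| <o \<kappa>"
        "not_weakly_divides L \<CC> {..<m} p (restrict_type p B) {}"
      from R1(3)[rule_format, OF this] obtain a where "a ` {..<m} \<subseteq> R1" "realizes \<CC> a p" by (elim exE conjE)
      then show "\<exists>a. a ` {..<m} \<subseteq> Dom Mp \<and> realizes \<CC> a p" using \<open>R1 \<subseteq> Dom Mp\<close> by (intro exI[of _ a]) blast
    qed
  next
    have "R2 \<subseteq> Dom Mp" using Mp(1) by blast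
    show "\<forall>A B C.
       B \<subseteq> A \<longrightarrow> A \<subseteq> Dom N \<longrightarrow> B \<subseteq> Dom M \<longrightarrow> |A| <o \<kappa> \<longrightarrow>
       C \<subseteq> Dom \<CC> \<longrightarrow> |C| <o \<kappa> \<longrightarrow>
       set_not_weakly_divides L \<CC> A (B \<union> C) B \<longrightarrow>
       (\<exists>C' c. C' \<subseteq> Dom Mp \<and> C' = c ` C \<and> realizes \<CC> c (tp L \<CC> C id (B \<union> A)))"
    proof (intro allI impI)
      fix A B C assume "B \<subseteq> A" "A \<subseteq> Dom N" "B \<subseteq> Dom M" "|A| <o \<kappa>" "C \<subseteq> Dom \<CC>" "|C| <o \<kappa>"
        "set_not_weakly_divides L \<CC> A (B \<union> C) B"
      from R2(3)[rule_format, OF this] obtain c where "c ` C \<subseteq> R2" "realizes \<CC> c (tp L \<CC> C id (B \<union> A))"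
        by (elim exE conjE)
      then show "\<exists>C' c. C' \<subseteq> Dom Mp \<and> C' = c ` C \<and> realizes \<CC> c (tp L \<CC> C id (B \<union> A))"
        using \<open>R2 \<subseteq> Dom Mp\<close> by (intro exI[of _ "c ` C"] exI[of _ c]) blast
    qed
  qed
qed

end
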